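(* Let $a$ be a lim-2 or lim-3 endpoint and $b$ a lim-4 endpoint for $\ell$ on $(a,b)$. Let $L$ be a self-adjoint extension of $L_{min}$ with separated boundary conditions (none at $a$ if $a$ is lim-2; one condition $[y,\phi](a)=0$ if $a$ is lim-3), whose boundary conditions at $b$ are $[y,\theta_1](b)=0=[y,\theta_2](b)$, where $\theta_1,\theta_2$ are solutions of $\ell y=\lambda_0y$ for some real $\lambda_0$. Let $b_j\nearrow b$, and let $L_j$ be the self-adjoint operator given by $\ell$ in $L^2(a,b_j;w)$ with the same boundary conditions as $L$ at $a$ and the boundary conditions $[y,\theta_1](b_j)=0=[y,\theta_2](b_j)$ at $b_j$. Let $\lambda\in\mathbb C\setminus\mathbb R$, $S=(L-\lambda)^{-1}$, $S_j=(L_j-\lambda)^{-1}$, and let $P_j$ be the orthogonal projection of $L^2(a,b;w)$ onto $L^2(a,b_j;w)$. Then: (1) $S-S_jP_j$ is a Hilbert–Schmidt integral operator; (2) $S-S_jP_j\to0$ in the Hilbert–Schmidt norm as $j\to\infty$.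
   Context: Let $-\infty\le a<b\le\infty$, and let $p,s,q,w$ be real-valued on $(a,b)$ with $1/p,s,q,w\in L^1_{loc}(a,b)$ and $p,w>0$ a.e. Quasi-derivatives: $y^{[0]}=y$, $y^{[1]}=y'$, $y^{[2]}=py''$, $y^{[3]}=-(py'')'+sy'$; $u_y=(y^{[0]},y^{[1]})^T$, $v_y=(y^{[3]},y^{[2]})^T$. $\ell y=\frac1w\{[(py'')'-sy']'+qy\}=\frac1w\{-(y^{[3]})'+qy\}$. $L^2(a,b;w)$ has inner product $\int_a^b f\overline g\,w\,dx$; $L^2(a,b_j;w)$ is regarded as a closed subspace of it via extension by zero. An endpoint is of lim-$p$ type if the space of solutions of $\ell y=iy$ square integrable (with weight $w$) near that endpoint has dimension $p$. $D_{max}$: all $y$ with $y^{[0]},\dots,y^{[3]}$ locally absolutely continuous on $(a,b)$ and $y,\ell y\in L^2(a,b;w)$. $D_{min}$: closure, in the graph norm $(\|y\|^2+\|\ell y\|^2)^{1/2}$, of the set of functions in $D_{max}$ with compact support in $(a,b)$; $L_{min}y=\ell y$ on $D_{min}$. $[f,g](x)=u_f^T\overline{v_g}-v_f^T\overline{u_g}$ at $x$; the limit at an endpoint exists when $f,g$ coincide near that endpoint with functions of $D_{max}$. In the lim-3 case $\phi\in D_{max}\setminus D_{min}$ vanishes near $b$ and $[\phi,\phi](a)=0$. $\theta_1,\theta_2$ are linearly independent and $[\theta_1,\theta_1]=[\theta_1,\theta_2]=[\theta_2,\theta_2]=0$ (these forms are constant in $x$). They need not be real-valued. *)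

theory Defs
  imports "HOL-Analysis.Analysis" "HOL-Library.Function_Algebras"
begin

text \<open>
  Elements of a complex L2 space are represented by functions; two functions that agree almost
  everywhere represent the same element.  An unbounded operator is represented by its graph, a
  set of pairs of functions.
\<close>

definition L2 :: "'a measure \<Rightarrow> ('a \<Rightarrow> complex) set" where
  "L2 M = {f \<in> borel_measurable M. integrable M (\<lambda>x. (norm (f x))\<^sup>2)}"

definition ip :: "'a measure \<Rightarrow> ('a \<Rightarrow> complex) \<Rightarrow> ('a \<Rightarrow> complex) \<Rightarrow> complex" where
  "ip M f g = (\<integral>x. f x * cnj (g x) \<partial>M)"

definition l2norm :: "'a measure \<Rightarrow> ('a \<Rightarrow> complex) \<Rightarrow> real" where
  "l2norm M f = sqrt (\<integral>x. (norm (f x))\<^sup>2 \<partial>M)"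

definition adjoint_graph ::
  "'a measure \<Rightarrow> (('a \<Rightarrow> complex) \<times> ('a \<Rightarrow> complex)) set \<Rightarrow> (('a \<Rightarrow> complex) \<times> ('a \<Rightarrow> complex)) set"
where
  "adjoint_graph M T = {(f, g). f \<in> L2 M \<and> g \<in> L2 M \<and> (\<forall>(u, v)\<in>T. ip M v f = ip M u g)}"

definition densely_defined ::
  "'a measure \<Rightarrow> (('a \<Rightarrow> complex) \<times> ('a \<Rightarrow> complex)) set \<Rightarrow> bool"
where
  "densely_defined M T \<longleftrightarrow>
     (\<forall>f\<in>L2 M. \<forall>\<epsilon>>0. \<exists>u\<in>Domain T. l2norm M (\<lambda>x. u x - f x) < \<epsilon>)"

definition self_adjoint ::
  "'a measure \<Rightarrow> (('a \<Rightarrow> complex) \<times> ('a \<Rightarrow> complex)) set \<Rightarrow> bool"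
where
  "self_adjoint M T \<longleftrightarrow>
     T \<subseteq> L2 M \<times> L2 M \<and> densely_defined M T \<and> T \<subseteq> adjoint_graph M T \<and>
     (\<forall>(f, g)\<in>adjoint_graph M T. \<exists>(u, v)\<in>T. (AE x in M. u x = f x) \<and> (AE x in M. v x = g x))"

definition resolvent ::
  "'a measure \<Rightarrow> (('a \<Rightarrow> complex) \<times> ('a \<Rightarrow> complex)) set \<Rightarrow> complex
     \<Rightarrow> ('a \<Rightarrow> complex) \<Rightarrow> ('a \<Rightarrow> complex)"
where
  "resolvent M T z f = (SOME y. \<exists>v. (y, v) \<in> T \<and> (AE x in M. v x - z * y x = f x))"

definition orth_proj ::
  "'a measure \<Rightarrow> ('a \<Rightarrow> complex) set \<Rightarrow> ('a \<Rightarrow> complex) \<Rightarrow> ('a \<Rightarrow> complex)"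
where
  "orth_proj M V f = (SOME g. g \<in> V \<and> (\<forall>v\<in>V. ip M (\<lambda>x. f x - g x) v = 0))"

definition zero_ext :: "'a set \<Rightarrow> ('a \<Rightarrow> complex) \<Rightarrow> ('a \<Rightarrow> complex)" where
  "zero_ext J f = (\<lambda>x. if x \<in> J then f x else 0)"

definition hs_integral_operator ::
  "'a measure \<Rightarrow> (('a \<Rightarrow> complex) \<Rightarrow> ('a \<Rightarrow> complex)) \<Rightarrow> bool"
where
  "hs_integral_operator M T \<longleftrightarrow>
     (\<exists>K. K \<in> L2 (M \<Otimes>\<^sub>M M) \<and>
        (\<forall>f\<in>L2 M. T f \<in> L2 M \<and> (AE x in M. T f x = (\<integral>t. K (x, t) * f t \<partial>M))))"

definition orthonormal_basis :: "'a measure \<Rightarrow> ('a \<Rightarrow> complex) set \<Rightarrow> bool" where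
  "orthonormal_basis M E \<longleftrightarrow>
     E \<subseteq> L2 M \<and> (\<forall>e\<in>E. \<forall>e'\<in>E. ip M e e' = (if e = e' then 1 else 0)) \<and>
     (\<forall>f\<in>L2 M. (\<forall>e\<in>E. ip M f e = 0) \<longrightarrow> (AE x in M. f x = 0))"

text \<open>
  The Hilbert-Schmidt norm computed with the orthonormal basis \<open>E\<close> (it does not depend on the
  choice of \<open>E\<close>).  The sum is taken in the extended nonnegative reals, so an operator that is not
  Hilbert-Schmidt has infinite norm.
\<close>

definition hs_norm ::
  "'a measure \<Rightarrow> ('a \<Rightarrow> complex) set \<Rightarrow> (('a \<Rightarrow> complex) \<Rightarrow> ('a \<Rightarrow> complex)) \<Rightarrow> ennreal"
where
  "hs_norm M E T =
     (let \<sigma> = (\<Sum>\<^sub>\<infinity>e\<in>E. \<integral>\<^sup>+x. ennreal ((norm (T e x))\<^sup>2) \<partial>M)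
      in if \<sigma> = \<infinity> then \<infinity> else ennreal (sqrt (enn2real \<sigma>)))"

definition abs_cont_on :: "real set \<Rightarrow> (real \<Rightarrow> complex) \<Rightarrow> bool" where
  "abs_cont_on S f \<longleftrightarrow>
     (\<forall>\<epsilon>>0. \<exists>\<delta>>0. \<forall>(n::nat) u v.
        (\<forall>i<n. u i \<le> v i \<and> {u i..v i} \<subseteq> S) \<and>
        disjoint_family_on (\<lambda>i. {u i<..<v i}) {..<n} \<and> (\<Sum>i<n. v i - u i) < \<delta>
        \<longrightarrow> (\<Sum>i<n. norm (f (v i) - f (u i))) < \<epsilon>)"

definition loc_abs_cont :: "real set \<Rightarrow> (real \<Rightarrow> complex) \<Rightarrow> bool" where
  "loc_abs_cont I f \<longleftrightarrow> (\<forall>c d. {c..d} \<subseteq> I \<longrightarrow> abs_cont_on {c..d} f)"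

definition L1_loc :: "real set \<Rightarrow> (real \<Rightarrow> real) \<Rightarrow> bool" where
  "L1_loc I f \<longleftrightarrow> (\<forall>c d. {c..d} \<subseteq> I \<longrightarrow> set_integrable lebesgue {c..d} f)"

text \<open>
  \<open>h\<close> is a function that is only determined almost everywhere in \<open>I\<close>: it counts as locally
  absolutely continuous if it has a locally absolutely continuous version, which is then unique
  on \<open>I\<close>.
\<close>

definition has_ac_version :: "real set \<Rightarrow> (real \<Rightarrow> complex) \<Rightarrow> bool" where
  "has_ac_version I h \<longleftrightarrow> (\<exists>g. loc_abs_cont I g \<and> (AE x in lebesgue_on I. g x = h x))"

definition ac_version :: "real set \<Rightarrow> (real \<Rightarrow> complex) \<Rightarrow> (real \<Rightarrow> complex)" where
  "ac_version I h = (SOME g. loc_abs_cont I g \<and> (AE x in lebesgue_on I. g x = h x))"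

definition qd1 :: "(real \<Rightarrow> complex) \<Rightarrow> (real \<Rightarrow> complex)" where
  "qd1 y = (\<lambda>x. vector_derivative y (at x))"

definition pre_qd2 :: "(real \<Rightarrow> real) \<Rightarrow> (real \<Rightarrow> complex) \<Rightarrow> (real \<Rightarrow> complex)" where
  "pre_qd2 p y = (\<lambda>x. of_real (p x) * vector_derivative (qd1 y) (at x))"

definition qd2 :: "real set \<Rightarrow> (real \<Rightarrow> real) \<Rightarrow> (real \<Rightarrow> complex) \<Rightarrow> (real \<Rightarrow> complex)" where
  "qd2 I p y = ac_version I (pre_qd2 p y)"

definition pre_qd3 ::
  "real set \<Rightarrow> (real \<Rightarrow> real) \<Rightarrow> (real \<Rightarrow> real) \<Rightarrow> (real \<Rightarrow> complex) \<Rightarrow> (real \<Rightarrow> complex)"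
where
  "pre_qd3 I p s y =
     (\<lambda>x. - vector_derivative (qd2 I p y) (at x) + of_real (s x) * qd1 y x)"

definition qd3 ::
  "real set \<Rightarrow> (real \<Rightarrow> real) \<Rightarrow> (real \<Rightarrow> real) \<Rightarrow> (real \<Rightarrow> complex) \<Rightarrow> (real \<Rightarrow> complex)"
where
  "qd3 I p s y = ac_version I (pre_qd3 I p s y)"

definition quasi_diff ::
  "real set \<Rightarrow> (real \<Rightarrow> real) \<Rightarrow> (real \<Rightarrow> real) \<Rightarrow> (real \<Rightarrow> complex) \<Rightarrow> bool"
where
  "quasi_diff I p s y \<longleftrightarrow>
     loc_abs_cont I y \<and> loc_abs_cont I (qd1 y) \<and>
     has_ac_version I (pre_qd2 p y) \<and> has_ac_version I (pre_qd3 I p s y)"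

definition ell ::
  "real set \<Rightarrow> (real \<Rightarrow> real) \<Rightarrow> (real \<Rightarrow> real) \<Rightarrow> (real \<Rightarrow> real) \<Rightarrow> (real \<Rightarrow> real)
     \<Rightarrow> (real \<Rightarrow> complex) \<Rightarrow> (real \<Rightarrow> complex)"
where
  "ell I p s q w y =
     (\<lambda>x. (1 / of_real (w x)) *
           (- vector_derivative (qd3 I p s y) (at x) + of_real (q x) * y x))"

definition bracket ::
  "real set \<Rightarrow> (real \<Rightarrow> real) \<Rightarrow> (real \<Rightarrow> real) \<Rightarrow> (real \<Rightarrow> complex) \<Rightarrow> (real \<Rightarrow> complex)
     \<Rightarrow> real \<Rightarrow> complex"
where
  "bracket I p s f g x =
     (f x * cnj (qd3 I p s g x) + qd1 f x * cnj (qd2 I p g x))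
     - (qd3 I p s f x * cnj (g x) + qd2 I p f x * cnj (qd1 g x))"

definition is_solution ::
  "real set \<Rightarrow> (real \<Rightarrow> real) \<Rightarrow> (real \<Rightarrow> real) \<Rightarrow> (real \<Rightarrow> real) \<Rightarrow> (real \<Rightarrow> real)
     \<Rightarrow> complex \<Rightarrow> (real \<Rightarrow> complex) \<Rightarrow> bool"
where
  "is_solution I p s q w z y \<longleftrightarrow>
     quasi_diff I p s y \<and> (AE x in lebesgue_on I. ell I p s q w y x = z * y x)"

definition wmeasure :: "real set \<Rightarrow> (real \<Rightarrow> real) \<Rightarrow> real measure" where
  "wmeasure I w = density (lebesgue_on I) (\<lambda>x. ennreal (w x))"

text \<open>
  Dimensions of solution spaces are complex dimensions.  Since the values of a solution outside
  the interval are irrelevant, they are normalised to \<open>0\<close> there.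
\<close>

global_interpretation cfun: vector_space "\<lambda>(c::complex) (f::real \<Rightarrow> complex). (\<lambda>x. c * f x)"
  by standard (auto simp: fun_eq_iff algebra_simps)

definition lim_type_left ::
  "ereal \<Rightarrow> ereal \<Rightarrow> (real \<Rightarrow> real) \<Rightarrow> (real \<Rightarrow> real) \<Rightarrow> (real \<Rightarrow> real) \<Rightarrow> (real \<Rightarrow> real)
     \<Rightarrow> nat \<Rightarrow> bool"
where
  "lim_type_left a b p s q w d \<longleftrightarrow>
     cfun.dim {y. is_solution (einterval a b) p s q w \<i> y \<and> (\<forall>x. x \<notin> einterval a b \<longrightarrow> y x = 0) \<and>
       (\<exists>c\<in>einterval a b. y \<in> L2 (wmeasure (einterval a (ereal c)) w))} = d"

definition lim_type_right ::
  "ereal \<Rightarrow> ereal \<Rightarrow> (real \<Rightarrow> real) \<Rightarrow> (real \<Rightarrow> real) \<Rightarrow> (real \<Rightarrow> real) \<Rightarrow> (real \<Rightarrow> real)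
     \<Rightarrow> nat \<Rightarrow> bool"
where
  "lim_type_right a b p s q w d \<longleftrightarrow>
     cfun.dim {y. is_solution (einterval a b) p s q w \<i> y \<and> (\<forall>x. x \<notin> einterval a b \<longrightarrow> y x = 0) \<and>
       (\<exists>c\<in>einterval a b. y \<in> L2 (wmeasure (einterval (ereal c) b) w))} = d"

definition Dmax ::
  "real set \<Rightarrow> (real \<Rightarrow> real) \<Rightarrow> (real \<Rightarrow> real) \<Rightarrow> (real \<Rightarrow> real) \<Rightarrow> (real \<Rightarrow> real)
     \<Rightarrow> (real \<Rightarrow> complex) set"
where
  "Dmax I p s q w =
     {y. quasi_diff I p s y \<and> y \<in> L2 (wmeasure I w) \<and> ell I p s q w y \<in> L2 (wmeasure I w)}"

definition graph_norm ::
  "real set \<Rightarrow> (real \<Rightarrow> real) \<Rightarrow> (real \<Rightarrow> real) \<Rightarrow> (real \<Rightarrow> real) \<Rightarrow> (real \<Rightarrow> real)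
     \<Rightarrow> (real \<Rightarrow> complex) \<Rightarrow> real"
where
  "graph_norm I p s q w y =
     sqrt ((l2norm (wmeasure I w) y)\<^sup>2 + (l2norm (wmeasure I w) (ell I p s q w y))\<^sup>2)"

definition Dmin ::
  "real set \<Rightarrow> (real \<Rightarrow> real) \<Rightarrow> (real \<Rightarrow> real) \<Rightarrow> (real \<Rightarrow> real) \<Rightarrow> (real \<Rightarrow> real)
     \<Rightarrow> (real \<Rightarrow> complex) set"
where
  "Dmin I p s q w =
     {y \<in> Dmax I p s q w. \<forall>\<epsilon>>0. \<exists>z\<in>Dmax I p s q w.
        (\<exists>c d. {c..d} \<subseteq> I \<and> (\<forall>x\<in>I - {c..d}. z x = 0)) \<and>
        graph_norm I p s q w (\<lambda>x. z x - y x) < \<epsilon>}"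

definition ell_graph ::
  "real set \<Rightarrow> (real \<Rightarrow> real) \<Rightarrow> (real \<Rightarrow> real) \<Rightarrow> (real \<Rightarrow> real) \<Rightarrow> (real \<Rightarrow> real)
     \<Rightarrow> (real \<Rightarrow> complex) set \<Rightarrow> ((real \<Rightarrow> complex) \<times> (real \<Rightarrow> complex)) set"
where
  "ell_graph I p s q w D = (\<lambda>y. (y, ell I p s q w y)) ` D"

text \<open>
  Boundary values of brackets are limits from inside the interval; as the endpoints may be infinite,
  the limits are taken in the extended reals.
\<close>

definition bracket_zero_left ::
  "ereal \<Rightarrow> ereal \<Rightarrow> (real \<Rightarrow> real) \<Rightarrow> (real \<Rightarrow> real) \<Rightarrow> (real \<Rightarrow> complex) \<Rightarrow> (real \<Rightarrow> complex) \<Rightarrow> bool"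
where
  "bracket_zero_left a b p s f g \<longleftrightarrow>
     ((\<lambda>t. bracket (einterval a b) p s f g (real_of_ereal t)) \<longlongrightarrow> 0) (at_right a)"

definition bracket_zero_right ::
  "ereal \<Rightarrow> ereal \<Rightarrow> (real \<Rightarrow> real) \<Rightarrow> (real \<Rightarrow> real) \<Rightarrow> (real \<Rightarrow> complex) \<Rightarrow> (real \<Rightarrow> complex) \<Rightarrow> bool"
where
  "bracket_zero_right a b p s f g \<longleftrightarrow>
     ((\<lambda>t. bracket (einterval a b) p s f g (real_of_ereal t)) \<longlongrightarrow> 0) (at_left b)"

text \<open>
  If the first parameter is \<open>None\<close>, no condition is imposed at \<open>a\<close>.
\<close>

definition bc_domain ::
  "(real \<Rightarrow> complex) option \<Rightarrow> (real \<Rightarrow> complex) \<Rightarrow> (real \<Rightarrow> complex) \<Rightarrow> ereal \<Rightarrow> ereal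
     \<Rightarrow> (real \<Rightarrow> real) \<Rightarrow> (real \<Rightarrow> real) \<Rightarrow> (real \<Rightarrow> real) \<Rightarrow> (real \<Rightarrow> real) \<Rightarrow> (real \<Rightarrow> complex) set"
where
  "bc_domain \<Phi> \<theta>\<^sub>1 \<theta>\<^sub>2 a b p s q w =
     {y \<in> Dmax (einterval a b) p s q w.
        (\<forall>\<phi>. \<Phi> = Some \<phi> \<longrightarrow> bracket_zero_left a b p s y \<phi>) \<and>
        bracket_zero_right a b p s y \<theta>\<^sub>1 \<and> bracket_zero_right a b p s y \<theta>\<^sub>2}"

definition bc_operator ::
  "(real \<Rightarrow> complex) option \<Rightarrow> (real \<Rightarrow> complex) \<Rightarrow> (real \<Rightarrow> complex) \<Rightarrow> ereal \<Rightarrow> ereal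
     \<Rightarrow> (real \<Rightarrow> real) \<Rightarrow> (real \<Rightarrow> real) \<Rightarrow> (real \<Rightarrow> real) \<Rightarrow> (real \<Rightarrow> real)
     \<Rightarrow> ((real \<Rightarrow> complex) \<times> (real \<Rightarrow> complex)) set"
where
  "bc_operator \<Phi> \<theta>\<^sub>1 \<theta>\<^sub>2 a b p s q w =
     ell_graph (einterval a b) p s q w (bc_domain \<Phi> \<theta>\<^sub>1 \<theta>\<^sub>2 a b p s q w)"

end

theory Submission
  imports Defs
begin

text \<open>
  On \<open>(a, b\<^sub>j)\<close> the difference of the two resolvents applied to \<open>f\<close> is a solution \<open>d\<close> of \<open>\<ell> d = \<mu> d\<close> that is
  admissible at \<open>a\<close>.  These solutions are two-dimensional and are parametrised by their brackets with
  \<open>\<theta>\<^sub>1, \<theta>\<^sub>2\<close>, at \<open>b\<close> as well as at \<open>b\<^sub>j\<close>: the boundary conditions are Lagrangian, so that vanishing brackets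
  at \<open>b\<^sub>j\<close> would force \<open>[d, d](b\<^sub>j) = 0\<close> and hence \<open>d = 0\<close>.  The operator therefore has rank two there, and it is
  determined by the functionals \<open>f \<mapsto> [S f, \<theta>\<^sub>i](b\<^sub>j)\<close>.  Green's representation of \<open>S f\<close> turns these into inner
  products with explicit functions whose norms tend to \<open>0\<close>, because \<open>[S f, \<theta>\<^sub>i](b) = 0\<close> and because every
  solution is square integrable near the lim-4 endpoint \<open>b\<close>.  On \<open>[b\<^sub>j, b)\<close> the operator is \<open>S\<close> itself, whose
  kernel has a square integrable tail for the same reason.  Both kernels are bounded by tensor products with small
  norms, and Bessel's inequality bounds the Hilbert-Schmidt norm by the norm of the kernel.
\<close>

text \<open>Self-adjointness of \<open>L\<close> enters through two consequences: (L - z) y = f is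
  solvable for every nonreal z, and the boundary form vanishes on the domain. Cutting functions off
  makes that form vanish at each endpoint separately. Solvability also produces the solutions that
  are admissible at \<open>a\<close> with prescribed boundary values at \<open>b\<close>: extend a
  function with these boundary values by zero towards \<open>a\<close> and subtract the resolvent of
  its defect. The lim-4 property speaks of the parameter \<open>\<i>\<close> alone, so square
  integrability for the other parameters is won by variation of constants, with a tail small enough
  to be absorbed. That the functionals at b_j tend to 0 on each f does not give norm convergence;
  their representing functions converge in norm to an explicit limit, and testing with the conjugate
  of this limit shows that it is 0. Absolute continuity is given by epsilon and delta; the analysis
  runs on pairs of a function and its density (\<open>is_primitive\<close>), and matching the two on
  open sets takes the Lebesgue differentiation and Radon-Nikodym theorems.\<close>

section \<open>Lebesgue differentiation on the line\<close>

lemma set_integral_absolutely_continuous: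
  fixes f :: "'a \<Rightarrow> 'b::{banach, second_countable_topology}"
  assumes f: "integrable M f" and "\<epsilon> > 0"
  obtains \<delta> where "\<delta> > 0"
    "\<And>A. A \<in> sets M \<Longrightarrow> emeasure M A < ennreal \<delta> \<Longrightarrow> (LINT x:A|M. norm (f x)) < \<epsilon>"
proof -
  have [measurable]: "f \<in> borel_measurable M" using f by auto
  \<comment> \<open>The part of \<open>norm (f x)\<close> above the level m has a small integral for
    large m. Below that level the integrand is at most m, so a set of small measure contributes
    little.\<close>
  have "(\<lambda>m::nat. LINT x|M. max 0 (norm (f x) - real m)) \<longlonglongrightarrow> (LINT x|M. 0)"
  proof (rule integral_dominated_convergence)
    show "integrable M (\<lambda>x. norm (f x))" using f by auto
    show "AE x in M. (\<lambda>m. max 0 (norm (f x) - real m)) \<longlonglongrightarrow> 0"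
    proof (rule AE_I2, rule tendsto_eventually)
      fix x
      obtain n :: nat where "norm (f x) \<le> n" using real_arch_simple by blast
      then show "\<forall>\<^sub>F m in sequentially. max 0 (norm (f x) - real m) = 0"
        by (auto simp: eventually_sequentially intro!: exI[of _ n])
    qed
  qed auto
  then have "\<forall>\<^sub>F m in sequentially. (LINT x|M. max 0 (norm (f x) - real m)) < \<epsilon> / 2"
    using \<open>\<epsilon> > 0\<close> by (intro order_tendstoD(2)) auto
  then obtain m :: nat where m: "(LINT x|M. max 0 (norm (f x) - real m)) < \<epsilon> / 2"
    by (auto simp: eventually_sequentially)
  show ?thesis
  proof
    \<comment> \<open>The summand 1 keeps the denominator positive at level m = 0; the part below
      the level then contributes less than \<epsilon>/2.\<close>
    show "\<epsilon> / (2 * (real m + 1)) > 0" using \<open>\<epsilon> > 0\<close> by simp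
    fix A assume A[measurable]: "A \<in> sets M" and small: "emeasure M A < ennreal (\<epsilon> / (2 * (real m + 1)))"
    have fin: "A \<in> fmeasurable M" using A small by (intro fmeasurableI) (auto intro: less_trans)
    then have mA: "measure M A < \<epsilon> / (2 * (real m + 1))"
      using small \<open>\<epsilon> > 0\<close> by (simp add: emeasure_eq_measure2 ennreal_less_iff)
    have i1: "integrable M (\<lambda>x. indicator A x * real m)"
      using fin by (auto simp: fmeasurable_def)
    have i2: "integrable M (\<lambda>x. max 0 (norm (f x) - real m))"
      by (rule Bochner_Integration.integrable_bound[OF f]) auto
    have "(LINT x:A|M. norm (f x)) \<le> (LINT x|M. indicator A x * real m + max 0 (norm (f x) - real m))"
      unfolding set_lebesgue_integral_def
      by (rule integral_mono) (use f i1 i2 integrable_mult_indicator[OF A, of "\<lambda>x. norm (f x)"] in \<open>auto simp: indicator_def\<close>)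
    also have "\<dots> = measure M A * m + (LINT x|M. max 0 (norm (f x) - real m))"
      using i1 i2 fin by (simp add: fmeasurable_def)
    also have "measure M A * m \<le> measure M A * (real m + 1)" by (simp add: mult_left_mono)
    also have "measure M A * (real m + 1) < \<epsilon> / 2" using mA by (simp add: field_simps)
    finally show "(LINT x:A|M. norm (f x)) < \<epsilon>" using m by linarith
  qed
qed

text \<open>Vitali covering argument. The zero set of \<open>k\<close> has an open neighbourhood
  \<open>U\<close> on which the integral of \<open>k\<close> is small. Disjoint balls in
  \<open>U\<close> with large averages have total length at most 1/\<eta> times that integral, and
  their fivefold dilates cover the set in question.\<close>

lemma negligible_large_averages_zero_set:
  fixes k :: "real \<Rightarrow> real"
  assumes k: "integrable lebesgue k" "\<And>x. 0 \<le> k x" and "\<eta> > 0"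
  shows "negligible {x. k x = 0 \<and> (\<forall>\<delta>>0. \<exists>t. 0 < t \<and> t < \<delta> \<and> (LINT y:ball x t|lebesgue. k y) > \<eta> * t)}"
    (is "negligible ?E")
  unfolding negligible_outer_le
proof (intro allI impI)
  fix e :: real assume "e > 0"
  have [measurable]: "k \<in> borel_measurable lebesgue" using k by auto
  \<comment> \<open>A dilated ball has length 10 \<tau>, while \<tau> is below 1/\<eta> times the
    integral over the original ball; this fixes the budget \<eta> e / 10 for the integral of
    \<open>k\<close> over \<open>U\<close>.\<close>
  have "\<eta> * e / 10 > 0" using \<open>e > 0\<close> \<open>\<eta> > 0\<close> by simp
  then obtain \<delta> where \<delta>: "\<delta> > 0"
    "\<And>A. A \<in> sets lebesgue \<Longrightarrow> emeasure lebesgue A < ennreal \<delta> \<Longrightarrow> (LINT x:A|lebesgue. norm (k x)) < \<eta> * e / 10"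
    using set_integral_absolutely_continuous[OF k(1)] by metis
  define Z where "Z = {x. k x = 0}"
  have Z: "Z \<in> sets lebesgue"
    using measurable_sets[of k lebesgue borel "{0}"] by (simp add: Z_def vimage_def)
  obtain U where U: "open U" "Z \<subseteq> U" "U - Z \<in> lmeasurable" "emeasure lebesgue (U - Z) < ennreal \<delta>"
    using sets_lebesgue_outer_open[OF Z \<delta>(1)] by blast
  have [measurable]: "U \<in> sets lebesgue" using U(1) by (simp add: borel_open)
  have ki: "set_integrable lebesgue A k" if "A \<in> sets lebesgue" for A
    using k(1) that unfolding set_integrable_def by (rule integrable_mult_indicator[rotated])
  \<comment> \<open>\<open>k\<close> vanishes on \<open>Z\<close>, so only the excess
    \<open>U - Z\<close> contributes, and its measure is below \<open>\<delta>\<close>.\<close>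
  have "(LINT x:U|lebesgue. k x) = (LINT x:(U - Z)|lebesgue. norm (k x))"
    unfolding set_lebesgue_integral_def
    by (rule Bochner_Integration.integral_cong) (use k(2) in \<open>auto simp: Z_def indicator_def\<close>)
  then have small: "(LINT x:U|lebesgue. k x) < \<eta> * e / 10"
    using \<delta>(2)[OF _ U(4)] U(3) by auto
  define g where "g x t = (LINT y:ball x t|lebesgue. k y)" for x t
  define E where "E = {x. k x = 0 \<and> (\<forall>\<delta>>0. \<exists>t. 0 < t \<and> t < \<delta> \<and> g x t > \<eta> * t)}"
  have "\<exists>t. 0 < t \<and> t < 1 \<and> ball x t \<subseteq> U \<and> g x t > \<eta> * t" if "x \<in> E" for x
  proof -
    have "x \<in> U" using that U(2) by (auto simp: Z_def E_def)
    then obtain r where r: "r > 0" "ball x r \<subseteq> U" using U(1) openE by blast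
    have "0 < min r 1" using r(1) by simp
    moreover have "\<forall>\<delta>>0. \<exists>t. 0 < t \<and> t < \<delta> \<and> g x t > \<eta> * t"
      using that unfolding E_def mem_Collect_eq by (rule conjunct2)
    ultimately have "\<exists>t. 0 < t \<and> t < min r 1 \<and> g x t > \<eta> * t" by iprover
    then obtain t where "0 < t" "t < min r 1" "g x t > \<eta> * t" by (elim exE conjE)
    moreover have "ball x t \<subseteq> ball x r" using \<open>t < min r 1\<close> by (intro subset_ball) simp
    ultimately show ?thesis using r(2) by (intro exI[of _ t]) auto
  qed
  then obtain \<tau> where \<tau>: "\<And>x. x \<in> E \<Longrightarrow> 0 < \<tau> x \<and> \<tau> x < 1 \<and> ball x (\<tau> x) \<subseteq> U \<and> g x (\<tau> x) > \<eta> * \<tau> x"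
    by metis
  obtain C where C: "countable C" "C \<subseteq> E" "pairwise (\<lambda>i j. disjnt (ball i (\<tau> i)) (ball j (\<tau> j))) C"
     "E \<subseteq> (\<Union>i\<in>C. ball i (5 * \<tau> i))"
  proof (rule Vitali_covering_lemma_balls[where S = E and K = E and a = "\<lambda>i. i" and r = \<tau> and B = 1])
    show "E \<subseteq> (\<Union>i\<in>E. ball i (\<tau> i))" using \<tau> by (auto intro!: bexI)
    show "0 < \<tau> i \<and> \<tau> i \<le> 1" if "i \<in> E" for i using \<tau>[OF that] by simp
  qed
  have bound: "measure lebesgue (\<Union>i\<in>D. ball i (5 * \<tau> i)) \<le> e" if D: "D \<subseteq> C" "finite D" for D
  proof -
    have DE: "i \<in> E" if "i \<in> D" for i using that D C by blast
    have "measure lebesgue (\<Union>i\<in>D. ball i (5 * \<tau> i)) \<le> (\<Sum>i\<in>D. measure lebesgue (ball i (5 * \<tau> i)))"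
      using D by (intro measure_UNION_le) auto
    also have "\<dots> = (\<Sum>i\<in>D. 10 * \<tau> i)"
    proof (rule sum.cong[OF refl])
      fix i assume "i \<in> D"
      then have "0 < \<tau> i" using \<tau> DE by blast
      then show "measure lebesgue (ball i (5 * \<tau> i)) = 10 * \<tau> i" by (simp add: ball_eq_greaterThanLessThan)
    qed
    also have "\<dots> \<le> (\<Sum>i\<in>D. 10 / \<eta> * (LINT y:ball i (\<tau> i)|lebesgue. k y))"
    proof (rule sum_mono)
      fix i assume "i \<in> D"
      then have "\<eta> * \<tau> i < (LINT y:ball i (\<tau> i)|lebesgue. k y)" using \<tau> DE unfolding g_def by blast
      then show "10 * \<tau> i \<le> 10 / \<eta> * (LINT y:ball i (\<tau> i)|lebesgue. k y)"
        using \<open>\<eta> > 0\<close> by (simp add: field_simps)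
    qed
    also have "\<dots> = 10 / \<eta> * (LINT y:(\<Union>i\<in>D. ball i (\<tau> i))|lebesgue. k y)"
    proof (subst set_integral_finite_Union)
      show "disjoint_family_on (\<lambda>i. ball i (\<tau> i)) D"
        using C(3) D(1) by (auto simp: disjoint_family_on_def pairwise_def disjnt_def)
    qed (use D ki in \<open>auto simp: sum_distrib_left\<close>)
    also have "\<dots> \<le> 10 / \<eta> * (LINT y:U|lebesgue. k y)"
    proof (rule mult_left_mono)
      have sub: "(\<Union>i\<in>D. ball i (\<tau> i)) \<subseteq> U" using \<tau> DE by blast
      show "(LINT y:(\<Union>i\<in>D. ball i (\<tau> i))|lebesgue. k y) \<le> (LINT y:U|lebesgue. k y)"
        unfolding set_lebesgue_integral_def
      proof (rule integral_mono)
        show "integrable lebesgue (\<lambda>x. indicat_real (\<Union>i\<in>D. ball i (\<tau> i)) x *\<^sub>R k x)"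
          by (rule integrable_mult_indicator[OF _ k(1)]) (use D in \<open>auto intro!: sets.finite_UN\<close>)
        show "integrable lebesgue (\<lambda>x. indicat_real U x *\<^sub>R k x)"
          using ki[of U] unfolding set_integrable_def by auto
        show "indicat_real (\<Union>i\<in>D. ball i (\<tau> i)) x *\<^sub>R k x \<le> indicat_real U x *\<^sub>R k x" for x
          using sub k(2)[of x] by (intro scaleR_right_mono) (auto simp: indicator_def simp del: UN_iff mem_ball)
      qed
    qed (use \<open>\<eta> > 0\<close> in auto)
    also have "\<dots> \<le> e" using small \<open>\<eta> > 0\<close> by (simp add: field_simps)
    finally show ?thesis .
  qed
  show "\<exists>T. ?E \<subseteq> T \<and> T \<in> lmeasurable \<and> measure lebesgue T \<le> e"
  proof (intro exI conjI)
    show "?E \<subseteq> (\<Union>i\<in>C. ball i (5 * \<tau> i))" using C(4) unfolding E_def g_def .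
    show "(\<Union>i\<in>C. ball i (5 * \<tau> i)) \<in> lmeasurable" "measure lebesgue (\<Union>i\<in>C. ball i (5 * \<tau> i)) \<le> e"
      using fmeasurable_UN_bound[of C "\<lambda>i. ball i (5 * \<tau> i)" lebesgue e]
        measure_UN_bound[of C "\<lambda>i. ball i (5 * \<tau> i)" lebesgue e] C(1) bound by (auto simp: lmeasurable_ball)
  qed
qed

text \<open>The upper half of Lebesgue's differentiation theorem; the lower half is its application to \<open>-h\<close>.\<close>

lemma AE_upper_averages:
  fixes h :: "real \<Rightarrow> real"
  assumes h: "integrable lebesgue h"
  shows "AE x in lebesgue. \<forall>e>0. \<exists>\<delta>>0. \<forall>u v. u \<le> x \<and> x \<le> v \<and> u < v \<and> v - u < \<delta> \<longrightarrow>
    (LINT y:{u..v}|lebesgue. h y) < (h x + e) * (v - u)"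
proof -
  have [measurable]: "h \<in> borel_measurable lebesgue" using h by auto
  \<comment> \<open>Where h x < r, the positive part of h - r vanishes at x, so the preceding lemma
    applies to it. The window [c, c+2] makes it integrable, and rational r and c keep the
    exceptional sets countable in number.\<close>
  define E where "E r c n = {x. max 0 (indicator {c..c+2} x * (h x - r)) = 0 \<and> (\<forall>\<delta>>0. \<exists>t. 0 < t \<and> t < \<delta> \<and>
      (LINT y:ball x t|lebesgue. max 0 (indicator {c..c+2} y * (h y - r))) > 1 / Suc n * t)}" for r c :: real and n :: nat
  have ki: "integrable lebesgue (\<lambda>y. max 0 (indicator {c..c+2} y * (h y - r)))" for r c :: real
  proof (rule integrable_max)
    have "integrable lebesgue (\<lambda>y. indicator {c..c+2} y *\<^sub>R h y - indicator {c..c+2} y *\<^sub>R r)"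
      by (intro Bochner_Integration.integrable_diff integrable_mult_indicator h integrable_scaleR_left) (auto simp: integrable_indicator_iff)
    then show "integrable lebesgue (\<lambda>y. indicator {c..c+2} y * (h y - r))" by (simp add: algebra_simps)
  qed auto
  have neg: "negligible (E r c n)" for r c n
    unfolding E_def by (rule negligible_large_averages_zero_set) (use ki in auto)
  have "negligible (\<Union>(r, c, n) \<in> \<rat> \<times> \<rat> \<times> UNIV. E r c n)"
    by (rule negligible_countable_Union) (use neg countable_rat in \<open>auto simp: image_iff\<close>)
  then have "AE x in lebesgue. x \<notin> (\<Union>(r, c, n) \<in> \<rat> \<times> \<rat> \<times> UNIV. E r c n)"
    unfolding negligible_iff_null_sets by (rule AE_not_in)
  then show ?thesis
  proof (eventually_elim, safe)
    fix x e :: real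
    assume nin: "x \<notin> (\<Union>(r, c, n) \<in> \<rat> \<times> \<rat> \<times> UNIV. E r c n)" and "e > 0"
    obtain r where r: "r \<in> \<rat>" "h x < r" "r < h x + e / 2" using Rats_dense_in_real[of "h x" "h x + e / 2"] \<open>e > 0\<close> by auto
    \<comment> \<open>The window [c, c+2] contains [x - 1/2, x + 1/2], hence every interval around x
      that is shorter than 1/2.\<close>
    obtain c where c: "c \<in> \<rat>" "x - 3/2 < c" "c < x - 1/2" using Rats_dense_in_real[of "x - 3/2" "x - 1/2"] by auto
    obtain n :: nat where n: "1 / Suc n < e / 4" using \<open>e > 0\<close> nat_approx_posE[of "e / 4"] by auto
    let ?k = "\<lambda>y. max 0 (indicator {c..c+2} y * (h y - r))"
    have "x \<notin> E r c n" using nin r c by auto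
    moreover have "?k x = 0" using r by (auto simp: indicator_def)
    moreover define g where "g t = (LINT y:ball x t|lebesgue. ?k y)" for t
    ultimately have "\<not> (\<forall>\<delta>>0. \<exists>t. 0 < t \<and> t < \<delta> \<and> g t > 1 / Suc n * t)"
      unfolding E_def by simp
    then have "\<exists>\<delta>>0. \<forall>t. 0 < t \<and> t < \<delta> \<longrightarrow> g t \<le> 1 / Suc n * t"
      by (meson not_le)
    then obtain \<delta> where \<delta>: "\<delta> > 0" "\<And>t. 0 < t \<Longrightarrow> t < \<delta> \<Longrightarrow> (LINT y:ball x t|lebesgue. ?k y) \<le> 1 / Suc n * t"
      unfolding g_def by blast
    show "\<exists>\<delta>>0. \<forall>u v. u \<le> x \<and> x \<le> v \<and> u < v \<and> v - u < \<delta> \<longrightarrow>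
        (LINT y:{u..v}|lebesgue. h y) < (h x + e) * (v - u)"
    proof (intro exI[of _ "min (\<delta>/2) (1/2)"] conjI allI impI)
      fix u v assume uv: "u \<le> x \<and> x \<le> v \<and> u < v \<and> v - u < min (\<delta>/2) (1/2)"
      \<comment> \<open>An interval containing x, not necessarily centred, lies in the centred ball
        whose radius is twice its length. This factor 2 is why 1 / Suc n was taken below e/4; the
        other e/2 is the distance kept between r and h x + e.\<close>
      have sub: "{u..v} \<subseteq> ball x (2 * (v - u))" using uv by (auto simp: dist_real_def)
      have sub2: "{u..v} \<subseteq> {c..c+2}" using uv c by auto
      have i1: "set_integrable lebesgue {u..v} h" "set_integrable lebesgue {u..v} (\<lambda>y. r)"
        unfolding set_integrable_def
        by (rule integrable_mult_indicator[OF _ h], simp)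
          (rule integrable_scaleR_left, use uv in \<open>simp add: integrable_indicator_iff\<close>)
      have "(LINT y:{u..v}|lebesgue. h y) - r * (v - u) = (LINT y:{u..v}|lebesgue. h y - r)"
        using uv i1 by (subst set_integral_diff(2)) (auto simp: set_lebesgue_integral_def)
      also have "\<dots> \<le> (LINT y:ball x (2 * (v - u))|lebesgue. ?k y)"
        unfolding set_lebesgue_integral_def
      proof (rule integral_mono)
        show "integrable lebesgue (\<lambda>y. indicat_real {u..v} y *\<^sub>R (h y - r))"
          using set_integral_diff(1)[OF i1] by (simp add: set_integrable_def)
        show "integrable lebesgue (\<lambda>y. indicat_real (ball x (2 * (v - u))) y *\<^sub>R ?k y)"
          by (rule integrable_mult_indicator) (use ki in auto)
        show "indicat_real {u..v} y *\<^sub>R (h y - r) \<le> indicat_real (ball x (2 * (v - u))) y *\<^sub>R ?k y" for y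
          using sub sub2 by (cases "y \<in> {u..v}") (auto simp: indicator_def)
      qed
      also have "\<dots> \<le> 1 / Suc n * (2 * (v - u))" using uv by (intro \<delta>(2)) auto
      also have "\<dots> = (2 * (1 / Suc n)) * (v - u)" by simp
      also have "\<dots> \<le> (e / 2) * (v - u)" using n uv by (intro mult_right_mono) linarith+
      also have "\<dots> < (h x + e - r) * (v - u)" using r uv by (intro mult_strict_right_mono) auto
      also have "\<dots> = (h x + e) * (v - u) - r * (v - u)" by (simp add: algebra_simps)
      finally show "(LINT y:{u..v}|lebesgue. h y) < (h x + e) * (v - u)" by simp
    qed (use \<delta> in auto)
  qed
qed


text \<open>The one-sided estimate is applied to the real and imaginary parts and their negatives,
  each with e/2, since the modulus is at most the sum of the moduli of the two parts.\<close>

lemma AE_averages: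
  fixes h :: "real \<Rightarrow> complex"
  assumes h: "integrable lebesgue h"
  shows "AE x in lebesgue. \<forall>e>0. \<exists>\<delta>>0. \<forall>u v. u \<le> x \<and> x \<le> v \<and> u < v \<and> v - u < \<delta> \<longrightarrow>
    norm ((LINT y:{u..v}|lebesgue. h y) - of_real (v - u) * h x) \<le> e * (v - u)"
proof -
  have hi: "set_integrable lebesgue {u..v} h" for u v
    unfolding set_integrable_def by (rule integrable_mult_indicator[OF _ h]) simp
  have re: "(LINT y:{u..v}|lebesgue. Re (h y)) = Re (LINT y:{u..v}|lebesgue. h y)"
    "(LINT y:{u..v}|lebesgue. - Re (h y)) = - Re (LINT y:{u..v}|lebesgue. h y)"
    "(LINT y:{u..v}|lebesgue. Im (h y)) = Im (LINT y:{u..v}|lebesgue. h y)"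
    "(LINT y:{u..v}|lebesgue. - Im (h y)) = - Im (LINT y:{u..v}|lebesgue. h y)" for u v
    using hi[of u v] unfolding set_lebesgue_integral_def set_integrable_def
    by (simp_all flip: integral_Re integral_Im)
  have "AE x in lebesgue. \<forall>e>0. \<exists>\<delta>>0. \<forall>u v. u \<le> x \<and> x \<le> v \<and> u < v \<and> v - u < \<delta> \<longrightarrow>
      Re (LINT y:{u..v}|lebesgue. h y) < (Re (h x) + e) * (v - u)"
    using AE_upper_averages[OF integrable_Re[OF h]] by (simp only: re)
  moreover have "AE x in lebesgue. \<forall>e>0. \<exists>\<delta>>0. \<forall>u v. u \<le> x \<and> x \<le> v \<and> u < v \<and> v - u < \<delta> \<longrightarrow>
      - Re (LINT y:{u..v}|lebesgue. h y) < (- Re (h x) + e) * (v - u)"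
    using AE_upper_averages[OF Bochner_Integration.integrable_minus[OF integrable_Re[OF h]]] by (simp only: re)
  moreover have "AE x in lebesgue. \<forall>e>0. \<exists>\<delta>>0. \<forall>u v. u \<le> x \<and> x \<le> v \<and> u < v \<and> v - u < \<delta> \<longrightarrow>
      Im (LINT y:{u..v}|lebesgue. h y) < (Im (h x) + e) * (v - u)"
    using AE_upper_averages[OF integrable_Im[OF h]] by (simp only: re)
  moreover have "AE x in lebesgue. \<forall>e>0. \<exists>\<delta>>0. \<forall>u v. u \<le> x \<and> x \<le> v \<and> u < v \<and> v - u < \<delta> \<longrightarrow>
      - Im (LINT y:{u..v}|lebesgue. h y) < (- Im (h x) + e) * (v - u)"
    using AE_upper_averages[OF Bochner_Integration.integrable_minus[OF integrable_Im[OF h]]] by (simp only: re)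
  ultimately show ?thesis
  proof (eventually_elim, intro allI impI)
    fix x e :: real
    assume *: "\<forall>e>0. \<exists>\<delta>>0. \<forall>u v. u \<le> x \<and> x \<le> v \<and> u < v \<and> v - u < \<delta> \<longrightarrow>
        Re (LINT y:{u..v}|lebesgue. h y) < (Re (h x) + e) * (v - u)"
      "\<forall>e>0. \<exists>\<delta>>0. \<forall>u v. u \<le> x \<and> x \<le> v \<and> u < v \<and> v - u < \<delta> \<longrightarrow>
        - Re (LINT y:{u..v}|lebesgue. h y) < (- Re (h x) + e) * (v - u)"
      "\<forall>e>0. \<exists>\<delta>>0. \<forall>u v. u \<le> x \<and> x \<le> v \<and> u < v \<and> v - u < \<delta> \<longrightarrow>
        Im (LINT y:{u..v}|lebesgue. h y) < (Im (h x) + e) * (v - u)"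
      "\<forall>e>0. \<exists>\<delta>>0. \<forall>u v. u \<le> x \<and> x \<le> v \<and> u < v \<and> v - u < \<delta> \<longrightarrow>
        - Im (LINT y:{u..v}|lebesgue. h y) < (- Im (h x) + e) * (v - u)"
      and "e > 0"
    have e: "e / 2 > 0" using \<open>e > 0\<close> by simp
    note s = *[THEN spec, THEN mp, OF e]
    from s(1) obtain d1 where d1: "d1 > 0" "\<forall>u v. u \<le> x \<and> x \<le> v \<and> u < v \<and> v - u < d1 \<longrightarrow>
        Re (LINT y:{u..v}|lebesgue. h y) < (Re (h x) + e/2) * (v - u)" by (elim exE conjE)
    from s(2) obtain d2 where d2: "d2 > 0" "\<forall>u v. u \<le> x \<and> x \<le> v \<and> u < v \<and> v - u < d2 \<longrightarrow>
        - Re (LINT y:{u..v}|lebesgue. h y) < (- Re (h x) + e/2) * (v - u)" by (elim exE conjE)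
    from s(3) obtain d3 where d3: "d3 > 0" "\<forall>u v. u \<le> x \<and> x \<le> v \<and> u < v \<and> v - u < d3 \<longrightarrow>
        Im (LINT y:{u..v}|lebesgue. h y) < (Im (h x) + e/2) * (v - u)" by (elim exE conjE)
    from s(4) obtain d4 where d4: "d4 > 0" "\<forall>u v. u \<le> x \<and> x \<le> v \<and> u < v \<and> v - u < d4 \<longrightarrow>
        - Im (LINT y:{u..v}|lebesgue. h y) < (- Im (h x) + e/2) * (v - u)" by (elim exE conjE)
    show "\<exists>\<delta>>0. \<forall>u v. u \<le> x \<and> x \<le> v \<and> u < v \<and> v - u < \<delta> \<longrightarrow>
        norm ((LINT y:{u..v}|lebesgue. h y) - of_real (v - u) * h x) \<le> e * (v - u)"
    proof (intro exI[of _ "min (min d1 d2) (min d3 d4)"] conjI allI impI)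
      fix u v assume uv: "u \<le> x \<and> x \<le> v \<and> u < v \<and> v - u < min (min d1 d2) (min d3 d4)"
      define z where "z = (LINT y:{u..v}|lebesgue. h y)"
      have "Re z < (Re (h x) + e/2) * (v - u)" "- Re z < (- Re (h x) + e/2) * (v - u)"
        "Im z < (Im (h x) + e/2) * (v - u)" "- Im z < (- Im (h x) + e/2) * (v - u)"
        using d1(2)[rule_format, of u v] d2(2)[rule_format, of u v] d3(2)[rule_format, of u v]
          d4(2)[rule_format, of u v] uv unfolding z_def by auto
      moreover have "Re (z - of_real (v - u) * h x) = Re z - Re (h x) * (v - u)"
        "Im (z - of_real (v - u) * h x) = Im z - Im (h x) * (v - u)" by (simp_all add: mult.commute)
      ultimately have "\<bar>Re (z - of_real (v - u) * h x)\<bar> \<le> e/2 * (v - u)" "\<bar>Im (z - of_real (v - u) * h x)\<bar> \<le> e/2 * (v - u)"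
        unfolding abs_le_iff distrib_right mult_minus_left by linarith+
      then show "norm (z - of_real (v - u) * h x) \<le> e * (v - u)"
        using cmod_le[of "z - of_real (v - u) * h x"] by linarith
    qed (use d1 d2 d3 d4 in auto)
  qed
qed

section \<open>Primitives and absolute continuity\<close>

text \<open>The working notion of local absolute continuity, with the density kept explicit: it may
  be changed on null sets, and the rules of calculus become rules for pairs.
  \<open>is_primitive_imp_loc_abs_cont\<close> and \<open>loc_abs_cont_imp_is_primitive\<close>
  connect it with the epsilon-delta notion.\<close>

definition is_primitive :: "real set \<Rightarrow> (real \<Rightarrow> complex) \<Rightarrow> (real \<Rightarrow> complex) \<Rightarrow> bool" where
  "is_primitive I F f \<longleftrightarrow> (\<forall>c d. c \<le> d \<longrightarrow> {c..d} \<subseteq> I \<longrightarrow>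
     set_integrable lebesgue {c..d} f \<and> (LINT x:{c..d}|lebesgue. f x) = F d - F c)"

lemma is_primitiveD:
  assumes "is_primitive I F f" "{c..d} \<subseteq> I"
  shows "set_integrable lebesgue {c..d} f" "c \<le> d \<Longrightarrow> (LINT x:{c..d}|lebesgue. f x) = F d - F c"
  using assms by (cases "c \<le> d"; auto simp: is_primitive_def set_integrable_def)+

text \<open>The density is integrable on compact subintervals only. Averages are therefore taken for
  its truncations to the countably many intervals with rational endpoints inside \<open>I\<close>;
  each point of \<open>I\<close> is interior to one of them.\<close>

lemma is_primitive_has_derivative:
  assumes F: "is_primitive I F f" and I: "open I"
  shows "AE x in lebesgue. x \<in> I \<longrightarrow> (F has_vector_derivative f x) (at x)"
proof -
  let ?h = "\<lambda>c d x. indicator {c..d} x *\<^sub>R f x"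
  have "AE x in lebesgue. \<forall>p\<in>{(c, d) \<in> \<rat> \<times> \<rat>. {c..d} \<subseteq> I}. \<forall>e>0. \<exists>\<delta>>0. \<forall>u v. u \<le> x \<and> x \<le> v \<and> u < v \<and> v - u < \<delta> \<longrightarrow>
     norm ((LINT y:{u..v}|lebesgue. ?h (fst p) (snd p) y) - of_real (v - u) * ?h (fst p) (snd p) x) \<le> e * (v - u)"
  proof (subst AE_ball_countable)
    show "countable {(c, d) \<in> \<rat> \<times> \<rat>. {c..d} \<subseteq> I}"
      by (rule countable_subset[of _ "\<rat> \<times> \<rat>"]) (auto simp: countable_rat)
    show "\<forall>p\<in>{(c, d) \<in> \<rat> \<times> \<rat>. {c..d} \<subseteq> I}. AE x in lebesgue. \<forall>e>0. \<exists>\<delta>>0. \<forall>u v. u \<le> x \<and> x \<le> v \<and> u < v \<and> v - u < \<delta> \<longrightarrow>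
     norm ((LINT y:{u..v}|lebesgue. ?h (fst p) (snd p) y) - of_real (v - u) * ?h (fst p) (snd p) x) \<le> e * (v - u)"
    proof
      fix p assume "p \<in> {(c, d) \<in> \<rat> \<times> \<rat>. {c..d} \<subseteq> I}"
      then have "integrable lebesgue (?h (fst p) (snd p))"
        using is_primitiveD(1)[OF F, of "fst p" "snd p"] by (auto simp: set_integrable_def)
      then show "AE x in lebesgue. \<forall>e>0. \<exists>\<delta>>0. \<forall>u v. u \<le> x \<and> x \<le> v \<and> u < v \<and> v - u < \<delta> \<longrightarrow>
         norm ((LINT y:{u..v}|lebesgue. ?h (fst p) (snd p) y) - of_real (v - u) * ?h (fst p) (snd p) x) \<le> e * (v - u)"
        by (rule AE_averages)
    qed
  qed
  then show ?thesis
  proof (eventually_elim, intro impI)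
    fix x
    assume *: "\<forall>p\<in>{(c, d) \<in> \<rat> \<times> \<rat>. {c..d} \<subseteq> I}. \<forall>e>0. \<exists>\<delta>>0. \<forall>u v. u \<le> x \<and> x \<le> v \<and> u < v \<and> v - u < \<delta> \<longrightarrow>
     norm ((LINT y:{u..v}|lebesgue. ?h (fst p) (snd p) y) - of_real (v - u) * ?h (fst p) (snd p) x) \<le> e * (v - u)"
      and "x \<in> I"
    obtain r where r: "r > 0" "ball x r \<subseteq> I" using \<open>x \<in> I\<close> I openE by blast
    obtain c where c: "c \<in> \<rat>" "x - r < c" "c < x" using Rats_dense_in_real[of "x - r" x] r(1) by auto
    obtain d where d: "d \<in> \<rat>" "x < d" "d < x + r" using Rats_dense_in_real[of x "x + r"] r(1) by auto
    have cd: "{c..d} \<subseteq> I" using r c d by (auto simp: subset_iff dist_real_def)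
    have avg: "\<forall>e>0. \<exists>\<delta>>0. \<forall>u v. u \<le> x \<and> x \<le> v \<and> u < v \<and> v - u < \<delta> \<longrightarrow>
      norm ((LINT y:{u..v}|lebesgue. ?h c d y) - of_real (v - u) * ?h c d x) \<le> e * (v - u)"
      using bspec[OF *, of "(c, d)"] c d cd by simp
    show "(F has_vector_derivative f x) (at x)"
      unfolding has_vector_derivative_def has_derivative_at_alt
    proof (intro conjI allI impI bounded_linear_scaleR_left)
      fix e :: real assume "e > 0"
      with avg obtain \<delta> where \<delta>: "\<delta> > 0" "\<forall>u v. u \<le> x \<and> x \<le> v \<and> u < v \<and> v - u < \<delta> \<longrightarrow>
        norm ((LINT y:{u..v}|lebesgue. ?h c d y) - of_real (v - u) * ?h c d x) \<le> e * (v - u)" by iprover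
      have key: "norm (F v - F u - of_real (v - u) * f x) \<le> e * (v - u)"
        if "u \<le> x" "x \<le> v" "u < v" "v - u < min \<delta> (min (x - c) (d - x))" for u v
      proof -
        have "{u..v} \<subseteq> {c..d}" using that by auto
        then have "(LINT y:{u..v}|lebesgue. ?h c d y) = (LINT y:{u..v}|lebesgue. f y)"
          unfolding set_lebesgue_integral_def
          by (intro Bochner_Integration.integral_cong) (auto simp: indicator_def)
        also have "\<dots> = F v - F u" using \<open>{u..v} \<subseteq> {c..d}\<close> cd that by (intro is_primitiveD(2)[OF F]) auto
        finally show ?thesis using \<delta>(2)[rule_format, of u v] that c d by simp
      qed
      show "\<exists>k>0. \<forall>y. norm (y - x) < k \<longrightarrow> norm (F y - F x - (y - x) *\<^sub>R f x) \<le> e * norm (y - x)"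
      proof (intro exI[of _ "min \<delta> (min (x - c) (d - x))"] conjI allI impI)
        fix y assume y: "norm (y - x) < min \<delta> (min (x - c) (d - x))"
        consider "y = x" | "y > x" | "y < x" by linarith
        then show "norm (F y - F x - (y - x) *\<^sub>R f x) \<le> e * norm (y - x)"
        proof cases
          case 2 then show ?thesis using key[of x y] y by (simp add: scaleR_conv_of_real)
        next
          case 3
          have "F y - F x - (y - x) *\<^sub>R f x = - (F x - F y - of_real (x - y) * f x)"
            by (simp add: scaleR_conv_of_real algebra_simps)
          with 3 show ?thesis using key[of y x] y by (simp only: norm_minus_cancel) auto
        qed auto
      qed (use \<delta> c d in auto)
    qed
  qed
qed

lemma sum_length_le_measure:
  fixes u v :: "nat \<Rightarrow> real"
  assumes "\<And>i. i < n \<Longrightarrow> u i \<le> v i" "disjoint_family_on (\<lambda>i. {u i<..<v i}) {..<n}"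
  shows "emeasure lebesgue (\<Union>i<n. {u i<..<v i}) = ennreal (\<Sum>i<n. v i - u i)"
proof -
  have "emeasure lebesgue (\<Union>i<n. {u i<..<v i}) = (\<Sum>i<n. emeasure lebesgue {u i<..<v i})"
    by (rule sum_emeasure[symmetric]) (use assms in auto)
  also have "\<dots> = (\<Sum>i<n. ennreal (v i - u i))"
    by (rule sum.cong) (use assms in auto)
  also have "\<dots> = ennreal (\<Sum>i<n. v i - u i)"
    by (rule sum_ennreal) (use assms in auto)
  finally show ?thesis .
qed

text \<open>Absolute continuity of the integral, applied to the union of the disjoint open
  intervals, whose measure is the sum of their lengths.\<close>

lemma is_primitive_imp_loc_abs_cont:
  assumes F: "is_primitive I F f"
  shows "loc_abs_cont I F"
  unfolding loc_abs_cont_def abs_cont_on_def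
proof (intro allI impI)
  fix c d \<epsilon> :: real assume cd: "{c..d} \<subseteq> I" and "\<epsilon> > 0"
  have fi: "integrable lebesgue (\<lambda>x. indicator {c..d} x *\<^sub>R f x)"
    using is_primitiveD(1)[OF F cd] by (simp add: set_integrable_def)
  obtain \<delta> where \<delta>: "\<delta> > 0" "\<And>A. A \<in> sets lebesgue \<Longrightarrow> emeasure lebesgue A < ennreal \<delta> \<Longrightarrow>
      (LINT x:A|lebesgue. norm (indicator {c..d} x *\<^sub>R f x)) < \<epsilon>"
    using set_integral_absolutely_continuous[OF fi \<open>\<epsilon> > 0\<close>] by blast
  show "\<exists>\<delta>>0. \<forall>(n::nat) u v. (\<forall>i<n. u i \<le> v i \<and> {u i..v i} \<subseteq> {c..d}) \<and>
        disjoint_family_on (\<lambda>i. {u i<..<v i}) {..<n} \<and> (\<Sum>i<n. v i - u i) < \<delta>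
        \<longrightarrow> (\<Sum>i<n. norm (F (v i) - F (u i))) < \<epsilon>"
  proof (intro exI[of _ \<delta>] conjI allI impI)
    fix n :: nat and u v :: "nat \<Rightarrow> real"
    assume "(\<forall>i<n. u i \<le> v i \<and> {u i..v i} \<subseteq> {c..d}) \<and>
        disjoint_family_on (\<lambda>i. {u i<..<v i}) {..<n} \<and> (\<Sum>i<n. v i - u i) < \<delta>"
    then have uv: "\<And>i. i < n \<Longrightarrow> u i \<le> v i" "\<And>i. i < n \<Longrightarrow> {u i..v i} \<subseteq> {c..d}"
      and disj: "disjoint_family_on (\<lambda>i. {u i<..<v i}) {..<n}" and len: "(\<Sum>i<n. v i - u i) < \<delta>" by auto
    have si: "set_integrable lebesgue A (\<lambda>x. norm (indicator {c..d} x *\<^sub>R f x))" if "A \<in> sets lebesgue" for A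
      unfolding set_integrable_def by (rule integrable_mult_indicator[OF that integrable_norm[OF fi]])
    have "(\<Sum>i<n. norm (F (v i) - F (u i))) \<le> (\<Sum>i<n. LINT x:{u i<..<v i}|lebesgue. norm (indicator {c..d} x *\<^sub>R f x))"
    proof (rule sum_mono)
      fix i assume "i \<in> {..<n}"
      then have i: "i < n" by simp
      have "F (v i) - F (u i) = (LINT x:{u i..v i}|lebesgue. f x)"
        using uv[OF i] cd by (intro is_primitiveD(2)[OF F, symmetric]) auto
      also have "\<dots> = (LINT x|lebesgue. indicator {u i<..<v i} x *\<^sub>R (indicator {c..d} x *\<^sub>R f x))"
        unfolding set_lebesgue_integral_def
      proof (rule integral_cong_AE)
        have "AE x in lebesgue. x \<notin> {u i, v i}" by (rule AE_not_in) (simp flip: negligible_iff_null_sets)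
        then show "AE x in lebesgue. indicat_real {u i..v i} x *\<^sub>R f x =
            indicat_real {u i<..<v i} x *\<^sub>R indicat_real {c..d} x *\<^sub>R f x"
          by eventually_elim (use uv(2)[OF i] in \<open>auto simp: indicator_def\<close>)
        have "set_integrable lebesgue {u i..v i} f"
          using uv(2)[OF i] cd by (intro is_primitiveD(1)[OF F]) auto
        then show "(\<lambda>x. indicat_real {u i..v i} x *\<^sub>R f x) \<in> borel_measurable lebesgue"
          unfolding set_integrable_def by auto
        show "(\<lambda>x. indicat_real {u i<..<v i} x *\<^sub>R indicat_real {c..d} x *\<^sub>R f x) \<in> borel_measurable lebesgue"
          by (intro borel_measurable_scaleR[OF _ borel_measurable_integrable[OF fi]] borel_measurable_indicator) auto
      qed
      also have "norm \<dots> \<le> (LINT x|lebesgue. norm (indicator {u i<..<v i} x *\<^sub>R (indicator {c..d} x *\<^sub>R f x)))"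
        by (rule integral_norm_bound)
      also have "\<dots> = (LINT x:{u i<..<v i}|lebesgue. norm (indicator {c..d} x *\<^sub>R f x))"
        unfolding set_lebesgue_integral_def by (simp add: mult.assoc)
      finally show "norm (F (v i) - F (u i)) \<le> (LINT x:{u i<..<v i}|lebesgue. norm (indicator {c..d} x *\<^sub>R f x))" .
    qed
    also have "\<dots> = (LINT x:(\<Union>i<n. {u i<..<v i})|lebesgue. norm (indicator {c..d} x *\<^sub>R f x))"
      by (rule set_integral_finite_Union[symmetric]) (use disj si in auto)
    also have "\<dots> < \<epsilon>"
    proof (rule \<delta>(2))
      show "emeasure lebesgue (\<Union>i<n. {u i<..<v i}) < ennreal \<delta>"
        using len uv(1) by (subst sum_length_le_measure[OF uv(1) disj]) (auto intro!: ennreal_lessI sum_nonneg \<delta>)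
    qed auto
    finally show "(\<Sum>i<n. norm (F (v i) - F (u i))) < \<epsilon>" .
  qed (use \<delta> in auto)
qed

text \<open>The index sets of the definition, initial segments of the naturals, are replaced by
  arbitrary finite sets. Later families are indexed by the pieces of a division or by pairs.\<close>

lemma abs_cont_onD:
  assumes "abs_cont_on S f" "\<epsilon> > 0"
  shows "\<exists>\<delta>>0. \<forall>(A::'i set) u v. finite A \<and> (\<forall>i\<in>A. u i \<le> v i \<and> {u i..v i} \<subseteq> S) \<and>
      disjoint_family_on (\<lambda>i. {u i<..<v i}) A \<and>
      (\<Sum>i\<in>A. v i - u i) < \<delta> \<longrightarrow> (\<Sum>i\<in>A. norm (f (v i) - f (u i))) < \<epsilon>"
proof -
  obtain \<delta> where \<delta>: "\<delta> > 0" "\<forall>(n::nat) u v. (\<forall>i<n. u i \<le> v i \<and> {u i..v i} \<subseteq> S) \<and>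
        disjoint_family_on (\<lambda>i. {u i<..<v i}) {..<n} \<and> (\<Sum>i<n. v i - u i) < \<delta>
        \<longrightarrow> (\<Sum>i<n. norm (f (v i) - f (u i))) < \<epsilon>"
    using assms unfolding abs_cont_on_def by iprover
  show ?thesis
  proof (intro exI[of _ \<delta>] conjI allI impI \<delta>(1))
    fix A :: "'i set" and u v
    assume "finite A \<and> (\<forall>i\<in>A. u i \<le> v i \<and> {u i..v i} \<subseteq> S) \<and>
      disjoint_family_on (\<lambda>i. {u i<..<v i}) A \<and> (\<Sum>i\<in>A. v i - u i) < \<delta>"
    then have A: "finite A" "\<And>i. i \<in> A \<Longrightarrow> u i \<le> v i" "\<And>i. i \<in> A \<Longrightarrow> {u i..v i} \<subseteq> S"
      "disjoint_family_on (\<lambda>i. {u i<..<v i}) A" "(\<Sum>i\<in>A. v i - u i) < \<delta>" by auto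
    obtain b where b: "bij_betw b {..<card A} A"
      using ex_bij_betw_nat_finite[OF A(1)] by (auto simp: atLeast0LessThan)
    then have bA: "b i \<in> A" if "i < card A" for i using that by (auto simp: bij_betw_def)
    have "(\<Sum>i<card A. v (b i) - u (b i)) < \<delta>"
      using A(5) sum.reindex_bij_betw[OF b, of "\<lambda>i. v i - u i"] by simp
    moreover have "disjoint_family_on (\<lambda>i. {u (b i)<..<v (b i)}) {..<card A}"
      using A(4) b bA unfolding disjoint_family_on_def bij_betw_def inj_on_def by (metis lessThan_iff)
    ultimately have "(\<Sum>i<card A. norm (f (v (b i)) - f (u (b i)))) < \<epsilon>"
      using A bA by (intro \<delta>(2)[rule_format]) auto
    then show "(\<Sum>i\<in>A. norm (f (v i) - f (u i))) < \<epsilon>"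
      using sum.reindex_bij_betw[OF b, of "\<lambda>i. norm (f (v i) - f (u i))"] by simp
  qed
qed

lemma abs_cont_on_imp_continuous_on:
  assumes "abs_cont_on {c..d} f"
  shows "continuous_on {c..d} f"
  unfolding continuous_on_iff
proof (intro ballI allI impI)
  fix x \<epsilon> :: real assume x: "x \<in> {c..d}" and "\<epsilon> > 0"
  obtain \<delta> where \<delta>: "\<delta> > 0" "\<forall>(A::unit set) u v. finite A \<and> (\<forall>i\<in>A. u i \<le> v i \<and> {u i..v i} \<subseteq> {c..d}) \<and>
      disjoint_family_on (\<lambda>i. {u i<..<v i}) A \<and> (\<Sum>i\<in>A. v i - u i) < \<delta> \<longrightarrow> (\<Sum>i\<in>A. norm (f (v i) - f (u i))) < \<epsilon>"
    using abs_cont_onD[OF assms \<open>\<epsilon> > 0\<close>] by iprover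
  show "\<exists>d'>0. \<forall>x'\<in>{c..d}. dist x' x < d' \<longrightarrow> dist (f x') (f x) < \<epsilon>"
  proof (intro exI[of _ \<delta>] conjI ballI impI)
    fix y assume y: "y \<in> {c..d}" "dist y x < \<delta>"
    show "dist (f y) (f x) < \<epsilon>"
      using \<delta>(2)[rule_format, of "{()}" "\<lambda>_. min x y" "\<lambda>_. max x y"] x y
      by (cases "x \<le> y") (auto simp: dist_norm norm_minus_commute disjoint_family_on_def min_def max_def)
  qed (use \<delta> in auto)
qed

lemma abs_cont_on_diff:
  assumes f: "abs_cont_on S f" and g: "abs_cont_on S g"
  shows "abs_cont_on S (\<lambda>x. f x - g x)"
  unfolding abs_cont_on_def
proof (intro allI impI)
  fix \<epsilon> :: real assume "\<epsilon> > 0"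
  then have e: "\<epsilon> / 2 > 0" by simp
  obtain d1 where d1: "d1 > 0" "\<forall>(A::nat set) u v. finite A \<and> (\<forall>i\<in>A. u i \<le> v i \<and> {u i..v i} \<subseteq> S) \<and>
      disjoint_family_on (\<lambda>i. {u i<..<v i}) A \<and> (\<Sum>i\<in>A. v i - u i) < d1 \<longrightarrow> (\<Sum>i\<in>A. norm (f (v i) - f (u i))) < \<epsilon>/2"
    using abs_cont_onD[OF f e] by iprover
  obtain d2 where d2: "d2 > 0" "\<forall>(A::nat set) u v. finite A \<and> (\<forall>i\<in>A. u i \<le> v i \<and> {u i..v i} \<subseteq> S) \<and>
      disjoint_family_on (\<lambda>i. {u i<..<v i}) A \<and> (\<Sum>i\<in>A. v i - u i) < d2 \<longrightarrow> (\<Sum>i\<in>A. norm (g (v i) - g (u i))) < \<epsilon>/2"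
    using abs_cont_onD[OF g e] by iprover
  show "\<exists>\<delta>>0. \<forall>(n::nat) u v. (\<forall>i<n. u i \<le> v i \<and> {u i..v i} \<subseteq> S) \<and>
        disjoint_family_on (\<lambda>i. {u i<..<v i}) {..<n} \<and> (\<Sum>i<n. v i - u i) < \<delta>
        \<longrightarrow> (\<Sum>i<n. norm (f (v i) - g (v i) - (f (u i) - g (u i)))) < \<epsilon>"
  proof (intro exI[of _ "min d1 d2"] conjI allI impI)
    fix n :: nat and u v
    assume *: "(\<forall>i<n. u i \<le> v i \<and> {u i..v i} \<subseteq> S) \<and>
        disjoint_family_on (\<lambda>i. {u i<..<v i}) {..<n} \<and> (\<Sum>i<n. v i - u i) < min d1 d2"
    have "(\<Sum>i<n. norm (f (v i) - g (v i) - (f (u i) - g (u i)))) \<le>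
        (\<Sum>i<n. norm (f (v i) - f (u i)) + norm (g (v i) - g (u i)))"
    proof (rule sum_mono)
      fix i
      have "f (v i) - g (v i) - (f (u i) - g (u i)) = (f (v i) - f (u i)) - (g (v i) - g (u i))" by simp
      then show "norm (f (v i) - g (v i) - (f (u i) - g (u i))) \<le> norm (f (v i) - f (u i)) + norm (g (v i) - g (u i))"
        by (metis norm_triangle_ineq4)
    qed
    also have "\<dots> < \<epsilon>/2 + \<epsilon>/2"
      unfolding sum.distrib using * by (intro add_strict_mono d1(2)[rule_format] d2(2)[rule_format]) auto
    finally show "(\<Sum>i<n. norm (f (v i) - g (v i) - (f (u i) - g (u i)))) < \<epsilon>" by simp
  qed (use d1 d2 in auto)
qed

section \<open>Densities of absolutely continuous functions\<close>

text \<open>Radon-Nikodym for the Lebesgue-Stieltjes measure of \<open>g\<close>: the epsilon-delta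
  condition on \<open>g\<close> makes this measure absolutely continuous with respect to Lebesgue
  measure.\<close>

lemma mono_abs_cont_has_density:
  fixes g :: "real \<Rightarrow> real"
  assumes "c \<le> d" and mono: "\<And>x y. c \<le> x \<Longrightarrow> x \<le> y \<Longrightarrow> y \<le> d \<Longrightarrow> g x \<le> g y"
    and ac: "abs_cont_on {c..d} (\<lambda>x. complex_of_real (g x))"
  obtains h :: "real \<Rightarrow> real" where "set_integrable lebesgue {c..d} h"
    "\<And>u v. c \<le> u \<Longrightarrow> u \<le> v \<Longrightarrow> v \<le> d \<Longrightarrow> (LINT x:{u..v}|lebesgue. h x) = g v - g u"
proof -
  \<comment> \<open>Clamping to [c, d] extends \<open>g\<close> by constants to a monotone
    continuous function on the whole line, as \<open>interval_measure\<close> expects.\<close>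
  define r where "r x = max c (min d x)" for x
  have r: "c \<le> r x" "r x \<le> d" "x \<le> y \<Longrightarrow> r x \<le> r y" "c \<le> x \<Longrightarrow> x \<le> d \<Longrightarrow> r x = x" for x y
    using \<open>c \<le> d\<close> by (auto simp: r_def)
  define G where "G x = g (r x)" for x
  have monoG: "x \<le> y \<Longrightarrow> G x \<le> G y" for x y unfolding G_def by (intro mono r)
  have contg: "continuous_on {c..d} g"
    using continuous_on_Re[OF abs_cont_on_imp_continuous_on[OF ac]] by simp
  have contG: "continuous_on UNIV G"
    unfolding G_def
    by (rule continuous_on_compose2[OF contg]) (use r in \<open>auto simp: r_def intro!: continuous_intros\<close>)
  define \<nu> where "\<nu> = interval_measure G"
  have setsnu[simp]: "sets \<nu> = sets borel" by (simp add: \<nu>_def)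
  have nuI: "emeasure \<nu> {x..y} = ennreal (G y - G x)" if "x \<le> y" for x y
    unfolding \<nu>_def by (rule emeasure_interval_measure_Icc[OF that monoG contG])
  have "absolutely_continuous lborel \<nu>"
    unfolding absolutely_continuous_def
  proof
    fix N :: "real set" assume N: "N \<in> null_sets lborel"
    have small: "emeasure \<nu> N \<le> ennreal \<epsilon>" if eps: "\<epsilon> > 0" for \<epsilon>
    proof -
      obtain \<delta> where \<delta>: "\<delta> > 0" "\<forall>(A::real set set) u v. finite A \<and> (\<forall>i\<in>A. u i \<le> v i \<and> {u i..v i} \<subseteq> {c..d}) \<and>
      disjoint_family_on (\<lambda>i. {u i<..<v i}) A \<and> (\<Sum>i\<in>A. v i - u i) < \<delta> \<longrightarrow> (\<Sum>i\<in>A. norm (complex_of_real (g (v i)) - g (u i))) < \<epsilon>"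
        using abs_cont_onD[OF ac eps] by iprover
      have "N \<in> sets borel" using N by auto
      then obtain U where U: "open U" "N \<subseteq> U" "emeasure lborel (U - N) < ennreal \<delta>"
        using outer_regular_lborel[OF _ \<delta>(1)] by blast
      have Ud: "emeasure lborel U < ennreal \<delta>"
        using U N emeasure_Diff_null_set[OF N, of U] by auto
      \<comment> \<open>These boxes may overlap. A finite subfamily is recut into a division, to
        which the epsilon-delta condition applies, and continuity from below then reaches all of
        \<open>U\<close>.\<close>
      obtain \<D> where \<D>: "countable \<D>" "\<D> \<subseteq> Pow U" "\<And>X. X \<in> \<D> \<Longrightarrow> \<exists>a b. X = cbox a b" "\<Union>\<D> = U"
        using open_countable_Union_open_cbox[OF U(1)] by metis
      have fin: "emeasure \<nu> (\<Union>\<F>) \<le> ennreal \<epsilon>" if \<F>: "finite \<F>" "\<F> \<subseteq> \<D>" for \<F>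
      proof -
        obtain p where p: "p division_of \<Union>\<F>"
          using elementary_unions_intervals[OF \<F>(1)] \<D>(3) \<F>(2) by (meson subsetD)
        note pD = division_ofD[OF p]
        have int: "k = {Inf k..Sup k} \<and> Inf k \<le> Sup k" if "k \<in> p" for k
        proof -
          obtain a b where k: "k = cbox a b" using pD(4)[OF \<open>k \<in> p\<close>] by blast
          with pD(3)[OF \<open>k \<in> p\<close>] have "a \<le> b" by auto
          with k show ?thesis by simp
        qed
        have interior: "interior k = {Inf k<..<Sup k}" if "k \<in> p" for k
          using arg_cong[OF conjunct1[OF int[OF that]], of interior] by (simp only: interior_atLeastAtMost_real)
        have len: "(\<Sum>k\<in>p. Sup k - Inf k) < \<delta>"
        proof -
          have "ennreal (\<Sum>k\<in>p. Sup k - Inf k) = (\<Sum>k\<in>p. ennreal (Sup k - Inf k))"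
            by (rule sum_ennreal[symmetric]) (use int in auto)
          also have "\<dots> = (\<Sum>k\<in>p. emeasure lborel {Inf k<..<Sup k})"
            by (rule sum.cong[OF refl]) (use int in auto)
          also have "\<dots> = emeasure lborel (\<Union>k\<in>p. {Inf k<..<Sup k})"
          proof (rule sum_emeasure)
            show "disjoint_family_on (\<lambda>k. {Inf k<..<Sup k}) p"
              unfolding disjoint_family_on_def
            proof (intro ballI impI)
              fix k k' assume k: "k \<in> p" "k' \<in> p" "k \<noteq> k'"
              show "{Inf k<..<Sup k} \<inter> {Inf k'<..<Sup k'} = {}"
                using pD(5)[OF k] interior[OF k(1)] interior[OF k(2)] by simp
            qed
          qed (use pD(1) in auto)
          also have "\<dots> \<le> emeasure lborel U"
          proof (rule emeasure_mono)
            have "{Inf k<..<Sup k} \<subseteq> U" if "k \<in> p" for k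
            proof -
              have "{Inf k<..<Sup k} \<subseteq> {Inf k..Sup k}" by auto
              also have "\<dots> = k" using int[OF that] by blast
              also have "k \<subseteq> U" using pD(2)[OF that] \<F> \<D> by blast
              finally show ?thesis .
            qed
            then show "(\<Union>k\<in>p. {Inf k<..<Sup k}) \<subseteq> U" by blast
          qed (use U in auto)
          also note Ud
          finally show ?thesis using \<delta>(1) by (simp add: ennreal_less_iff sum_nonneg int)
        qed
        have "emeasure \<nu> (\<Union>\<F>) = emeasure \<nu> (\<Union>k\<in>p. k)" using pD(6) by simp
        also have "\<dots> \<le> (\<Sum>k\<in>p. emeasure \<nu> k)"
          by (rule emeasure_subadditive_finite) (use pD(1,4) in fastforce)+
        also have "\<dots> = (\<Sum>k\<in>p. ennreal (G (Sup k) - G (Inf k)))"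
        proof (rule sum.cong[OF refl])
          fix k assume "k \<in> p"
          show "emeasure \<nu> k = ennreal (G (Sup k) - G (Inf k))"
            using arg_cong[OF conjunct1[OF int[OF \<open>k \<in> p\<close>]], of "emeasure \<nu>"]
              nuI[OF conjunct2[OF int[OF \<open>k \<in> p\<close>]]] by (rule trans)
        qed
        also have "\<dots> = ennreal (\<Sum>k\<in>p. G (Sup k) - G (Inf k))"
          by (rule sum_ennreal) (use int monoG in auto)
        also have "(\<Sum>k\<in>p. G (Sup k) - G (Inf k)) = (\<Sum>k\<in>p. norm (complex_of_real (g (r (Sup k))) - g (r (Inf k))))"
        proof (rule sum.cong[OF refl])
          fix k assume "k \<in> p"
          then have "G (Inf k) \<le> G (Sup k)" using int monoG by blast
          then show "G (Sup k) - G (Inf k) = norm (complex_of_real (g (r (Sup k))) - g (r (Inf k)))"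
            unfolding G_def of_real_diff[symmetric] norm_of_real by simp
        qed
        finally have *: "emeasure \<nu> (\<Union>\<F>) \<le> ennreal (\<Sum>k\<in>p. norm (complex_of_real (g (r (Sup k))) - g (r (Inf k))))"
          by simp
        \<comment> \<open>Clamping the endpoints shortens the intervals and keeps them disjoint, so
          the clamped family is admissible for the condition on \<open>g\<close>.\<close>
        have "(\<Sum>k\<in>p. norm (complex_of_real (g (r (Sup k))) - g (r (Inf k)))) \<le> \<epsilon>"
        proof (rule less_imp_le, rule \<delta>(2)[rule_format], intro conjI ballI pD(1))
          show "r (Inf k) \<le> r (Sup k)" if "k \<in> p" for k using int[OF that] r by auto
          show "{r (Inf k)..r (Sup k)} \<subseteq> {c..d}" for k using r by (auto intro: order_trans)
          have "(\<Sum>k\<in>p. r (Sup k) - r (Inf k)) \<le> (\<Sum>k\<in>p. Sup k - Inf k)"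
          proof (rule sum_mono)
            fix k assume "k \<in> p"
            then have "Inf k \<le> Sup k" using int by blast
            with \<open>c \<le> d\<close> show "r (Sup k) - r (Inf k) \<le> Sup k - Inf k"
              by (simp add: r_def max_def min_def)
          qed
          then show "(\<Sum>k\<in>p. r (Sup k) - r (Inf k)) < \<delta>" using len by simp
          show "disjoint_family_on (\<lambda>k. {r (Inf k)<..<r (Sup k)}) p"
            unfolding disjoint_family_on_def
          proof (intro ballI impI)
            fix k k' assume k: "k \<in> p" "k' \<in> p" "k \<noteq> k'"
            have sub: "{r (Inf k)<..<r (Sup k)} \<subseteq> interior k" if "k \<in> p" for k
              unfolding interior[OF that] by (auto simp: r_def max_def min_def split: if_splits)
            show "{r (Inf k)<..<r (Sup k)} \<inter> {r (Inf k')<..<r (Sup k')} = {}"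
              using sub[OF k(1)] sub[OF k(2)] pD(5)[OF k] by blast
          qed
        qed
        with * show ?thesis by (meson ennreal_leI order_trans)
      qed
      have "emeasure \<nu> U \<le> ennreal \<epsilon>"
      proof (cases "\<D> = {}")
        case True
        then show ?thesis using \<D>(4) by simp
      next
        case False
        let ?A = "\<lambda>n. \<Union>(from_nat_into \<D> ` {..n})"
        have UA: "(\<Union>n. ?A n) = U"
        proof -
          have "from_nat_into \<D> n \<subseteq> ?A n" for n by (rule Union_upper) simp
          then have "(\<Union>n. from_nat_into \<D> n) = (\<Union>n. ?A n)" by blast
          then show ?thesis using range_from_nat_into[OF False \<D>(1)] \<D>(4) by simp
        qed
        have "(SUP n. emeasure \<nu> (?A n)) = emeasure \<nu> (\<Union>n. ?A n)"
        proof (rule SUP_emeasure_incseq)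
          have "from_nat_into \<D> n \<in> sets borel" for n
            using \<D>(3)[OF from_nat_into[OF False, of n]] by auto
          then show "range ?A \<subseteq> sets \<nu>" by auto
          show "incseq ?A" by (force simp: incseq_def)
        qed
        moreover have "(SUP n. emeasure \<nu> (?A n)) \<le> ennreal \<epsilon>"
          by (intro SUP_least fin) (use from_nat_into[OF False] in auto)
        ultimately show ?thesis using UA by simp
      qed
      moreover have "emeasure \<nu> N \<le> emeasure \<nu> U" using U by (intro emeasure_mono) auto
      ultimately show ?thesis by (rule order_trans[rotated])
    qed
    have "emeasure \<nu> N \<le> 0"
      by (rule ennreal_le_epsilon) (simp only: add_0 small)
    then have "emeasure \<nu> N = 0" by simp
    then show "N \<in> null_sets \<nu>" using N by (auto simp: null_sets_def)
  qed
  then obtain h where h: "h \<in> borel_measurable lborel" "density lborel h = \<nu>"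
    using sigma_finite_measure.Radon_Nikodym[OF sigma_finite_lborel, of \<nu>] by auto
  note [measurable] = h(1)
  have nnI: "(\<integral>\<^sup>+x. h x * indicator {u..v} x \<partial>lborel) = ennreal (g v - g u)"
    if "c \<le> u" "u \<le> v" "v \<le> d" for u v
    using nuI[OF that(2)] that r(4)[of u] r(4)[of v] unfolding h(2)[symmetric]
    by (simp add: emeasure_density G_def)
  have fin: "AE x in lborel. x \<in> {c..d} \<longrightarrow> h x \<noteq> \<infinity>"
  proof -
    have "AE x in lborel. h x * indicator {c..d} x \<noteq> \<infinity>"
      by (rule nn_integral_noteq_infinite) (use nnI[of c d] \<open>c \<le> d\<close> in auto)
    then show ?thesis by eventually_elim (auto simp: indicator_def)
  qed
  have hb: "has_bochner_integral lborel (\<lambda>x. indicator {u..v} x *\<^sub>R enn2real (h x)) (g v - g u)"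
    if uv: "c \<le> u" "u \<le> v" "v \<le> d" for u v
  proof (rule has_bochner_integral_nn_integral)
    have "(\<integral>\<^sup>+x. ennreal (indicator {u..v} x *\<^sub>R enn2real (h x)) \<partial>lborel) = (\<integral>\<^sup>+x. h x * indicator {u..v} x \<partial>lborel)"
      by (rule nn_integral_cong_AE, rule AE_mp[OF fin], rule AE_I2)
        (use uv in \<open>auto simp: indicator_def less_top\<close>)
    then show "(\<integral>\<^sup>+x. ennreal (indicator {u..v} x *\<^sub>R enn2real (h x)) \<partial>lborel) = ennreal (g v - g u)"
      using nnI[OF uv] by simp
  qed (use mono[OF uv] in auto)
  show ?thesis
  proof (rule that[of "\<lambda>x. enn2real (h x)"])
    show "set_integrable lebesgue {c..d} (\<lambda>x. enn2real (h x))"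
      using hb[of c d] \<open>c \<le> d\<close> unfolding set_integrable_def
      by (subst integrable_completion) (auto simp: has_bochner_integral_iff)
    show "(LINT x:{u..v}|lebesgue. enn2real (h x)) = g v - g u" if "c \<le> u" "u \<le> v" "v \<le> d" for u v
      using hb[OF that] unfolding set_lebesgue_integral_def
      by (subst integral_completion) (auto simp: has_bochner_integral_iff)
  qed
qed

text \<open>The supremum of this set is the total variation of \<open>g\<close> on \<open>[c, d]\<close>.\<close>

definition variation_sums :: "(real \<Rightarrow> real) \<Rightarrow> real \<Rightarrow> real \<Rightarrow> real set" where
  "variation_sums g c d = {\<Sum>i<n. \<bar>g (v i) - g (u i)\<bar> | (n::nat) u v.
     (\<forall>i<n. c \<le> u i \<and> u i \<le> v i \<and> v i \<le> d) \<and> disjoint_family_on (\<lambda>i. {u i<..<v i}) {..<n}}"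

lemma zero_in_variation_sums: "0 \<in> variation_sums g c d"
  unfolding variation_sums_def by (rule CollectI, intro exI[of _ 0]) (auto simp: disjoint_family_on_def)

lemma increment_in_variation_sums: "c \<le> d \<Longrightarrow> \<bar>g d - g c\<bar> \<in> variation_sums g c d"
  unfolding variation_sums_def
  by (rule CollectI, rule exI[of _ 1], rule exI[of _ "\<lambda>_. c"], rule exI[of _ "\<lambda>_. d"]) (auto simp: disjoint_family_on_def)

lemma variation_sums_add:
  assumes "s \<in> variation_sums g c x" "t \<in> variation_sums g x d" "c \<le> x" "x \<le> d"
  shows "s + t \<in> variation_sums g c d"
proof -
  obtain n u v where 1: "s = (\<Sum>i<n. \<bar>g (v i) - g (u i)\<bar>)" "\<And>i. i < n \<Longrightarrow> c \<le> u i \<and> u i \<le> v i \<and> v i \<le> x"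
    "disjoint_family_on (\<lambda>i. {u i<..<v i}) {..<n::nat}"
    using assms(1) unfolding variation_sums_def by auto
  obtain m u' v' where 2: "t = (\<Sum>i<m. \<bar>g (v' i) - g (u' i)\<bar>)" "\<And>i. i < m \<Longrightarrow> x \<le> u' i \<and> u' i \<le> v' i \<and> v' i \<le> d"
    "disjoint_family_on (\<lambda>i. {u' i<..<v' i}) {..<m::nat}"
    using assms(2) unfolding variation_sums_def by auto
  let ?u = "\<lambda>i. if i < n then u i else u' (i - n)" and ?v = "\<lambda>i. if i < n then v i else v' (i - n)"
  have "(\<Sum>i<n+m. \<bar>g (?v i) - g (?u i)\<bar>) = s + t"
  proof -
    have "(\<Sum>i<n+m. \<bar>g (?v i) - g (?u i)\<bar>) = (\<Sum>i<n. \<bar>g (?v i) - g (?u i)\<bar>) + (\<Sum>i<m. \<bar>g (?v (n + i)) - g (?u (n + i))\<bar>)"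
      by (induction m) (simp_all add: add.assoc)
    then show ?thesis by (simp add: 1 2)
  qed
  moreover have "c \<le> ?u i \<and> ?u i \<le> ?v i \<and> ?v i \<le> d" if "i < n + m" for i
  proof (cases "i < n")
    case False
    then have "i - n < m" using that by linarith
    from 2(2)[OF this] False assms show ?thesis by auto
  qed (use 1(2)[of i] assms in auto)
  moreover have "disjoint_family_on (\<lambda>i. {?u i<..<?v i}) {..<n+m}"
    unfolding disjoint_family_on_def
  proof (intro ballI impI)
    fix i j assume ij: "i \<in> {..<n+m}" "j \<in> {..<n+m}" "i \<noteq> j"
    have sep: "{u i<..<v i} \<inter> {u' (j - n)<..<v' (j - n)} = {}" if "i < n" "j < n + m" "\<not> j < n" for i j
    proof -
      have "j - n < m" using that by linarith
      then have "v i \<le> u' (j - n)" using 1(2)[OF that(1)] 2(2) by (meson order_trans)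
      then show ?thesis by auto
    qed
    consider "i < n" "j < n" | "i < n" "\<not> j < n" | "\<not> i < n" "j < n" | "\<not> i < n" "\<not> j < n" by blast
    then show "{?u i<..<?v i} \<inter> {?u j<..<?v j} = {}"
    proof cases
      case 1
      then show ?thesis using \<open>disjoint_family_on (\<lambda>i. {u i<..<v i}) {..<n}\<close> ij by (auto simp: disjoint_family_on_def)
    next
      case 2 then show ?thesis using sep[of i j] ij by simp
    next
      case 3 then show ?thesis using sep[of j i] ij by (simp add: Int_commute)
    next
      case 4
      then have "i - n < m" "j - n < m" "i - n \<noteq> j - n" using ij by auto
      then show ?thesis using 2(3) 4 unfolding disjoint_family_on_def by auto
    qed
  qed
  ultimately have "s + t = (\<Sum>i<n+m. \<bar>g (?v i) - g (?u i)\<bar>) \<and>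
      (\<forall>i<n+m. c \<le> ?u i \<and> ?u i \<le> ?v i \<and> ?v i \<le> d) \<and> disjoint_family_on (\<lambda>i. {?u i<..<?v i}) {..<n+m}"
    by simp
  then show ?thesis unfolding variation_sums_def
    by (intro CollectI exI)
qed

text \<open>Each interval is cut at x by taking minima and maxima of its endpoints with x. An
  interval that straddles x gives two pieces, handled by the triangle inequality; for any other one
  a piece degenerates to a point.\<close>

lemma variation_sums_split:
  assumes "s \<in> variation_sums g c d" "c \<le> x" "x \<le> d"
  obtains s1 s2 where "s1 \<in> variation_sums g c x" "s2 \<in> variation_sums g x d" "s \<le> s1 + s2"
proof -
  obtain n u v where 1: "s = (\<Sum>i<n. \<bar>g (v i) - g (u i)\<bar>)" "\<And>i. i < n \<Longrightarrow> c \<le> u i \<and> u i \<le> v i \<and> v i \<le> d"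
    "disjoint_family_on (\<lambda>i. {u i<..<v i}) {..<n::nat}"
    using assms(1) unfolding variation_sums_def by auto
  let ?s1 = "\<Sum>i<n. \<bar>g (min (v i) x) - g (min (u i) x)\<bar>" and ?s2 = "\<Sum>i<n. \<bar>g (max (v i) x) - g (max (u i) x)\<bar>"
  have sub: "{min (u i) x<..<min (v i) x} \<subseteq> {u i<..<v i}" "{max (u i) x<..<max (v i) x} \<subseteq> {u i<..<v i}" for i
    by (auto simp: min_def max_def split: if_splits)
  have b1: "\<forall>i<n. c \<le> min (u i) x \<and> min (u i) x \<le> min (v i) x \<and> min (v i) x \<le> x"
  proof (intro allI impI)
    fix i assume "i < n"
    from 1(2)[OF this] assms(2,3) show "c \<le> min (u i) x \<and> min (u i) x \<le> min (v i) x \<and> min (v i) x \<le> x" by (auto simp: min_def)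
  qed
  have d1: "disjoint_family_on (\<lambda>i. {min (u i) x<..<min (v i) x}) {..<n}"
    unfolding disjoint_family_on_def
  proof (intro ballI impI)
    fix i j assume "i \<in> {..<n}" "j \<in> {..<n}" "i \<noteq> j"
    then have "{u i<..<v i} \<inter> {u j<..<v j} = {}" using 1(3) unfolding disjoint_family_on_def by blast
    then show "{min (u i) x<..<min (v i) x} \<inter> {min (u j) x<..<min (v j) x} = {}" using sub(1) by blast
  qed
  have b2: "\<forall>i<n. x \<le> max (u i) x \<and> max (u i) x \<le> max (v i) x \<and> max (v i) x \<le> d"
  proof (intro allI impI)
    fix i assume "i < n"
    from 1(2)[OF this] assms(2,3) show "x \<le> max (u i) x \<and> max (u i) x \<le> max (v i) x \<and> max (v i) x \<le> d" by (auto simp: max_def)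
  qed
  have d2: "disjoint_family_on (\<lambda>i. {max (u i) x<..<max (v i) x}) {..<n}"
    unfolding disjoint_family_on_def
  proof (intro ballI impI)
    fix i j assume "i \<in> {..<n}" "j \<in> {..<n}" "i \<noteq> j"
    then have "{u i<..<v i} \<inter> {u j<..<v j} = {}" using 1(3) unfolding disjoint_family_on_def by blast
    then show "{max (u i) x<..<max (v i) x} \<inter> {max (u j) x<..<max (v j) x} = {}" using sub(2) by blast
  qed
  show ?thesis
  proof
    show "?s1 \<in> variation_sums g c x" unfolding variation_sums_def
      by (rule CollectI, rule exI[of _ n], rule exI[of _ "\<lambda>i. min (u i) x"], rule exI[of _ "\<lambda>i. min (v i) x"], intro conjI refl d1)
        (rule b1)
    show "?s2 \<in> variation_sums g x d" unfolding variation_sums_def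
      by (rule CollectI, rule exI[of _ n], rule exI[of _ "\<lambda>i. max (u i) x"], rule exI[of _ "\<lambda>i. max (v i) x"], intro conjI refl d2)
        (rule b2)
    show "s \<le> ?s1 + ?s2" unfolding 1(1) sum.distrib[symmetric]
    proof (rule sum_mono)
      fix i
      consider "x \<le> u i" "x \<le> v i" | "u i \<le> x" "x \<le> v i" | "u i \<le> x" "v i \<le> x" | "x \<le> u i" "v i \<le> x" by linarith
      then show "\<bar>g (v i) - g (u i)\<bar> \<le> \<bar>g (min (v i) x) - g (min (u i) x)\<bar> + \<bar>g (max (v i) x) - g (max (u i) x)\<bar>"
        by cases (auto simp: min_def max_def)
    qed
  qed
qed

text \<open>\<open>V\<close> is the total variation on [c, x]. The inequality says that both V and V
  - g are nondecreasing, which is the Jordan decomposition; \<open>V\<close> inherits absolute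
  continuity because near-optimal subdivisions of short intervals are again families of small total
  length.\<close>

lemma abs_cont_imp_mono_decomposition:
  fixes g :: "real \<Rightarrow> real"
  assumes "c \<le> d" and ac: "abs_cont_on {c..d} (\<lambda>x. complex_of_real (g x))"
  obtains V where "\<And>x y. c \<le> x \<Longrightarrow> x \<le> y \<Longrightarrow> y \<le> d \<Longrightarrow> \<bar>g y - g x\<bar> \<le> V y - V x"
    "abs_cont_on {c..d} (\<lambda>x. complex_of_real (V x))"
proof -
  have sum_le: "(\<Sum>i<n. v i - u i) \<le> y - x"
    if "\<And>i. i < n \<Longrightarrow> x \<le> u i \<and> u i \<le> v i \<and> v i \<le> y" "disjoint_family_on (\<lambda>i. {u i<..<v i}) {..<n::nat}" "x \<le> y"
    for n u v and x y :: real
  proof -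
    have "ennreal (\<Sum>i<n. v i - u i) = emeasure lebesgue (\<Union>i<n. {u i<..<v i})"
      by (rule sum_length_le_measure[symmetric]) (use that in auto)
    also have "\<dots> \<le> emeasure lebesgue {x..y}"
      by (rule emeasure_mono) (use that in \<open>auto, (meson less_le_trans le_less_trans less_imp_le)+\<close>)
    also have "\<dots> = ennreal (y - x)" using that by simp
    finally show ?thesis using that(3) by simp
  qed
  have bdd: "bdd_above (variation_sums g c d)"
  proof -
    obtain \<delta> where \<delta>: "\<delta> > 0" "\<forall>(A::nat set) u v. finite A \<and> (\<forall>i\<in>A. u i \<le> v i \<and> {u i..v i} \<subseteq> {c..d}) \<and>
      disjoint_family_on (\<lambda>i. {u i<..<v i}) A \<and> (\<Sum>i\<in>A. v i - u i) < \<delta> \<longrightarrow>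
      (\<Sum>i\<in>A. norm (complex_of_real (g (v i)) - complex_of_real (g (u i)))) < 1"
      using abs_cont_onD[OF ac, of 1] zero_less_one by iprover
    \<comment> \<open>On intervals shorter than the \<delta> belonging to 1, all variation sums are
      at most 1. Bisection carries boundedness over to [c, d], since sums over adjacent intervals
      split.\<close>
    have "c \<le> c \<longrightarrow> d \<le> d \<longrightarrow> bdd_above (variation_sums g c d)"
    proof (rule Bolzano[OF \<open>c \<le> d\<close>, where P = "\<lambda>y z. c \<le> y \<longrightarrow> z \<le> d \<longrightarrow> bdd_above (variation_sums g y z)"])
      fix x y z
      assume *: "c \<le> x \<longrightarrow> y \<le> d \<longrightarrow> bdd_above (variation_sums g x y)"
        "c \<le> y \<longrightarrow> z \<le> d \<longrightarrow> bdd_above (variation_sums g y z)" "x \<le> y" "y \<le> z"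
      show "c \<le> x \<longrightarrow> z \<le> d \<longrightarrow> bdd_above (variation_sums g x z)"
      proof (intro impI)
        assume "c \<le> x" "z \<le> d"
        with * obtain K1 K2 where K: "\<And>s. s \<in> variation_sums g x y \<Longrightarrow> s \<le> K1" "\<And>s. s \<in> variation_sums g y z \<Longrightarrow> s \<le> K2"
          unfolding bdd_above_def by force
        show "bdd_above (variation_sums g x z)"
        proof (rule bdd_aboveI[of _ "K1 + K2"])
          fix s assume "s \<in> variation_sums g x z"
          from variation_sums_split[OF this *(3,4)] K show "s \<le> K1 + K2" by (smt (verit))
        qed
      qed
    next
      fix x assume "c \<le> x" "x \<le> d"
      show "\<exists>e>0. \<forall>y z. y \<le> x \<and> x \<le> z \<and> z - y < e \<longrightarrow> c \<le> y \<longrightarrow> z \<le> d \<longrightarrow> bdd_above (variation_sums g y z)"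
      proof (intro exI[of _ \<delta>] conjI allI impI \<delta>(1))
        fix y z assume yz: "y \<le> x \<and> x \<le> z \<and> z - y < \<delta>" "c \<le> y" "z \<le> d"
        show "bdd_above (variation_sums g y z)"
        proof (rule bdd_aboveI[of _ 1])
          fix s assume "s \<in> variation_sums g y z"
          then obtain n u v where s: "s = (\<Sum>i<n. \<bar>g (v i) - g (u i)\<bar>)" "\<And>i. i < n \<Longrightarrow> y \<le> u i \<and> u i \<le> v i \<and> v i \<le> z"
            "disjoint_family_on (\<lambda>i. {u i<..<v i}) {..<n::nat}"
            unfolding variation_sums_def by auto
          have "(\<Sum>i<n. v i - u i) < \<delta>" using sum_le[OF s(2,3)] yz by force
          then have "(\<Sum>i<n. norm (complex_of_real (g (v i)) - complex_of_real (g (u i)))) < 1"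
            using s yz by (intro \<delta>(2)[rule_format]) (auto, (meson order_trans)+)
          then show "s \<le> 1" unfolding s(1) of_real_diff[symmetric] norm_of_real by simp
        qed
      qed
    qed
    then show ?thesis by simp
  qed
  have sub: "variation_sums g x y \<subseteq> variation_sums g c d" if "c \<le> x" "y \<le> d" for x y
  proof
    fix s assume "s \<in> variation_sums g x y"
    then obtain n u v where s: "s = (\<Sum>i<n. \<bar>g (v i) - g (u i)\<bar>)" "\<forall>i<n. x \<le> u i \<and> u i \<le> v i \<and> v i \<le> y"
      "disjoint_family_on (\<lambda>i. {u i<..<v i}) {..<n::nat}"
      unfolding variation_sums_def by blast
    have "\<forall>i<n. c \<le> u i \<and> u i \<le> v i \<and> v i \<le> d" using s(2) that by (meson order_trans)
    with s show "s \<in> variation_sums g c d" unfolding variation_sums_def by blast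
  qed
  have bddxy: "bdd_above (variation_sums g x y)" if "c \<le> x" "y \<le> d" for x y
    using bdd_above_mono[OF bdd sub[OF that]] .
  have ne: "variation_sums g x y \<noteq> {}" for x y using zero_in_variation_sums by blast
  define V where "V x = Sup (variation_sums g c x)" for x
  have lower: "\<bar>g y - g x\<bar> \<le> V y - V x" if "c \<le> x" "x \<le> y" "y \<le> d" for x y
  proof -
    have "V x \<le> V y - \<bar>g y - g x\<bar>" unfolding V_def
    proof (rule cSup_least[OF ne])
      fix s assume "s \<in> variation_sums g c x"
      then have "s + \<bar>g y - g x\<bar> \<in> variation_sums g c y"
        using that by (intro variation_sums_add[of _ _ _ x] increment_in_variation_sums)
      then have "s + \<bar>g y - g x\<bar> \<le> Sup (variation_sums g c y)"
        using that by (intro cSup_upper bddxy) auto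
      then show "s \<le> Sup (variation_sums g c y) - \<bar>g y - g x\<bar>" by simp
    qed
    then show ?thesis by simp
  qed
  have upper: "V y - V x \<le> Sup (variation_sums g x y)" if xy: "c \<le> x" "x \<le> y" "y \<le> d" for x y
  proof -
    have "V y \<le> V x + Sup (variation_sums g x y)" unfolding V_def
    proof (rule cSup_least[OF ne])
      fix s assume "s \<in> variation_sums g c y"
      then obtain s1 s2 where "s1 \<in> variation_sums g c x" "s2 \<in> variation_sums g x y" "s \<le> s1 + s2"
        by (rule variation_sums_split[of s g c y x]) (use xy in auto)
      moreover have "s1 \<le> Sup (variation_sums g c x)" "s2 \<le> Sup (variation_sums g x y)"
        using calculation xy by (auto intro!: cSup_upper bddxy)
      ultimately show "s \<le> Sup (variation_sums g c x) + Sup (variation_sums g x y)" by simp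
    qed
    then show ?thesis by simp
  qed
  have "abs_cont_on {c..d} (\<lambda>x. complex_of_real (V x))"
    unfolding abs_cont_on_def
  proof (intro allI impI)
    fix \<epsilon> :: real assume "\<epsilon> > 0"
    then have e: "\<epsilon> / 2 > 0" by simp
    obtain \<delta> where \<delta>: "\<delta> > 0" "\<forall>(A::(nat \<times> nat) set) u v. finite A \<and> (\<forall>i\<in>A. u i \<le> v i \<and> {u i..v i} \<subseteq> {c..d}) \<and>
      disjoint_family_on (\<lambda>i. {u i<..<v i}) A \<and> (\<Sum>i\<in>A. v i - u i) < \<delta> \<longrightarrow>
      (\<Sum>i\<in>A. norm (complex_of_real (g (v i)) - complex_of_real (g (u i)))) < \<epsilon> / 2"
      using abs_cont_onD[OF ac e] by iprover
    show "\<exists>\<delta>>0. \<forall>(n::nat) u v. (\<forall>i<n. u i \<le> v i \<and> {u i..v i} \<subseteq> {c..d}) \<and>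
        disjoint_family_on (\<lambda>i. {u i<..<v i}) {..<n} \<and> (\<Sum>i<n. v i - u i) < \<delta>
        \<longrightarrow> (\<Sum>i<n. norm (complex_of_real (V (v i)) - complex_of_real (V (u i)))) < \<epsilon>"
    proof (intro exI[of _ \<delta>] conjI allI impI \<delta>(1))
      fix n :: nat and u v :: "nat \<Rightarrow> real"
      assume *: "(\<forall>i<n. u i \<le> v i \<and> {u i..v i} \<subseteq> {c..d}) \<and>
        disjoint_family_on (\<lambda>i. {u i<..<v i}) {..<n} \<and> (\<Sum>i<n. v i - u i) < \<delta>"
      have uv: "c \<le> u i" "u i \<le> v i" "v i \<le> d" if "i < n" for i using * that by auto
      \<comment> \<open>\<open>Q\<close> picks a subdivision of the i-th interval that misses the
        variation by at most \<epsilon> / (2 (n + 1)). All subdivisions together form one family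
        indexed by pairs, with total length still below \<delta>, and the deficits add up to at most
        \<epsilon>/2.\<close>
      define Q where "Q i m u' v' \<longleftrightarrow> (\<forall>k<m. u i \<le> u' k \<and> u' k \<le> v' k \<and> v' k \<le> v i) \<and>
          disjoint_family_on (\<lambda>i. {u' i<..<v' i}) {..<m::nat} \<and>
          V (v i) - V (u i) < (\<Sum>k<m. \<bar>g (v' k) - g (u' k)\<bar>) + \<epsilon> / (2 * Suc n)" for i m u' v'
      have "\<exists>m u' v'. Q i m u' v'" if i: "i < n" for i
      proof -
        have "Sup (variation_sums g (u i) (v i)) - \<epsilon> / (2 * Suc n) < Sup (variation_sums g (u i) (v i))"
          using \<open>\<epsilon> > 0\<close> by simp
        then obtain s where s: "s \<in> variation_sums g (u i) (v i)" "Sup (variation_sums g (u i) (v i)) - \<epsilon> / (2 * Suc n) < s"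
          using less_cSup_iff[OF ne bddxy] uv[OF i] by blast
        from s(1) obtain m u' v' where m: "s = (\<Sum>k<m. \<bar>g (v' k) - g (u' k)\<bar>)"
          "\<forall>k<m. u i \<le> u' k \<and> u' k \<le> v' k \<and> v' k \<le> v i" "disjoint_family_on (\<lambda>i. {u' i<..<v' i}) {..<m::nat}"
          unfolding variation_sums_def by blast
        have "V (v i) - V (u i) \<le> Sup (variation_sums g (u i) (v i))" by (rule upper) (use uv[OF i] in auto)
        then have "V (v i) - V (u i) < s + \<epsilon> / (2 * Suc n)" using s(2) by linarith
        with m show ?thesis unfolding Q_def by blast
      qed
      then obtain m u' v' where Q: "\<And>i. i < n \<Longrightarrow> Q i (m i) (u' i) (v' i)" by metis
      then have m: "\<And>i. i < n \<Longrightarrow> (\<forall>k<m i. u i \<le> u' i k \<and> u' i k \<le> v' i k \<and> v' i k \<le> v i) \<and>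
          disjoint_family_on (\<lambda>k. {u' i k<..<v' i k}) {..<m i} \<and>
          V (v i) - V (u i) < (\<Sum>k<m i. \<bar>g (v' i k) - g (u' i k)\<bar>) + \<epsilon> / (2 * Suc n)"
        unfolding Q_def by blast
      let ?A = "Sigma {..<n} (\<lambda>i. {..<m i})"
      have "(\<Sum>i<n. norm (complex_of_real (V (v i)) - complex_of_real (V (u i)))) = (\<Sum>i<n. V (v i) - V (u i))"
      proof (rule sum.cong[OF refl])
        fix i assume "i \<in> {..<n}"
        then have "\<bar>g (v i) - g (u i)\<bar> \<le> V (v i) - V (u i)" using uv by (intro lower) auto
        then have "0 \<le> V (v i) - V (u i)" by linarith
        then show "norm (complex_of_real (V (v i)) - complex_of_real (V (u i))) = V (v i) - V (u i)"
          unfolding of_real_diff[symmetric] norm_of_real by simp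
      qed
      also have "\<dots> \<le> (\<Sum>i<n. (\<Sum>k<m i. \<bar>g (v' i k) - g (u' i k)\<bar>) + \<epsilon> / (2 * Suc n))"
        by (rule sum_mono) (use m in \<open>auto intro: less_imp_le\<close>)
      also have "\<dots> = (\<Sum>i<n. \<Sum>k<m i. \<bar>g (v' i k) - g (u' i k)\<bar>) + real n * (\<epsilon> / (2 * Suc n))"
        by (simp add: sum.distrib)
      also have "(\<Sum>i<n. \<Sum>k<m i. \<bar>g (v' i k) - g (u' i k)\<bar>) =
          (\<Sum>p\<in>?A. norm (complex_of_real (g (v' (fst p) (snd p))) - complex_of_real (g (u' (fst p) (snd p)))))"
        unfolding of_real_diff[symmetric] norm_of_real by (subst sum.Sigma) (auto simp: case_prod_beta)
      also have "\<dots> < \<epsilon> / 2"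
      proof (rule \<delta>(2)[rule_format], intro conjI ballI)
        show "finite ?A" by simp
        fix p assume p: "p \<in> ?A"
        then show "u' (fst p) (snd p) \<le> v' (fst p) (snd p)" using m by auto
        show "{u' (fst p) (snd p)..v' (fst p) (snd p)} \<subseteq> {c..d}"
          using p m[of "fst p"] uv[of "fst p"] by (auto, (meson order_trans)+)
      next
        show "disjoint_family_on (\<lambda>p. {u' (fst p) (snd p)<..<v' (fst p) (snd p)}) ?A"
          unfolding disjoint_family_on_def
        proof (intro ballI impI)
          fix p q assume pq: "p \<in> ?A" "q \<in> ?A" "p \<noteq> q"
          show "{u' (fst p) (snd p)<..<v' (fst p) (snd p)} \<inter> {u' (fst q) (snd q)<..<v' (fst q) (snd q)} = {}"
          proof (cases "fst p = fst q")
            case True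
            then have "snd p \<noteq> snd q" using pq(3) prod_eq_iff by blast
            then show ?thesis using m[of "fst p"] pq True unfolding disjoint_family_on_def by auto
          next
            case False
            have "{u (fst p)<..<v (fst p)} \<inter> {u (fst q)<..<v (fst q)} = {}"
              using * pq False unfolding disjoint_family_on_def by auto
            moreover have "{u' (fst p) (snd p)<..<v' (fst p) (snd p)} \<subseteq> {u (fst p)<..<v (fst p)}" if "p \<in> ?A" for p
              using m[of "fst p"] that by force
            ultimately show ?thesis using pq by blast
          qed
        qed
        have "(\<Sum>p\<in>?A. v' (fst p) (snd p) - u' (fst p) (snd p)) = (\<Sum>i<n. \<Sum>k<m i. v' i k - u' i k)"
          by (subst sum.Sigma) (auto simp: case_prod_beta)
        also have "\<dots> \<le> (\<Sum>i<n. v i - u i)"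
          by (rule sum_mono, rule sum_le) (use m uv in auto)
        finally show "(\<Sum>p\<in>?A. v' (fst p) (snd p) - u' (fst p) (snd p)) < \<delta>" using * by simp
      qed
      also have "\<epsilon> / 2 + real n * (\<epsilon> / (2 * Suc n)) \<le> \<epsilon>"
        using \<open>\<epsilon> > 0\<close> by (simp add: field_simps)
      finally show "(\<Sum>i<n. norm (complex_of_real (V (v i)) - complex_of_real (V (u i)))) < \<epsilon>" by simp
    qed
  qed
  with lower show ?thesis by (rule that)
qed

text \<open>Difference of the densities of the two nondecreasing functions V and V - g.\<close>

lemma real_abs_cont_has_density:
  fixes g :: "real \<Rightarrow> real"
  assumes cd: "c \<le> d" and ac: "abs_cont_on {c..d} (\<lambda>x. complex_of_real (g x))"
  obtains h :: "real \<Rightarrow> real" where "set_integrable lebesgue {c..d} h"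
    "\<And>u v. c \<le> u \<Longrightarrow> u \<le> v \<Longrightarrow> v \<le> d \<Longrightarrow> (LINT x:{u..v}|lebesgue. h x) = g v - g u"
proof -
  obtain V where V: "\<And>x y. c \<le> x \<Longrightarrow> x \<le> y \<Longrightarrow> y \<le> d \<Longrightarrow> \<bar>g y - g x\<bar> \<le> V y - V x"
    "abs_cont_on {c..d} (\<lambda>x. complex_of_real (V x))"
    using abs_cont_imp_mono_decomposition[OF cd ac] by blast
  have V1: "V x \<le> V y" if "c \<le> x" "x \<le> y" "y \<le> d" for x y using V(1)[OF that] by linarith
  have V2: "V x - g x \<le> V y - g y" if "c \<le> x" "x \<le> y" "y \<le> d" for x y using V(1)[OF that] by linarith
  have ac2: "abs_cont_on {c..d} (\<lambda>x. complex_of_real (V x - g x))"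
    using abs_cont_on_diff[OF V(2) ac] by simp
  obtain h1 where h1: "set_integrable lebesgue {c..d} h1"
    "\<And>u v. c \<le> u \<Longrightarrow> u \<le> v \<Longrightarrow> v \<le> d \<Longrightarrow> (LINT x:{u..v}|lebesgue. h1 x) = V v - V u"
    using mono_abs_cont_has_density[OF cd V1 V(2)] by blast
  obtain h2 where h2: "set_integrable lebesgue {c..d} h2"
    "\<And>u v. c \<le> u \<Longrightarrow> u \<le> v \<Longrightarrow> v \<le> d \<Longrightarrow> (LINT x:{u..v}|lebesgue. h2 x) = (V v - g v) - (V u - g u)"
    using mono_abs_cont_has_density[OF cd V2 ac2] by blast
  show ?thesis
  proof (rule that[of "\<lambda>x. h1 x - h2 x"])
    show "set_integrable lebesgue {c..d} (\<lambda>x. h1 x - h2 x)" using h1(1) h2(1) by (rule set_integral_diff)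
    fix u v assume uv: "c \<le> u" "u \<le> v" "v \<le> d"
    have "set_integrable lebesgue {u..v} h1" "set_integrable lebesgue {u..v} h2"
      using uv by (auto intro: set_integrable_subset[OF h1(1)] set_integrable_subset[OF h2(1)])
    from set_integral_diff(2)[OF this] show "(LINT x:{u..v}|lebesgue. h1 x - h2 x) = g v - g u"
      using h1(2)[OF uv] h2(2)[OF uv] by simp
  qed
qed

lemma abs_cont_on_Re_Im:
  assumes "abs_cont_on S F"
  shows "abs_cont_on S (\<lambda>x. complex_of_real (Re (F x)))" "abs_cont_on S (\<lambda>x. complex_of_real (Im (F x)))"
proof -
  have *: "abs_cont_on S G" if "\<And>x y. norm (G x - G y) \<le> norm (F x - F y)" for G
    using assms unfolding abs_cont_on_def
    by (smt (verit) sum_mono that)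
  show "abs_cont_on S (\<lambda>x. complex_of_real (Re (F x)))" "abs_cont_on S (\<lambda>x. complex_of_real (Im (F x)))"
    by (rule *, metis minus_complex.simps abs_Re_le_cmod abs_Im_le_cmod norm_of_real of_real_diff)+
qed

lemma abs_cont_has_density:
  assumes cd: "c \<le> d" and ac: "abs_cont_on {c..d} F"
  obtains h :: "real \<Rightarrow> complex" where "set_integrable lebesgue {c..d} h"
    "\<And>u v. c \<le> u \<Longrightarrow> u \<le> v \<Longrightarrow> v \<le> d \<Longrightarrow> (LINT x:{u..v}|lebesgue. h x) = F v - F u"
proof -
  obtain h1 where h1: "set_integrable lebesgue {c..d} h1"
    "\<And>u v. c \<le> u \<Longrightarrow> u \<le> v \<Longrightarrow> v \<le> d \<Longrightarrow> (LINT x:{u..v}|lebesgue. h1 x) = Re (F v) - Re (F u)"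
    using real_abs_cont_has_density[OF cd abs_cont_on_Re_Im(1)[OF ac]] by blast
  obtain h2 where h2: "set_integrable lebesgue {c..d} h2"
    "\<And>u v. c \<le> u \<Longrightarrow> u \<le> v \<Longrightarrow> v \<le> d \<Longrightarrow> (LINT x:{u..v}|lebesgue. h2 x) = Im (F v) - Im (F u)"
    using real_abs_cont_has_density[OF cd abs_cont_on_Re_Im(2)[OF ac]] by blast
  have of_real: "set_integrable lebesgue A (\<lambda>x. complex_of_real (h x))"
    "(LINT x:A|lebesgue. complex_of_real (h x)) = of_real (LINT x:A|lebesgue. h x)"
    if "set_integrable lebesgue A h" for A h
    using that unfolding set_integrable_def set_lebesgue_integral_def
    by (simp_all add: scaleR_conv_of_real flip: of_real_mult)
  show ?thesis
  proof (rule that[of "\<lambda>x. complex_of_real (h1 x) + \<i> * complex_of_real (h2 x)"])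
    show "set_integrable lebesgue {c..d} (\<lambda>x. complex_of_real (h1 x) + \<i> * complex_of_real (h2 x))"
      by (intro set_integral_add set_integrable_mult_right of_real h1 h2)
    fix u v assume uv: "c \<le> u" "u \<le> v" "v \<le> d"
    have "set_integrable lebesgue {u..v} h1" "set_integrable lebesgue {u..v} h2"
      using uv by (auto intro: set_integrable_subset[OF h1(1)] set_integrable_subset[OF h2(1)])
    then have "(LINT x:{u..v}|lebesgue. complex_of_real (h1 x) + \<i> * complex_of_real (h2 x)) =
        of_real (LINT x:{u..v}|lebesgue. h1 x) + \<i> * of_real (LINT x:{u..v}|lebesgue. h2 x)"
      by (subst set_integral_add(2)) (auto simp: of_real intro!: set_integrable_mult_right)
    also have "\<dots> = F v - F u" using h1(2)[OF uv] h2(2)[OF uv] by (simp add: complex_eq_iff)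
    finally show "(LINT x:{u..v}|lebesgue. complex_of_real (h1 x) + \<i> * complex_of_real (h2 x)) = F v - F u" .
  qed
qed

lemma set_integrable_cong_AE_lebesgue:
  fixes f g :: "real \<Rightarrow> 'a::euclidean_space"
  assumes f: "set_integrable lebesgue A f" and eq: "AE x in lebesgue. x \<in> A \<longrightarrow> f x = g x"
  shows "set_integrable lebesgue A g" "(LINT x:A|lebesgue. f x) = (LINT x:A|lebesgue. g x)"
proof -
  obtain N where N: "N \<in> null_sets lebesgue" "{x \<in> space lebesgue. \<not> (x \<in> A \<longrightarrow> f x = g x)} \<subseteq> N"
    using eq unfolding eventually_ae_filter by blast
  then have neg: "negligible N" by (simp add: negligible_iff_null_sets)
  have g: "g absolutely_integrable_on A"
    by (rule absolutely_integrable_spike[OF f neg]) (use N in auto)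
  then show "set_integrable lebesgue A g" .
  show "(LINT x:A|lebesgue. f x) = (LINT x:A|lebesgue. g x)"
    unfolding set_lebesgue_integral_eq_integral(2)[OF f] set_lebesgue_integral_eq_integral(2)[OF g]
    by (rule integral_spike[OF neg]) (use N in auto)
qed

text \<open>The Radon-Nikodym density is identified with the pointwise derivative by the
  differentiation theorem. It is found on one compact interval at a time, while the derivative is a
  single density for all of them.\<close>

theorem loc_abs_cont_imp_is_primitive:
  assumes "open I" and F: "loc_abs_cont I F"
  shows "is_primitive I F (\<lambda>x. vector_derivative F (at x))"
  unfolding is_primitive_def
proof (intro allI impI)
  fix c d :: real assume cd: "c \<le> d" "{c..d} \<subseteq> I"
  obtain h where h: "set_integrable lebesgue {c..d} h"
    "\<And>u v. c \<le> u \<Longrightarrow> u \<le> v \<Longrightarrow> v \<le> d \<Longrightarrow> (LINT x:{u..v}|lebesgue. h x) = F v - F u"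
    using abs_cont_has_density[OF cd(1)] F cd(2) unfolding loc_abs_cont_def by blast
  have "is_primitive {c<..<d} F h"
    unfolding is_primitive_def
  proof (intro allI impI conjI)
    fix x y assume "x \<le> y" "{x..y} \<subseteq> {c<..<d}"
    then have "c \<le> x" "y \<le> d" by auto
    then show "set_integrable lebesgue {x..y} h" "(LINT x:{x..y}|lebesgue. h x) = F y - F x"
      using h(2) \<open>x \<le> y\<close> by (auto intro: set_integrable_subset[OF h(1)])
  qed
  from is_primitive_has_derivative[OF this open_greaterThanLessThan]
  have "AE x in lebesgue. x \<in> {c<..<d} \<longrightarrow> (F has_vector_derivative h x) (at x)" .
  moreover have "AE x in lebesgue. x \<notin> {c, d}" by (rule AE_not_in) (simp flip: negligible_iff_null_sets)
  ultimately have ae: "AE x in lebesgue. x \<in> {c..d} \<longrightarrow> h x = vector_derivative F (at x)"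
    by eventually_elim (auto simp: vector_derivative_at)
  show "set_integrable lebesgue {c..d} (\<lambda>x. vector_derivative F (at x)) \<and>
     (LINT x:{c..d}|lebesgue. vector_derivative F (at x)) = F d - F c"
    using set_integrable_cong_AE_lebesgue[OF h(1) ae] h(2)[of c d] cd by auto
qed

section \<open>The space of square integrable functions\<close>

lemma L2D: "f \<in> L2 M \<Longrightarrow> f \<in> borel_measurable M" "f \<in> L2 M \<Longrightarrow> integrable M (\<lambda>x. (norm (f x))\<^sup>2)"
  by (auto simp: L2_def)

lemma L2I_bound:
  assumes "f \<in> borel_measurable M" "integrable M g" "AE x in M. (norm (f x))\<^sup>2 \<le> g x"
  shows "f \<in> L2 M"
  unfolding L2_def
proof (intro CollectI conjI assms(1))
  show "integrable M (\<lambda>x. (norm (f x))\<^sup>2)"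
  proof (rule Bochner_Integration.integrable_bound[OF assms(2)])
    show "AE x in M. norm ((norm (f x))\<^sup>2) \<le> norm (g x)"
      using assms(3) by eventually_elim (auto simp: abs_le_iff)
  qed (use assms(1) in measurable)
qed

lemma L2_iff_nn_integral:
  "f \<in> L2 M \<longleftrightarrow> f \<in> borel_measurable M \<and> (\<integral>\<^sup>+x. ennreal ((norm (f x))\<^sup>2) \<partial>M) < \<infinity>"
  by (auto simp: L2_def integrable_iff_bounded)

lemma L2_nn_integral:
  assumes "f \<in> L2 M"
  shows "(\<integral>\<^sup>+x. ennreal ((norm (f x))\<^sup>2) \<partial>M) = ennreal ((l2norm M f)\<^sup>2)"
  using assms unfolding l2norm_def L2_def
  by (subst nn_integral_eq_integral) auto

lemma L2_zero: "(\<lambda>x. 0) \<in> L2 M"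
  by (simp add: L2_def)

lemma L2_scale: "f \<in> L2 M \<Longrightarrow> (\<lambda>x. c * f x) \<in> L2 M"
  by (auto simp: L2_def norm_mult power_mult_distrib)

lemma L2_cnj: "f \<in> L2 M \<Longrightarrow> (\<lambda>x. cnj (f x)) \<in> L2 M"
  by (auto simp: L2_def intro: borel_measurable_continuous_onI[THEN measurable_compose[rotated]] continuous_intros)

lemma norm_add_sq_le: "(norm (a + b))\<^sup>2 \<le> 2 * (norm a)\<^sup>2 + 2 * (norm (b::complex))\<^sup>2"
proof -
  have "(norm (a + b))\<^sup>2 \<le> (norm a + norm b)\<^sup>2" by (intro power_mono norm_triangle_ineq) auto
  also have "\<dots> \<le> 2 * (norm a)\<^sup>2 + 2 * (norm b)\<^sup>2"
    using zero_le_power2[of "norm a - norm b"] by (simp add: power2_eq_square algebra_simps)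
  finally show ?thesis .
qed

lemma L2_add:
  assumes f: "f \<in> L2 M" and g: "g \<in> L2 M"
  shows "(\<lambda>x. f x + g x) \<in> L2 M"
proof (rule L2I_bound)
  show "(\<lambda>x. f x + g x) \<in> borel_measurable M" using L2D(1)[OF f] L2D(1)[OF g] by measurable
  show "integrable M (\<lambda>x. 2 * (norm (f x))\<^sup>2 + 2 * (norm (g x))\<^sup>2)"
    using L2D(2)[OF f] L2D(2)[OF g] by auto
qed (simp add: norm_add_sq_le)

lemma L2_diff: "f \<in> L2 M \<Longrightarrow> g \<in> L2 M \<Longrightarrow> (\<lambda>x. f x - g x) \<in> L2 M"
  using L2_add[of f M "\<lambda>x. (-1) * g x"] L2_scale[of g M "-1"] by simp

lemma L2_sum: "(\<And>i. i \<in> A \<Longrightarrow> f i \<in> L2 M) \<Longrightarrow> (\<lambda>x. \<Sum>i\<in>A. f i x) \<in> L2 M"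
  by (induction A rule: infinite_finite_induct) (auto intro: L2_zero L2_add)

lemma L2_prod_integrable:
  assumes f: "f \<in> L2 M" and g: "g \<in> L2 M"
  shows "integrable M (\<lambda>x. f x * g x)" "integrable M (\<lambda>x. norm (f x) * norm (g x))"
proof -
  have [measurable]: "f \<in> borel_measurable M" "g \<in> borel_measurable M"
    using L2D(1)[OF f] L2D(1)[OF g] by auto
  have i: "integrable M (\<lambda>x. (norm (f x))\<^sup>2 + (norm (g x))\<^sup>2)"
    using L2D(2)[OF f] L2D(2)[OF g] by auto
  have le: "norm (f x) * norm (g x) \<le> (norm (f x))\<^sup>2 + (norm (g x))\<^sup>2" for x
  proof -
    have "2 * (norm (f x) * norm (g x)) \<le> (norm (f x))\<^sup>2 + (norm (g x))\<^sup>2"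
      using sum_squares_bound[of "norm (f x)" "norm (g x)"] by (simp add: mult.assoc)
    moreover have "0 \<le> norm (f x) * norm (g x)" by simp
    ultimately show ?thesis by linarith
  qed
  show "integrable M (\<lambda>x. f x * g x)"
    by (rule Bochner_Integration.integrable_bound[OF i]) (use le in \<open>auto simp: norm_mult\<close>)
  show "integrable M (\<lambda>x. norm (f x) * norm (g x))"
    by (rule Bochner_Integration.integrable_bound[OF i]) (use le in \<open>auto simp: norm_mult\<close>)
qed

lemma l2norm_nonneg: "0 \<le> l2norm M f"
  by (simp add: l2norm_def)

lemma l2norm_sq: "(l2norm M f)\<^sup>2 = (\<integral>x. (norm (f x))\<^sup>2 \<partial>M)"
  by (simp add: l2norm_def)

text \<open>The quadratic is tested at its minimum C / A. For A = 0 it is affine, and its value at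
  (B + 1) / C would be -B - 2, negative because B is its value at 0.\<close>

lemma quadratic_nonneg_imp:
  fixes A B C :: real
  assumes "\<And>t. 0 \<le> A * t\<^sup>2 - 2 * C * t + B" "0 \<le> A" "0 \<le> C"
  shows "C\<^sup>2 \<le> A * B"
proof (cases "A = 0")
  case True
  have "C = 0"
  proof (rule ccontr)
    assume "C \<noteq> 0"
    then have "2 * C * ((B + 1) / C) = 2 * (B + 1)" by simp
    with assms(1)[of "(B + 1) / C"] True assms(1)[of 0] show False by simp
  qed
  then show ?thesis using True by simp
next
  case False
  then have "A > 0" using assms(2) by simp
  have "0 \<le> A * (C / A)\<^sup>2 - 2 * C * (C / A) + B" by (rule assms(1))
  also have "\<dots> = B - C\<^sup>2 / A" using \<open>A > 0\<close> by (simp add: field_simps power2_eq_square)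
  finally show ?thesis using \<open>A > 0\<close> by (simp add: field_simps)
qed

lemma L2_Cauchy_Schwarz:
  assumes f: "f \<in> L2 M" and g: "g \<in> L2 M"
  shows "(\<integral>x. norm (f x) * norm (g x) \<partial>M) \<le> l2norm M f * l2norm M g"
proof -
  let ?A = "\<integral>x. (norm (f x))\<^sup>2 \<partial>M" and ?B = "\<integral>x. (norm (g x))\<^sup>2 \<partial>M" and ?C = "\<integral>x. norm (f x) * norm (g x) \<partial>M"
  have "0 \<le> ?A * t\<^sup>2 - 2 * ?C * t + ?B" for t
  proof -
    have "0 \<le> (\<integral>x. (t * norm (f x) - norm (g x))\<^sup>2 \<partial>M)" by simp
    also have "\<dots> = (\<integral>x. t\<^sup>2 * (norm (f x))\<^sup>2 - (2 * t) * (norm (f x) * norm (g x)) + (norm (g x))\<^sup>2 \<partial>M)"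
      by (rule Bochner_Integration.integral_cong) (auto simp: power2_eq_square algebra_simps)
    also have "\<dots> = t\<^sup>2 * ?A - (2 * t) * ?C + ?B"
      using L2D(2)[OF f] L2D(2)[OF g] L2_prod_integrable(2)[OF f g] by simp
    finally show ?thesis by (simp add: algebra_simps)
  qed
  then have "?C\<^sup>2 \<le> ?A * ?B" by (rule quadratic_nonneg_imp) auto
  then have "?C \<le> sqrt (?A * ?B)" by (rule real_le_rsqrt)
  then show ?thesis by (simp add: l2norm_def real_sqrt_mult)
qed

lemma ip_le: 
  assumes f: "f \<in> L2 M" and g: "g \<in> L2 M"
  shows "norm (ip M f g) \<le> l2norm M f * l2norm M g"
proof -
  have "norm (ip M f g) \<le> (\<integral>x. norm (f x) * norm (g x) \<partial>M)"
    unfolding ip_def by (rule order_trans[OF integral_norm_bound]) (simp add: norm_mult)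
  also note L2_Cauchy_Schwarz[OF f g]
  finally show ?thesis .
qed

lemma l2norm_triangle:
  assumes f: "f \<in> L2 M" and g: "g \<in> L2 M"
  shows "l2norm M (\<lambda>x. f x + g x) \<le> l2norm M f + l2norm M g"
proof (rule power2_le_imp_le)
  have "(l2norm M (\<lambda>x. f x + g x))\<^sup>2 \<le> (\<integral>x. (norm (f x))\<^sup>2 + 2 * (norm (f x) * norm (g x)) + (norm (g x))\<^sup>2 \<partial>M)"
    unfolding l2norm_sq
  proof (rule integral_mono)
    show "integrable M (\<lambda>x. (norm (f x + g x))\<^sup>2)" using L2D(2)[OF L2_add[OF f g]] .
    show "integrable M (\<lambda>x. (norm (f x))\<^sup>2 + 2 * (norm (f x) * norm (g x)) + (norm (g x))\<^sup>2)"
      using L2D(2)[OF f] L2D(2)[OF g] L2_prod_integrable(2)[OF f g] by auto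
    show "(norm (f x + g x))\<^sup>2 \<le> (norm (f x))\<^sup>2 + 2 * (norm (f x) * norm (g x)) + (norm (g x))\<^sup>2" for x
      using power_mono[OF norm_triangle_ineq[of "f x" "g x"], of 2] by (simp add: power2_eq_square algebra_simps)
  qed
  also have "\<dots> = (l2norm M f)\<^sup>2 + 2 * (\<integral>x. norm (f x) * norm (g x) \<partial>M) + (l2norm M g)\<^sup>2"
    using L2D(2)[OF f] L2D(2)[OF g] L2_prod_integrable(2)[OF f g] by (simp add: l2norm_sq)
  also have "\<dots> \<le> (l2norm M f + l2norm M g)\<^sup>2"
    using L2_Cauchy_Schwarz[OF f g] by (simp add: power2_eq_square algebra_simps)
  finally show "(l2norm M (\<lambda>x. f x + g x))\<^sup>2 \<le> (l2norm M f + l2norm M g)\<^sup>2" .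
qed (simp add: l2norm_nonneg)

lemma l2norm_scale: "l2norm M (\<lambda>x. c * f x) = norm c * l2norm M f"
proof -
  have "(\<integral>x. (norm (c * f x))\<^sup>2 \<partial>M) = (norm c)\<^sup>2 * (\<integral>x. (norm (f x))\<^sup>2 \<partial>M)"
    by (simp add: norm_mult power_mult_distrib)
  then show ?thesis unfolding l2norm_def by (simp add: real_sqrt_mult)
qed

lemma l2norm_minus_commute: "l2norm M (\<lambda>x. f x - g x) = l2norm M (\<lambda>x. g x - f x)"
  by (simp add: l2norm_def norm_minus_commute)

lemma l2norm_triangle_diff:
  assumes "f \<in> L2 M" "g \<in> L2 M" "h \<in> L2 M"
  shows "l2norm M (\<lambda>x. f x - h x) \<le> l2norm M (\<lambda>x. f x - g x) + l2norm M (\<lambda>x. g x - h x)"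
  using l2norm_triangle[OF L2_diff[OF assms(1,2)] L2_diff[OF assms(2,3)]] by simp

lemma l2norm_cong_AE:
  assumes "AE x in M. f x = g x" "f \<in> borel_measurable M" "g \<in> borel_measurable M"
  shows "l2norm M f = l2norm M g"
  unfolding l2norm_def
  by (rule arg_cong[of _ _ sqrt], rule integral_cong_AE) (use assms in \<open>auto elim: eventually_mono\<close>)

lemma L2_cong_AE:
  assumes "f \<in> L2 M" "AE x in M. f x = g x" "g \<in> borel_measurable M"
  shows "g \<in> L2 M"
  by (rule L2I_bound[OF assms(3) L2D(2)[OF assms(1)]]) (use assms(2) in eventually_elim, simp)

lemma l2norm_eq_0_AE:
  assumes "f \<in> L2 M" "l2norm M f = 0"
  shows "AE x in M. f x = 0"
proof -
  have "(\<integral>x. (norm (f x))\<^sup>2 \<partial>M) = 0" using assms(2) l2norm_sq[of M f] by simp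
  then have "AE x in M. (norm (f x))\<^sup>2 = 0"
    using integral_nonneg_eq_0_iff_AE[OF L2D(2)[OF assms(1)]] by simp
  then show ?thesis by eventually_elim simp
qed

lemma ip_add_left: "f \<in> L2 M \<Longrightarrow> g \<in> L2 M \<Longrightarrow> h \<in> L2 M \<Longrightarrow> ip M (\<lambda>x. f x + g x) h = ip M f h + ip M g h"
  unfolding ip_def by (simp add: distrib_right L2_prod_integrable L2_cnj)

lemma ip_add_right: "f \<in> L2 M \<Longrightarrow> g \<in> L2 M \<Longrightarrow> h \<in> L2 M \<Longrightarrow> ip M h (\<lambda>x. f x + g x) = ip M h f + ip M h g"
  unfolding ip_def by (simp add: distrib_left L2_prod_integrable L2_cnj)

lemma ip_diff_left: "f \<in> L2 M \<Longrightarrow> g \<in> L2 M \<Longrightarrow> h \<in> L2 M \<Longrightarrow> ip M (\<lambda>x. f x - g x) h = ip M f h - ip M g h"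
  unfolding ip_def by (simp add: left_diff_distrib L2_prod_integrable L2_cnj)

lemma ip_diff_right: "f \<in> L2 M \<Longrightarrow> g \<in> L2 M \<Longrightarrow> h \<in> L2 M \<Longrightarrow> ip M h (\<lambda>x. f x - g x) = ip M h f - ip M h g"
  unfolding ip_def by (simp add: right_diff_distrib L2_prod_integrable L2_cnj)

lemma ip_scale_left: "ip M (\<lambda>x. c * f x) g = c * ip M f g"
  unfolding ip_def by (simp add: mult.assoc)

lemma ip_scale_right: "ip M f (\<lambda>x. c * g x) = cnj c * ip M f g"
  unfolding ip_def by (simp add: mult.left_commute)

lemma ip_commute: "ip M g f = cnj (ip M f g)"
  unfolding ip_def by (simp flip: Bochner_Integration.integral_cnj add: mult.commute)

lemma ip_self: "ip M f f = of_real ((l2norm M f)\<^sup>2)"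
  unfolding ip_def l2norm_sq complex_norm_square[symmetric] by (rule integral_complex_of_real)

lemma ip_tendsto_right:
  assumes "\<And>n. f n \<in> L2 M" "g \<in> L2 M" "h \<in> L2 M" "(\<lambda>n. l2norm M (\<lambda>x. f n x - g x)) \<longlonglongrightarrow> 0"
  shows "(\<lambda>n. ip M h (f n)) \<longlonglongrightarrow> ip M h g"
proof (rule LIM_zero_cancel)
  show "(\<lambda>n. ip M h (f n) - ip M h g) \<longlonglongrightarrow> 0"
  proof (rule Lim_null_comparison)
    show "\<forall>\<^sub>F n in sequentially. norm (ip M h (f n) - ip M h g) \<le> l2norm M h * l2norm M (\<lambda>x. f n x - g x)"
      using ip_le[OF assms(3) L2_diff[OF assms(1,2)]] by (intro always_eventually allI) (simp add: ip_diff_right assms)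
    show "(\<lambda>n. l2norm M h * l2norm M (\<lambda>x. f n x - g x)) \<longlonglongrightarrow> 0"
      using tendsto_mult_right_zero[OF assms(4)] .
  qed
qed

text \<open>Bounded terms 2^k |D_k|^2 give |D_k| at most a constant times 2^(-k/2), a geometric
  majorant. The weight replaces a Cauchy-Schwarz argument for series.\<close>

lemma summable_if_weighted_squares:
  fixes D :: "nat \<Rightarrow> complex"
  assumes "(\<Sum>k. ennreal (2^k * (norm (D k))\<^sup>2)) \<noteq> \<infinity>"
  shows "summable D"
proof -
  have "summable (\<lambda>k. 2^k * (norm (D k))\<^sup>2)"
    using assms by (intro summable_suminf_not_top) (auto simp: top_ennreal_def)
  then have "Bseq (\<lambda>k. 2^k * (norm (D k))\<^sup>2)"
    by (intro convergent_imp_Bseq) (auto simp: convergent_def dest: summable_LIMSEQ_zero)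
  then obtain C where C: "C > 0" "\<And>k. norm (2^k * (norm (D k))\<^sup>2) \<le> C" by (auto elim: BseqE)
  have "norm (D k) \<le> sqrt C * (1 / sqrt 2)^k" for k
  proof -
    have "2^k * (norm (D k))\<^sup>2 \<le> C" using C(2)[of k] by (simp add: abs_mult)
    then have "(norm (D k))\<^sup>2 \<le> C / 2^k" by (simp add: field_simps)
    then have "norm (D k) \<le> sqrt (C / 2^k)" by (rule real_le_rsqrt)
    also have "\<dots> = sqrt C * (1 / sqrt 2)^k" by (simp add: real_sqrt_divide real_sqrt_power power_one_over)
    finally show ?thesis .
  qed
  moreover have "summable (\<lambda>k. sqrt C * (1 / sqrt 2)^k)"
    by (intro summable_mult summable_geometric) (simp add: real_less_rsqrt)
  ultimately show ?thesis
    using summable_comparison_test'[of "\<lambda>k. sqrt C * (1 / sqrt 2)^k" 0 D] by blast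
qed

text \<open>Riesz-Fischer. Along a rapidly Cauchy subsequence the weighted squares of the increments
  are integrable in sum, hence finite almost everywhere, so the subsequence converges almost
  everywhere.\<close>

theorem L2_complete:
  assumes f: "\<And>n. f n \<in> L2 M"
    and Cauchy: "\<And>e. e > 0 \<Longrightarrow> \<exists>N. \<forall>m\<ge>N. \<forall>n\<ge>N. l2norm M (\<lambda>x. f m x - f n x) < e"
  obtains g where "g \<in> L2 M" "(\<lambda>n. l2norm M (\<lambda>x. f n x - g x)) \<longlonglongrightarrow> 0"
proof -
  have [measurable]: "f n \<in> borel_measurable M" for n using L2D(1)[OF f] .
  have "\<exists>N. \<forall>m\<ge>N. \<forall>n\<ge>N. l2norm M (\<lambda>x. f m x - f n x) < (1/2)^k" for k
    by (rule Cauchy) simp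
  then obtain N where N: "\<And>k m n. m \<ge> N k \<Longrightarrow> n \<ge> N k \<Longrightarrow> l2norm M (\<lambda>x. f m x - f n x) < (1/2)^k"
    by metis
  \<comment> \<open>The sum dominates every N i with i up to k, so both r k and r (Suc k) are at
    least N k; the summand k makes the index tend to infinity.\<close>
  define r where "r k = k + (\<Sum>i\<le>k. N i)" for k
  have r1: "N k \<le> r k" for k unfolding r_def using member_le_sum[of k "{..k}" N] by simp
  have r2: "N k \<le> r (Suc k)" for k unfolding r_def using member_le_sum[of k "{..Suc k}" N] by simp
  have rk: "k \<le> r k" for k by (simp add: r_def)
  let ?D = "\<lambda>k x. f (r (Suc k)) x - f (r k) x"
  have "(\<integral>\<^sup>+x. (\<Sum>k. ennreal (2^k * (norm (?D k x))\<^sup>2)) \<partial>M) = (\<Sum>k. \<integral>\<^sup>+x. ennreal (2^k * (norm (?D k x))\<^sup>2) \<partial>M)"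
    by (rule nn_integral_suminf) measurable
  \<comment> \<open>An increment has norm below 2^(-k), so its weighted square integrates to at most
    2^k 4^(-k) = 2^(-k).\<close>
  also have "\<dots> \<le> (\<Sum>k. ennreal ((1/2)^k))"
  proof (rule suminf_le)
    fix k
    have "(\<integral>\<^sup>+x. ennreal (2^k * (norm (?D k x))\<^sup>2) \<partial>M) = ennreal (2^k) * (\<integral>\<^sup>+x. ennreal ((norm (?D k x))\<^sup>2) \<partial>M)"
      by (subst nn_integral_cmult[symmetric]) (auto simp: ennreal_mult)
    also have "\<dots> = ennreal (2^k * (l2norm M (?D k))\<^sup>2)"
      by (simp add: L2_nn_integral L2_diff f ennreal_mult)
    also have "\<dots> \<le> ennreal ((1/2)^k)"
    proof (rule ennreal_leI)
      have "l2norm M (?D k) \<le> (1/2)^k" using N[OF r2 r1, of k] by simp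
      then have "(l2norm M (?D k))\<^sup>2 \<le> ((1/2)^k)\<^sup>2" by (intro power_mono l2norm_nonneg)
      then have "2^k * (l2norm M (?D k))\<^sup>2 \<le> 2^k * ((1/2)^k)\<^sup>2" by simp
      also have "\<dots> = (1/2)^k" by (simp add: power2_eq_square power_mult_distrib[symmetric] mult.assoc[symmetric])
      finally show "2^k * (l2norm M (?D k))\<^sup>2 \<le> (1/2)^k" .
    qed
    finally show "(\<integral>\<^sup>+x. ennreal (2^k * (norm (?D k x))\<^sup>2) \<partial>M) \<le> ennreal ((1/2)^k)" .
  qed auto
  also have "\<dots> < \<infinity>"
    by (subst suminf_ennreal_eq[OF _ geometric_sums[of "1/2::real"]]) auto
  finally have "AE x in M. (\<Sum>k. ennreal (2^k * (norm (?D k x))\<^sup>2)) \<noteq> \<infinity>"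
    by (intro nn_integral_noteq_infinite) auto
  then have conv: "AE x in M. convergent (\<lambda>k. f (r k) x)"
  proof eventually_elim
    fix x assume *: "(\<Sum>k. ennreal (2^k * (norm (?D k x))\<^sup>2)) \<noteq> \<infinity>"
    then have "summable (\<lambda>k. ?D k x)" by (rule summable_if_weighted_squares)
    then have "convergent (\<lambda>n. \<Sum>k<n. ?D k x)" by (simp add: summable_iff_convergent)
    moreover have "(\<Sum>k<n. ?D k x) = f (r n) x - f (r 0) x" for n by (induction n) auto
    ultimately have "convergent (\<lambda>n. (f (r n) x - f (r 0) x) + f (r 0) x)"
      by (intro convergent_add convergent_const) simp
    then show "convergent (\<lambda>k. f (r k) x)" by simp
  qed
  define g where "g x = lim (\<lambda>k. f (r k) x)" for x
  have [measurable]: "g \<in> borel_measurable M" unfolding g_def by measurable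
  have lim: "AE x in M. (\<lambda>k. f (r k) x) \<longlonglongrightarrow> g x"
    using conv by eventually_elim (simp add: g_def convergent_LIMSEQ_iff)
  \<comment> \<open>Fatou's lemma along the subsequence turns the Cauchy estimate into an estimate
    against the limit. It serves both for the square integrability of \<open>g\<close> and for the
    convergence.\<close>
  have small: "(\<integral>\<^sup>+x. ennreal ((norm (f n x - g x))\<^sup>2) \<partial>M) \<le> ennreal (e\<^sup>2)"
    if "e > 0" "\<forall>m\<ge>K. l2norm M (\<lambda>x. f n x - f m x) < e" for n K e
  proof -
    have "(\<integral>\<^sup>+x. ennreal ((norm (f n x - g x))\<^sup>2) \<partial>M) = (\<integral>\<^sup>+x. liminf (\<lambda>k. ennreal ((norm (f n x - f (r k) x))\<^sup>2)) \<partial>M)"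
    proof (rule nn_integral_cong_AE)
      show "AE x in M. ennreal ((norm (f n x - g x))\<^sup>2) = liminf (\<lambda>k. ennreal ((norm (f n x - f (r k) x))\<^sup>2))"
        using lim
      proof eventually_elim
        fix x assume "(\<lambda>k. f (r k) x) \<longlonglongrightarrow> g x"
        then have "(\<lambda>k. ennreal ((norm (f n x - f (r k) x))\<^sup>2)) \<longlonglongrightarrow> ennreal ((norm (f n x - g x))\<^sup>2)"
          by (intro tendsto_intros)
        then show "ennreal ((norm (f n x - g x))\<^sup>2) = liminf (\<lambda>k. ennreal ((norm (f n x - f (r k) x))\<^sup>2))"
          by (rule lim_imp_Liminf[OF sequentially_bot, symmetric])
      qed
    qed
    also have "\<dots> \<le> liminf (\<lambda>k. \<integral>\<^sup>+x. ennreal ((norm (f n x - f (r k) x))\<^sup>2) \<partial>M)"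
      by (rule nn_integral_liminf) measurable
    also have "\<dots> \<le> limsup (\<lambda>k. \<integral>\<^sup>+x. ennreal ((norm (f n x - f (r k) x))\<^sup>2) \<partial>M)"
      by (rule Liminf_le_Limsup) simp
    also have "\<dots> \<le> ennreal (e\<^sup>2)"
    proof (rule Limsup_bounded)
      show "\<forall>\<^sub>F k in sequentially. (\<integral>\<^sup>+x. ennreal ((norm (f n x - f (r k) x))\<^sup>2) \<partial>M) \<le> ennreal (e\<^sup>2)"
        using eventually_ge_at_top[of K]
      proof eventually_elim
        case (elim k)
        then have "l2norm M (\<lambda>x. f n x - f (r k) x) \<le> e" using that(2) rk[of k] by (auto intro: less_imp_le)
        then show ?case by (simp add: L2_nn_integral L2_diff f ennreal_leI power_mono l2norm_nonneg)
      qed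
    qed
    finally show ?thesis .
  qed
  obtain K where K: "\<forall>m\<ge>K. \<forall>n\<ge>K. l2norm M (\<lambda>x. f m x - f n x) < 1" using Cauchy[of 1] by auto
  have "(\<lambda>x. f K x - g x) \<in> L2 M"
    unfolding L2_iff_nn_integral using small[of 1 K K] K by (auto intro: le_less_trans)
  from L2_diff[OF f[of K] this] have g: "g \<in> L2 M" by simp
  moreover have "(\<lambda>n. l2norm M (\<lambda>x. f n x - g x)) \<longlonglongrightarrow> 0"
  proof (rule LIMSEQ_I)
    fix e :: real assume "e > 0"
    then obtain K where K: "\<forall>m\<ge>K. \<forall>n\<ge>K. l2norm M (\<lambda>x. f m x - f n x) < e/2" using Cauchy[of "e/2"] by auto
    have "l2norm M (\<lambda>x. f n x - g x) < e" if "n \<ge> K" for n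
    proof -
      have "ennreal ((l2norm M (\<lambda>x. f n x - g x))\<^sup>2) \<le> ennreal ((e/2)\<^sup>2)"
        using small[of "e/2" K n] K that \<open>e > 0\<close> by (simp add: L2_nn_integral L2_diff f g)
      then have "(l2norm M (\<lambda>x. f n x - g x))\<^sup>2 \<le> (e/2)\<^sup>2" using \<open>e > 0\<close> by (simp add: ennreal_le_iff)
      then have "l2norm M (\<lambda>x. f n x - g x) \<le> e/2" by (rule power2_le_imp_le) (use \<open>e > 0\<close> in simp)
      then show ?thesis using \<open>e > 0\<close> by simp
    qed
    then show "\<exists>no. \<forall>n\<ge>no. norm (l2norm M (\<lambda>x. f n x - g x) - 0) < e" by (auto simp: l2norm_nonneg)
  qed
  ultimately show ?thesis by (rule that)
qed

section \<open>The resolvent of a self-adjoint operator\<close>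

lemma l2norm_diff_sq:
  assumes "f \<in> L2 M" "g \<in> L2 M"
  shows "(l2norm M (\<lambda>x. f x - g x))\<^sup>2 = (l2norm M f)\<^sup>2 - 2 * Re (ip M f g) + (l2norm M g)\<^sup>2"
proof -
  have "complex_of_real ((l2norm M (\<lambda>x. f x - g x))\<^sup>2) = ip M (\<lambda>x. f x - g x) (\<lambda>x. f x - g x)"
    by (simp add: ip_self)
  also have "\<dots> = ip M f f - ip M f g - (ip M g f - ip M g g)"
    using assms by (simp add: ip_diff_left ip_diff_right L2_diff)
  also have "\<dots> = complex_of_real ((l2norm M f)\<^sup>2 + (l2norm M g)\<^sup>2) - (ip M f g + cnj (ip M f g))"
    by (simp add: ip_self ip_commute[of M f g])
  finally show ?thesis by (simp add: complex_eq_iff)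
qed

text \<open>The projection theorem for a subspace that is closed only up to almost everywhere
  equality: elements are functions, so the limit of a minimising sequence is replaced by an
  equivalent member \<open>r'\<close> of \<open>R\<close>.\<close>

lemma closed_subspace_trivial_complement:
  assumes R: "R \<subseteq> L2 M" "\<And>f g c. f \<in> R \<Longrightarrow> g \<in> R \<Longrightarrow> (\<lambda>x. f x + c * g x) \<in> R" "(\<lambda>x. 0) \<in> R"
    and closed: "\<And>r g. (\<And>n. r n \<in> R) \<Longrightarrow> g \<in> L2 M \<Longrightarrow> (\<lambda>n. l2norm M (\<lambda>x. r n x - g x)) \<longlonglongrightarrow> 0 \<Longrightarrow>
        \<exists>r\<in>R. AE x in M. r x = g x"
    and triv: "\<And>g. g \<in> L2 M \<Longrightarrow> (\<And>r. r \<in> R \<Longrightarrow> ip M r g = 0) \<Longrightarrow> AE x in M. g x = 0"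
    and f: "f \<in> L2 M"
  shows "\<exists>r\<in>R. AE x in M. r x = f x"
proof -
  have RL: "r \<in> L2 M" if "r \<in> R" for r using R(1) that by blast
  define d where "d = (INF r\<in>R. (l2norm M (\<lambda>x. f x - r x))\<^sup>2)"
  have bdd: "bdd_below ((\<lambda>r. (l2norm M (\<lambda>x. f x - r x))\<^sup>2) ` R)" by (rule bdd_belowI[of _ 0]) auto
  have dle: "d \<le> (l2norm M (\<lambda>x. f x - r x))\<^sup>2" if "r \<in> R" for r
    unfolding d_def by (rule cINF_lower[OF bdd that])
  have "\<exists>r\<in>R. (l2norm M (\<lambda>x. f x - r x))\<^sup>2 < d + 1 / Suc n" for n :: nat
  proof (rule ccontr)
    assume *: "\<not> ?thesis"
    have "d + 1 / Suc n \<le> d" unfolding d_def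
      by (rule cINF_greatest) (use * R(3) in \<open>auto simp: not_less d_def\<close>)
    then show False by simp
  qed
  then obtain r where r: "\<And>n::nat. r n \<in> R" "\<And>n. (l2norm M (\<lambda>x. f x - r n x))\<^sup>2 < d + 1 / Suc n"
    by metis
  \<comment> \<open>Parallelogram law: the midpoint of r m and r n lies in \<open>R\<close>, so its
    squared distance from f is at least d.\<close>
  have par: "(l2norm M (\<lambda>x. r m x - r n x))\<^sup>2 \<le> 2 / Suc m + 2 / Suc n" for m n
  proof -
    have "(\<lambda>x. r m x + 1 * r n x) \<in> R" using r R(2) by blast
    from R(2)[OF R(3) this, of "1/2"] have h: "(\<lambda>x. (1/2) * (r m x + r n x)) \<in> R" by simp
    have fr: "(\<lambda>x. f x - r k x) \<in> L2 M" for k using f RL r by (intro L2_diff) auto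
    have "(l2norm M (\<lambda>x. r m x - r n x))\<^sup>2 + 4 * (l2norm M (\<lambda>x. f x - (1/2) * (r m x + r n x)))\<^sup>2 =
        2 * (l2norm M (\<lambda>x. f x - r m x))\<^sup>2 + 2 * (l2norm M (\<lambda>x. f x - r n x))\<^sup>2"
    proof -
      have 1: "(\<integral>x. (norm (r m x - r n x))\<^sup>2 + 4 * (norm (f x - (1/2) * (r m x + r n x)))\<^sup>2 \<partial>M) =
          (\<integral>x. 2 * (norm (f x - r m x))\<^sup>2 + 2 * (norm (f x - r n x))\<^sup>2 \<partial>M)"
      proof (rule Bochner_Integration.integral_cong[OF refl])
        fix x
        have "(norm (a - b))\<^sup>2 + 4 * (norm (c - (1/2) * (a + b)))\<^sup>2 = 2 * (norm (c - a))\<^sup>2 + 2 * (norm (c - b))\<^sup>2"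
          for a b c :: complex
          unfolding cmod_power2 by (simp add: power2_eq_square field_simps)
        then show "(norm (r m x - r n x))\<^sup>2 + 4 * (norm (f x - (1/2) * (r m x + r n x)))\<^sup>2 =
          2 * (norm (f x - r m x))\<^sup>2 + 2 * (norm (f x - r n x))\<^sup>2" .
      qed
      have i: "integrable M (\<lambda>x. (norm (r m x - r n x))\<^sup>2)" "integrable M (\<lambda>x. (norm (f x - (1/2) * (r m x + r n x)))\<^sup>2)"
        "integrable M (\<lambda>x. (norm (f x - r m x))\<^sup>2)" "integrable M (\<lambda>x. (norm (f x - r n x))\<^sup>2)"
        using L2D(2)[OF L2_diff[OF RL[OF r(1)] RL[OF r(1)]]] L2D(2)[OF L2_diff[OF f RL[OF h]]] L2D(2)[OF fr] by auto
      show ?thesis unfolding l2norm_sq using 1 i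
        by (simp only: Bochner_Integration.integral_add Bochner_Integration.integrable_mult_right Bochner_Integration.integral_mult_right)
    qed
    with dle[OF h] r(2)[of m] r(2)[of n] show ?thesis by simp
  qed
  obtain g where g: "g \<in> L2 M" "(\<lambda>n. l2norm M (\<lambda>x. r n x - g x)) \<longlonglongrightarrow> 0"
  proof (rule L2_complete[of r])
    show "r n \<in> L2 M" for n using RL r by blast
    fix e :: real assume "e > 0"
    then obtain N :: nat where N: "1 / Suc N < e\<^sup>2 / 4" using nat_approx_posE[of "e\<^sup>2 / 4"] by auto
    show "\<exists>N. \<forall>m\<ge>N. \<forall>n\<ge>N. l2norm M (\<lambda>x. r m x - r n x) < e"
    proof (intro exI[of _ N] allI impI)
      fix m n assume "N \<le> m" "N \<le> n"
      then have "1 / Suc m \<le> 1 / Suc N" "1 / Suc n \<le> 1 / Suc N" by (auto simp: frac_le)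
      with par[of m n] N have "(l2norm M (\<lambda>x. r m x - r n x))\<^sup>2 < e\<^sup>2" by simp
      then show "l2norm M (\<lambda>x. r m x - r n x) < e" by (rule power2_less_imp_less) (use \<open>e > 0\<close> in simp)
    qed
  qed auto
  obtain r' where r': "r' \<in> R" "AE x in M. r' x = g x" using closed[OF r(1) g] by blast
  have lim: "(\<lambda>n. l2norm M (\<lambda>x. f x - r n x)) \<longlonglongrightarrow> l2norm M (\<lambda>x. f x - g x)"
  proof (rule LIM_zero_cancel, rule Lim_null_comparison[OF _ g(2)], intro always_eventually allI)
    fix n
    have "l2norm M (\<lambda>x. f x - r n x) \<le> l2norm M (\<lambda>x. f x - g x) + l2norm M (\<lambda>x. g x - r n x)"
      "l2norm M (\<lambda>x. f x - g x) \<le> l2norm M (\<lambda>x. f x - r n x) + l2norm M (\<lambda>x. r n x - g x)"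
      using f g(1) RL[OF r(1)] by (auto intro!: l2norm_triangle_diff)
    then show "norm (l2norm M (\<lambda>x. f x - r n x) - l2norm M (\<lambda>x. f x - g x)) \<le> l2norm M (\<lambda>x. r n x - g x)"
      unfolding l2norm_minus_commute[of M g "r n"] real_norm_def by linarith
  qed
  have "(l2norm M (\<lambda>x. f x - g x))\<^sup>2 \<le> d"
  proof (rule LIMSEQ_le[OF tendsto_power[OF lim, of 2]])
    show "(\<lambda>n. d + 1 / real (Suc n)) \<longlonglongrightarrow> d"
      using tendsto_add[OF tendsto_const LIMSEQ_inverse_real_of_nat, of d] by (simp add: inverse_eq_divide)
    show "\<exists>N. \<forall>n\<ge>N. (l2norm M (\<lambda>x. f x - r n x))\<^sup>2 \<le> d + 1 / real (Suc n)" using r(2) by (auto intro: less_imp_le)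
  qed
  moreover have "l2norm M (\<lambda>x. f x - g x) = l2norm M (\<lambda>x. f x - r' x)"
    by (rule l2norm_cong_AE) (use r'(2) f g(1) RL[OF r'(1)] in \<open>auto elim: eventually_mono intro!: L2D(1)[OF L2_diff]\<close>)
  ultimately have min: "(l2norm M (\<lambda>x. f x - r' x))\<^sup>2 \<le> d" by simp
  let ?h = "\<lambda>x. f x - r' x"
  have h: "?h \<in> L2 M" using f RL[OF r'(1)] by (rule L2_diff)
  have "ip M s ?h = 0" if s: "s \<in> R" for s
  proof -
    define \<alpha> where "\<alpha> = ip M ?h s"
    have "2 * t * (norm \<alpha>)\<^sup>2 \<le> t\<^sup>2 * (norm \<alpha>)\<^sup>2 * (l2norm M s)\<^sup>2" for t :: real
    proof -
      have cs: "(\<lambda>x. (of_real t * \<alpha>) * s x) \<in> L2 M" using RL[OF s] by (rule L2_scale)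
      have "d \<le> (l2norm M (\<lambda>x. f x - (r' x + (of_real t * \<alpha>) * s x)))\<^sup>2"
        using R(2)[OF r'(1) s] by (intro dle) auto
      also have "\<dots> = (l2norm M (\<lambda>x. ?h x - (of_real t * \<alpha>) * s x))\<^sup>2" by (simp add: algebra_simps)
      also have "\<dots> = (l2norm M ?h)\<^sup>2 - 2 * Re (ip M ?h (\<lambda>x. (of_real t * \<alpha>) * s x)) + (l2norm M (\<lambda>x. (of_real t * \<alpha>) * s x))\<^sup>2"
        by (rule l2norm_diff_sq[OF h cs])
      also have "Re (ip M ?h (\<lambda>x. (of_real t * \<alpha>) * s x)) = t * (norm \<alpha>)\<^sup>2"
        unfolding ip_scale_right \<alpha>_def[symmetric] cmod_power2
        by (simp add: algebra_simps) (simp add: power2_eq_square)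
      also have "(l2norm M (\<lambda>x. (of_real t * \<alpha>) * s x))\<^sup>2 = t\<^sup>2 * (norm \<alpha>)\<^sup>2 * (l2norm M s)\<^sup>2"
        unfolding l2norm_scale by (simp add: norm_mult power_mult_distrib)
      finally show ?thesis using min by linarith
    qed
    note * = this
    have "\<alpha> = 0"
    proof (rule ccontr)
      assume "\<alpha> \<noteq> 0"
      then have pos: "(norm \<alpha>)\<^sup>2 > 0" by simp
      have "2 * t \<le> t\<^sup>2 * (l2norm M s)\<^sup>2" for t
      proof -
        have "(2 * t) * (norm \<alpha>)\<^sup>2 \<le> (t\<^sup>2 * (l2norm M s)\<^sup>2) * (norm \<alpha>)\<^sup>2" using *[of t] by (simp add: algebra_simps)
        then show ?thesis using pos by (rule mult_right_le_imp_le)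
      qed
      \<comment> \<open>The value of t that refutes the inequality. The summand 1 covers K = 0, and
        u K \<le> 1 gives u (u K) \<le> u, less than 2 u.\<close>
      define K u where "K = (l2norm M s)\<^sup>2" and "u = 1 / (K + 1)"
      have "K \<ge> 0" "u > 0" by (auto simp: K_def u_def add_nonneg_pos)
      then have "u * K \<le> 1" by (simp add: u_def)
      then have "u * (u * K) \<le> u * 1" using \<open>u > 0\<close> by (intro mult_left_mono) auto
      moreover have "2 * u \<le> u * (u * K)"
        using \<open>\<And>t. 2 * t \<le> t\<^sup>2 * (l2norm M s)\<^sup>2\<close>[of u] by (simp add: K_def power2_eq_square mult.assoc)
      ultimately show False using \<open>u > 0\<close> by linarith
    qed
    then show ?thesis by (simp add: \<alpha>_def ip_commute[of M _ s])
  qed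
  then have "AE x in M. ?h x = 0" by (rule triv[OF h])
  then have "AE x in M. r' x = f x" by eventually_elim simp
  with r'(1) show ?thesis by blast
qed

text \<open>Symmetry makes the inner product of v and y real, so pairing v - z y with y has
  imaginary part -Im z times the squared norm of y. Cauchy-Schwarz finishes.\<close>

lemma symmetric_graph_lower_bound:
  assumes "(y, v) \<in> T" "T \<subseteq> L2 M \<times> L2 M" "T \<subseteq> adjoint_graph M T"
  shows "\<bar>Im z\<bar> * l2norm M y \<le> l2norm M (\<lambda>x. v x - z * y x)"
proof -
  have y: "y \<in> L2 M" and v: "v \<in> L2 M" using assms by auto
  have "ip M v y = ip M y v" using assms unfolding adjoint_graph_def by fastforce
  then have "Im (ip M v y) = 0" using ip_commute[of M y v] by (simp add: complex_eq_iff)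
  moreover have "ip M (\<lambda>x. v x - z * y x) y = ip M v y - z * of_real ((l2norm M y)\<^sup>2)"
    using y v by (simp add: ip_diff_left L2_scale ip_scale_left ip_self)
  ultimately have "Im (ip M (\<lambda>x. v x - z * y x) y) = - (Im z * (l2norm M y)\<^sup>2)" by simp
  then have "\<bar>Im z\<bar> * (l2norm M y)\<^sup>2 \<le> norm (ip M (\<lambda>x. v x - z * y x) y)"
    using abs_Im_le_cmod[of "ip M (\<lambda>x. v x - z * y x) y"] by (simp add: abs_mult)
  also have "\<dots> \<le> l2norm M (\<lambda>x. v x - z * y x) * l2norm M y"
    using y v by (intro ip_le L2_diff L2_scale)
  finally have *: "(\<bar>Im z\<bar> * l2norm M y) * l2norm M y \<le> l2norm M (\<lambda>x. v x - z * y x) * l2norm M y"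
    by (simp add: power2_eq_square mult.assoc)
  show ?thesis
  proof (cases "l2norm M y = 0")
    case False
    then have "l2norm M y > 0" using l2norm_nonneg[of M y] by simp
    with * show ?thesis by (rule mult_right_le_imp_le)
  qed (simp add: l2norm_nonneg)
qed

text \<open>The range of T - z is closed by the lower bound and the closedness of the adjoint, and
  has trivial orthogonal complement because such an element lies in the kernel of T - cnj z.
  Linearity of the graph is asked for up to null sets in the second component, since
  \<open>ell\<close> of a linear combination is linear only almost everywhere.\<close>

theorem self_adjoint_resolvent_exists:
  assumes sa: "self_adjoint M T" and z: "z \<notin> \<real>"
    and lin: "\<And>y v y' v' c. (y, v) \<in> T \<Longrightarrow> (y', v') \<in> T \<Longrightarrow>
        \<exists>v''. (\<lambda>x. y x + c * y' x, v'') \<in> T \<and> (AE x in M. v'' x = v x + c * v' x)"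
    and ne: "T \<noteq> {}" and f: "f \<in> L2 M"
  shows "\<exists>y v. (y, v) \<in> T \<and> (AE x in M. v x - z * y x = f x)"
proof -
  have T: "T \<subseteq> L2 M \<times> L2 M" "T \<subseteq> adjoint_graph M T"
    "\<And>f g. (f, g) \<in> adjoint_graph M T \<Longrightarrow> \<exists>(u, v)\<in>T. (AE x in M. u x = f x) \<and> (AE x in M. v x = g x)"
    using sa unfolding self_adjoint_def by auto
  have TL: "y \<in> L2 M" "v \<in> L2 M" if "(y, v) \<in> T" for y v using T(1) that by auto
  have Im: "\<bar>Im z\<bar> > 0" using z by (auto simp: complex_is_Real_iff)
  define R where "R = {h \<in> L2 M. \<exists>y v. (y, v) \<in> T \<and> (AE x in M. v x - z * y x = h x)}"
  have RI: "h \<in> R" if "(y, v) \<in> T" "AE x in M. v x - z * y x = h x" "h \<in> L2 M" for h y v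
    using that unfolding R_def by blast
  have "\<exists>r\<in>R. AE x in M. r x = f x"
  proof (rule closed_subspace_trivial_complement[OF _ _ _ _ _ f])
    show "R \<subseteq> L2 M" by (auto simp: R_def)
    fix g h c assume "g \<in> R" "h \<in> R"
    then obtain y v y' v' where *: "g \<in> L2 M" "(y, v) \<in> T" "AE x in M. v x - z * y x = g x"
      "h \<in> L2 M" "(y', v') \<in> T" "AE x in M. v' x - z * y' x = h x" unfolding R_def by blast
    obtain v'' where v'': "(\<lambda>x. y x + c * y' x, v'') \<in> T" "AE x in M. v'' x = v x + c * v' x"
      using lin[OF *(2,5)] by blast
    have "AE x in M. v'' x - z * (y x + c * y' x) = g x + c * h x"
      using v''(2) *(3,6) by eventually_elim (auto simp: algebra_simps)
    then show "(\<lambda>x. g x + c * h x) \<in> R" by (rule RI[OF v''(1)]) (intro L2_add L2_scale *)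
  next
    obtain y v where yv: "(y, v) \<in> T" using ne by auto
    obtain v' where v': "(\<lambda>x. y x + (-1) * y x, v') \<in> T" "AE x in M. v' x = v x + (-1) * v x"
      using lin[OF yv yv, of "-1"] by blast
    have "AE x in M. v' x - z * (y x + (-1) * y x) = 0" using v'(2) by eventually_elim simp
    then show "(\<lambda>x. 0) \<in> R" by (rule RI[OF v'(1)]) (rule L2_zero)
  next
    fix r g assume r: "\<And>n::nat. r n \<in> R" and g: "g \<in> L2 M" "(\<lambda>n. l2norm M (\<lambda>x. r n x - g x)) \<longlonglongrightarrow> 0"
    have rL: "r n \<in> L2 M" for n using r unfolding R_def by blast
    have "\<exists>y v. (y, v) \<in> T \<and> (AE x in M. v x - z * y x = r n x)" for n using r unfolding R_def by blast
    then obtain y v where yv: "\<And>n. (y n, v n) \<in> T" "\<And>n. AE x in M. v n x - z * y n x = r n x" by metis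
    note yL = TL(1)[OF yv(1)] and vL = TL(2)[OF yv(1)]
    \<comment> \<open>Applied to differences of graph elements, the lower bound makes
      \<open>y n\<close> a Cauchy sequence as soon as \<open>r n\<close> is one.\<close>
    have bound: "\<bar>Im z\<bar> * l2norm M (\<lambda>x. y m x - y n x) \<le> l2norm M (\<lambda>x. r m x - r n x)" for m n
    proof -
      obtain v' where v': "(\<lambda>x. y m x + (-1) * y n x, v') \<in> T" "AE x in M. v' x = v m x + (-1) * v n x"
        using lin[OF yv(1)[of m] yv(1)[of n], of "-1"] by blast
      have "\<bar>Im z\<bar> * l2norm M (\<lambda>x. y m x + (-1) * y n x) \<le> l2norm M (\<lambda>x. v' x - z * (y m x + (-1) * y n x))"
        using symmetric_graph_lower_bound[OF v'(1) T(1,2)] .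
      also have "\<dots> = l2norm M (\<lambda>x. r m x - r n x)"
      proof (rule l2norm_cong_AE)
        show "AE x in M. v' x - z * (y m x + (-1) * y n x) = r m x - r n x"
          using v'(2) yv(2)[of m] yv(2)[of n] by eventually_elim (simp add: algebra_simps)
        show "(\<lambda>x. v' x - z * (y m x + (-1) * y n x)) \<in> borel_measurable M"
          by (intro L2D(1) L2_diff L2_scale TL(2)[OF v'(1)] TL(1)[OF v'(1)])
        show "(\<lambda>x. r m x - r n x) \<in> borel_measurable M" by (intro L2D(1) L2_diff rL)
      qed
      finally show ?thesis by simp
    qed
    obtain u where u: "u \<in> L2 M" "(\<lambda>n. l2norm M (\<lambda>x. y n x - u x)) \<longlonglongrightarrow> 0"
    proof (rule L2_complete[of y, OF yL])
      fix e :: real assume "e > 0"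
      then have e': "\<bar>Im z\<bar> * e / 2 > 0" using Im by simp
      from order_tendstoD(2)[OF g(2) this] obtain N where N: "\<forall>n\<ge>N. l2norm M (\<lambda>x. r n x - g x) < \<bar>Im z\<bar> * e / 2"
        by (auto simp: eventually_sequentially)
      show "\<exists>N. \<forall>m\<ge>N. \<forall>n\<ge>N. l2norm M (\<lambda>x. y m x - y n x) < e"
      proof (intro exI[of _ N] allI impI)
        fix m n assume mn: "N \<le> m" "N \<le> n"
        have "\<bar>Im z\<bar> * l2norm M (\<lambda>x. y m x - y n x) \<le> l2norm M (\<lambda>x. r m x - r n x)" by (rule bound)
        also have "\<dots> \<le> l2norm M (\<lambda>x. r m x - g x) + l2norm M (\<lambda>x. g x - r n x)"
          by (rule l2norm_triangle_diff[OF rL g(1) rL])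
        also have "\<dots> < \<bar>Im z\<bar> * e"
          using N[rule_format, OF mn(1)] N[rule_format, OF mn(2)] unfolding l2norm_minus_commute[of M g] by linarith
        finally show "l2norm M (\<lambda>x. y m x - y n x) < e" using Im by simp
      qed
    qed auto
    let ?w = "\<lambda>x. g x + z * u x"
    have w: "?w \<in> L2 M" using g(1) u(1) by (intro L2_add L2_scale)
    have vlim: "(\<lambda>n. l2norm M (\<lambda>x. v n x - ?w x)) \<longlonglongrightarrow> 0"
    proof (rule Lim_null_comparison, intro always_eventually allI)
      fix n
      have "l2norm M (\<lambda>x. v n x - ?w x) = l2norm M (\<lambda>x. (r n x - g x) + z * (y n x - u x))"
      proof (rule l2norm_cong_AE)
        show "AE x in M. v n x - ?w x = (r n x - g x) + z * (y n x - u x)"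
          using yv(2)[of n] by eventually_elim (auto simp: algebra_simps)
        show "(\<lambda>x. v n x - ?w x) \<in> borel_measurable M" by (intro L2D(1) L2_diff vL w)
        show "(\<lambda>x. (r n x - g x) + z * (y n x - u x)) \<in> borel_measurable M"
          by (intro L2D(1) L2_diff L2_add L2_scale rL g yL u)
      qed
      also have "\<dots> \<le> l2norm M (\<lambda>x. r n x - g x) + l2norm M (\<lambda>x. z * (y n x - u x))"
        by (intro l2norm_triangle L2_diff L2_scale rL g yL u)
      also have "l2norm M (\<lambda>x. z * (y n x - u x)) = norm z * l2norm M (\<lambda>x. y n x - u x)" by (rule l2norm_scale)
      finally show "norm (l2norm M (\<lambda>x. v n x - ?w x)) \<le> l2norm M (\<lambda>x. r n x - g x) + norm z * l2norm M (\<lambda>x. y n x - u x)"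
        by (simp add: l2norm_nonneg)
      show "(\<lambda>n. l2norm M (\<lambda>x. r n x - g x) + norm z * l2norm M (\<lambda>x. y n x - u x)) \<longlonglongrightarrow> 0"
        using tendsto_add[OF g(2) tendsto_mult_right_zero[OF u(2), of "norm z"]] by simp
    qed
    \<comment> \<open>The adjoint graph is closed under L2 limits of pairs; self-adjointness then
      returns a representative of the limit that belongs to \<open>T\<close>.\<close>
    have "(u, ?w) \<in> adjoint_graph M T"
      unfolding adjoint_graph_def
    proof (intro CollectI case_prodI conjI ballI u(1) w)
      fix p assume "p \<in> T"
      obtain a b where p: "p = (a, b)" by (cases p)
      have ab: "a \<in> L2 M" "b \<in> L2 M" using TL \<open>p \<in> T\<close> p by auto
      have "ip M b (y n) = ip M a (v n)" for n
        using T(2) yv(1)[of n] \<open>p \<in> T\<close> p unfolding adjoint_graph_def by fastforce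
      then have "(\<lambda>n. ip M a (v n)) \<longlonglongrightarrow> ip M b u"
        using ip_tendsto_right[OF yL u(1) ab(2) u(2)] by simp
      then have "ip M b u = ip M a ?w"
        using ip_tendsto_right[OF vL w ab(1) vlim] by (rule LIMSEQ_unique)
      then show "case p of (a, b) \<Rightarrow> ip M b u = ip M a ?w" using p by simp
    qed
    then obtain a b where ab: "(a, b) \<in> T" "AE x in M. a x = u x" "AE x in M. b x = ?w x" using T(3) by blast
    have "AE x in M. b x - z * a x = g x" using ab(2,3) by eventually_elim simp
    then have "g \<in> R" by (rule RI[OF ab(1)]) (rule g(1))
    then show "\<exists>r\<in>R. AE x in M. r x = g x" by (intro bexI[of _ g]) auto
  next
    fix g assume g: "g \<in> L2 M" and orth: "\<And>r. r \<in> R \<Longrightarrow> ip M r g = 0"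
    \<comment> \<open>Orthogonality to the range says that g is an eigenvector of the adjoint for
      cnj z, which the lower bound at cnj z excludes unless g = 0 almost everywhere.\<close>
    have "(g, \<lambda>x. cnj z * g x) \<in> adjoint_graph M T"
      unfolding adjoint_graph_def
    proof (intro CollectI case_prodI conjI ballI g L2_scale)
      fix p assume "p \<in> T"
      obtain a b where p: "p = (a, b)" by (cases p)
      have ab: "(a, b) \<in> T" "a \<in> L2 M" "b \<in> L2 M" using TL \<open>p \<in> T\<close> p by auto
      have "(\<lambda>x. b x - z * a x) \<in> R" by (rule RI[OF ab(1)]) (use ab in \<open>auto intro!: L2_diff L2_scale\<close>)
      then have "ip M b g - z * ip M a g = 0"
        using orth[of "\<lambda>x. b x - z * a x"] ab g by (simp add: ip_diff_left L2_scale ip_scale_left)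
      then show "case p of (a, b) \<Rightarrow> ip M b g = ip M a (\<lambda>x. cnj z * g x)"
        using p by (simp add: ip_scale_right)
    qed
    then obtain a b where ab: "(a, b) \<in> T" "AE x in M. a x = g x" "AE x in M. b x = cnj z * g x" using T(3) by blast
    have "l2norm M (\<lambda>x. b x - cnj z * a x) = l2norm M (\<lambda>x. 0)"
    proof (rule l2norm_cong_AE)
      show "AE x in M. b x - cnj z * a x = 0" using ab(2,3) by eventually_elim simp
      show "(\<lambda>x. b x - cnj z * a x) \<in> borel_measurable M" by (intro L2D(1) L2_diff L2_scale TL[OF ab(1)])
    qed simp
    then have "\<bar>Im z\<bar> * l2norm M a \<le> 0"
      using symmetric_graph_lower_bound[OF ab(1) T(1,2), of "cnj z"] by (simp add: l2norm_def)
    then have "l2norm M a = 0" using Im l2norm_nonneg[of M a] by (simp add: mult_le_0_iff)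
    then have "AE x in M. a x = 0" using TL(1)[OF ab(1)] by (intro l2norm_eq_0_AE)
    with ab(2) show "AE x in M. g x = 0" by eventually_elim simp
  qed
  then obtain r where r: "r \<in> R" "AE x in M. r x = f x" by blast
  then obtain y v where yv: "(y, v) \<in> T" "AE x in M. v x - z * y x = r x" unfolding R_def by blast
  have "AE x in M. v x - z * y x = f x" using yv(2) r(2) by eventually_elim simp
  with yv(1) show ?thesis by blast
qed

section \<open>Calculus of primitives\<close>

lemma is_primitive_subset: "is_primitive I F f \<Longrightarrow> J \<subseteq> I \<Longrightarrow> is_primitive J F f"
  unfolding is_primitive_def by blast

lemma loc_abs_cont_continuous_on:
  assumes "open I" "loc_abs_cont I F"
  shows "continuous_on I F"
proof (rule continuous_at_imp_continuous_on, rule ballI)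
  fix x assume "x \<in> I"
  then obtain e where e: "e > 0" "cball x e \<subseteq> I" using assms(1) open_contains_cball by blast
  then have "continuous_on {x - e..x + e} F"
    using assms(2) unfolding loc_abs_cont_def by (metis abs_cont_on_imp_continuous_on cball_eq_atLeastAtMost)
  then show "isCont F x"
    using e(1) by (intro continuous_on_interior[of "{x - e..x + e}"]) auto
qed

lemma is_primitive_continuous_on: "open I \<Longrightarrow> is_primitive I F f \<Longrightarrow> continuous_on I F"
  using loc_abs_cont_continuous_on is_primitive_imp_loc_abs_cont by blast

lemma is_primitive_add:
  assumes "is_primitive I F f" "is_primitive I G g"
  shows "is_primitive I (\<lambda>x. F x + G x) (\<lambda>x. f x + g x)"
  using assms unfolding is_primitive_def by (simp add: set_integral_add)

lemma is_primitive_scale: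
  assumes "is_primitive I F f"
  shows "is_primitive I (\<lambda>x. k * F x) (\<lambda>x. k * f x)"
  using assms unfolding is_primitive_def by (simp add: right_diff_distrib)

lemma is_primitive_diff:
  assumes "is_primitive I F f" "is_primitive I G g"
  shows "is_primitive I (\<lambda>x. F x - G x) (\<lambda>x. f x - g x)"
  using assms unfolding is_primitive_def by (simp add: set_integral_diff)

lemma is_primitive_cnj:
  assumes "is_primitive I F f"
  shows "is_primitive I (\<lambda>x. cnj (F x)) (\<lambda>x. cnj (f x))"
proof -
  have *: "(\<lambda>x. indicator A x *\<^sub>R cnj (f x)) = (\<lambda>x. cnj (indicator A x *\<^sub>R f x))" for A by auto
  show ?thesis using assms
    unfolding is_primitive_def set_integrable_def set_lebesgue_integral_def *
    by (auto simp del: complex_cnj_scaleR)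
qed

lemma is_primitive_cong:
  assumes F: "is_primitive I F f" and G: "\<And>x. x \<in> I \<Longrightarrow> F x = G x"
    and ae: "AE x in lebesgue. x \<in> I \<longrightarrow> f x = g x"
  shows "is_primitive I G g"
  unfolding is_primitive_def
proof (intro allI impI)
  fix c d :: real assume cd: "c \<le> d" "{c..d} \<subseteq> I"
  have "AE x in lebesgue. x \<in> {c..d} \<longrightarrow> f x = g x" using ae by eventually_elim (use cd in auto)
  note * = set_integrable_cong_AE_lebesgue[OF is_primitiveD(1)[OF F cd(2)] this] is_primitiveD(2)[OF F cd(2,1)]
  show "set_integrable lebesgue {c..d} g \<and> (LINT x:{c..d}|lebesgue. g x) = G d - G c"
  proof -
    have "F c = G c" "F d = G d" using G cd by auto
    with * show ?thesis by auto
  qed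
qed

lemma is_primitive_zero_imp_constant:
  assumes F: "is_primitive I F f" and "AE x in lebesgue. x \<in> I \<longrightarrow> f x = 0" and I: "is_interval I" and xy: "x \<in> I" "y \<in> I"
  shows "F x = F y"
proof -
  have F0: "is_primitive I F (\<lambda>x. 0)" by (rule is_primitive_cong[OF F]) (use assms in auto)
  have *: "F x = F y" if "x \<in> I" "y \<in> I" "x \<le> y" for x y
  proof -
    have "{x..y} \<subseteq> I" using mem_is_interval_1_I[OF I that(1,2)] by auto
    from is_primitiveD(2)[OF F0 this that(3)] show ?thesis by (simp add: set_lebesgue_integral_def)
  qed
  show ?thesis
  proof (cases "x \<le> y")
    case True then show ?thesis by (rule *[OF xy])
  next
    case False then have "y \<le> x" by simp
    then show ?thesis by (rule *[OF xy(2,1), symmetric])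
  qed
qed

lemma is_primitive_imp_vector_derivative:
  assumes "is_primitive I F f" "open I"
  shows "AE x in lebesgue. x \<in> I \<longrightarrow> vector_derivative F (at x) = f x"
  using is_primitive_has_derivative[OF assms] by eventually_elim (auto simp: vector_derivative_at)

text \<open>For a continuous density the derivative exists at every point and not only almost
  everywhere. The first quasi-derivative \<open>qd1\<close> is a pointwise derivative, so it has to
  be controlled at every point.\<close>

lemma is_primitive_continuous_has_derivative:
  assumes F: "is_primitive I F f" and I: "open I" and f: "continuous_on I f" and x: "x \<in> I"
  shows "(F has_vector_derivative f x) (at x)"
proof -
  obtain e where e: "e > 0" "cball x e \<subseteq> I" using I x open_contains_cball by blast
  then have sub: "{x - e..x + e} \<subseteq> I" by (simp add: cball_eq_atLeastAtMost)
  have "((\<lambda>u. integral {x - e..u} f) has_vector_derivative f x) (at x within {x - e..x + e})"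
    by (rule integral_has_vector_derivative) (use e sub f continuous_on_subset in auto)
  then have "((\<lambda>u. F (x - e) + integral {x - e..u} f) has_vector_derivative f x) (at x within {x - e..x + e})"
    by (auto intro!: derivative_eq_intros)
  then have "(F has_vector_derivative f x) (at x within {x - e..x + e})"
  proof (rule has_vector_derivative_transform[rotated 2])
    fix u assume u: "u \<in> {x - e..x + e}"
    then have s: "{x - e..u} \<subseteq> I" using sub by auto
    show "F u = F (x - e) + integral {x - e..u} f"
      using is_primitiveD[OF F s] u set_lebesgue_integral_eq_integral(2)[OF is_primitiveD(1)[OF F s]] by auto
  qed (use e in auto)
  then show ?thesis
    using e(1) at_within_interior[of x "{x - e..x + e}"] by simp
qed

text \<open>The common reason why products and exponentials stay absolutely continuous: the
  increments of \<open>H\<close> are controlled by those of \<open>F\<close> and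
  \<open>G\<close>.\<close>

lemma loc_abs_cont_Lipschitz_image:
  assumes F: "loc_abs_cont I F" and G: "loc_abs_cont I G"
    and lip: "\<And>c d. {c..d} \<subseteq> I \<Longrightarrow> \<exists>B>0. \<forall>x\<in>{c..d}. \<forall>y\<in>{c..d}. norm (H y - H x) \<le> B * norm (F y - F x) + B * norm (G y - G x)"
  shows "loc_abs_cont I H"
  unfolding loc_abs_cont_def
proof (intro allI impI)
  fix c d assume cd: "{c..d} \<subseteq> I"
  obtain B where B: "B > 0" "\<And>x y. x \<in> {c..d} \<Longrightarrow> y \<in> {c..d} \<Longrightarrow> norm (H y - H x) \<le> B * norm (F y - F x) + B * norm (G y - G x)"
    using lip[OF cd] by blast
  have acF: "abs_cont_on {c..d} F" and acG: "abs_cont_on {c..d} G" using F G cd by (auto simp: loc_abs_cont_def)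
  show "abs_cont_on {c..d} H"
    unfolding abs_cont_on_def
  proof (intro allI impI)
    fix \<epsilon> :: real assume "\<epsilon> > 0"
    then have e: "\<epsilon> / (2 * B) > 0" using B by simp
    obtain d1 where d1: "d1 > 0" "\<forall>(n::nat) u v. (\<forall>i<n. u i \<le> v i \<and> {u i..v i} \<subseteq> {c..d}) \<and>
        disjoint_family_on (\<lambda>i. {u i<..<v i}) {..<n} \<and> (\<Sum>i<n. v i - u i) < d1
        \<longrightarrow> (\<Sum>i<n. norm (F (v i) - F (u i))) < \<epsilon> / (2 * B)"
      using acF e unfolding abs_cont_on_def by iprover
    obtain d2 where d2: "d2 > 0" "\<forall>(n::nat) u v. (\<forall>i<n. u i \<le> v i \<and> {u i..v i} \<subseteq> {c..d}) \<and>
        disjoint_family_on (\<lambda>i. {u i<..<v i}) {..<n} \<and> (\<Sum>i<n. v i - u i) < d2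
        \<longrightarrow> (\<Sum>i<n. norm (G (v i) - G (u i))) < \<epsilon> / (2 * B)"
      using acG e unfolding abs_cont_on_def by iprover
    show "\<exists>\<delta>>0. \<forall>(n::nat) u v. (\<forall>i<n. u i \<le> v i \<and> {u i..v i} \<subseteq> {c..d}) \<and>
        disjoint_family_on (\<lambda>i. {u i<..<v i}) {..<n} \<and> (\<Sum>i<n. v i - u i) < \<delta>
        \<longrightarrow> (\<Sum>i<n. norm (H (v i) - H (u i))) < \<epsilon>"
    proof (intro exI[of _ "min d1 d2"] conjI allI impI)
      fix n :: nat and u v
      assume *: "(\<forall>i<n. u i \<le> v i \<and> {u i..v i} \<subseteq> {c..d}) \<and>
        disjoint_family_on (\<lambda>i. {u i<..<v i}) {..<n} \<and> (\<Sum>i<n. v i - u i) < min d1 d2"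
      have "(\<Sum>i<n. norm (H (v i) - H (u i))) \<le> (\<Sum>i<n. B * norm (F (v i) - F (u i)) + B * norm (G (v i) - G (u i)))"
        by (rule sum_mono, rule B(2)) (use * in auto)
      also have "\<dots> = B * (\<Sum>i<n. norm (F (v i) - F (u i))) + B * (\<Sum>i<n. norm (G (v i) - G (u i)))"
        by (simp add: sum.distrib sum_distrib_left)
      also have "\<dots> < B * (\<epsilon> / (2 * B)) + B * (\<epsilon> / (2 * B))"
        using d1(2)[rule_format, of n u v] d2(2)[rule_format, of n u v] * B(1)
        by (intro add_strict_mono mult_strict_left_mono) auto
      also have "\<dots> = \<epsilon>" using B(1) by simp
      finally show "(\<Sum>i<n. norm (H (v i) - H (u i))) < \<epsilon>" .
    qed (use d1 d2 in auto)
  qed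
qed

lemma loc_abs_cont_bounded:
  assumes "loc_abs_cont I F" "{c..d} \<subseteq> I"
  obtains B where "B > 0" "\<And>x. x \<in> {c..d} \<Longrightarrow> norm (F x) \<le> B"
proof -
  have "continuous_on {c..d} F" using assms unfolding loc_abs_cont_def by (blast intro: abs_cont_on_imp_continuous_on)
  then have "bounded (F ` {c..d})" by (intro compact_imp_bounded compact_continuous_image) auto
  then show ?thesis unfolding bounded_pos using that by auto
qed

text \<open>Boundedness on compact intervals gives local absolute continuity of the product; its
  density is then identified at the almost all points where both factors are differentiable.\<close>

lemma is_primitive_mult:
  assumes F: "is_primitive I F f" and G: "is_primitive I G g" and I: "open I"
  shows "is_primitive I (\<lambda>x. F x * G x) (\<lambda>x. f x * G x + F x * g x)"
proof -
  note lF = is_primitive_imp_loc_abs_cont[OF F] and lG = is_primitive_imp_loc_abs_cont[OF G]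
  have "loc_abs_cont I (\<lambda>x. F x * G x)"
  proof (rule loc_abs_cont_Lipschitz_image[OF lF lG])
    fix c d assume cd: "{c..d} \<subseteq> I"
    obtain B1 where B1: "B1 > 0" "\<And>x. x \<in> {c..d} \<Longrightarrow> norm (F x) \<le> B1" using loc_abs_cont_bounded[OF lF cd] by blast
    obtain B2 where B2: "B2 > 0" "\<And>x. x \<in> {c..d} \<Longrightarrow> norm (G x) \<le> B2" using loc_abs_cont_bounded[OF lG cd] by blast
    show "\<exists>B>0. \<forall>x\<in>{c..d}. \<forall>y\<in>{c..d}. norm (F y * G y - F x * G x) \<le> B * norm (F y - F x) + B * norm (G y - G x)"
    proof (intro exI[of _ "max B1 B2"] conjI ballI)
      fix x y assume xy: "x \<in> {c..d}" "y \<in> {c..d}"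
      have "norm (F y * G y - F x * G x) = norm (G y * (F y - F x) + F x * (G y - G x))" by (simp add: algebra_simps)
      also have "\<dots> \<le> norm (G y) * norm (F y - F x) + norm (F x) * norm (G y - G x)"
        by (metis norm_mult norm_triangle_ineq)
      also have "\<dots> \<le> max B1 B2 * norm (F y - F x) + max B1 B2 * norm (G y - G x)"
        using B1(2)[OF xy(1)] B2(2)[OF xy(2)] by (intro add_mono mult_right_mono) auto
      finally show "norm (F y * G y - F x * G x) \<le> max B1 B2 * norm (F y - F x) + max B1 B2 * norm (G y - G x)" .
    qed (use B1 in auto)
  qed
  then have P: "is_primitive I (\<lambda>x. F x * G x) (\<lambda>x. vector_derivative (\<lambda>x. F x * G x) (at x))"
    by (rule loc_abs_cont_imp_is_primitive[OF I])
  show ?thesis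
  proof (rule is_primitive_cong[OF P])
    show "AE x in lebesgue. x \<in> I \<longrightarrow> vector_derivative (\<lambda>x. F x * G x) (at x) = f x * G x + F x * g x"
      using is_primitive_has_derivative[OF F I] is_primitive_has_derivative[OF G I]
    proof (eventually_elim, intro impI)
      fix x assume "x \<in> I \<longrightarrow> (F has_vector_derivative f x) (at x)" "x \<in> I \<longrightarrow> (G has_vector_derivative g x) (at x)" "x \<in> I"
      then have "((\<lambda>x. F x * G x) has_vector_derivative F x * g x + f x * G x) (at x)"
        by (intro has_vector_derivative_mult) auto
      then show "vector_derivative (\<lambda>x. F x * G x) (at x) = f x * G x + F x * g x"
        by (simp add: vector_derivative_at)
    qed
  qed simp
qed

lemma is_primitive_exp:
  assumes F: "is_primitive I F f" and I: "open I"
  shows "is_primitive I (\<lambda>x. exp (F x)) (\<lambda>x. f x * exp (F x))"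
proof -
  note lF = is_primitive_imp_loc_abs_cont[OF F]
  have "loc_abs_cont I (\<lambda>x. exp (F x))"
  proof (rule loc_abs_cont_Lipschitz_image[OF lF lF])
    fix c d assume cd: "{c..d} \<subseteq> I"
    obtain B1 where B1: "B1 > 0" "\<And>x. x \<in> {c..d} \<Longrightarrow> norm (F x) \<le> B1" using loc_abs_cont_bounded[OF lF cd] by blast
    show "\<exists>B>0. \<forall>x\<in>{c..d}. \<forall>y\<in>{c..d}. norm (exp (F y) - exp (F x)) \<le> B * norm (F y - F x) + B * norm (F y - F x)"
    proof (intro exI[of _ "exp B1"] conjI ballI)
      fix x y assume xy: "x \<in> {c..d}" "y \<in> {c..d}"
      have "norm (exp (F y) - exp (F x)) \<le> exp B1 * norm (F y - F x)"
      proof (rule field_differentiable_bound[of "cball 0 B1"])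
        show "norm (exp z) \<le> exp B1" if "z \<in> cball 0 B1" for z :: complex
          using that complex_Re_le_cmod[of z] by (auto simp: norm_exp_eq_Re)
        show "(exp has_field_derivative exp z) (at z within cball 0 B1)" for z :: complex
          by (rule DERIV_subset[OF DERIV_exp]) auto
      qed (use B1 xy in auto)
      also have "\<dots> \<le> exp B1 * norm (F y - F x) + exp B1 * norm (F y - F x)" by simp
      finally show "norm (exp (F y) - exp (F x)) \<le> exp B1 * norm (F y - F x) + exp B1 * norm (F y - F x)" .
    qed simp
  qed
  then have P: "is_primitive I (\<lambda>x. exp (F x)) (\<lambda>x. vector_derivative (\<lambda>x. exp (F x)) (at x))"
    by (rule loc_abs_cont_imp_is_primitive[OF I])
  show ?thesis
  proof (rule is_primitive_cong[OF P])
    show "AE x in lebesgue. x \<in> I \<longrightarrow> vector_derivative (\<lambda>x. exp (F x)) (at x) = f x * exp (F x)"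
      using is_primitive_has_derivative[OF F I]
    proof (eventually_elim, intro impI)
      fix x assume "x \<in> I \<longrightarrow> (F has_vector_derivative f x) (at x)" "x \<in> I"
      then have "(F has_vector_derivative f x) (at x)" by blast
      then have "((exp \<circ> F) has_vector_derivative f x * exp (F x)) (at x)"
        by (rule field_vector_diff_chain_at) (rule DERIV_exp)
      then show "vector_derivative (\<lambda>x. exp (F x)) (at x) = f x * exp (F x)"
        by (simp add: vector_derivative_at o_def)
    qed
  qed simp
qed

lemma set_integral_combine:
  fixes f :: "real \<Rightarrow> 'a::euclidean_space"
  assumes f: "set_integrable lebesgue {c..d} f" and "c \<le> e" "e \<le> d"
  shows "(LINT x:{c..d}|lebesgue. f x) = (LINT x:{c..e}|lebesgue. f x) + (LINT x:{e..d}|lebesgue. f x)"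
proof -
  have 1: "set_integrable lebesgue {c..e} f" "set_integrable lebesgue {e..d} f"
    using assms by (auto intro: set_integrable_subset[OF f])
  show ?thesis
    using Henstock_Kurzweil_Integration.integral_combine[OF assms(2,3) set_lebesgue_integral_eq_integral(1)[OF f]]
    by (simp add: set_lebesgue_integral_eq_integral(2) f 1)
qed

text \<open>One of the two intervals is empty or a point.\<close>

definition oriented_integral :: "real \<Rightarrow> real \<Rightarrow> (real \<Rightarrow> 'a::euclidean_space) \<Rightarrow> 'a" where
  "oriented_integral c x f = (LINT t:{c..x}|lebesgue. f t) - (LINT t:{x..c}|lebesgue. f t)"

lemma set_integral_point: "(LINT t:{x..y}|lebesgue. f t) = (0 :: 'a::euclidean_space)" if "y \<le> x" for x y :: real
proof -
  have "AE t in lebesgue. t \<notin> {x, y}" by (rule AE_not_in) (simp flip: negligible_iff_null_sets)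
  then have "AE t in lebesgue. indicat_real {x..y} t *\<^sub>R f t = 0"
    by eventually_elim (use that in \<open>auto simp: indicator_def\<close>)
  then show ?thesis unfolding set_lebesgue_integral_def by (rule integral_eq_zero_AE)
qed

lemma oriented_integral_simps:
  "c \<le> x \<Longrightarrow> oriented_integral c x f = (LINT t:{c..x}|lebesgue. f t)"
  "x \<le> c \<Longrightarrow> oriented_integral c x f = - (LINT t:{x..c}|lebesgue. f t)"
  by (simp_all add: oriented_integral_def set_integral_point)

lemma oriented_integral_diff:
  assumes f: "\<And>u v. u \<in> I \<Longrightarrow> v \<in> I \<Longrightarrow> set_integrable lebesgue {u..v} f" and I: "c \<in> I" "x \<in> I" "y \<in> I" and "x \<le> y"
  shows "oriented_integral c y f - oriented_integral c x f = (LINT t:{x..y}|lebesgue. f t)"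
proof -
  consider "c \<le> x" | "x \<le> c" "c \<le> y" | "y \<le> c" by linarith
  then show ?thesis
  proof cases
    case 1 then show ?thesis using assms set_integral_combine[OF f[of c y], of x] by (simp add: oriented_integral_simps)
  next
    case 2 then show ?thesis using assms set_integral_combine[OF f[of x y], of c] by (simp add: oriented_integral_simps)
  next
    case 3 then show ?thesis using assms set_integral_combine[OF f[of x c], of y] by (simp add: oriented_integral_simps)
  qed
qed

lemma is_primitive_oriented_integral:
  fixes f :: "real \<Rightarrow> complex"
  assumes f: "\<And>u v. u \<in> I \<Longrightarrow> v \<in> I \<Longrightarrow> set_integrable lebesgue {u..v} f" and "c \<in> I"
  shows "is_primitive I (\<lambda>x. oriented_integral c x f) f"
  unfolding is_primitive_def
proof (intro allI impI)
  fix u v :: real assume "u \<le> v" "{u..v} \<subseteq> I"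
  then have "u \<in> I" "v \<in> I" by auto
  then show "set_integrable lebesgue {u..v} f \<and> (LINT x:{u..v}|lebesgue. f x) = oriented_integral c v f - oriented_integral c u f"
    using f oriented_integral_diff[OF f \<open>c \<in> I\<close>] \<open>u \<le> v\<close> by auto
qed

lemma set_integrable_mult_continuous:
  fixes f g :: "real \<Rightarrow> complex"
  assumes f: "set_integrable lebesgue {c..d} f" and g: "continuous_on {c..d} g"
  shows "set_integrable lebesgue {c..d} (\<lambda>x. f x * g x)"
proof -
  have "(\<lambda>x. g x * f x) absolutely_integrable_on {c..d}"
  proof (rule absolutely_integrable_bounded_measurable_product[where h = "(*)", OF _ _ _ _ f])
    show "bilinear ((*) :: complex \<Rightarrow> complex \<Rightarrow> complex)"
      using bilinear_conv_bounded_bilinear bounded_bilinear_mult by blast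
    show "g \<in> borel_measurable (lebesgue_on {c..d})"
      by (rule continuous_imp_measurable_on_sets_lebesgue[OF g]) simp
    show "bounded (g ` {c..d})" by (intro compact_imp_bounded compact_continuous_image g) auto
  qed simp
  then show ?thesis by (simp add: mult.commute)
qed

section \<open>Linear systems with locally integrable coefficients\<close>

lemma norm_vec_le_sum: "norm (x :: complex^'n) \<le> (\<Sum>i\<in>UNIV. norm (x $ i))"
  unfolding norm_vec_def by (rule L2_set_le_sum) simp

lemma norm_oriented_integral_le:
  fixes h :: "real \<Rightarrow> complex"
  assumes "set_integrable lebesgue {min c x..max c x} h"
  shows "norm (oriented_integral c x h) \<le> (LINT t:{min c x..max c x}|lebesgue. norm (h t))"
proof (cases "c \<le> x")
  case True
  then show ?thesis using set_integral_norm_bound[OF assms] by (simp add: oriented_integral_simps min_def max_def)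
next
  case False
  then show ?thesis using set_integral_norm_bound[OF assms] by (simp add: oriented_integral_simps min_def max_def)
qed

text \<open>The weight \<open>exp (2 m)\<close> makes the Volterra operator a contraction (Bielecki's norm).\<close>

lemma exp_weight_integral:
  fixes a :: "real \<Rightarrow> real"
  assumes I: "open I" "is_interval I" and a: "\<And>c d. {c..d} \<subseteq> I \<Longrightarrow> set_integrable lebesgue {c..d} a"
    and pos: "\<And>t. 0 \<le> a t" and x: "x0 \<in> I" "x \<in> I"
  defines "m \<equiv> \<lambda>x. \<bar>oriented_integral x0 x a\<bar>"
  shows "set_integrable lebesgue {min x0 x..max x0 x} (\<lambda>t. a t * exp (2 * m t))"
    "(LINT t:{min x0 x..max x0 x}|lebesgue. a t * exp (2 * m t)) = (exp (2 * m x) - 1) / 2"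
    "continuous_on I m"
proof -
  have sub: "{u..v} \<subseteq> I" if "u \<in> I" "v \<in> I" for u v using mem_is_interval_1_I[OF I(2) that] by auto
  have ac: "set_integrable lebesgue {u..v} (\<lambda>t. complex_of_real (a t))" if "u \<in> I" "v \<in> I" for u v
    using a[OF sub[OF that]] unfolding set_integrable_def by (simp add: scaleR_conv_of_real flip: of_real_mult)
  have ofr: "(LINT t:A|lebesgue. complex_of_real (f t)) = of_real (LINT t:A|lebesgue. f t)" for A f
    unfolding set_lebesgue_integral_def by (simp add: scaleR_conv_of_real flip: of_real_mult)
  define n where "n x = oriented_integral x0 x a" for x
  have nN: "oriented_integral x0 x (\<lambda>t. complex_of_real (a t)) = of_real (n x)" for x
    unfolding oriented_integral_def n_def ofr by simp
  have N: "is_primitive I (\<lambda>x. complex_of_real (n x)) (\<lambda>t. complex_of_real (a t))"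
    using is_primitive_oriented_integral[OF ac x(1)] unfolding nN .
  have nonneg: "0 \<le> n t" if "x0 \<le> t" for t
    unfolding n_def oriented_integral_simps(1)[OF that] set_lebesgue_integral_def by (rule integral_nonneg_AE) (simp add: pos)
  have nonpos: "n t \<le> 0" if "t \<le> x0" for t
    unfolding n_def oriented_integral_simps(2)[OF that] set_lebesgue_integral_def
    by (simp add: pos)
  have cn: "continuous_on I n"
    using continuous_on_Re[OF is_primitive_continuous_on[OF I(1) N]] by simp
  then show "continuous_on I m" unfolding m_def n_def[symmetric] by (intro continuous_intros)
  have n0: "n x0 = 0" by (simp add: n_def oriented_integral_def)
  \<comment> \<open>a exp(2 k n) has the primitive exp(2 k n) / (2 k). The choice k = 1 serves to
    the right of x0, and k = -1 to the left, where the oriented integral n is nonpositive.\<close>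
  have E: "is_primitive I (\<lambda>x. 1 / (2 * k) * exp (2 * k * complex_of_real (n x)))
      (\<lambda>t. complex_of_real (a t) * exp (2 * k * complex_of_real (n t)))" if "k \<noteq> 0" for k
    using is_primitive_scale[OF is_primitive_exp[OF is_primitive_scale[OF N, of "2 * k"] I(1)], of "1 / (2 * k)"] that
    by (simp add: field_simps)
  have I1: "set_integrable lebesgue {u..v} (\<lambda>t. a t * exp (2 * k * n t))"
    "(LINT t:{u..v}|lebesgue. a t * exp (2 * k * n t)) = (exp (2 * k * n v) - exp (2 * k * n u)) / (2 * k)"
    if uv: "u \<in> I" "v \<in> I" "u \<le> v" and k: "k \<noteq> 0" for u v k
  proof -
    have "complex_of_real k \<noteq> 0" using k by simp
    note E' = is_primitiveD[OF E[OF this] sub[OF uv(1,2)]]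
    have eq: "complex_of_real (a t) * exp (2 * complex_of_real k * complex_of_real (n t)) = complex_of_real (a t * exp (2 * k * n t))" for t
      by (simp flip: exp_of_real)
    have "set_integrable lebesgue {u..v} (\<lambda>t. complex_of_real (a t * exp (2 * k * n t)))" using E'(1) unfolding eq .
    then have "set_integrable lebesgue {u..v} (\<lambda>t. Re (complex_of_real (a t * exp (2 * k * n t))))"
      unfolding set_integrable_def by (drule_tac integrable_Re) simp
    then show "set_integrable lebesgue {u..v} (\<lambda>t. a t * exp (2 * k * n t))" by simp
    have "complex_of_real (LINT t:{u..v}|lebesgue. a t * exp (2 * k * n t)) =
        1 / (2 * of_real k) * exp (2 * of_real k * of_real (n v)) - 1 / (2 * of_real k) * exp (2 * of_real k * of_real (n u))"
      using E'(2)[OF uv(3)] unfolding eq ofr .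
    also have "\<dots> = complex_of_real ((exp (2 * k * n v) - exp (2 * k * n u)) / (2 * k))"
      by (simp add: diff_divide_distrib flip: exp_of_real)
    finally show "(LINT t:{u..v}|lebesgue. a t * exp (2 * k * n t)) = (exp (2 * k * n v) - exp (2 * k * n u)) / (2 * k)"
      by (simp only: of_real_eq_iff)
  qed
  have "set_integrable lebesgue {min x0 x..max x0 x} (\<lambda>t. a t * exp (2 * m t)) \<and>
    (LINT t:{min x0 x..max x0 x}|lebesgue. a t * exp (2 * m t)) = (exp (2 * m x) - 1) / 2"
  proof (cases "x0 \<le> x")
    case True
    have mm: "m t = n t" if "t \<in> {x0..x}" for t using nonneg[of t] that by (simp add: m_def n_def)
    have "set_integrable lebesgue {x0..x} (\<lambda>t. a t * exp (2 * m t)) \<longleftrightarrow> set_integrable lebesgue {x0..x} (\<lambda>t. a t * exp (2 * 1 * n t))"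
      by (rule set_integrable_cong) (auto simp: mm)
    moreover have "(LINT t:{x0..x}|lebesgue. a t * exp (2 * m t)) = (LINT t:{x0..x}|lebesgue. a t * exp (2 * 1 * n t))"
      by (rule set_lebesgue_integral_cong) (auto simp: mm)
    moreover have "m x = n x" using mm True by simp
    ultimately show ?thesis using I1[of x0 x 1] x True n0 by (simp add: min_def max_def)
  next
    case False
    have mm: "m t = - n t" if "t \<in> {x..x0}" for t using nonpos[of t] that by (simp add: m_def n_def)
    have "set_integrable lebesgue {x..x0} (\<lambda>t. a t * exp (2 * m t)) \<longleftrightarrow> set_integrable lebesgue {x..x0} (\<lambda>t. a t * exp (2 * (-1) * n t))"
      by (rule set_integrable_cong) (auto simp: mm)
    moreover have "(LINT t:{x..x0}|lebesgue. a t * exp (2 * m t)) = (LINT t:{x..x0}|lebesgue. a t * exp (2 * (-1) * n t))"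
      by (rule set_lebesgue_integral_cong) (auto simp: mm)
    moreover have "m x = - n x" using mm False by simp
    ultimately show ?thesis using I1[of x x0 "-1"] x False n0 by (simp add: min_def max_def field_simps)
  qed
  then show "set_integrable lebesgue {min x0 x..max x0 x} (\<lambda>t. a t * exp (2 * m t))"
    "(LINT t:{min x0 x..max x0 x}|lebesgue. a t * exp (2 * m t)) = (exp (2 * m x) - 1) / 2" by auto
qed

text \<open>Caratheodory systems U' = A U + g. The coefficients are merely locally integrable, so
  the equation is read componentwise through \<open>is_primitive\<close>.\<close>

locale linear_system =
  fixes I :: "real set" and A :: "real \<Rightarrow> complex^'n^'n" and g :: "real \<Rightarrow> complex^'n"
  assumes I: "open I" "is_interval I"
    and A: "\<And>c d i j. {c..d} \<subseteq> I \<Longrightarrow> set_integrable lebesgue {c..d} (\<lambda>t. A t $ i $ j)"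
    and g: "\<And>c d i. {c..d} \<subseteq> I \<Longrightarrow> set_integrable lebesgue {c..d} (\<lambda>t. g t $ i)"
begin

text \<open>Continuity is listed separately because \<open>J\<close> is often a compact interval,
  whereas \<open>is_primitive_continuous_on\<close> speaks of open sets.\<close>

definition solves :: "real set \<Rightarrow> (real \<Rightarrow> complex^'n) \<Rightarrow> bool" where
  "solves J U \<longleftrightarrow> continuous_on J U \<and> (\<forall>i. is_primitive J (\<lambda>x. U x $ i) (\<lambda>x. (A x *v U x + g x) $ i))"

definition size :: "real \<Rightarrow> real" where
  "size t = (\<Sum>i\<in>UNIV. \<Sum>j\<in>UNIV. norm (A t $ i $ j))"

lemma sub: "u \<in> I \<Longrightarrow> v \<in> I \<Longrightarrow> {u..v} \<subseteq> I"
  by (rule subsetI) (metis atLeastAtMost_iff mem_is_interval_1_I[OF I(2)])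

lemma size_nonneg: "0 \<le> size t" unfolding size_def by (intro sum_nonneg) auto

lemma size_integrable: "{c..d} \<subseteq> I \<Longrightarrow> set_integrable lebesgue {c..d} size"
  unfolding size_def set_integrable_def scaleR_sum_right
proof (intro Bochner_Integration.integrable_sum)
  fix i j assume "{c..d} \<subseteq> I"
  from integrable_norm[OF A[OF this, of i j, unfolded set_integrable_def]]
  show "integrable lebesgue (\<lambda>x. indicat_real {c..d} x *\<^sub>R norm (A x $ i $ j))" by simp
qed

lemma matrix_vector_integrable:
  assumes "{c..d} \<subseteq> I" "continuous_on {c..d} V"
  shows "set_integrable lebesgue {c..d} (\<lambda>t. (A t *v V t) $ i)"
proof -
  have "set_integrable lebesgue {c..d} (\<lambda>t. A t $ i $ j * V t $ j)" for j
    by (rule set_integrable_mult_continuous[OF A[OF assms(1)]]) (intro continuous_intros assms)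
  then show ?thesis unfolding matrix_vector_mult_def set_integrable_def vec_lambda_beta scaleR_sum_right
    by (intro Bochner_Integration.integrable_sum)
qed

lemma sum_norm_matrix_vector_le: "(\<Sum>i\<in>UNIV. norm ((A t *v v) $ i)) \<le> size t * norm v"
proof -
  have "norm ((A t *v v) $ i) \<le> (\<Sum>j\<in>UNIV. norm (A t $ i $ j) * norm v)" for i
    unfolding matrix_vector_mult_def vec_lambda_beta
    by (rule order_trans[OF norm_sum], rule sum_mono) (simp add: norm_mult mult_left_mono Finite_Cartesian_Product.norm_nth_le)
  then have "(\<Sum>i\<in>UNIV. norm ((A t *v v) $ i)) \<le> (\<Sum>i\<in>UNIV. \<Sum>j\<in>UNIV. norm (A t $ i $ j) * norm v)"
    by (rule sum_mono)
  then show ?thesis by (simp add: size_def sum_distrib_right)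
qed

definition weight :: "real \<Rightarrow> real \<Rightarrow> real" where
  "weight x0 x = exp (2 * \<bar>oriented_integral x0 x size\<bar>)"

lemma weight_ge_1: "1 \<le> weight x0 x" by (simp add: weight_def)

lemma weight_continuous: "x0 \<in> I \<Longrightarrow> continuous_on I (weight x0)"
  unfolding weight_def
  by (intro continuous_intros exp_weight_integral(3)[OF I size_integrable size_nonneg])

text \<open>The integral of \<open>size\<close> times the weight is half of the weight minus 1, so
  one Volterra integration halves a bound relative to the weight, on intervals of any length.
  Uniqueness and contraction both rest on this.\<close>

lemma volterra_bound:
  assumes x: "x0 \<in> {c..d}" "x \<in> {c..d}" "{c..d} \<subseteq> I" and V: "continuous_on {c..d} V"
    and K: "0 \<le> K" "\<And>t. t \<in> {c..d} \<Longrightarrow> norm (V t) \<le> K * weight x0 t"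
  shows "(\<Sum>i\<in>UNIV. norm (oriented_integral x0 x (\<lambda>t. (A t *v V t) $ i))) \<le> K * weight x0 x / 2"
proof -
  let ?S = "{min x0 x..max x0 x}"
  have S: "?S \<subseteq> {c..d}" using x by auto
  have x0I: "x0 \<in> I" "x \<in> I" using x by auto
  note w = exp_weight_integral[OF I size_integrable size_nonneg x0I, folded weight_def]
  have hi: "set_integrable lebesgue ?S (\<lambda>t. (A t *v V t) $ i)" for i
    by (rule matrix_vector_integrable[OF order_trans[OF S x(3)] continuous_on_subset[OF V S]])
  have hn: "set_integrable lebesgue ?S (\<lambda>t. norm ((A t *v V t) $ i))" for i
    using integrable_norm[OF hi[of i, unfolded set_integrable_def]] unfolding set_integrable_def by simp
  have "(\<Sum>i\<in>UNIV. norm (oriented_integral x0 x (\<lambda>t. (A t *v V t) $ i))) \<le>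
      (\<Sum>i\<in>UNIV. LINT t:?S|lebesgue. norm ((A t *v V t) $ i))"
    by (intro sum_mono norm_oriented_integral_le hi)
  also have "\<dots> = (LINT t:?S|lebesgue. (\<Sum>i\<in>UNIV. norm ((A t *v V t) $ i)))"
    unfolding set_lebesgue_integral_def scaleR_sum_right
    by (rule Bochner_Integration.integral_sum[symmetric]) (use hn in \<open>simp add: set_integrable_def\<close>)
  also have "\<dots> \<le> (LINT t:?S|lebesgue. K * (size t * weight x0 t))"
  proof (rule set_integral_mono)
    show "set_integrable lebesgue ?S (\<lambda>t. \<Sum>i\<in>UNIV. norm ((A t *v V t) $ i))"
      using hn unfolding set_integrable_def scaleR_sum_right by (intro Bochner_Integration.integrable_sum) auto
    show "set_integrable lebesgue ?S (\<lambda>t. K * (size t * weight x0 t))" using w(1) by simp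
    fix t assume "t \<in> ?S"
    with S have "t \<in> {c..d}" by (rule subsetD)
    then have "norm (V t) \<le> K * weight x0 t" by (rule K(2))
    then have "size t * norm (V t) \<le> size t * (K * weight x0 t)" by (intro mult_left_mono size_nonneg)
    then show "(\<Sum>i\<in>UNIV. norm ((A t *v V t) $ i)) \<le> K * (size t * weight x0 t)"
      using sum_norm_matrix_vector_le[of t "V t"] by (simp add: algebra_simps)
  qed
  also have "\<dots> = K * ((weight x0 x - 1) / 2)" using w(2) by simp
  also have "\<dots> \<le> K * weight x0 x / 2" using K(1) by (simp add: field_simps)
  finally show ?thesis .
qed

text \<open>At the point y where the quotient of the difference by the weight is maximal, the
  Volterra bound gives norm (W y) \<le> norm (W y) / 2.\<close>

lemma solves_unique_compact:
  assumes cd: "{c..d} \<subseteq> I" and x0: "x0 \<in> {c..d}" and U: "solves {c..d} U" and V: "solves {c..d} V" and eq: "U x0 = V x0"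
    and x: "x \<in> {c..d}"
  shows "U x = V x"
proof -
  define W where "W x = U x - V x" for x
  have cW: "continuous_on {c..d} W" using U V unfolding W_def solves_def by (intro continuous_intros) auto
  have W: "is_primitive {c..d} (\<lambda>x. W x $ i) (\<lambda>x. (A x *v W x) $ i)" for i
  proof -
    have "is_primitive {c..d} (\<lambda>x. U x $ i - V x $ i) (\<lambda>x. (A x *v U x + g x) $ i - (A x *v V x + g x) $ i)"
      using U V unfolding solves_def by (intro is_primitive_diff) blast+
    moreover have "(A x *v U x + g x) $ i - (A x *v V x + g x) $ i = (A x *v W x) $ i" for x
      by (simp add: W_def matrix_vector_mult_diff_distrib)
    ultimately show ?thesis by (simp add: W_def)
  qed
  have W_eq: "W x $ i = oriented_integral x0 x (\<lambda>t. (A t *v W t) $ i)" if "x \<in> {c..d}" for x i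
  proof (cases "x0 \<le> x")
    case True
    then show ?thesis using is_primitiveD(2)[OF W, of x0 x i] that x0 eq
      by (simp add: oriented_integral_simps W_def)
  next
    case False
    then show ?thesis using is_primitiveD(2)[OF W, of x x0 i] that x0 eq
      by (simp add: oriented_integral_simps W_def)
  qed
  have x0I: "x0 \<in> I" using x0 cd by auto
  have cq: "continuous_on {c..d} (\<lambda>x. norm (W x) / weight x0 x)"
    using weight_ge_1[of x0] by (intro continuous_intros cW continuous_on_subset[OF weight_continuous[OF x0I] cd])
      (metis not_one_le_zero)
  have "{c..d} \<noteq> {}" using x0 by auto
  from continuous_attains_sup[OF compact_Icc this cq]
  obtain y where y: "y \<in> {c..d}" "\<And>t. t \<in> {c..d} \<Longrightarrow> norm (W t) / weight x0 t \<le> norm (W y) / weight x0 y"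
    by blast
  define K where "K = norm (W y) / weight x0 y"
  have wpos: "weight x0 t > 0" for t using weight_ge_1[of x0 t] by linarith
  have Wt: "norm (W t) \<le> K * weight x0 t" if "t \<in> {c..d}" for t
    using y(2)[OF that] wpos[of t] by (simp add: K_def pos_divide_le_eq)
  have "K \<ge> 0" using wpos[of y] by (simp add: K_def)
  have "norm (W y) \<le> (\<Sum>i\<in>UNIV. norm (W y $ i))" by (rule norm_vec_le_sum)
  also have "\<dots> = (\<Sum>i\<in>UNIV. norm (oriented_integral x0 y (\<lambda>t. (A t *v W t) $ i)))" using W_eq[OF y(1)] by simp
  also have "\<dots> \<le> K * weight x0 y / 2" by (rule volterra_bound[OF x0 y(1) cd cW \<open>K \<ge> 0\<close> Wt])
  also have "\<dots> = norm (W y) / 2" using wpos[of y] by (simp add: K_def)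
  finally have "norm (W y) = 0" by simp
  then have "K = 0" by (simp add: K_def)
  with Wt[OF x] show ?thesis by (simp add: W_def)
qed

text \<open>Banach's fixed point theorem for the unknown W = U / weight: the supremum norm of W is
  the weighted norm of U, for which the Volterra operator contracts with factor 1/2.\<close>

lemma solves_exists_compact:
  assumes cd: "{c..d} \<subseteq> I" and x0: "x0 \<in> {c..d}"
  shows "\<exists>U. solves {c..d} U \<and> U x0 = u0"
proof -
  have "c \<le> d" using x0 by auto
  have x0I: "x0 \<in> I" using x0 cd by auto
  define r where "r x = max c (min d x)" for x
  have r: "r x \<in> {c..d}" "x \<in> {c..d} \<Longrightarrow> r x = x" for x using \<open>c \<le> d\<close> by (auto simp: r_def)
  have rc: "continuous_on S r" for S unfolding r_def by (intro continuous_intros)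
  have wpos: "weight x0 t > 0" for t using weight_ge_1[of x0 t] by linarith
  have wc: "continuous_on {c..d} (weight x0)" by (rule continuous_on_subset[OF weight_continuous[OF x0I] cd])
  have subint: "{u..v} \<subseteq> I" if "u \<in> {c..d}" "v \<in> {c..d}" for u v using that cd by auto
  define Q where "Q W x = (\<chi> i. u0 $ i + oriented_integral x0 x (\<lambda>t. (A t *v (weight x0 t *\<^sub>R W t) + g t) $ i))"
    for W :: "real \<Rightarrow> complex^'n" and x
  have int: "set_integrable lebesgue {u..v} (\<lambda>t. (A t *v (weight x0 t *\<^sub>R W t) + g t) $ i)"
    if "continuous_on {c..d} W" "u \<in> {c..d}" "v \<in> {c..d}" for W u v i
    unfolding vector_add_component
  proof (rule set_integral_add(1)[OF matrix_vector_integrable g])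
    have s: "{u..v} \<subseteq> {c..d}" using that by auto
    show "continuous_on {u..v} (\<lambda>t. weight x0 t *\<^sub>R W t)"
      by (rule continuous_on_subset[OF _ s]) (intro continuous_intros wc that)
  qed (use subint that in auto)
  have Qp: "is_primitive {c..d} (\<lambda>x. Q W x $ i) (\<lambda>t. (A t *v (weight x0 t *\<^sub>R W t) + g t) $ i)"
    if "continuous_on {c..d} W" for W i
    using is_primitive_oriented_integral[OF int[OF that] x0] unfolding is_primitive_def Q_def by simp
  have Qc: "continuous_on {c..d} (Q W)" if "continuous_on {c..d} W" for W
  proof -
    have "continuous_on {c..d} (\<lambda>x. Q W x $ i)" for i
      using is_primitive_imp_loc_abs_cont[OF Qp[OF that]] unfolding loc_abs_cont_def
      by (blast intro: abs_cont_on_imp_continuous_on)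
    then have "continuous_on {c..d} (\<lambda>x. \<chi> i. Q W x $ i)" by (rule continuous_on_vec_lambda)
    then show ?thesis by simp
  qed
  \<comment> \<open>Composition with the clamp \<open>r\<close> turns a function on [c, d] into a
    bounded continuous function on the line, so that the complete space of bounded continuous
    functions is available.\<close>
  define T where "T W x = (1 / weight x0 (r x)) *\<^sub>R Q W (r x)" for W x
  have Tb: "T W \<in> bcontfun" if "continuous_on UNIV W" for W
  proof -
    have c1: "continuous_on {c..d} (\<lambda>x. (1 / weight x0 x) *\<^sub>R Q W x)"
      by (intro continuous_intros wc Qc continuous_on_subset[OF that]) (use wpos less_irrefl in \<open>auto, metis\<close>)
    have "continuous_on UNIV (T W)"
      unfolding T_def by (rule continuous_on_compose2[OF c1 rc]) (use r in auto)
    moreover have "bounded (range (T W))"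
    proof (rule bounded_subset)
      show "bounded ((\<lambda>x. (1 / weight x0 x) *\<^sub>R Q W x) ` {c..d})"
        by (intro compact_imp_bounded compact_continuous_image c1) simp
      show "range (T W) \<subseteq> (\<lambda>x. (1 / weight x0 x) *\<^sub>R Q W x) ` {c..d}" using r by (auto simp: T_def)
    qed
    ultimately show ?thesis by (simp add: bcontfun_def)
  qed
  define F where "F W = Bcontfun (T (apply_bcontfun W))" for W :: "real \<Rightarrow>\<^sub>C (complex^'n)"
  have F: "apply_bcontfun (F W) = T (apply_bcontfun W)" for W
    unfolding F_def by (rule Bcontfun_inverse[OF Tb]) simp
  have contr: "dist (F W) (F V) \<le> 1/2 * dist W V" for W V
  proof (rule dist_bound)
    fix x
    let ?D = "\<lambda>t. weight x0 t *\<^sub>R (W t - V t)"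
    have cWV: "continuous_on {c..d} ?D" by (intro continuous_intros wc) auto
    have b: "norm (?D t) \<le> dist W V * weight x0 t" for t
      using dist_bounded[of W t V] wpos[of t] by (simp add: dist_norm mult.commute mult_left_mono)
    have "Q W y $ i - Q V y $ i = oriented_integral x0 y (\<lambda>t. (A t *v ?D t) $ i)" if y: "y \<in> {c..d}" for y i
    proof -
      have cc: "continuous_on {c..d} W" "continuous_on {c..d} V" by auto
      have "oriented_integral x0 y (\<lambda>t. (A t *v (weight x0 t *\<^sub>R W t) + g t) $ i) - oriented_integral x0 y (\<lambda>t. (A t *v (weight x0 t *\<^sub>R V t) + g t) $ i)
         = oriented_integral x0 y (\<lambda>t. (A t *v (weight x0 t *\<^sub>R W t) + g t) $ i - (A t *v (weight x0 t *\<^sub>R V t) + g t) $ i)"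
        using int[OF cc(1) x0 y, of i] int[OF cc(2) x0 y, of i] int[OF cc(1) y x0, of i] int[OF cc(2) y x0, of i]
        unfolding oriented_integral_def by (simp only: set_integral_diff(2)) simp
      also have "(\<lambda>t. (A t *v (weight x0 t *\<^sub>R W t) + g t) $ i - (A t *v (weight x0 t *\<^sub>R V t) + g t) $ i) = (\<lambda>t. (A t *v ?D t) $ i)"
        by (simp add: fun_eq_iff scaleR_diff_right matrix_vector_mult_diff_distrib)
      finally show ?thesis by (simp add: Q_def)
    qed
    then have "norm (Q W (r x) - Q V (r x)) \<le> (\<Sum>i\<in>UNIV. norm (oriented_integral x0 (r x) (\<lambda>t. (A t *v ?D t) $ i)))"
      using norm_vec_le_sum[of "Q W (r x) - Q V (r x)"] r(1)[of x] by simp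
    also have "\<dots> \<le> dist W V * weight x0 (r x) / 2"
      by (rule volterra_bound[OF x0 r(1) cd cWV]) (use b in auto)
    finally have q: "norm (Q W (r x) - Q V (r x)) \<le> dist W V * weight x0 (r x) / 2" .
    have "dist (F W x) (F V x) = norm ((1 / weight x0 (r x)) *\<^sub>R (Q W (r x) - Q V (r x)))"
      unfolding F T_def dist_norm by (simp add: scaleR_diff_right)
    also have "\<dots> = norm (Q W (r x) - Q V (r x)) / weight x0 (r x)"
      using wpos[of "r x"] by simp
    also have "\<dots> \<le> 1/2 * dist W V" using q wpos[of "r x"] by (simp add: pos_divide_le_eq algebra_simps)
    finally show "dist (F W x) (F V x) \<le> 1/2 * dist W V" .
  qed
  have "\<exists>!W. F W = W" by (rule banach_fix_type[of "1/2"]) (use contr in auto)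
  then obtain W where W: "F W = W" by blast
  define U where "U x = weight x0 x *\<^sub>R W x" for x
  have UQ: "U x = Q W x" if "x \<in> {c..d}" for x
  proof -
    have "W x = (1 / weight x0 x) *\<^sub>R Q W x" using F[of W] W r(2)[OF that] by (metis T_def)
    then show ?thesis using wpos[of x] by (simp add: U_def)
  qed
  have "solves {c..d} U"
    unfolding solves_def
  proof (intro conjI allI)
    show "continuous_on {c..d} U" unfolding U_def by (intro continuous_intros wc) auto
    show "is_primitive {c..d} (\<lambda>x. U x $ i) (\<lambda>x. (A x *v U x + g x) $ i)" for i
      by (rule is_primitive_cong[OF Qp[of W i]]) (auto simp: UQ, auto simp: U_def UQ[symmetric])
  qed
  moreover have "U x0 = u0" using UQ[OF x0] by (simp add: Q_def oriented_integral_def vec_eq_iff)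
  ultimately show ?thesis by blast
qed

lemma solves_subset: "solves J U \<Longrightarrow> J' \<subseteq> J \<Longrightarrow> solves J' U"
  unfolding solves_def using is_primitive_subset continuous_on_subset by blast

theorem solves_unique:
  assumes "solves J U" "solves J V" "J \<subseteq> I" "is_interval J" "x0 \<in> J" "x \<in> J" "U x0 = V x0"
  shows "U x = V x"
proof -
  have s: "{min x0 x..max x0 x} \<subseteq> J"
    using mem_is_interval_1_I[OF assms(4), of "min x0 x" "max x0 x"] assms(5,6) by (auto simp: min_def max_def)
  show ?thesis
    by (rule solves_unique_compact[of "min x0 x" "max x0 x" x0 U V])
      (use s assms solves_subset in \<open>auto simp: min_def max_def\<close>)
qed

text \<open>The value at x is read off from the solution on the smallest compact interval containing
  x0 and x; by uniqueness any larger interval gives the same value, so the local solutions fit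
  together.\<close>

theorem solves_exists:
  assumes x0: "x0 \<in> I"
  shows "\<exists>U. solves I U \<and> U x0 = u0"
proof -
  have "\<exists>U. solves {c..d} U \<and> U x0 = u0" if "{c..d} \<subseteq> I" "x0 \<in> {c..d}" for c d
    by (rule solves_exists_compact[OF that])
  then obtain S where S: "\<And>c d. {c..d} \<subseteq> I \<Longrightarrow> x0 \<in> {c..d} \<Longrightarrow> solves {c..d} (S c d) \<and> S c d x0 = u0"
    by metis
  define U where "U x = S (min x0 x) (max x0 x) x" for x
  have UE: "U x = S c d x" if cd: "{c..d} \<subseteq> I" "x0 \<in> {c..d}" "x \<in> {c..d}" for c d x
  proof -
    have s: "{min x0 x..max x0 x} \<subseteq> {c..d}" "x0 \<in> {min x0 x..max x0 x}" "x \<in> {min x0 x..max x0 x}" using cd by auto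
    have s0: "{min x0 x..max x0 x} \<subseteq> I" using s(1) cd(1) by (rule order_trans)
    note a = S[OF s0 s(2)] and b = S[OF cd(1,2)]
    have "S (min x0 x) (max x0 x) x0 = S c d x0" using a b by simp
    then show ?thesis unfolding U_def
      by (rule solves_unique_compact[OF s0 s(2) conjunct1[OF a] solves_subset[OF conjunct1[OF b] s(1)] _ s(3)])
  qed
  have ext: "\<exists>c' d'. {c'..d'} \<subseteq> I \<and> x0 \<in> {c'..d'} \<and> {c..d} \<subseteq> {c'..d'}" if "{c..d} \<subseteq> I" "c \<le> d" for c d
  proof (intro exI conjI)
    have "c \<in> I" "d \<in> I" using that by auto
    then show "{min x0 c..max x0 d} \<subseteq> I" using x0 by (intro sub) (auto simp: min_def max_def)
  qed (use that in auto)
  have solcd: "solves {c..d} U" if cd: "{c..d} \<subseteq> I" "c \<le> d" for c d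
  proof -
    obtain c' d' where cd': "{c'..d'} \<subseteq> I" "x0 \<in> {c'..d'}" "{c..d} \<subseteq> {c'..d'}" using ext[OF cd] by blast
    have eq: "S c' d' x = U x" if "x \<in> {c..d}" for x using UE[OF cd'(1,2)] that cd'(3) by auto
    have s: "solves {c..d} (S c' d')" using S[OF cd'(1,2)] solves_subset cd'(3) by blast
    show ?thesis unfolding solves_def
    proof (intro conjI allI)
      show "continuous_on {c..d} U" by (rule continuous_on_eq[of _ "S c' d'"]) (use s eq in \<open>auto simp: solves_def\<close>)
      show "is_primitive {c..d} (\<lambda>x. U x $ i) (\<lambda>x. (A x *v U x + g x) $ i)" for i
        by (rule is_primitive_cong[where F = "\<lambda>x. S c' d' x $ i" and f = "\<lambda>x. (A x *v S c' d' x + g x) $ i"])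
          (use s eq in \<open>auto simp: solves_def\<close>)
    qed
  qed
  have p: "is_primitive I (\<lambda>x. U x $ i) (\<lambda>x. (A x *v U x + g x) $ i)" for i
    unfolding is_primitive_def
  proof (intro allI impI)
    fix c d :: real assume cd: "c \<le> d" "{c..d} \<subseteq> I"
    then have P: "is_primitive {c..d} (\<lambda>x. U x $ i) (\<lambda>x. (A x *v U x + g x) $ i)"
      using solcd unfolding solves_def by blast
    from is_primitiveD[OF this, of c d] cd
    show "set_integrable lebesgue {c..d} (\<lambda>x. (A x *v U x + g x) $ i) \<and>
      (LINT x:{c..d}|lebesgue. (A x *v U x + g x) $ i) = U d $ i - U c $ i" by auto
  qed
  have "continuous_on I (\<lambda>x. \<chi> i. U x $ i)"
    by (rule continuous_on_vec_lambda) (rule is_primitive_continuous_on[OF I(1) p])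
  then have "solves I U" unfolding solves_def using p by simp
  moreover have "U x0 = u0" using S[of x0 x0] x0 by (simp add: U_def)
  ultimately show ?thesis by blast
qed

end

section \<open>Quasi-derivatives as a first-order system\<close>

lemma loc_abs_cont_cong:
  assumes "loc_abs_cont I f" "\<And>x. x \<in> I \<Longrightarrow> f x = g x"
  shows "loc_abs_cont I g"
  unfolding loc_abs_cont_def
proof (intro allI impI)
  fix c d assume cd: "{c..d} \<subseteq> I"
  have ac: "abs_cont_on {c..d} f" using assms(1) cd by (auto simp: loc_abs_cont_def)
  show "abs_cont_on {c..d} g"
    unfolding abs_cont_on_def
  proof (intro allI impI)
    fix \<epsilon> :: real assume "\<epsilon> > 0"
    then obtain \<delta> where \<delta>: "\<delta> > 0" "\<forall>(n::nat) u v. (\<forall>i<n. u i \<le> v i \<and> {u i..v i} \<subseteq> {c..d}) \<and>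
        disjoint_family_on (\<lambda>i. {u i<..<v i}) {..<n} \<and> (\<Sum>i<n. v i - u i) < \<delta>
        \<longrightarrow> (\<Sum>i<n. norm (f (v i) - f (u i))) < \<epsilon>"
      using ac unfolding abs_cont_on_def by iprover
    show "\<exists>\<delta>>0. \<forall>(n::nat) u v. (\<forall>i<n. u i \<le> v i \<and> {u i..v i} \<subseteq> {c..d}) \<and>
        disjoint_family_on (\<lambda>i. {u i<..<v i}) {..<n} \<and> (\<Sum>i<n. v i - u i) < \<delta>
        \<longrightarrow> (\<Sum>i<n. norm (g (v i) - g (u i))) < \<epsilon>"
    proof (intro exI[of _ \<delta>] conjI allI impI \<delta>(1))
      fix n :: nat and u v :: "nat \<Rightarrow> real"
      assume *: "(\<forall>i<n. u i \<le> v i \<and> {u i..v i} \<subseteq> {c..d}) \<and>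
        disjoint_family_on (\<lambda>i. {u i<..<v i}) {..<n} \<and> (\<Sum>i<n. v i - u i) < \<delta>"
      have "g (u i) = f (u i) \<and> g (v i) = f (v i)" if "i < n" for i
      proof -
        have "u i \<le> v i \<and> {u i..v i} \<subseteq> {c..d}" using * that by blast
        then have "u i \<in> {c..d}" "v i \<in> {c..d}" by auto
        then have "u i \<in> I" "v i \<in> I" using cd by auto
        then show ?thesis using assms(2) by simp
      qed
      then have "(\<Sum>i<n. norm (g (v i) - g (u i))) = (\<Sum>i<n. norm (f (v i) - f (u i)))" by simp
      also have "\<dots> < \<epsilon>" by (rule \<delta>(2)[rule_format]) (rule *)
      finally show "(\<Sum>i<n. norm (g (v i) - g (u i))) < \<epsilon>" .
    qed
  qed
qed

lemma AE_lebesgue_on_iff: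
  assumes "open I"
  shows "(AE x in lebesgue_on I. P x) \<longleftrightarrow> (AE x in lebesgue. x \<in> I \<longrightarrow> P x)"
  using assms by (subst AE_restrict_space_iff) auto

lemma continuous_on_AE_eq:
  fixes f g :: "real \<Rightarrow> complex"
  assumes I: "open I" and f: "continuous_on I f" and g: "continuous_on I g"
    and ae: "AE x in lebesgue. x \<in> I \<longrightarrow> f x = g x" and x: "x \<in> I"
  shows "f x = g x"
proof (rule ccontr)
  assume ne: "f x \<noteq> g x"
  have "continuous_on I (\<lambda>x. f x - g x)" using f g by (intro continuous_intros)
  then have "open (I \<inter> (\<lambda>x. f x - g x) -` (- {0}))" by (rule continuous_open_preimage) (use I in auto)
  moreover have "x \<in> I \<inter> (\<lambda>x. f x - g x) -` (- {0})" using x ne by auto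
  ultimately obtain e where e: "e > 0" "ball x e \<subseteq> I \<inter> (\<lambda>x. f x - g x) -` (- {0})" using openE by blast
  have "AE y in lebesgue. y \<notin> ball x e" using ae by eventually_elim (use e in auto)
  then have "ball x e \<in> null_sets lebesgue" by (subst (asm) AE_iff_null_sets[symmetric]) auto
  then have "emeasure lebesgue (ball x e) = 0" by auto
  then show False using e(1) by (simp add: ball_eq_greaterThanLessThan)
qed

text \<open>Two locally absolutely continuous versions agree almost everywhere, hence by continuity
  everywhere on the open set. This pins down the choice inside \<open>ac_version\<close>.\<close>

lemma ac_version_eq:
  assumes I: "open I" and g: "loc_abs_cont I g" and ae: "AE x in lebesgue. x \<in> I \<longrightarrow> g x = h x"
  shows "has_ac_version I h" "\<And>x. x \<in> I \<Longrightarrow> ac_version I h x = g x"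
proof -
  show h: "has_ac_version I h" unfolding has_ac_version_def AE_lebesgue_on_iff[OF I] using g ae by blast
  from someI_ex[OF this[unfolded has_ac_version_def]]
  have v: "loc_abs_cont I (ac_version I h)" "AE x in lebesgue. x \<in> I \<longrightarrow> ac_version I h x = h x"
    unfolding ac_version_def AE_lebesgue_on_iff[OF I] by auto
  fix x assume "x \<in> I"
  show "ac_version I h x = g x"
  proof (rule continuous_on_AE_eq[OF I _ _ _ \<open>x \<in> I\<close>])
    show "AE x in lebesgue. x \<in> I \<longrightarrow> ac_version I h x = g x" using v(2) ae by eventually_elim simp
  qed (use loc_abs_cont_continuous_on[OF I] v g in auto)
qed

lemma ac_version_props:
  assumes "open I" "has_ac_version I h"
  shows "loc_abs_cont I (ac_version I h)" "AE x in lebesgue. x \<in> I \<longrightarrow> ac_version I h x = h x"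
  using someI_ex[OF assms(2)[unfolded has_ac_version_def]]
  unfolding ac_version_def AE_lebesgue_on_iff[OF assms(1)] by auto

lemma vector_derivative_cong_open:
  assumes "open I" "x \<in> I" "\<And>x. x \<in> I \<Longrightarrow> f x = g x"
  shows "vector_derivative f (at x) = vector_derivative g (at x)"
  by (rule vector_derivative_cong_eq) (use assms in \<open>auto simp: eventually_nhds\<close>)

lemma is_primitive_glue:
  assumes F: "is_primitive I F f" and G: "is_primitive I G g" and eq: "F e = G e"
  shows "is_primitive I (\<lambda>x. if x \<le> e then F x else G x) (\<lambda>x. if x \<le> e then f x else g x)"
  unfolding is_primitive_def
proof (intro allI impI)
  fix c d :: real assume cd: "c \<le> d" "{c..d} \<subseteq> I"
  let ?h = "\<lambda>x. if x \<le> e then f x else g x" and ?H = "\<lambda>x. if x \<le> e then F x else G x"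
  have L: "set_integrable lebesgue {u..v} ?h \<and> (LINT x:{u..v}|lebesgue. ?h x) = ?H v - ?H u"
    if "u \<le> v" "v \<le> e" "{u..v} \<subseteq> I" for u v
  proof -
    have ae: "AE x in lebesgue. x \<in> {u..v} \<longrightarrow> f x = ?h x" using that by (intro AE_I2) auto
    show ?thesis using set_integrable_cong_AE_lebesgue[OF is_primitiveD(1)[OF F that(3)] ae] is_primitiveD(2)[OF F that(3,1)] that by auto
  qed
  have R: "set_integrable lebesgue {u..v} ?h \<and> (LINT x:{u..v}|lebesgue. ?h x) = ?H v - ?H u"
    if "u \<le> v" "e \<le> u" "{u..v} \<subseteq> I" for u v
  proof -
    have "AE x in lebesgue. x \<notin> {e}" by (rule AE_not_in) (simp flip: negligible_iff_null_sets)
    then have ae: "AE x in lebesgue. x \<in> {u..v} \<longrightarrow> g x = ?h x" by eventually_elim (use that in auto)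
    have "?H v = G v" "?H u = G u" using that eq by (auto simp: antisym_conv)
    with set_integrable_cong_AE_lebesgue[OF is_primitiveD(1)[OF G that(3)] ae] is_primitiveD(2)[OF G that(3,1)]
    show ?thesis by (simp only: simp_thms)
  qed
  consider "d \<le> e" | "e \<le> c" | "c \<le> e" "e \<le> d" by linarith
  then show "set_integrable lebesgue {c..d} ?h \<and> (LINT x:{c..d}|lebesgue. ?h x) = ?H d - ?H c"
  proof cases
    case 1 then show ?thesis using L cd by blast
  next
    case 2 then show ?thesis using R cd by blast
  next
    case 3
    have 1: "set_integrable lebesgue {c..e} ?h \<and> (LINT x:{c..e}|lebesgue. ?h x) = ?H e - ?H c"
      by (rule L) (use 3 cd in auto)
    have 2: "set_integrable lebesgue {e..d} ?h \<and> (LINT x:{e..d}|lebesgue. ?h x) = ?H d - ?H e"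
      by (rule R) (use 3 cd in auto)
    have "set_integrable lebesgue ({c..e} \<union> {e..d}) ?h" by (rule set_integrable_Un) (use 1 2 in auto)
    moreover have "{c..e} \<union> {e..d} = {c..d}" using 3 by auto
    ultimately have i: "set_integrable lebesgue {c..d} ?h" by simp
    show ?thesis using i set_integral_combine[OF i 3] 1 2 by simp
  qed
qed

locale quasi_expression =
  fixes I :: "real set" and p s q w :: "real \<Rightarrow> real"
  assumes I: "open I" "is_interval I"
    and coeffs: "L1_loc I (\<lambda>x. 1 / p x)" "L1_loc I s" "L1_loc I q" "L1_loc I w"
    and pos: "AE x in lebesgue. x \<in> I \<longrightarrow> p x > 0" "AE x in lebesgue. x \<in> I \<longrightarrow> w x > 0"
begin

lemma subI: "u \<in> I \<Longrightarrow> v \<in> I \<Longrightarrow> {u..v} \<subseteq> I"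
  by (rule subsetI) (metis atLeastAtMost_iff mem_is_interval_1_I[OF I(2)])

text \<open>\<open>h\<close> plays the role of \<open>\<ell> y\<^sub>0\<close>.\<close>

definition system :: "(real \<Rightarrow> complex) \<Rightarrow> (real \<Rightarrow> complex) \<Rightarrow> (real \<Rightarrow> complex) \<Rightarrow> (real \<Rightarrow> complex) \<Rightarrow> (real \<Rightarrow> complex) \<Rightarrow> bool" where
  "system y0 y1 y2 y3 h \<longleftrightarrow> is_primitive I y0 y1 \<and> is_primitive I y1 (\<lambda>x. y2 x / of_real (p x)) \<and>
     is_primitive I y2 (\<lambda>x. of_real (s x) * y1 x - y3 x) \<and>
     is_primitive I y3 (\<lambda>x. of_real (q x) * y0 x - of_real (w x) * h x)"

abbreviation "qdiff \<equiv> quasi_diff I p s"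
abbreviation "el \<equiv> ell I p s q w"

lemma quasi_diff_imp_system:
  assumes y: "qdiff y"
  shows "system y (qd1 y) (qd2 I p y) (qd3 I p s y) (el y)"
proof -
  have y0: "is_primitive I y (qd1 y)" unfolding qd1_def
    by (rule loc_abs_cont_imp_is_primitive[OF I(1)]) (use y in \<open>simp add: quasi_diff_def\<close>)
  have y1: "is_primitive I (qd1 y) (\<lambda>x. vector_derivative (qd1 y) (at x))"
    by (rule loc_abs_cont_imp_is_primitive[OF I(1)]) (use y in \<open>simp add: quasi_diff_def\<close>)
  have h2: "has_ac_version I (pre_qd2 p y)" and h3: "has_ac_version I (pre_qd3 I p s y)"
    using y by (auto simp: quasi_diff_def)
  note v2 = ac_version_props[OF I(1) h2, folded qd2_def] and v3 = ac_version_props[OF I(1) h3, folded qd3_def]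
  have y2: "is_primitive I (qd2 I p y) (\<lambda>x. vector_derivative (qd2 I p y) (at x))"
    by (rule loc_abs_cont_imp_is_primitive[OF I(1) v2(1)])
  have y3: "is_primitive I (qd3 I p s y) (\<lambda>x. vector_derivative (qd3 I p s y) (at x))"
    by (rule loc_abs_cont_imp_is_primitive[OF I(1) v3(1)])
  show ?thesis unfolding system_def
  proof (intro conjI y0)
    show "is_primitive I (qd1 y) (\<lambda>x. qd2 I p y x / of_real (p x))"
    proof (rule is_primitive_cong[OF y1])
      show "AE x in lebesgue. x \<in> I \<longrightarrow> vector_derivative (qd1 y) (at x) = qd2 I p y x / of_real (p x)"
        using v2(2) pos(1) by eventually_elim (auto simp: pre_qd2_def)
    qed simp
    show "is_primitive I (qd2 I p y) (\<lambda>x. of_real (s x) * qd1 y x - qd3 I p s y x)"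
    proof (rule is_primitive_cong[OF y2])
      show "AE x in lebesgue. x \<in> I \<longrightarrow> vector_derivative (qd2 I p y) (at x) = of_real (s x) * qd1 y x - qd3 I p s y x"
        using v3(2) by eventually_elim (auto simp: pre_qd3_def)
    qed simp
    show "is_primitive I (qd3 I p s y) (\<lambda>x. of_real (q x) * y x - of_real (w x) * el y x)"
    proof (rule is_primitive_cong[OF y3])
      show "AE x in lebesgue. x \<in> I \<longrightarrow> vector_derivative (qd3 I p s y) (at x) = of_real (q x) * y x - of_real (w x) * el y x"
        using pos(2) by eventually_elim (auto simp: ell_def)
    qed simp
  qed
qed

text \<open>The way back from systems to the nested definitions of the quasi-derivatives. Linearity,
  conjugation and gluing are easy componentwise for systems and are transferred by this
  lemma.\<close>

lemma system_imp_quasi_diff: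
  assumes S: "system y0 y1 y2 y3 h"
  shows "qdiff y0" "\<And>x. x \<in> I \<Longrightarrow> qd1 y0 x = y1 x" "\<And>x. x \<in> I \<Longrightarrow> qd2 I p y0 x = y2 x"
    "\<And>x. x \<in> I \<Longrightarrow> qd3 I p s y0 x = y3 x" "AE x in lebesgue. x \<in> I \<longrightarrow> el y0 x = h x"
proof -
  note P = S[unfolded system_def]
  have P0: "is_primitive I y0 y1" and P1: "is_primitive I y1 (\<lambda>x. y2 x / of_real (p x))"
    and P2: "is_primitive I y2 (\<lambda>x. of_real (s x) * y1 x - y3 x)"
    and P3: "is_primitive I y3 (\<lambda>x. of_real (q x) * y0 x - of_real (w x) * h x)" using P by auto
  \<comment> \<open>\<open>y1\<close> is itself a primitive, hence continuous, so \<open>y0\<close>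
    is differentiable at every point of \<open>I\<close> and not just almost everywhere.\<close>
  have e1: "qd1 y0 x = y1 x" if "x \<in> I" for x
    unfolding qd1_def by (rule vector_derivative_at)
      (rule is_primitive_continuous_has_derivative[OF P0 I(1) is_primitive_continuous_on[OF I(1) P1] that])
  have d1: "vector_derivative (qd1 y0) (at x) = vector_derivative y1 (at x)" if "x \<in> I" for x
    by (rule vector_derivative_cong_open[OF I(1) that e1])
  have a2: "AE x in lebesgue. x \<in> I \<longrightarrow> y2 x = pre_qd2 p y0 x"
    using is_primitive_imp_vector_derivative[OF P1 I(1)] pos(1)
    by eventually_elim (auto simp: pre_qd2_def d1)
  note v2 = ac_version_eq[OF I(1) is_primitive_imp_loc_abs_cont[OF P2] a2, folded qd2_def]
  have d2: "vector_derivative (qd2 I p y0) (at x) = vector_derivative y2 (at x)" if "x \<in> I" for x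
    by (rule vector_derivative_cong_open[OF I(1) that v2(2)])
  have a3: "AE x in lebesgue. x \<in> I \<longrightarrow> y3 x = pre_qd3 I p s y0 x"
    using is_primitive_imp_vector_derivative[OF P2 I(1)]
    by eventually_elim (auto simp: pre_qd3_def d2 e1)
  note v3 = ac_version_eq[OF I(1) is_primitive_imp_loc_abs_cont[OF P3] a3, folded qd3_def]
  have d3: "vector_derivative (qd3 I p s y0) (at x) = vector_derivative y3 (at x)" if "x \<in> I" for x
    by (rule vector_derivative_cong_open[OF I(1) that v3(2)])
  show "qdiff y0" unfolding quasi_diff_def
    using is_primitive_imp_loc_abs_cont[OF P0] loc_abs_cont_cong[OF is_primitive_imp_loc_abs_cont[OF P1] e1[symmetric]] v2(1) v3(1)
    by blast
  show "qd1 y0 x = y1 x" "qd2 I p y0 x = y2 x" "qd3 I p s y0 x = y3 x" if "x \<in> I" for x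
    using e1[OF that] v2(2)[OF that] v3(2)[OF that] by auto
  show "AE x in lebesgue. x \<in> I \<longrightarrow> el y0 x = h x"
    using is_primitive_imp_vector_derivative[OF P3 I(1)] pos(2)
    by eventually_elim (auto simp: ell_def d3)
qed

lemma system_lin:
  assumes "system y0 y1 y2 y3 h" "system z0 z1 z2 z3 k"
  shows "system (\<lambda>x. y0 x + c * z0 x) (\<lambda>x. y1 x + c * z1 x) (\<lambda>x. y2 x + c * z2 x) (\<lambda>x. y3 x + c * z3 x) (\<lambda>x. h x + c * k x)"
proof -
  have P: "is_primitive I (\<lambda>x. F x + c * G x) e"
    if "is_primitive I F f" "is_primitive I G g" "\<And>x. f x + c * g x = e x" for F G f g e
    using is_primitive_add[OF that(1) is_primitive_scale[OF that(2), of c]] unfolding that(3) .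
  show ?thesis
    using assms unfolding system_def
    by (elim conjE, intro conjI; elim P) (auto simp: algebra_simps add_divide_distrib)
qed

lemma system_cnj:
  assumes "system y0 y1 y2 y3 h"
  shows "system (\<lambda>x. cnj (y0 x)) (\<lambda>x. cnj (y1 x)) (\<lambda>x. cnj (y2 x)) (\<lambda>x. cnj (y3 x)) (\<lambda>x. cnj (h x))"
proof -
  have P: "is_primitive I (\<lambda>x. cnj (F x)) r" if "is_primitive I F f" "(\<lambda>x. cnj (f x)) = r" for F f r
    using is_primitive_cnj[OF that(1)] unfolding that(2) .
  show ?thesis
    using assms unfolding system_def
    by (elim conjE, intro conjI; elim P) (auto simp: fun_eq_iff)
qed

lemma system_glue:
  assumes "system y0 y1 y2 y3 h" "system z0 z1 z2 z3 k" "y0 e = z0 e" "y1 e = z1 e" "y2 e = z2 e" "y3 e = z3 e"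
  shows "system (\<lambda>x. if x \<le> e then y0 x else z0 x) (\<lambda>x. if x \<le> e then y1 x else z1 x)
    (\<lambda>x. if x \<le> e then y2 x else z2 x) (\<lambda>x. if x \<le> e then y3 x else z3 x) (\<lambda>x. if x \<le> e then h x else k x)"
proof -
  have P: "is_primitive I (\<lambda>x. if x \<le> e then F x else G x) r"
    if "is_primitive I F f" "is_primitive I G g" "F e = G e" "(\<lambda>x. if x \<le> e then f x else g x) = r" for F G f g r
    using is_primitive_glue[OF that(1,2,3)] unfolding that(4) .
  show ?thesis
    using assms unfolding system_def
    by (elim conjE, intro conjI; elim P) (auto simp: fun_eq_iff)
qed

lemma system_cong:
  assumes "system y0 y1 y2 y3 h" "\<And>x. x \<in> I \<Longrightarrow> y0 x = z0 x" "AE x in lebesgue. x \<in> I \<longrightarrow> h x = k x"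
  shows "system z0 y1 y2 y3 k"
proof -
  note P = assms(1)[unfolded system_def]
  have "is_primitive I z0 y1" by (rule is_primitive_cong[where F = y0 and f = y1]) (use P assms(2) in auto)
  moreover have "is_primitive I y3 (\<lambda>x. of_real (q x) * z0 x - of_real (w x) * k x)"
  proof (rule is_primitive_cong)
    show "is_primitive I y3 (\<lambda>x. of_real (q x) * y0 x - of_real (w x) * h x)" using P by blast
    show "AE x in lebesgue. x \<in> I \<longrightarrow> of_real (q x) * y0 x - of_real (w x) * h x = of_real (q x) * z0 x - of_real (w x) * k x"
      using assms(3) by eventually_elim (use assms(2) in auto)
  qed simp
  ultimately show ?thesis using P unfolding system_def by blast
qed

subsection \<open>The Lagrange identity\<close>

abbreviation "br \<equiv> bracket I p s"

text \<open>In the derivative of the four products the mixed terms with y1 and y3 cancel, and the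
  terms with 1/p, s and q cancel because the coefficients are real. Only the terms with w
  remain.\<close>

theorem Lagrange_identity:
  assumes f: "qdiff f" and g: "qdiff g"
  shows "is_primitive I (br f g) (\<lambda>x. of_real (w x) * (el f x * cnj (g x) - f x * cnj (el g x)))"
proof -
  note F = quasi_diff_imp_system[OF f, unfolded system_def] and G = quasi_diff_imp_system[OF g, unfolded system_def]
  note m = is_primitive_mult[OF _ is_primitive_cnj I(1)]
  have m1: "is_primitive I (\<lambda>x. f x * cnj (qd3 I p s g x)) (\<lambda>x. qd1 f x * cnj (qd3 I p s g x) + f x * cnj (of_real (q x) * g x - of_real (w x) * el g x))"
    by (rule m) (use F G in auto)
  have m2: "is_primitive I (\<lambda>x. qd1 f x * cnj (qd2 I p g x)) (\<lambda>x. qd2 I p f x / of_real (p x) * cnj (qd2 I p g x) + qd1 f x * cnj (of_real (s x) * qd1 g x - qd3 I p s g x))"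
    by (rule m) (use F G in auto)
  have m3: "is_primitive I (\<lambda>x. qd3 I p s f x * cnj (g x)) (\<lambda>x. (of_real (q x) * f x - of_real (w x) * el f x) * cnj (g x) + qd3 I p s f x * cnj (qd1 g x))"
    by (rule m) (use F G in auto)
  have m4: "is_primitive I (\<lambda>x. qd2 I p f x * cnj (qd1 g x)) (\<lambda>x. (of_real (s x) * qd1 f x - qd3 I p s f x) * cnj (qd1 g x) + qd2 I p f x * cnj (qd2 I p g x / of_real (p x)))"
    by (rule m) (use F G in auto)
  show ?thesis
    by (rule is_primitive_cong[OF is_primitive_diff[OF is_primitive_add[OF m1 m2] is_primitive_add[OF m3 m4]]])
      (auto simp: bracket_def algebra_simps intro!: AE_I2)
qed

subsection \<open>Initial value problems\<close>

definition data :: "(real \<Rightarrow> complex) \<Rightarrow> real \<Rightarrow> complex^4" where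
  "data y x = (\<chi> i. if i = 1 then y x else if i = 2 then qd1 y x else if i = 3 then qd2 I p y x else qd3 I p s y x)"

lemma data_nth: "data y x $ 1 = y x" "data y x $ 2 = qd1 y x" "data y x $ 3 = qd2 I p y x" "data y x $ 4 = qd3 I p s y x"
  by (auto simp: data_def)

lemma data_eq_iff: "data y x = v \<longleftrightarrow> y x = v $ 1 \<and> qd1 y x = v $ 2 \<and> qd2 I p y x = v $ 3 \<and> qd3 I p s y x = v $ 4"
  by (auto simp: vec_eq_iff forall_4 data_nth)

text \<open>A nondegenerate skew-Hermitian form on the space of Cauchy data. Questions about
  brackets at an interior point become linear algebra for it.\<close>

definition form :: "complex^4 \<Rightarrow> complex^4 \<Rightarrow> complex" where
  "form u v = (u $ 1 * cnj (v $ 4) + u $ 2 * cnj (v $ 3)) - (u $ 4 * cnj (v $ 1) + u $ 3 * cnj (v $ 2))"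

lemma bracket_eq_form: "br f g x = form (data f x) (data g x)"
  by (simp add: bracket_def form_def data_nth)

definition coefficient_matrix :: "complex \<Rightarrow> real \<Rightarrow> complex^4^4" where
  "coefficient_matrix z t = (\<chi> i j.
     if i = 1 \<and> j = 2 then 1
     else if i = 2 \<and> j = 3 then of_real (1 / p t)
     else if i = 3 \<and> j = 2 then of_real (s t)
     else if i = 3 \<and> j = 4 then - 1
     else if i = 4 \<and> j = 1 then of_real (q t) - z * of_real (w t)
     else 0)"

definition inhomogeneity :: "(real \<Rightarrow> complex) \<Rightarrow> real \<Rightarrow> complex^4" where
  "inhomogeneity f t = (\<chi> i. if i = 4 then - (of_real (w t) * f t) else 0)"

lemma L1_loc_of_real: "L1_loc I f \<Longrightarrow> {c..d} \<subseteq> I \<Longrightarrow> set_integrable lebesgue {c..d} (\<lambda>t. complex_of_real (f t))"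
  unfolding L1_loc_def set_integrable_def by (simp add: scaleR_conv_of_real flip: of_real_mult)

lemma linear_system_coefficients:
  assumes f: "\<And>c d. {c..d} \<subseteq> I \<Longrightarrow> set_integrable lebesgue {c..d} (\<lambda>t. of_real (w t) * f t)"
  shows "linear_system I (coefficient_matrix z) (inhomogeneity f)"
proof
  fix c d :: real and i j :: 4 assume cd: "{c..d} \<subseteq> I"
  note ofr = coeffs[THEN L1_loc_of_real[OF _ cd]]
  have const: "set_integrable lebesgue {c..d} (\<lambda>t. k)" for k :: complex
    by (rule absolutely_integrable_continuous_real) auto
  have qw: "set_integrable lebesgue {c..d} (\<lambda>t. of_real (q t) - z * of_real (w t))"
    by (intro set_integral_diff set_integrable_mult_right ofr)
  have if_int: "set_integrable lebesgue {c..d} (\<lambda>t. if P then f t else g t)"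
    if "set_integrable lebesgue {c..d} f" "set_integrable lebesgue {c..d} g" for P and f g :: "real \<Rightarrow> complex"
    using that by (cases P) simp_all
  show "set_integrable lebesgue {c..d} (\<lambda>t. coefficient_matrix z t $ i $ j)"
    unfolding coefficient_matrix_def vec_lambda_beta by (intro if_int ofr const qw)
  have "set_integrable lebesgue {c..d} (\<lambda>t. - (of_real (w t) * f t))"
    using f[OF cd] by (simp add: set_integrable_def)
  then show "set_integrable lebesgue {c..d} (\<lambda>t. inhomogeneity f t $ i)"
    unfolding inhomogeneity_def vec_lambda_beta by (intro if_int const)
qed (use I in auto)

lemma rhs_nth:
  "(coefficient_matrix z t *v u + inhomogeneity f t) $ 1 = u $ 2"
  "(coefficient_matrix z t *v u + inhomogeneity f t) $ 2 = u $ 3 / of_real (p t)"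
  "(coefficient_matrix z t *v u + inhomogeneity f t) $ 3 = of_real (s t) * u $ 2 - u $ 4"
  "(coefficient_matrix z t *v u + inhomogeneity f t) $ 4 = of_real (q t) * u $ 1 - of_real (w t) * (z * u $ 1 + f t)"
  by (simp_all add: coefficient_matrix_def inhomogeneity_def matrix_vector_mult_def sum_4 algebra_simps)

theorem ivp_exists:
  assumes f: "\<And>c d. {c..d} \<subseteq> I \<Longrightarrow> set_integrable lebesgue {c..d} (\<lambda>t. of_real (w t) * f t)" and x0: "x0 \<in> I"
  shows "\<exists>y. qdiff y \<and> (AE x in lebesgue. x \<in> I \<longrightarrow> el y x = z * y x + f x) \<and> data y x0 = u0"
proof -
  interpret linear_system I "coefficient_matrix z" "inhomogeneity f" by (rule linear_system_coefficients[OF f])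
  obtain U where U: "solves I U" "U x0 = u0" using solves_exists[OF x0] by blast
  have P: "is_primitive I (\<lambda>x. U x $ i) (\<lambda>x. (coefficient_matrix z x *v U x + inhomogeneity f x) $ i)" for i
    using U(1) unfolding solves_def by blast
  have "system (\<lambda>x. U x $ 1) (\<lambda>x. U x $ 2) (\<lambda>x. U x $ 3) (\<lambda>x. U x $ 4) (\<lambda>x. z * U x $ 1 + f x)"
    using P[of 1] P[of 2] P[of 3] P[of 4] unfolding system_def rhs_nth by blast
  from system_imp_quasi_diff[OF this]
  show ?thesis by (intro exI[of _ "\<lambda>x. U x $ 1"]) (auto simp: data_eq_iff x0 U(2))
qed

theorem ivp_unique:
  assumes y: "qdiff y" "AE x in lebesgue. x \<in> I \<longrightarrow> el y x = z * y x"
    and x0: "x0 \<in> I" "data y x0 = 0" and x: "x \<in> I"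
  shows "data y x = 0"
proof -
  interpret linear_system I "coefficient_matrix z" "inhomogeneity (\<lambda>x. 0)"
    by (rule linear_system_coefficients) (simp add: set_integrable_def)
  have S: "system y (qd1 y) (qd2 I p y) (qd3 I p s y) (\<lambda>x. z * y x)"
    by (rule system_cong[OF quasi_diff_imp_system[OF y(1)] _ y(2)]) simp
  have P: "is_primitive I (\<lambda>x. data y x $ i) (\<lambda>x. (coefficient_matrix z x *v data y x + inhomogeneity (\<lambda>x. 0) x) $ i)" for i
    using exhaust_4[of i] S unfolding system_def by (auto simp only: rhs_nth data_nth add_0_right)
  have "continuous_on I (\<lambda>x. \<chi> i. data y x $ i)"
    by (rule continuous_on_vec_lambda) (rule is_primitive_continuous_on[OF I(1) P])
  then have "solves I (data y)" unfolding solves_def using P by simp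
  moreover have "inhomogeneity (\<lambda>x. 0) t = 0" for t by (simp add: inhomogeneity_def vec_eq_iff)
  then have "solves I (\<lambda>x. 0)" unfolding solves_def by (simp add: is_primitive_def set_integrable_def)
  ultimately show ?thesis using solves_unique[of I "data y" "\<lambda>x. 0" x0 x] I x0 x by auto
qed

end

section \<open>The weighted space and boundary values\<close>

locale weighted_expression =
  fixes a b :: ereal and p s q w :: "real \<Rightarrow> real"
  assumes ab: "a < b"
    and coeffs': "L1_loc (einterval a b) (\<lambda>x. 1 / p x)" "L1_loc (einterval a b) s" "L1_loc (einterval a b) q" "L1_loc (einterval a b) w"
    and pos': "AE x in lebesgue. x \<in> einterval a b \<longrightarrow> p x > 0" "AE x in lebesgue. x \<in> einterval a b \<longrightarrow> w x > 0"
begin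

abbreviation "II \<equiv> einterval a b"
abbreviation "M \<equiv> wmeasure (einterval a b) w"

lemma is_interval_einterval: "is_interval (einterval a b)"
  unfolding is_interval_1 einterval_def
  by (auto, metis ereal_less_eq(3) less_le_trans, metis ereal_less_eq(3) le_less_trans)

lemma quasi_expression_einterval: "quasi_expression (einterval a b) p s q w"
  by (rule quasi_expression.intro[OF open_einterval is_interval_einterval coeffs' pos'])

sublocale quasi_expression "einterval a b" p s q w
  by (rule quasi_expression_einterval)

lemma exhaust:
  "\<exists>l u :: nat \<Rightarrow> real. (\<forall>n. {l n..u n} \<subseteq> II) \<and> (\<forall>x\<in>II. \<forall>\<^sub>F n in sequentially. x \<in> {l n..u n})"
proof (rule einterval_Icc_approximation[OF ab])
  fix u l :: "nat \<Rightarrow> real"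
  assume ul: "II = (\<Union>i. {l i .. u i})" "incseq u" "decseq l" "\<And>i. l i < u i"
  have ev: "\<forall>\<^sub>F n in sequentially. x \<in> {l n..u n}" if x: "x \<in> II" for x
  proof -
    obtain i where "x \<in> {l i..u i}" using x ul(1) by blast
    then have "x \<in> {l n..u n}" if "n \<ge> i" for n
      using incseqD[OF ul(2) that] decseqD[OF ul(3) that] by auto
    then show ?thesis unfolding eventually_sequentially by blast
  qed
  have sub: "{l n..u n} \<subseteq> II" for n unfolding ul(1) by blast
  show ?thesis using sub ev by blast
qed

lemma locally_integrable_imp_measurable:
  fixes f :: "real \<Rightarrow> 'a::{banach, second_countable_topology}"
  assumes f: "\<And>c d. {c..d} \<subseteq> II \<Longrightarrow> set_integrable lebesgue {c..d} f"
  shows "f \<in> borel_measurable (lebesgue_on II)"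
proof -
  obtain l u :: "nat \<Rightarrow> real" where lu: "\<And>n. {l n..u n} \<subseteq> II" "\<And>x. x \<in> II \<Longrightarrow> \<forall>\<^sub>F n in sequentially. x \<in> {l n..u n}"
    using exhaust by blast
  show ?thesis
  proof (rule borel_measurable_LIMSEQ_metric)
    show "(\<lambda>x. indicator {l n..u n} x *\<^sub>R f x) \<in> borel_measurable (lebesgue_on II)" for n
      using f[OF lu(1)] unfolding set_integrable_def by (auto intro: measurable_restrict_space1)
    fix x assume "x \<in> space (lebesgue_on II)"
    then have "x \<in> II" by simp
    from lu(2)[OF this] have "\<forall>\<^sub>F n in sequentially. indicator {l n..u n} x *\<^sub>R f x = f x"
      by eventually_elim auto
    then show "(\<lambda>n. indicator {l n..u n} x *\<^sub>R f x) \<longlonglongrightarrow> f x" by (rule tendsto_eventually)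
  qed
qed

lemma w_measurable: "w \<in> borel_measurable (lebesgue_on II)"
  by (rule locally_integrable_imp_measurable) (use coeffs(4) in \<open>auto simp: L1_loc_def\<close>)

lemma sets_M: "sets M = sets (lebesgue_on II)" and space_M: "space M = II"
  by (auto simp: wmeasure_def)

lemma measurable_M: "borel_measurable M = borel_measurable (lebesgue_on II)"
  by (rule measurable_cong_sets) (auto simp: sets_M)

lemma open_sets_M: "A \<in> sets lebesgue \<Longrightarrow> A \<subseteq> II \<Longrightarrow> A \<in> sets M"
  unfolding sets_M using sets_restrict_space_iff[of II lebesgue A] by auto

text \<open>Since w > 0 almost everywhere, the null sets of the weighted measure are the Lebesgue
  null sets of the interval.\<close>

lemma AE_M: "(AE x in M. P x) \<longleftrightarrow> (AE x in lebesgue. x \<in> II \<longrightarrow> P x)"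
proof -
  have "(AE x in M. P x) \<longleftrightarrow> (AE x in lebesgue_on II. 0 < ennreal (w x) \<longrightarrow> P x)"
    unfolding wmeasure_def by (rule AE_density) (use w_measurable in measurable)
  also have "\<dots> \<longleftrightarrow> (AE x in lebesgue. x \<in> II \<longrightarrow> 0 < ennreal (w x) \<longrightarrow> P x)"
    by (rule AE_lebesgue_on_iff[OF I(1)])
  also have "\<dots> \<longleftrightarrow> (AE x in lebesgue. x \<in> II \<longrightarrow> P x)"
  proof
    assume "AE x in lebesgue. x \<in> II \<longrightarrow> 0 < ennreal (w x) \<longrightarrow> P x"
    with pos(2) show "AE x in lebesgue. x \<in> II \<longrightarrow> P x" by eventually_elim auto
  next
    assume "AE x in lebesgue. x \<in> II \<longrightarrow> P x"
    then show "AE x in lebesgue. x \<in> II \<longrightarrow> 0 < ennreal (w x) \<longrightarrow> P x" by eventually_elim auto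
  qed
  finally show ?thesis .
qed

lemma w_nonneg: "AE x in lebesgue_on II. 0 \<le> w x"
  unfolding AE_lebesgue_on_iff[OF I(1)] using pos(2) by eventually_elim auto

lemma integrable_M:
  fixes f :: "real \<Rightarrow> complex"
  assumes f: "f \<in> borel_measurable M" and A: "A \<in> sets lebesgue" "A \<subseteq> II"
  shows "set_integrable M A f \<longleftrightarrow> set_integrable lebesgue A (\<lambda>x. of_real (w x) * f x)"
    "(LINT x:A|M. f x) = (LINT x:A|lebesgue. of_real (w x) * f x)"
proof -
  have AI: "A \<in> sets (lebesgue_on II)" using open_sets_M[OF A] by (simp add: sets_M)
  have m: "(\<lambda>x. indicator A x *\<^sub>R f x) \<in> borel_measurable (lebesgue_on II)"
    using f AI unfolding measurable_M by measurable
  have eq: "(\<lambda>x. indicator II x *\<^sub>R (w x *\<^sub>R (indicator A x *\<^sub>R f x))) = (\<lambda>x. indicator A x *\<^sub>R (of_real (w x) * f x))"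
    using A(2) by (auto simp: fun_eq_iff indicator_def scaleR_conv_of_real)
  have II: "II \<inter> space lebesgue \<in> sets lebesgue" by simp
  show "set_integrable M A f \<longleftrightarrow> set_integrable lebesgue A (\<lambda>x. of_real (w x) * f x)"
    unfolding set_integrable_def wmeasure_def
    by (subst integrable_density[OF m w_measurable w_nonneg], subst integrable_restrict_space[OF II], subst eq) simp
  show "(LINT x:A|M. f x) = (LINT x:A|lebesgue. of_real (w x) * f x)"
    unfolding set_lebesgue_integral_def wmeasure_def
    by (subst integral_density[OF m w_measurable w_nonneg], subst integral_restrict_space[OF II], subst eq) simp
qed

lemma continuous_measurable_M: "continuous_on II f \<Longrightarrow> f \<in> borel_measurable M" for f :: "real \<Rightarrow> complex"
  unfolding measurable_M by (rule continuous_imp_measurable_on_sets_lebesgue) auto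

lemma qdiff_continuous: "qdiff y \<Longrightarrow> continuous_on II y"
  using quasi_diff_imp_system is_primitive_continuous_on[OF I(1)] unfolding system_def by blast

lemma zero_ext_measurable:
  "f \<in> borel_measurable M \<Longrightarrow> A \<in> sets M \<Longrightarrow> zero_ext A f \<in> borel_measurable M"
  unfolding zero_ext_def by (rule measurable_If_set) (auto intro: sets.Int)

lemma zero_ext_L2:
  assumes "f \<in> L2 M" "A \<in> sets M"
  shows "zero_ext A f \<in> L2 M"
  by (rule L2I_bound[OF zero_ext_measurable[OF L2D(1)[OF assms(1)] assms(2)] L2D(2)[OF assms(1)]])
    (auto simp: zero_ext_def)

lemma zero_ext_L2_mono:
  assumes "zero_ext A f \<in> L2 M" "B \<in> sets M" "B \<subseteq> A"
  shows "zero_ext B f \<in> L2 M"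
proof -
  have "zero_ext B f = zero_ext B (zero_ext A f)" using assms(3) by (auto simp: zero_ext_def fun_eq_iff)
  with zero_ext_L2[OF assms(1,2)] show ?thesis by simp
qed

lemma zero_ext_L2_Un:
  assumes "zero_ext A f \<in> L2 M" "zero_ext B f \<in> L2 M" "A \<in> sets M" "B \<in> sets M"
  shows "zero_ext (A \<union> B) f \<in> L2 M"
proof -
  have "zero_ext (A \<union> B) f = (\<lambda>x. zero_ext A f x + zero_ext (B - A) f x)" by (auto simp: zero_ext_def fun_eq_iff)
  moreover have "zero_ext (B - A) f \<in> L2 M" by (rule zero_ext_L2_mono[OF assms(2)]) (use assms in auto)
  ultimately show ?thesis using L2_add[OF assms(1)] by simp
qed

lemma continuous_zero_ext_L2:
  assumes f: "continuous_on II f" and cd: "{c..d} \<subseteq> II"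
  shows "zero_ext {c..d} f \<in> L2 M"
proof -
  have A: "{c..d} \<in> sets M" by (rule open_sets_M) (use cd in auto)
  have c: "continuous_on {c..d} f" by (rule continuous_on_subset[OF f cd])
  have fm: "f \<in> borel_measurable M" by (rule continuous_measurable_M[OF f])
  have "continuous_on II (\<lambda>x. f x * cnj (f x))" by (intro continuous_intros f)
  then have m: "(\<lambda>x. f x * cnj (f x)) \<in> borel_measurable M" by (rule continuous_measurable_M)
  have "set_integrable lebesgue {c..d} (\<lambda>x. of_real (w x) * (f x * cnj (f x)))"
    by (rule set_integrable_mult_continuous[OF L1_loc_of_real[OF coeffs(4) cd]]) (intro continuous_intros c)
  then have "set_integrable M {c..d} (\<lambda>x. f x * cnj (f x))" using integrable_M(1)[OF m _ cd] by simp
  then have i: "integrable M (\<lambda>x. norm (indicator {c..d} x *\<^sub>R (f x * cnj (f x))))"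
    unfolding set_integrable_def by (rule integrable_norm)
  show ?thesis
    by (rule L2I_bound[OF zero_ext_measurable[OF fm A] i])
      (auto simp: zero_ext_def indicator_def norm_mult power2_eq_square)
qed

text \<open>Identifies the measure of a subinterval with a restriction of \<open>M\<close>, so that
  membership in the smaller L2 space can be tested on zero extensions.\<close>

lemma restrict_M:
  assumes "open J" "J \<subseteq> II"
  shows "wmeasure J w = restrict_space M J"
proof (rule measure_eqI)
  have J: "J \<in> sets lebesgue" "J \<in> sets M" using assms open_sets_M[of J] by (auto simp: borel_open)
  have spJ: "J \<inter> space M \<in> sets M" using J by (simp add: sets.Int)
  have eqA: "A \<in> sets (restrict_space M J) \<longleftrightarrow> A \<in> sets lebesgue \<and> A \<subseteq> J" for A
  proof -
    have "A \<in> sets (restrict_space M J) \<longleftrightarrow> A \<subseteq> J \<and> A \<in> sets M" by (rule sets_restrict_space_iff[OF spJ])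
    moreover have "A \<in> sets M \<longleftrightarrow> A \<subseteq> II \<and> A \<in> sets lebesgue"
      unfolding sets_M by (rule sets_restrict_space_iff) simp
    ultimately show ?thesis using assms(2) by blast
  qed
  show "sets (wmeasure J w) = sets (restrict_space M J)"
  proof (rule set_eqI)
    fix A
    have "A \<in> sets (lebesgue_on J) \<longleftrightarrow> A \<subseteq> J \<and> A \<in> sets lebesgue"
      by (rule sets_restrict_space_iff) (use J in simp)
    then show "A \<in> sets (wmeasure J w) \<longleftrightarrow> A \<in> sets (restrict_space M J)"
      unfolding eqA by (auto simp: wmeasure_def)
  qed
  fix A assume "A \<in> sets (wmeasure J w)"
  then have A: "A \<in> sets lebesgue" "A \<subseteq> J" using J by (auto simp: wmeasure_def sets_restrict_space_iff)
  have wJ: "w \<in> borel_measurable (lebesgue_on J)"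
    using measurable_restrict_mono[OF w_measurable assms(2)] .
  have "emeasure (wmeasure J w) A = (\<integral>\<^sup>+x. ennreal (w x) * indicator A x \<partial>lebesgue_on J)"
    unfolding wmeasure_def by (rule emeasure_density) (use wJ A J in \<open>auto simp: sets_restrict_space_iff\<close>)
  also have "\<dots> = (\<integral>\<^sup>+x. ennreal (w x) * indicator A x * indicator J x \<partial>lebesgue)"
    by (rule nn_integral_restrict_space) (use J in auto)
  also have "\<dots> = (\<integral>\<^sup>+x. ennreal (w x) * indicator A x * indicator II x \<partial>lebesgue)"
    by (rule nn_integral_cong) (use A assms(2) in \<open>auto simp: indicator_def\<close>)
  also have "\<dots> = (\<integral>\<^sup>+x. ennreal (w x) * indicator A x \<partial>lebesgue_on II)"
    by (rule nn_integral_restrict_space[symmetric]) auto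
  also have "\<dots> = emeasure M A"
    unfolding wmeasure_def
    by (rule emeasure_density[symmetric]) (use w_measurable A assms(2) in \<open>auto simp: sets_restrict_space_iff\<close>)
  also have "\<dots> = emeasure (restrict_space M J) A"
    using A spJ J(2) by (intro emeasure_restrict_space[symmetric]) auto
  finally show "emeasure (wmeasure J w) A = emeasure (restrict_space M J) A" .
qed

lemma L2_wmeasure_iff:
  assumes J: "open J" "J \<subseteq> II"
  shows "f \<in> L2 (wmeasure J w) \<longleftrightarrow> zero_ext J f \<in> L2 M"
proof -
  have JM: "J \<inter> space M \<in> sets M" using open_sets_M[of J] J by (auto simp: borel_open space_M Int_absorb2)
  have "f \<in> borel_measurable (restrict_space M J) \<longleftrightarrow> zero_ext J f \<in> borel_measurable M"
    unfolding zero_ext_def using measurable_restrict_space_iff[OF JM, of 0 borel f] by simp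
  moreover have "(\<lambda>x. indicat_real J x *\<^sub>R (norm (f x))\<^sup>2) = (\<lambda>x. (norm (zero_ext J f x))\<^sup>2)"
    by (auto simp: zero_ext_def fun_eq_iff indicator_def)
  ultimately show ?thesis
    unfolding L2_def restrict_M[OF J] by (simp add: integrable_restrict_space[OF JM])
qed

lemma emeasure_M_Icc_finite:
  assumes cd: "{c..d} \<subseteq> II"
  shows "emeasure M {c..d} < \<infinity>"
proof -
  have A: "{c..d} \<in> sets M" by (rule open_sets_M) (use cd in auto)
  have "zero_ext {c..d} (\<lambda>x. 1) \<in> L2 M" by (rule continuous_zero_ext_L2[OF _ cd]) simp
  moreover have "(\<lambda>x. (norm (zero_ext {c..d} (\<lambda>x. 1) x))\<^sup>2) = indicat_real {c..d}"
    by (auto simp: zero_ext_def fun_eq_iff indicator_def)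
  ultimately have "integrable M (indicat_real {c..d})" unfolding L2_def by simp
  then have "emeasure M ({c..d} \<inter> space M) < \<infinity>" by (simp add: integrable_indicator_iff)
  then show ?thesis using cd by (simp add: space_M Int_absorb2)
qed

lemma sigma_finite_M: "sigma_finite_measure M"
proof
  obtain l u :: "nat \<Rightarrow> real" where lu: "\<And>n. {l n..u n} \<subseteq> II" "\<And>x. x \<in> II \<Longrightarrow> \<forall>\<^sub>F n in sequentially. x \<in> {l n..u n}"
    using exhaust by blast
  show "\<exists>A. countable A \<and> A \<subseteq> sets M \<and> \<Union>A = space M \<and> (\<forall>a\<in>A. emeasure M a \<noteq> \<infinity>)"
  proof (intro exI[of _ "range (\<lambda>n. {l n..u n})"] conjI)
    show "range (\<lambda>n. {l n..u n}) \<subseteq> sets M" using lu(1) by (auto intro!: open_sets_M)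
    show "\<Union>(range (\<lambda>n. {l n..u n})) = space M"
    proof
      show "\<Union>(range (\<lambda>n. {l n..u n})) \<subseteq> space M" using lu(1) by (auto simp: space_M)
      show "space M \<subseteq> \<Union>(range (\<lambda>n. {l n..u n}))"
      proof
        fix x assume "x \<in> space M"
        then have "\<forall>\<^sub>F n in sequentially. x \<in> {l n..u n}" using lu(2)[of x] by (simp add: space_M)
        then obtain n where "x \<in> {l n..u n}" unfolding eventually_sequentially by blast
        then show "x \<in> \<Union>(range (\<lambda>n. {l n..u n}))" by blast
      qed
    qed
    show "\<forall>a\<in>range (\<lambda>n. {l n..u n}). emeasure M a \<noteq> \<infinity>" using emeasure_M_Icc_finite[OF lu(1)] by (auto simp: less_top)
  qed simp
qed

lemma Lagrange_integral:
  assumes f: "qdiff f" and g: "qdiff g" and cd: "c \<le> d" "{c..d} \<subseteq> II"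
    and m: "(\<lambda>x. el f x * cnj (g x) - f x * cnj (el g x)) \<in> borel_measurable M"
  shows "(LINT x:{c..d}|M. el f x * cnj (g x) - f x * cnj (el g x)) = br f g d - br f g c"
  using is_primitiveD(2)[OF Lagrange_identity[OF f g] cd(2,1)] integrable_M(2)[OF m _ cd(2)] by simp

end

section \<open>Restriction and patching\<close>

context quasi_expression
begin

lemma restrict_expression:
  assumes "open J" "is_interval J" "J \<subseteq> I"
  shows "quasi_expression J p s q w"
proof
  have "L1_loc J f" if "L1_loc I f" for f using that assms(3) unfolding L1_loc_def by blast
  then show "L1_loc J (\<lambda>x. 1 / p x)" "L1_loc J s" "L1_loc J q" "L1_loc J w" using coeffs by blast+
  show "AE x in lebesgue. x \<in> J \<longrightarrow> p x > 0" using pos(1) by eventually_elim (use assms(3) in blast)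
  show "AE x in lebesgue. x \<in> J \<longrightarrow> w x > 0" using pos(2) by eventually_elim (use assms(3) in blast)
qed (use assms in auto)

text \<open>\<open>qd2\<close> and \<open>qd3\<close> depend on the interval through a choice of
  version. The system on the larger interval restricts, and its uniqueness shows that the
  quasi-derivatives restrict too.\<close>

lemma restrict_quasi_diff:
  assumes J: "open J" "is_interval J" "J \<subseteq> I" and y: "qdiff y"
  shows "quasi_diff J p s y" "\<And>x. x \<in> J \<Longrightarrow> qd2 J p y x = qd2 I p y x" "\<And>x. x \<in> J \<Longrightarrow> qd3 J p s y x = qd3 I p s y x"
    "AE x in lebesgue. x \<in> J \<longrightarrow> ell J p s q w y x = el y x"
proof -
  interpret J: quasi_expression J p s q w by (rule restrict_expression[OF J])
  have "J.system y (qd1 y) (qd2 I p y) (qd3 I p s y) (el y)"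
    using quasi_diff_imp_system[OF y] is_primitive_subset[OF _ J(3)] unfolding system_def J.system_def by blast
  note * = J.system_imp_quasi_diff[OF this]
  show "quasi_diff J p s y" "\<And>x. x \<in> J \<Longrightarrow> qd2 J p y x = qd2 I p y x" "\<And>x. x \<in> J \<Longrightarrow> qd3 J p s y x = qd3 I p s y x"
    "AE x in lebesgue. x \<in> J \<longrightarrow> ell J p s q w y x = el y x"
    using *(1,3,4,5) by blast+
qed

lemma restrict_bracket:
  assumes J: "open J" "is_interval J" "J \<subseteq> I" and f: "qdiff f" and g: "qdiff g" and x: "x \<in> J"
  shows "bracket J p s f g x = br f g x"
  unfolding bracket_def using restrict_quasi_diff(2,3)[OF J f x] restrict_quasi_diff(2,3)[OF J g x] by simp

lemma quasi_diff_cong_on: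
  assumes J: "open J" "is_interval J" "J \<subseteq> I" and y: "quasi_diff J p s y" and eq: "\<And>x. x \<in> J \<Longrightarrow> y x = z x"
  shows "quasi_diff J p s z" "\<And>x. x \<in> J \<Longrightarrow> qd1 z x = qd1 y x" "\<And>x. x \<in> J \<Longrightarrow> qd2 J p z x = qd2 J p y x"
    "\<And>x. x \<in> J \<Longrightarrow> qd3 J p s z x = qd3 J p s y x" "AE x in lebesgue. x \<in> J \<longrightarrow> ell J p s q w z x = ell J p s q w y x"
proof -
  interpret J: quasi_expression J p s q w by (rule restrict_expression[OF J])
  have "J.system z (qd1 y) (qd2 J p y) (qd3 J p s y) (ell J p s q w y)"
    by (rule J.system_cong[OF J.quasi_diff_imp_system[OF y] eq]) auto
  note * = J.system_imp_quasi_diff[OF this]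
  show "quasi_diff J p s z" "\<And>x. x \<in> J \<Longrightarrow> qd1 z x = qd1 y x" "\<And>x. x \<in> J \<Longrightarrow> qd2 J p z x = qd2 J p y x"
    "\<And>x. x \<in> J \<Longrightarrow> qd3 J p s z x = qd3 J p s y x" "AE x in lebesgue. x \<in> J \<longrightarrow> ell J p s q w z x = ell J p s q w y x"
    using * by blast+
qed

lemma local_eq:
  assumes J: "open J" "is_interval J" "J \<subseteq> I" and y: "qdiff y" and z: "qdiff z" and eq: "\<And>x. x \<in> J \<Longrightarrow> y x = z x"
  shows "\<And>x. x \<in> J \<Longrightarrow> data z x = data y x" "AE x in lebesgue. x \<in> J \<longrightarrow> el z x = el y x"
proof -
  note ry = restrict_quasi_diff[OF J y] and rz = restrict_quasi_diff[OF J z]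
  have c: "qd1 z x = qd1 y x" "qd2 J p z x = qd2 J p y x" "qd3 J p s z x = qd3 J p s y x" if "x \<in> J" for x
    by (rule quasi_diff_cong_on(2-4)[OF J ry(1)]; use eq that in simp)+
  have c5: "AE x in lebesgue. x \<in> J \<longrightarrow> ell J p s q w z x = ell J p s q w y x"
    by (rule quasi_diff_cong_on(5)[OF J ry(1)]) (rule eq)
  show "data z x = data y x" if "x \<in> J" for x
    using ry(2,3)[OF that] rz(2,3)[OF that] c[OF that] eq[OF that] by (simp add: data_eq_iff data_nth)
  show "AE x in lebesgue. x \<in> J \<longrightarrow> el z x = el y x"
    using ry(4) rz(4) c5 by eventually_elim auto
qed

lemma qdiff_lin:
  assumes y: "qdiff y" and z: "qdiff z"
  shows "qdiff (\<lambda>x. y x + k * z x)" "\<And>x. x \<in> I \<Longrightarrow> data (\<lambda>x. y x + k * z x) x = data y x + k *s data z x"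
    "AE x in lebesgue. x \<in> I \<longrightarrow> el (\<lambda>x. y x + k * z x) x = el y x + k * el z x"
proof -
  note * = system_imp_quasi_diff[OF system_lin[OF quasi_diff_imp_system[OF y] quasi_diff_imp_system[OF z], of k]]
  show "qdiff (\<lambda>x. y x + k * z x)" "AE x in lebesgue. x \<in> I \<longrightarrow> el (\<lambda>x. y x + k * z x) x = el y x + k * el z x"
    using *(1,5) by auto
  show "data (\<lambda>x. y x + k * z x) x = data y x + k *s data z x" if "x \<in> I" for x
    using *(2,3,4)[OF that] by (simp add: data_eq_iff data_nth)
qed

lemma qdiff_zero: "qdiff (\<lambda>x. 0)" "\<And>x. x \<in> I \<Longrightarrow> data (\<lambda>x. 0) x = 0" "AE x in lebesgue. x \<in> I \<longrightarrow> el (\<lambda>x. 0) x = 0"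
proof -
  have "system (\<lambda>x. 0) (\<lambda>x. 0) (\<lambda>x. 0) (\<lambda>x. 0) (\<lambda>x. 0)"
    unfolding system_def is_primitive_def by (simp add: set_integrable_def)
  note * = system_imp_quasi_diff[OF this]
  show "qdiff (\<lambda>x. 0)" "AE x in lebesgue. x \<in> I \<longrightarrow> el (\<lambda>x. 0) x = 0" using *(1,5) by auto
  show "data (\<lambda>x. 0) x = 0" if "x \<in> I" for x using *(2,3,4)[OF that] by (simp add: data_eq_iff)
qed

lemma qdiff_cnj:
  assumes y: "qdiff y"
  shows "qdiff (\<lambda>x. cnj (y x))" "AE x in lebesgue. x \<in> I \<longrightarrow> el (\<lambda>x. cnj (y x)) x = cnj (el y x)"
  using system_imp_quasi_diff(1,5)[OF system_cnj[OF quasi_diff_imp_system[OF y]]] by auto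

lemma qdiff_glue:
  assumes y: "qdiff y" and z: "qdiff z" and eq: "data y e = data z e"
  shows "qdiff (\<lambda>x. if x \<le> e then y x else z x)"
    "\<And>x. x \<in> I \<Longrightarrow> data (\<lambda>x. if x \<le> e then y x else z x) x = (if x \<le> e then data y x else data z x)"
    "AE x in lebesgue. x \<in> I \<longrightarrow> el (\<lambda>x. if x \<le> e then y x else z x) x = (if x \<le> e then el y x else el z x)"
proof -
  have e: "y e = z e" "qd1 y e = qd1 z e" "qd2 I p y e = qd2 I p z e" "qd3 I p s y e = qd3 I p s z e"
    using eq by (auto simp: data_eq_iff data_nth)
  note * = system_imp_quasi_diff[OF system_glue[OF quasi_diff_imp_system[OF y] quasi_diff_imp_system[OF z] e]]
  show "qdiff (\<lambda>x. if x \<le> e then y x else z x)"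
    "AE x in lebesgue. x \<in> I \<longrightarrow> el (\<lambda>x. if x \<le> e then y x else z x) x = (if x \<le> e then el y x else el z x)"
    using *(1,5) by auto
  show "data (\<lambda>x. if x \<le> e then y x else z x) x = (if x \<le> e then data y x else data z x)" if "x \<in> I" for x
    using *(2,3,4)[OF that] by (simp add: data_eq_iff data_nth)
qed

definition Sol :: "complex \<Rightarrow> (real \<Rightarrow> complex) set" where
  "Sol z = {y. qdiff y \<and> (AE x in lebesgue. x \<in> I \<longrightarrow> el y x = z * y x)}"

lemma SolD: "y \<in> Sol z \<Longrightarrow> qdiff y" "y \<in> Sol z \<Longrightarrow> AE x in lebesgue. x \<in> I \<longrightarrow> el y x = z * y x"
  by (auto simp: Sol_def)

lemma Sol_lin: assumes "y \<in> Sol z" "y' \<in> Sol z" shows "(\<lambda>x. y x + k * y' x) \<in> Sol z"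
proof -
  have "AE x in lebesgue. x \<in> I \<longrightarrow> el (\<lambda>x. y x + k * y' x) x = z * (y x + k * y' x)"
    using qdiff_lin(3)[OF SolD(1)[OF assms(1)] SolD(1)[OF assms(2)], of k] SolD(2)[OF assms(1)] SolD(2)[OF assms(2)]
    by eventually_elim (auto simp: algebra_simps)
  with qdiff_lin(1)[OF SolD(1)[OF assms(1)] SolD(1)[OF assms(2)]] show ?thesis by (simp add: Sol_def)
qed

lemma Sol_zero: "(\<lambda>x. 0) \<in> Sol z"
  using qdiff_zero(1,3) by (simp add: Sol_def)

lemma Sol_exists: "x0 \<in> I \<Longrightarrow> \<exists>y\<in>Sol z. data y x0 = u0"
  using ivp_exists[of "\<lambda>x. 0" x0 z u0] by (auto simp: Sol_def set_integrable_def)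

lemma Sol_unique: "y \<in> Sol z \<Longrightarrow> x0 \<in> I \<Longrightarrow> data y x0 = 0 \<Longrightarrow> x \<in> I \<Longrightarrow> data y x = 0"
  using ivp_unique by (auto simp: Sol_def)

lemma Sol_cnj: assumes "y \<in> Sol z" shows "(\<lambda>x. cnj (y x)) \<in> Sol (cnj z)"
proof -
  have "AE x in lebesgue. x \<in> I \<longrightarrow> el (\<lambda>x. cnj (y x)) x = cnj z * cnj (y x)"
    using qdiff_cnj(2)[OF SolD(1)[OF assms]] SolD(2)[OF assms] by eventually_elim auto
  with qdiff_cnj(1)[OF SolD(1)[OF assms]] show ?thesis by (simp add: Sol_def)
qed

definition fundamental :: "complex \<Rightarrow> real \<Rightarrow> 4 \<Rightarrow> real \<Rightarrow> complex" where
  "fundamental z x0 k = (SOME y. y \<in> Sol z \<and> data y x0 = axis k 1)"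

lemma fundamental: "x0 \<in> I \<Longrightarrow> fundamental z x0 k \<in> Sol z" "x0 \<in> I \<Longrightarrow> data (fundamental z x0 k) x0 = axis k 1"
proof -
  assume "x0 \<in> I"
  then have "\<exists>y. y \<in> Sol z \<and> data y x0 = axis k 1" using Sol_exists by blast
  from someI_ex[OF this] show "fundamental z x0 k \<in> Sol z" "data (fundamental z x0 k) x0 = axis k 1"
    unfolding fundamental_def by auto
qed

lemma Sol_comb:
  fixes e :: "4 \<Rightarrow> real \<Rightarrow> complex"
  assumes "\<And>k. e k \<in> Sol z"
  shows "(\<lambda>x. \<Sum>k\<in>UNIV. c k * e k x) \<in> Sol z" "x \<in> I \<Longrightarrow> data (\<lambda>x. \<Sum>k\<in>UNIV. c k * e k x) x = (\<Sum>k\<in>UNIV. c k *s data (e k) x)"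
proof -
  have "(\<lambda>x. \<Sum>k\<in>A. c k * e k x) \<in> Sol z \<and> (\<forall>x\<in>I. data (\<lambda>x. \<Sum>k\<in>A. c k * e k x) x = (\<Sum>k\<in>A. c k *s data (e k) x))" for A
  proof (induction A rule: infinite_finite_induct)
    case (insert k A)
    then have IH: "(\<lambda>x. \<Sum>k\<in>A. c k * e k x) \<in> Sol z" by blast
    have eq: "(\<lambda>x. \<Sum>k\<in>insert k A. c k * e k x) = (\<lambda>x. (\<Sum>k\<in>A. c k * e k x) + c k * e k x)"
      using insert by (simp add: add.commute)
    show ?case unfolding eq using Sol_lin[OF IH assms, of "c k" k] qdiff_lin(2)[OF SolD(1)[OF IH] SolD(1)[OF assms], of _ "c k" k] insert
      by (simp add: add.commute)
  qed (use Sol_zero qdiff_zero in auto)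
  then show "(\<lambda>x. \<Sum>k\<in>UNIV. c k * e k x) \<in> Sol z" "x \<in> I \<Longrightarrow> data (\<lambda>x. \<Sum>k\<in>UNIV. c k * e k x) x = (\<Sum>k\<in>UNIV. c k *s data (e k) x)"
    by blast+
qed

lemma sum_axis: "(\<Sum>k\<in>UNIV. c k *s axis k 1) = (\<chi> k. c k)" for c :: "4 \<Rightarrow> complex"
  by (simp add: vec_eq_iff axis_def forall_4 sum_4)

lemma Sol_eq_on:
  assumes "y \<in> Sol z" "y' \<in> Sol z" "x0 \<in> I" "data y x0 = data y' x0" "x \<in> I"
  shows "data y x = data y' x" "y x = y' x"
proof -
  have d: "data (\<lambda>x. y x + (-1) * y' x) x = data y x - data y' x" if "x \<in> I" for x
    using qdiff_lin(2)[OF SolD(1)[OF assms(1)] SolD(1)[OF assms(2)] that, of "-1"] by (simp add: vec_eq_iff)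
  have "data (\<lambda>x. y x + (-1) * y' x) x = 0"
    by (rule Sol_unique[OF Sol_lin[OF assms(1,2), of "-1"] assms(3) _ assms(5)]) (use d[OF assms(3)] assms(4) in simp)
  then show "data y x = data y' x" using d[OF assms(5)] by simp
  then show "y x = y' x" by (metis data_nth(1))
qed

lemma Sol_expand:
  assumes y: "y \<in> Sol z" and x0: "x0 \<in> I" and x: "x \<in> I"
  shows "y x = (\<Sum>k\<in>UNIV. data y x0 $ k * fundamental z x0 k x)"
proof (rule Sol_eq_on(2)[OF y Sol_comb(1) x0 _ x])
  show "fundamental z x0 k \<in> Sol z" for k by (rule fundamental(1)[OF x0])
  show "data y x0 = data (\<lambda>x. \<Sum>k\<in>UNIV. data y x0 $ k * fundamental z x0 k x) x0"
    by (subst Sol_comb(2)[OF fundamental(1)[OF x0] x0]) (simp add: fundamental(2)[OF x0] sum_axis)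
qed

subsection \<open>The pairing between solutions for \<open>z\<close> and \<open>cnj z\<close>\<close>

lemma form_lin_left: "form (u + k *s v) t = form u t + k * form v t"
  by (simp add: form_def algebra_simps)

lemma form_lin_right: "form t (u + k *s v) = form t u + cnj k * form t v"
  by (simp add: form_def algebra_simps)

lemma form_commute: "form v u = - cnj (form u v)"
  by (simp add: form_def algebra_simps)

lemma form_axis: "form u (axis 4 1) = u $ 1" "form u (axis 3 1) = u $ 2" "form u (axis 2 1) = - u $ 3" "form u (axis 1 1) = - u $ 4"
  by (simp_all add: form_def axis_def)

text \<open>For the parameters z and cnj z the two terms of the Lagrange density coincide.\<close>

lemma bracket_Sol_constant:
  assumes f: "f \<in> Sol z" and g: "g \<in> Sol (cnj z)" and xy: "x \<in> I" "y \<in> I"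
  shows "br f g x = br f g y"
proof (rule is_primitive_zero_imp_constant[OF Lagrange_identity[OF SolD(1)[OF f] SolD(1)[OF g]] _ I(2) xy])
  show "AE x in lebesgue. x \<in> I \<longrightarrow> of_real (w x) * (el f x * cnj (g x) - f x * cnj (el g x)) = 0"
    using SolD(2)[OF f] SolD(2)[OF g] by eventually_elim auto
qed

text \<open>\<open>dual_fundamental\<close> is the basis of \<open>Sol z\<close> dual to \<open>fundamental (cnj z)\<close> with respect to the bracket.\<close>

definition dual_vector :: "4 \<Rightarrow> complex^4" where
  "dual_vector k = (if k = 1 then - axis 4 1 else if k = 2 then - axis 3 1 else if k = 3 then axis 2 1 else axis 1 1)"

definition dual_fundamental :: "complex \<Rightarrow> real \<Rightarrow> 4 \<Rightarrow> real \<Rightarrow> complex" where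
  "dual_fundamental z x0 k = (SOME y. y \<in> Sol z \<and> data y x0 = dual_vector k)"

lemma dual_fundamental: "x0 \<in> I \<Longrightarrow> dual_fundamental z x0 k \<in> Sol z" "x0 \<in> I \<Longrightarrow> data (dual_fundamental z x0 k) x0 = dual_vector k"
proof -
  assume "x0 \<in> I"
  then have "\<exists>y. y \<in> Sol z \<and> data y x0 = dual_vector k" using Sol_exists by blast
  from someI_ex[OF this] show "dual_fundamental z x0 k \<in> Sol z" "data (dual_fundamental z x0 k) x0 = dual_vector k"
    unfolding dual_fundamental_def by auto
qed

lemma dual_expand_vector: "u = (\<Sum>k\<in>UNIV. form u (axis k 1) *s dual_vector k)"
  unfolding sum_4 form_axis by (simp add: vec_eq_iff forall_4 dual_vector_def axis_def)

text \<open>Variation of constants in bracket form, valid for an arbitrary function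
  \<open>y\<close>. At a given x, replace \<open>y\<close> by the solution \<open>u\<close> with the
  same data; the brackets of \<open>u\<close> with solutions for cnj z are constant, so they are the
  coefficients of \<open>u\<close> read off at x0.\<close>

theorem dual_expansion:
  assumes x0: "x0 \<in> I" and x: "x \<in> I"
  shows "data y x = (\<Sum>k\<in>UNIV. br y (fundamental (cnj z) x0 k) x *s data (dual_fundamental z x0 k) x)"
proof -
  obtain u where u: "u \<in> Sol z" "data u x = data y x" using Sol_exists[OF x] by blast
  have c: "br y (fundamental (cnj z) x0 k) x = form (data u x0) (axis k 1)" for k
  proof -
    have "br y (fundamental (cnj z) x0 k) x = br u (fundamental (cnj z) x0 k) x" by (simp add: bracket_eq_form u(2))
    also have "\<dots> = br u (fundamental (cnj z) x0 k) x0"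
      by (rule bracket_Sol_constant[OF u(1) fundamental(1)[OF x0] x x0])
    finally show ?thesis by (simp add: bracket_eq_form fundamental(2)[OF x0])
  qed
  let ?e = "dual_fundamental z x0" and ?c = "\<lambda>k. form (data u x0) (axis k 1)"
  have "data u x = data (\<lambda>x. \<Sum>k\<in>UNIV. ?c k * ?e k x) x"
  proof (rule Sol_eq_on(1)[OF u(1) Sol_comb(1) x0 _ x])
    show "?e k \<in> Sol z" for k by (rule dual_fundamental(1)[OF x0])
    show "data u x0 = data (\<lambda>x. \<Sum>k\<in>UNIV. ?c k * ?e k x) x0"
      by (subst Sol_comb(2)[OF dual_fundamental(1)[OF x0] x0], subst dual_fundamental(2)[OF x0]) (rule dual_expand_vector)
  qed
  also have "\<dots> = (\<Sum>k\<in>UNIV. ?c k *s data (?e k) x)"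
    by (rule Sol_comb(2)[OF dual_fundamental(1)[OF x0] x])
  finally show ?thesis unfolding u(2) c .
qed

end

context weighted_expression
begin

lemma Sol_zero_on_subinterval:
  assumes y: "y \<in> Sol z" and cd: "c < d" "{c..d} \<subseteq> II" and ae: "AE x in lebesgue. x \<in> {c..d} \<longrightarrow> y x = 0" and x: "x \<in> II"
  shows "data y x = 0"
proof -
  have J: "open {c<..<d}" "is_interval {c<..<d}" "{c<..<d} \<subseteq> II" using cd by auto
  have y0: "y t = 0" if "t \<in> {c<..<d}" for t
  proof (rule continuous_on_AE_eq[OF J(1) _ _ _ that])
    show "continuous_on {c<..<d} y" by (rule continuous_on_subset[OF qdiff_continuous[OF SolD(1)[OF y]] J(3)])
    show "AE x in lebesgue. x \<in> {c<..<d} \<longrightarrow> y x = 0" using ae by eventually_elim auto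
  qed simp
  obtain m where m: "c < m" "m < d" using dense[OF cd(1)] by blast
  then have mI: "m \<in> II" and mJ: "m \<in> {c<..<d}" using J(3) by auto
  have "data y m = data (\<lambda>x. 0) m"
    by (rule local_eq(1)[OF J qdiff_zero(1) SolD(1)[OF y] _ mJ]) (simp add: y0)
  then have "data y m = 0" using qdiff_zero(2)[OF mI] by simp
  then show ?thesis by (rule Sol_unique[OF y mI _ x])
qed

text \<open>Naimark's patching lemma: arbitrary Cauchy data at both ends of [c, d] are joined by a
  function with continuous \<open>ell\<close>. The right-hand side is sought among the combinations
  of four solutions of ell \<eta> = 0.\<close>

lemma control:
  assumes cd: "c < d" "{c..d} \<subseteq> II"
  shows "\<exists>z h. qdiff z \<and> continuous_on II h \<and> (AE x in lebesgue. x \<in> II \<longrightarrow> el z x = h x) \<and> data z c = u \<and> data z d = v"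
proof -
  have cI: "c \<in> II" and dI: "d \<in> II" using cd by auto
  define \<eta> where "\<eta> = fundamental 0 d"
  have \<eta>: "\<eta> k \<in> Sol 0" "data (\<eta> k) d = axis k 1" for k unfolding \<eta>_def using fundamental[OF dI] by auto
  have \<eta>c: "continuous_on II (\<eta> k)" for k using qdiff_continuous SolD(1)[OF \<eta>(1)] .
  define N where "N k = zero_ext {c..d} (\<eta> k)" for k
  have N: "N k \<in> L2 M" for k unfolding N_def by (rule continuous_zero_ext_L2[OF \<eta>c cd(2)])
  \<comment> \<open>Gram matrix of these solutions on [c, d]. A null vector would give a combination
    that vanishes on [c, d], hence identically by unique continuation.\<close>
  define G :: "complex^4^4" where "G = (\<chi> k l. ip M (N l) (N k))"
  have Gx: "(G *v x) $ k = ip M (\<lambda>t. \<Sum>l\<in>UNIV. x $ l * N l t) (N k)" for x k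
    using N by (simp add: G_def matrix_vector_mult_def sum_4 ip_add_left L2_add L2_scale ip_scale_left mult.commute)
  have inj: "x = 0" if "G *v x = 0" for x
  proof -
    let ?S = "\<lambda>t. \<Sum>l\<in>UNIV. x $ l * N l t"
    have S: "?S \<in> L2 M" by (intro L2_sum L2_scale N)
    have "ip M ?S ?S = (\<Sum>k\<in>UNIV. cnj (x $ k) * ip M ?S (N k))"
      using N S unfolding sum_4 by (simp add: ip_add_right L2_add L2_scale ip_scale_right)
    also have "\<dots> = 0" using that by (simp flip: Gx)
    finally have "l2norm M ?S = 0" by (simp add: ip_self)
    then have "AE t in M. ?S t = 0" by (rule l2norm_eq_0_AE[OF S])
    then have "AE t in lebesgue. t \<in> {c..d} \<longrightarrow> (\<Sum>l\<in>UNIV. x $ l * \<eta> l t) = 0"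
      unfolding AE_M by eventually_elim (use cd(2) in \<open>auto simp: N_def zero_ext_def\<close>)
    then have "data (\<lambda>t. \<Sum>l\<in>UNIV. x $ l * \<eta> l t) d = 0"
      by (rule Sol_zero_on_subinterval[OF Sol_comb(1)[OF \<eta>(1)] cd _ dI])
    then show "x = 0" unfolding Sol_comb(2)[OF \<eta>(1) dI] \<eta>(2) sum_axis by (simp add: vec_eq_iff)
  qed
  have lin: "linear (\<lambda>x. G *v x)"
  proof (rule linearI)
    show "G *v (x + y) = G *v x + G *v y" for x y by (rule matrix_vector_right_distrib)
    show "G *v (r *\<^sub>R x) = r *\<^sub>R (G *v x)" for r x by (simp add: vec_eq_iff matrix_vector_mult_def scaleR_sum_right)
  qed
  have "inj (\<lambda>x. G *v x)" using linear_injective_0[OF lin] inj by blast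
  then have "surj (\<lambda>x. G *v x)" using linear_injective_imp_surjective[OF lin] by blast
  obtain z0 where z0: "z0 \<in> Sol 0" "data z0 c = u" using Sol_exists[OF cI] by blast
  \<comment> \<open>The moments of the right-hand side against the \<open>\<eta> k\<close> must
    supply the difference between the target \<open>v\<close> and the data at \<open>d\<close> of
    the homogeneous solution \<open>z0\<close>.\<close>
  obtain x where x: "G *v x = (\<chi> k. form (v - data z0 d) (axis k 1))" using \<open>surj (\<lambda>x. G *v x)\<close> by (metis surjD)
  define h where "h t = (\<Sum>l\<in>UNIV. x $ l * \<eta> l t)" for t
  have hc: "continuous_on II h" unfolding h_def by (intro continuous_intros \<eta>c)
  have hi: "set_integrable lebesgue {c'..d'} (\<lambda>t. of_real (w t) * h t)" if "{c'..d'} \<subseteq> II" for c' d'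
    by (rule set_integrable_mult_continuous[OF L1_loc_of_real[OF coeffs(4) that] continuous_on_subset[OF hc that]])
  obtain z where z: "qdiff z" "AE x in lebesgue. x \<in> II \<longrightarrow> el z x = 0 * z x + h x" "data z c = u"
    using ivp_exists[OF hi cI, of 0 u] by blast
  have z': "AE x in lebesgue. x \<in> II \<longrightarrow> el z x = h x" using z(2) by simp
  \<comment> \<open>Since ell vanishes on \<open>\<eta> k\<close>, the increment of the bracket is a
    moment of \<open>h\<close>, that is, a component of \<open>G *v x\<close>.\<close>
  have br_eq: "br z (\<eta> k) d - br z (\<eta> k) c = (G *v x) $ k" for k
  proof -
    have "continuous_on II (\<lambda>t. h t * cnj (\<eta> k t))" by (intro continuous_intros hc \<eta>c)
    then have m: "(\<lambda>t. h t * cnj (\<eta> k t)) \<in> borel_measurable M" by (rule continuous_measurable_M)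
    have "is_primitive II (br z (\<eta> k)) (\<lambda>t. of_real (w t) * (h t * cnj (\<eta> k t)))"
    proof (rule is_primitive_cong[OF Lagrange_identity[OF z(1) SolD(1)[OF \<eta>(1)[of k]]]])
      show "AE t in lebesgue. t \<in> II \<longrightarrow> of_real (w t) * (el z t * cnj (\<eta> k t) - z t * cnj (el (\<eta> k) t)) = of_real (w t) * (h t * cnj (\<eta> k t))"
        using z' SolD(2)[OF \<eta>(1)[of k]] by eventually_elim auto
    qed simp
    from is_primitiveD(2)[OF this cd(2)] cd(1)
    have "br z (\<eta> k) d - br z (\<eta> k) c = (LINT t:{c..d}|lebesgue. of_real (w t) * (h t * cnj (\<eta> k t)))" by simp
    also have "\<dots> = (LINT t:{c..d}|M. h t * cnj (\<eta> k t))" by (rule integrable_M(2)[symmetric, OF m _ cd(2)]) simp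
    also have "\<dots> = ip M (\<lambda>t. \<Sum>l\<in>UNIV. x $ l * N l t) (N k)"
      unfolding ip_def set_lebesgue_integral_def
      by (rule Bochner_Integration.integral_cong[OF refl]) (auto simp: N_def h_def zero_ext_def indicator_def)
    finally show ?thesis by (simp add: Gx)
  qed
  have br_eq0: "br z0 (\<eta> k) d = br z0 (\<eta> k) c" for k
    by (rule bracket_Sol_constant[of z0 0]) (use z0(1) \<eta>(1) cI dI in auto)
  have bc: "br z (\<eta> k) c = br z0 (\<eta> k) c" for k by (simp add: bracket_eq_form z(3) z0(2))
  have f: "form (data z d) (axis k 1) = form v (axis k 1)" for k
  proof -
    have "form (data z d) (axis k 1) = br z (\<eta> k) d" by (simp add: bracket_eq_form \<eta>(2))
    also have "\<dots> = br z0 (\<eta> k) d + form (v - data z0 d) (axis k 1)"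
      using br_eq[of k] br_eq0[of k] bc[of k] by (simp add: x diff_eq_eq add.commute)
    also have "\<dots> = form v (axis k 1)"
      using form_lin_left[of v "-1" "data z0 d" "axis k 1"] by (simp add: bracket_eq_form \<eta>(2) form_def)
    finally show ?thesis .
  qed
  have "data z d = v" by (subst (1 2) dual_expand_vector) (simp add: f)
  with z(1,3) z' hc show ?thesis by blast
qed

text \<open>Two gluings around a controlled middle piece. The continuity of \<open>h\<close> is
  recorded because it makes \<open>ell\<close> of the middle piece square integrable.\<close>

theorem patch:
  assumes y: "qdiff y1" "qdiff y2" and cd: "c < d" "{c..d} \<subseteq> II"
  shows "\<exists>Z. qdiff Z \<and> (\<forall>x\<in>II. x \<le> c \<longrightarrow> data Z x = data y1 x) \<and> (\<forall>x\<in>II. d < x \<longrightarrow> data Z x = data y2 x) \<and>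
    (AE x in lebesgue. x \<in> II \<longrightarrow> x \<le> c \<longrightarrow> el Z x = el y1 x) \<and> (AE x in lebesgue. x \<in> II \<longrightarrow> d < x \<longrightarrow> el Z x = el y2 x) \<and>
    (\<exists>h. continuous_on II h \<and> (AE x in lebesgue. x \<in> II \<longrightarrow> c < x \<longrightarrow> x \<le> d \<longrightarrow> el Z x = h x))"
proof -
  obtain z h where z: "qdiff z" "continuous_on II h" "AE x in lebesgue. x \<in> II \<longrightarrow> el z x = h x"
    "data z c = data y1 c" "data z d = data y2 d"
    using control[OF cd, of "data y1 c" "data y2 d"] by blast
  note g1 = qdiff_glue[OF z(1) y(2) z(5)]
  let ?Z1 = "\<lambda>x. if x \<le> d then z x else y2 x"
  have "c \<in> II" using cd by auto
  then have e: "data y1 c = data ?Z1 c" using g1(2)[of c] z(4) cd(1) by simp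
  note g2 = qdiff_glue[OF y(1) g1(1) e]
  let ?Z = "\<lambda>x. if x \<le> c then y1 x else ?Z1 x"
  show ?thesis
  proof (rule exI[of _ ?Z], intro conjI ballI impI)
    show "qdiff ?Z" by (rule g2(1))
    show "data ?Z x = data y1 x" if "x \<in> II" "x \<le> c" for x using g2(2) that by simp
    show "data ?Z x = data y2 x" if "x \<in> II" "d < x" for x using g2(2)[of x] g1(2)[of x] that cd(1) by simp
    show "AE x in lebesgue. x \<in> II \<longrightarrow> x \<le> c \<longrightarrow> el ?Z x = el y1 x" using g2(3) by eventually_elim auto
    show "AE x in lebesgue. x \<in> II \<longrightarrow> d < x \<longrightarrow> el ?Z x = el y2 x"
      using g2(3) g1(3) by eventually_elim (use cd(1) in auto)
    show "\<exists>h. continuous_on II h \<and> (AE x in lebesgue. x \<in> II \<longrightarrow> c < x \<longrightarrow> x \<le> d \<longrightarrow> el ?Z x = h x)"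
    proof (intro exI[of _ h] conjI z(2))
      show "AE x in lebesgue. x \<in> II \<longrightarrow> c < x \<longrightarrow> x \<le> d \<longrightarrow> el ?Z x = h x"
        using g2(3) g1(3) z(3) by eventually_elim auto
    qed
  qed
qed

end

section \<open>Boundary behaviour\<close>

lemma l2norm_mono:
  assumes "g \<in> L2 M" "f \<in> borel_measurable M" "AE x in M. norm (f x) \<le> norm (g x)"
  shows "f \<in> L2 M" "l2norm M f \<le> l2norm M g"
proof -
  have ae: "AE x in M. (norm (f x))\<^sup>2 \<le> (norm (g x))\<^sup>2"
    using assms(3) by eventually_elim (simp add: power_mono)
  show f: "f \<in> L2 M" by (rule L2I_bound[OF assms(2) L2D(2)[OF assms(1)] ae])
  show "l2norm M f \<le> l2norm M g" unfolding l2norm_def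
    by (rule real_sqrt_le_mono, rule integral_mono_AE[OF L2D(2)[OF f] L2D(2)[OF assms(1)] ae])
qed

lemma borel_measurable_cnj:
  assumes "f \<in> borel_measurable M"
  shows "(\<lambda>x. cnj (f x)) \<in> borel_measurable M"
  by (rule measurable_compose[OF assms borel_measurable_continuous_onI]) (intro continuous_intros)

lemma l2norm_sum_le:
  assumes "finite A" "\<And>i. i \<in> A \<Longrightarrow> f i \<in> L2 M"
  shows "l2norm M (\<lambda>x. \<Sum>i\<in>A. f i x) \<le> (\<Sum>i\<in>A. l2norm M (f i))"
  using assms
proof (induction A rule: finite_induct)
  case (insert i A)
  have "l2norm M (\<lambda>x. f i x + (\<Sum>i\<in>A. f i x)) \<le> l2norm M (f i) + l2norm M (\<lambda>x. \<Sum>i\<in>A. f i x)"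
    by (rule l2norm_triangle) (use insert.prems in \<open>auto intro: L2_sum\<close>)
  with insert show ?case by force
qed (simp add: l2norm_def)

context weighted_expression
begin

definition HR :: "real \<Rightarrow> real set" where "HR c = II \<inter> {c..}"
definition HL :: "real \<Rightarrow> real set" where "HL c = II \<inter> {..c}"

lemma HR_sets: "HR c \<in> sets M" and HL_sets: "HL c \<in> sets M"
  unfolding HR_def HL_def by (rule open_sets_M; auto)+

lemma HR_sub: "HR c \<subseteq> II" by (auto simp: HR_def)

lemma Icc_sets: "{c..d} \<subseteq> II \<Longrightarrow> {c..d} \<in> sets M" by (rule open_sets_M) auto

text \<open>A sequential form of convergence to the possibly infinite endpoint \<open>b\<close> that
  mentions real numbers only, suited to dominated convergence over [c, S n].\<close>

definition tends_right :: "(nat \<Rightarrow> real) \<Rightarrow> bool" where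
  "tends_right S \<longleftrightarrow> (\<forall>n. S n \<in> II) \<and> (\<forall>x\<in>II. \<forall>\<^sub>F n in sequentially. x < S n)"

definition tends_left :: "(nat \<Rightarrow> real) \<Rightarrow> bool" where
  "tends_left S \<longleftrightarrow> (\<forall>n. S n \<in> II) \<and> (\<forall>x\<in>II. \<forall>\<^sub>F n in sequentially. S n < x)"

abbreviation lim_right :: "(real \<Rightarrow> complex) \<Rightarrow> complex \<Rightarrow> bool" where
  "lim_right F l \<equiv> ((\<lambda>t. F (real_of_ereal t)) \<longlongrightarrow> l) (at_left b)"

abbreviation lim_left :: "(real \<Rightarrow> complex) \<Rightarrow> complex \<Rightarrow> bool" where
  "lim_left F l \<equiv> ((\<lambda>t. F (real_of_ereal t)) \<longlongrightarrow> l) (at_right a)"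

lemma real_of_ereal_mem:
  assumes "a < t" "t < b"
  shows "real_of_ereal t \<in> II" "ereal (real_of_ereal t) = t"
proof -
  have "t \<noteq> \<infinity>" "t \<noteq> - \<infinity>" using assms by auto
  then have e: "ereal (real_of_ereal t) = t" by (cases t) auto
  then show "ereal (real_of_ereal t) = t" .
  show "real_of_ereal t \<in> II" using assms e by (simp add: einterval_def)
qed

lemma tends_rightI:
  assumes "\<And>n. S n \<in> II" "(\<lambda>n. ereal (S n)) \<longlonglongrightarrow> b"
  shows "tends_right S"
  unfolding tends_right_def
proof (intro conjI allI ballI assms(1))
  fix x assume "x \<in> II"
  then have "ereal x < b" by (simp add: einterval_def)
  from order_tendstoD(1)[OF assms(2) this] show "\<forall>\<^sub>F n in sequentially. x < S n" by eventually_elim simp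
qed

lemma lim_rightI:
  assumes "\<And>S. tends_right S \<Longrightarrow> (\<lambda>n. F (S n)) \<longlonglongrightarrow> l"
  shows "lim_right F l"
proof (rule tendsto_at_left_sequentially[OF ab])
  fix S :: "nat \<Rightarrow> ereal"
  assume S: "\<And>n. S n < b" "\<And>n. a < S n" "S \<longlonglongrightarrow> b"
  show "(\<lambda>n. F (real_of_ereal (S n))) \<longlonglongrightarrow> l"
  proof (rule assms, rule tends_rightI)
    show "real_of_ereal (S n) \<in> II" for n by (rule real_of_ereal_mem(1)[OF S(2,1)])
    show "(\<lambda>n. ereal (real_of_ereal (S n))) \<longlonglongrightarrow> b" using S(3) by (simp add: real_of_ereal_mem(2)[OF S(2,1)])
  qed
qed

lemma lim_leftI:
  assumes "\<And>S. tends_left S \<Longrightarrow> (\<lambda>n. F (S n)) \<longlonglongrightarrow> l"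
  shows "lim_left F l"
proof (rule tendsto_at_right_sequentially[OF ab])
  fix S :: "nat \<Rightarrow> ereal"
  assume S: "\<And>n. a < S n" "\<And>n. S n < b" "S \<longlonglongrightarrow> a"
  show "(\<lambda>n. F (real_of_ereal (S n))) \<longlonglongrightarrow> l"
  proof (rule assms, unfold tends_left_def, intro conjI allI ballI)
    show "real_of_ereal (S n) \<in> II" for n by (rule real_of_ereal_mem(1)[OF S(1,2)])
    fix x assume "x \<in> II"
    then have "a < ereal x" by (simp add: einterval_def)
    from order_tendstoD(2)[OF S(3) this] show "\<forall>\<^sub>F n in sequentially. real_of_ereal (S n) < x"
    proof eventually_elim
      case (elim n)
      then show ?case using real_of_ereal_mem(2)[OF S(1,2), of n] by (metis less_ereal.simps(1))
    qed
  qed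
qed

lemma lim_rightD:
  assumes "lim_right F l" "\<And>n. S n \<in> II" "(\<lambda>n. ereal (S n)) \<longlonglongrightarrow> b"
  shows "(\<lambda>n. F (S n)) \<longlonglongrightarrow> l"
proof -
  have "filterlim (\<lambda>n. ereal (S n)) (at_left b) sequentially"
    unfolding filterlim_at using assms(2,3) by (auto simp: einterval_def less_imp_neq)
  from filterlim_compose[OF assms(1) this] show ?thesis by simp
qed

lemma lim_right_unique: "lim_right F l \<Longrightarrow> lim_right F l' \<Longrightarrow> l = l'"
proof (rule tendsto_unique)
  show "at_left b \<noteq> bot"
    unfolding trivial_limit_def eventually_at_left[OF ab] using dense by blast
qed

lemma lim_left_unique: "lim_left F l \<Longrightarrow> lim_left F l' \<Longrightarrow> l = l'"
proof (rule tendsto_unique)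
  show "at_right a \<noteq> bot"
    unfolding trivial_limit_def eventually_at_right[OF ab] using dense by blast
qed

lemma el_measurable:
  assumes y: "qdiff y"
  shows "el y \<in> borel_measurable M"
proof -
  have "loc_abs_cont II (qd3 II p s y)"
    using quasi_diff_imp_system[OF y] is_primitive_imp_loc_abs_cont unfolding system_def by blast
  from loc_abs_cont_imp_is_primitive[OF I(1) this]
  have 1: "(\<lambda>x. vector_derivative (qd3 II p s y) (at x)) \<in> borel_measurable (lebesgue_on II)"
    by (intro locally_integrable_imp_measurable is_primitiveD(1))
  have 2: "q \<in> borel_measurable (lebesgue_on II)"
    by (rule locally_integrable_imp_measurable) (use coeffs(3) in \<open>auto simp: L1_loc_def\<close>)
  have 3: "y \<in> borel_measurable (lebesgue_on II)"
    using continuous_measurable_M[OF qdiff_continuous[OF y]] unfolding measurable_M .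
  show ?thesis unfolding measurable_M ell_def using 1 2 3 w_measurable by measurable
qed

abbreviation "Lag f g x \<equiv> el f x * cnj (g x) - f x * cnj (el g x)"

lemma Lag_measurable:
  assumes f: "qdiff f" and g: "qdiff g"
  shows "(\<lambda>x. Lag f g x) \<in> borel_measurable M"
  by (intro borel_measurable_diff borel_measurable_times borel_measurable_cnj el_measurable f g
      continuous_measurable_M qdiff_continuous)

lemma Lag_Icc:
  assumes "qdiff f" "qdiff g" "c \<le> d" "c \<in> II" "d \<in> II"
  shows "(LINT x:{c..d}|M. Lag f g x) = br f g d - br f g c"
  by (rule Lagrange_integral[OF assms(1-3) subI[OF assms(4,5)] Lag_measurable[OF assms(1,2)]])

lemma Lag_integrable:
  assumes f: "zero_ext A f \<in> L2 M" "zero_ext A (el f) \<in> L2 M" and g: "zero_ext A g \<in> L2 M" "zero_ext A (el g) \<in> L2 M"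
  shows "set_integrable M A (\<lambda>x. Lag f g x)"
proof -
  have "integrable M (\<lambda>x. zero_ext A (el f) x * cnj (zero_ext A g x) - zero_ext A f x * cnj (zero_ext A (el g) x))"
    by (intro Bochner_Integration.integrable_diff L2_prod_integrable(1) L2_cnj f g)
  also have "(\<lambda>x. zero_ext A (el f) x * cnj (zero_ext A g x) - zero_ext A f x * cnj (zero_ext A (el g) x)) = (\<lambda>x. indicator A x *\<^sub>R Lag f g x)"
    by (auto simp: zero_ext_def fun_eq_iff)
  finally show ?thesis unfolding set_integrable_def .
qed

lemma HR_dominated:
  assumes i: "set_integrable M (HR c) g" and S: "tends_right S" and c: "c \<in> II"
  shows "(\<lambda>n. LINT x:{c..S n}|M. g x) \<longlonglongrightarrow> (LINT x:HR c|M. (g x :: complex))"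
  unfolding set_lebesgue_integral_def
proof (rule integral_dominated_convergence)
  have SI: "S n \<in> II" for n using S by (simp add: tends_right_def)
  let ?h = "\<lambda>x. indicator (HR c) x *\<^sub>R g x"
  have eq: "(\<lambda>x. indicator {c..S n} x *\<^sub>R g x) = (\<lambda>x. indicator {c..S n} x *\<^sub>R ?h x)" for n
    using subI[OF c SI, of n] by (auto simp: HR_def fun_eq_iff indicator_def)
  have hm: "?h \<in> borel_measurable M" using i unfolding set_integrable_def by simp
  then show "?h \<in> borel_measurable M" .
  show "(\<lambda>x. indicator {c..S n} x *\<^sub>R g x) \<in> borel_measurable M" for n
    unfolding eq by (intro borel_measurable_scaleR borel_measurable_indicator Icc_sets subI c SI hm)
  show "integrable M (\<lambda>x. norm (?h x))" using i unfolding set_integrable_def by (rule integrable_norm)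
  show "AE x in M. norm (indicator {c..S n} x *\<^sub>R g x) \<le> norm (?h x)" for n
    using subI[OF c SI, of n] by (intro AE_I2) (auto simp: HR_def indicator_def)
  show "AE x in M. (\<lambda>n. indicator {c..S n} x *\<^sub>R g x) \<longlonglongrightarrow> ?h x"
  proof (rule AE_I2, rule tendsto_eventually)
    fix x assume "x \<in> space M"
    then have "x \<in> II" by (simp add: space_M)
    then have "\<forall>\<^sub>F n in sequentially. x < S n" using S by (simp add: tends_right_def)
    then show "\<forall>\<^sub>F n in sequentially. indicator {c..S n} x *\<^sub>R g x = ?h x"
      by eventually_elim (use \<open>x \<in> II\<close> in \<open>auto simp: HR_def indicator_def\<close>)
  qed
qed

lemma HL_dominated:
  assumes i: "set_integrable M (HL c) g" and S: "tends_left S" and c: "c \<in> II"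
  shows "(\<lambda>n. LINT x:{S n..c}|M. g x) \<longlonglongrightarrow> (LINT x:HL c|M. (g x :: complex))"
  unfolding set_lebesgue_integral_def
proof (rule integral_dominated_convergence)
  have SI: "S n \<in> II" for n using S by (simp add: tends_left_def)
  let ?h = "\<lambda>x. indicator (HL c) x *\<^sub>R g x"
  have eq: "(\<lambda>x. indicator {S n..c} x *\<^sub>R g x) = (\<lambda>x. indicator {S n..c} x *\<^sub>R ?h x)" for n
    using subI[OF SI c, of n] by (auto simp: HL_def fun_eq_iff indicator_def)
  have hm: "?h \<in> borel_measurable M" using i unfolding set_integrable_def by simp
  then show "?h \<in> borel_measurable M" .
  show "(\<lambda>x. indicator {S n..c} x *\<^sub>R g x) \<in> borel_measurable M" for n
    unfolding eq by (intro borel_measurable_scaleR borel_measurable_indicator Icc_sets subI c SI hm)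
  show "integrable M (\<lambda>x. norm (?h x))" using i unfolding set_integrable_def by (rule integrable_norm)
  show "AE x in M. norm (indicator {S n..c} x *\<^sub>R g x) \<le> norm (?h x)" for n
    using subI[OF SI c, of n] by (intro AE_I2) (auto simp: HL_def indicator_def)
  show "AE x in M. (\<lambda>n. indicator {S n..c} x *\<^sub>R g x) \<longlonglongrightarrow> ?h x"
  proof (rule AE_I2, rule tendsto_eventually)
    fix x assume "x \<in> space M"
    then have "x \<in> II" by (simp add: space_M)
    then have "\<forall>\<^sub>F n in sequentially. S n < x" using S by (simp add: tends_left_def)
    then show "\<forall>\<^sub>F n in sequentially. indicator {S n..c} x *\<^sub>R g x = ?h x"
      by eventually_elim (use \<open>x \<in> II\<close> in \<open>auto simp: HL_def indicator_def\<close>)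
  qed
qed

text \<open>By the Lagrange identity the bracket at S n is its value at c plus an integral over
  [c, S n], which converges to the integral up to the endpoint.\<close>

lemma bracket_lim_right:
  assumes f: "qdiff f" and g: "qdiff g" and c: "c \<in> II" and i: "set_integrable M (HR c) (\<lambda>x. Lag f g x)"
  shows "lim_right (br f g) (br f g c + (LINT x:HR c|M. Lag f g x))"
proof (rule lim_rightI)
  fix S assume S: "tends_right S"
  then have "\<forall>\<^sub>F n in sequentially. c < S n" using c by (simp add: tends_right_def)
  then have ev: "\<forall>\<^sub>F n in sequentially. br f g c + (LINT x:{c..S n}|M. Lag f g x) = br f g (S n)"
    by eventually_elim (use Lag_Icc[OF f g _ c] S in \<open>simp add: tends_right_def\<close>)
  have "(\<lambda>n. br f g c + (LINT x:{c..S n}|M. Lag f g x)) \<longlonglongrightarrow> br f g c + (LINT x:HR c|M. Lag f g x)"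
    by (intro tendsto_intros HR_dominated[OF i S c])
  then show "(\<lambda>n. br f g (S n)) \<longlonglongrightarrow> br f g c + (LINT x:HR c|M. Lag f g x)"
    by (rule Lim_transform_eventually[OF _ ev])
qed

lemma bracket_lim_left:
  assumes f: "qdiff f" and g: "qdiff g" and c: "c \<in> II" and i: "set_integrable M (HL c) (\<lambda>x. Lag f g x)"
  shows "lim_left (br f g) (br f g c - (LINT x:HL c|M. Lag f g x))"
proof (rule lim_leftI)
  fix S assume S: "tends_left S"
  then have "\<forall>\<^sub>F n in sequentially. S n < c" using c by (simp add: tends_left_def)
  then have ev: "\<forall>\<^sub>F n in sequentially. br f g c - (LINT x:{S n..c}|M. Lag f g x) = br f g (S n)"
    by eventually_elim (use Lag_Icc[OF f g _ _ c] S in \<open>simp add: tends_left_def\<close>)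
  have "(\<lambda>n. br f g c - (LINT x:{S n..c}|M. Lag f g x)) \<longlonglongrightarrow> br f g c - (LINT x:HL c|M. Lag f g x)"
    by (intro tendsto_intros HL_dominated[OF i S c])
  then show "(\<lambda>n. br f g (S n)) \<longlonglongrightarrow> br f g c - (LINT x:HL c|M. Lag f g x)"
    by (rule Lim_transform_eventually[OF _ ev])
qed

subsection \<open>Square integrability near an endpoint\<close>

text \<open>Quantified over all c, which makes it handy to use. For continuous functions one c is
  enough (\<open>L2_near_b_I\<close>), since the compact piece in between always has finite
  norm.\<close>

definition L2_near_b :: "(real \<Rightarrow> complex) \<Rightarrow> bool" where "L2_near_b y \<longleftrightarrow> (\<forall>c\<in>II. zero_ext (HR c) y \<in> L2 M)"
definition L2_near_a :: "(real \<Rightarrow> complex) \<Rightarrow> bool" where "L2_near_a y \<longleftrightarrow> (\<forall>c\<in>II. zero_ext (HL c) y \<in> L2 M)"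

lemma L2_near_b_I:
  assumes y: "continuous_on II y" and c: "c \<in> II" and z: "zero_ext (HR c) y \<in> L2 M"
  shows "L2_near_b y"
  unfolding L2_near_b_def
proof
  fix e assume e: "e \<in> II"
  have "zero_ext ({e..c} \<union> HR c) y \<in> L2 M"
    by (rule zero_ext_L2_Un[OF continuous_zero_ext_L2[OF y subI[OF e c]] z Icc_sets[OF subI[OF e c]] HR_sets])
  then show "zero_ext (HR e) y \<in> L2 M"
    by (rule zero_ext_L2_mono[OF _ HR_sets]) (auto simp: HR_def)
qed

lemma L2_near_a_I:
  assumes y: "continuous_on II y" and c: "c \<in> II" and z: "zero_ext (HL c) y \<in> L2 M"
  shows "L2_near_a y"
  unfolding L2_near_a_def
proof
  fix e assume e: "e \<in> II"
  have "zero_ext ({c..e} \<union> HL c) y \<in> L2 M"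
    by (rule zero_ext_L2_Un[OF continuous_zero_ext_L2[OF y subI[OF c e]] z Icc_sets[OF subI[OF c e]] HL_sets])
  then show "zero_ext (HL e) y \<in> L2 M"
    by (rule zero_ext_L2_mono[OF _ HL_sets]) (auto simp: HL_def)
qed

lemma zero_ext_lin: "zero_ext A (\<lambda>x. y x + k * z x) = (\<lambda>x. zero_ext A y x + k * zero_ext A z x)"
  by (auto simp: zero_ext_def fun_eq_iff)

lemma L2_near_b_lin: "L2_near_b y \<Longrightarrow> L2_near_b z \<Longrightarrow> L2_near_b (\<lambda>x. y x + k * z x)"
  unfolding L2_near_b_def zero_ext_lin by (intro ballI L2_add L2_scale) auto

lemma L2_near_a_lin: "L2_near_a y \<Longrightarrow> L2_near_a z \<Longrightarrow> L2_near_a (\<lambda>x. y x + k * z x)"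
  unfolding L2_near_a_def zero_ext_lin by (intro ballI L2_add L2_scale) auto

lemma L2_near_b_zero: "L2_near_b (\<lambda>x. 0)" and L2_near_a_zero: "L2_near_a (\<lambda>x. 0)"
  unfolding L2_near_b_def L2_near_a_def zero_ext_def by (auto intro: L2_zero)

lemma L2_near_b_sum: "(\<And>i. i \<in> A \<Longrightarrow> L2_near_b (f i)) \<Longrightarrow> L2_near_b (\<lambda>x. \<Sum>i\<in>A. c i * f i x)"
proof (induction A rule: infinite_finite_induct)
  case (insert i A)
  then have "L2_near_b (\<lambda>x. (\<Sum>i\<in>A. c i * f i x) + c i * f i x)" by (intro L2_near_b_lin) auto
  with insert(1,2) show ?case by (simp add: add.commute)
qed (auto intro: L2_near_b_zero)

lemma L2_near_b_cnj: "L2_near_b y \<Longrightarrow> L2_near_b (\<lambda>x. cnj (y x))"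
proof -
  have "zero_ext A (\<lambda>x. cnj (y x)) = (\<lambda>x. cnj (zero_ext A y x))" for A by (auto simp: zero_ext_def fun_eq_iff)
  then show "L2_near_b y \<Longrightarrow> L2_near_b (\<lambda>x. cnj (y x))" unfolding L2_near_b_def by (simp add: L2_cnj)
qed

lemma zero_ext_cong: "(\<And>x. x \<in> A \<Longrightarrow> f x = g x) \<Longrightarrow> zero_ext A f = zero_ext A g"
  by (auto simp: zero_ext_def fun_eq_iff)

lemma L2_near_b_cong: "L2_near_b y \<Longrightarrow> (\<And>x. x \<in> II \<Longrightarrow> y x = z x) \<Longrightarrow> L2_near_b z"
  unfolding L2_near_b_def using zero_ext_cong[of "HR _" y z] HR_sub by (metis subsetD)

lemma L2_zero_ext_II: "zero_ext II f \<in> L2 M \<longleftrightarrow> f \<in> L2 M"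
proof -
  have "zero_ext II f \<in> borel_measurable M \<longleftrightarrow> f \<in> borel_measurable M"
    by (rule measurable_cong) (simp add: space_M zero_ext_def)
  moreover have "integrable M (\<lambda>x. (norm (zero_ext II f x))\<^sup>2) \<longleftrightarrow> integrable M (\<lambda>x. (norm (f x))\<^sup>2)"
    by (rule Bochner_Integration.integrable_cong) (auto simp: space_M zero_ext_def)
  ultimately show ?thesis by (simp add: L2_def)
qed

lemma L2_iff_NA_NB: "c \<in> II \<Longrightarrow> zero_ext (HL c) f \<in> L2 M \<Longrightarrow> zero_ext (HR c) f \<in> L2 M \<Longrightarrow> f \<in> L2 M"
proof -
  assume "zero_ext (HL c) f \<in> L2 M" "zero_ext (HR c) f \<in> L2 M"
  then have "zero_ext (HL c \<union> HR c) f \<in> L2 M" by (rule zero_ext_L2_Un[OF _ _ HL_sets HR_sets])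
  moreover have "HL c \<union> HR c = II" by (auto simp: HL_def HR_def)
  ultimately show ?thesis by (simp add: L2_zero_ext_II)
qed

lemma L2_NA_NB: "f \<in> L2 M \<Longrightarrow> L2_near_a f" "f \<in> L2 M \<Longrightarrow> L2_near_b f"
  unfolding L2_near_a_def L2_near_b_def by (auto intro: zero_ext_L2 HL_sets HR_sets)

lemma einterval_right: "c \<in> II \<Longrightarrow> einterval (ereal c) b = HR c - {c}"
  unfolding HR_def einterval_def by (auto intro: less_trans)

lemma einterval_left: "c \<in> II \<Longrightarrow> einterval a (ereal c) = HL c - {c}"
  unfolding HL_def einterval_def by (auto, metis less_ereal.simps(1) less_trans)

lemma point_in_II:
  obtains c where "c \<in> II"
proof -
  obtain c where "a < ereal c" "ereal c < b" using ereal_dense2[OF ab] by blast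
  then show ?thesis using that by (auto simp: einterval_def)
qed

lemma larger_point: assumes "c \<in> II" obtains d where "d \<in> II" "c < d"
proof -
  have "ereal c < b" using assms by (simp add: einterval_def)
  then obtain d where "ereal c < ereal d" "ereal d < b" using ereal_dense2 by blast
  moreover have "a < ereal c" using assms by (simp add: einterval_def)
  then have "a < ereal d" using \<open>ereal c < ereal d\<close> by (rule less_trans)
  ultimately show ?thesis using that[of d] by (simp add: einterval_def)
qed

lemma smaller_point: assumes "c \<in> II" obtains d where "d \<in> II" "d < c"
proof -
  have "a < ereal c" using assms by (simp add: einterval_def)
  then obtain d where "a < ereal d" "ereal d < ereal c" using ereal_dense2 by blast
  moreover have "ereal c < b" using assms by (simp add: einterval_def)
  with \<open>ereal d < ereal c\<close> have "ereal d < b" by (rule less_trans)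
  ultimately show ?thesis using that[of d] by (simp add: einterval_def)
qed

lemma L2_near_b_from_einterval:
  assumes y: "continuous_on II y" and c: "c \<in> II" and L: "y \<in> L2 (wmeasure (einterval (ereal c) b) w)"
  shows "L2_near_b y"
proof -
  have e: "einterval (ereal c) b = HR c - {c}" by (rule einterval_right[OF c])
  have z: "zero_ext (HR c - {c}) y \<in> L2 M"
  proof -
    have "einterval (ereal c) b \<subseteq> II" unfolding e using HR_sub[of c] by blast
    from L[unfolded L2_wmeasure_iff[OF open_einterval this]] show ?thesis unfolding e .
  qed
  obtain d where d: "d \<in> II" "c < d" using larger_point[OF c] by blast
  show ?thesis by (rule L2_near_b_I[OF y d(1) zero_ext_L2_mono[OF z HR_sets]]) (use d in \<open>auto simp: HR_def\<close>)
qed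

end

section \<open>Hilbert-Schmidt kernels\<close>

lemma L2_tensor:
  assumes M: "sigma_finite_measure M" and u: "u \<in> L2 M" and v: "v \<in> L2 M"
  shows "(\<lambda>z. u (fst z) * v (snd z)) \<in> L2 (M \<Otimes>\<^sub>M M)" "l2norm (M \<Otimes>\<^sub>M M) (\<lambda>z. u (fst z) * v (snd z)) = l2norm M u * l2norm M v"
proof -
  interpret sigma_finite_measure M by (rule M)
  note [measurable] = L2D(1)[OF u] L2D(1)[OF v]
  have m: "(\<lambda>z. u (fst z) * v (snd z)) \<in> borel_measurable (M \<Otimes>\<^sub>M M)" by measurable
  have "(\<integral>\<^sup>+z. ennreal ((norm (u (fst z) * v (snd z)))\<^sup>2) \<partial>(M \<Otimes>\<^sub>M M)) =
      (\<integral>\<^sup>+x. \<integral>\<^sup>+t. ennreal ((norm (u (fst (x, t)) * v (snd (x, t))))\<^sup>2) \<partial>M \<partial>M)"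
    by (rule nn_integral_fst[symmetric]) measurable
  also have "\<dots> = (\<integral>\<^sup>+x. \<integral>\<^sup>+t. ennreal ((norm (u x))\<^sup>2) * ennreal ((norm (v t))\<^sup>2) \<partial>M \<partial>M)"
    by (simp add: norm_mult power_mult_distrib ennreal_mult')
  also have "\<dots> = (\<integral>\<^sup>+x. ennreal ((norm (u x))\<^sup>2) * ennreal ((l2norm M v)\<^sup>2) \<partial>M)"
    by (intro nn_integral_cong) (simp add: nn_integral_cmult L2_nn_integral[OF v])
  also have "\<dots> = ennreal ((l2norm M u)\<^sup>2) * ennreal ((l2norm M v)\<^sup>2)"
    by (simp add: nn_integral_multc L2_nn_integral[OF u])
  also have "\<dots> = ennreal ((l2norm M u * l2norm M v)\<^sup>2)" by (simp add: power_mult_distrib ennreal_mult')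
  finally have e: "(\<integral>\<^sup>+z. ennreal ((norm (u (fst z) * v (snd z)))\<^sup>2) \<partial>(M \<Otimes>\<^sub>M M)) = ennreal ((l2norm M u * l2norm M v)\<^sup>2)" .
  show L: "(\<lambda>z. u (fst z) * v (snd z)) \<in> L2 (M \<Otimes>\<^sub>M M)" unfolding L2_iff_nn_integral using m e by simp
  have "ennreal ((l2norm (M \<Otimes>\<^sub>M M) (\<lambda>z. u (fst z) * v (snd z)))\<^sup>2) = ennreal ((l2norm M u * l2norm M v)\<^sup>2)"
    using L2_nn_integral[OF L] e by simp
  then have "(l2norm (M \<Otimes>\<^sub>M M) (\<lambda>z. u (fst z) * v (snd z)))\<^sup>2 = (l2norm M u * l2norm M v)\<^sup>2" by simp
  then show "l2norm (M \<Otimes>\<^sub>M M) (\<lambda>z. u (fst z) * v (snd z)) = l2norm M u * l2norm M v"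
    by (simp add: power2_eq_iff_nonneg l2norm_nonneg)
qed

lemma ip_sum_left:
  assumes "finite F" "\<And>e. e \<in> F \<Longrightarrow> u e \<in> L2 M" "h \<in> L2 M"
  shows "ip M (\<lambda>x. \<Sum>e\<in>F. c e * u e x) h = (\<Sum>e\<in>F. c e * ip M (u e) h)"
  using assms(1,2)
proof (induction F)
  case (insert e F)
  have "ip M (\<lambda>x. c e * u e x + (\<Sum>e\<in>F. c e * u e x)) h = ip M (\<lambda>x. c e * u e x) h + ip M (\<lambda>x. \<Sum>e\<in>F. c e * u e x) h"
    using insert.prems by (intro ip_add_left L2_scale L2_sum assms(3)) auto
  then show ?case using insert by (simp add: ip_scale_left)
qed (simp add: ip_def)

text \<open>The projection \<open>s\<close> satisfies <s, s> = <s, g> = A, so Cauchy-Schwarz bounds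
  A by sqrt A times the norm of g.\<close>

lemma Bessel_inequality:
  assumes F: "finite F" "F \<subseteq> L2 M" "\<And>e e'. e \<in> F \<Longrightarrow> e' \<in> F \<Longrightarrow> ip M e e' = (if e = e' then 1 else 0)" and g: "g \<in> L2 M"
  shows "(\<Sum>e\<in>F. (norm (ip M g e))\<^sup>2) \<le> (l2norm M g)\<^sup>2"
proof -
  define s where "s = (\<lambda>x. \<Sum>e\<in>F. ip M g e * e x)"
  define A where "A = (\<Sum>e\<in>F. (norm (ip M g e))\<^sup>2)"
  have FL: "e \<in> L2 M" if "e \<in> F" for e using F(2) that by blast
  have s: "s \<in> L2 M" unfolding s_def by (intro L2_sum L2_scale FL)
  have se: "ip M s e = ip M g e" if e: "e \<in> F" for e
  proof -
    have "ip M s e = (\<Sum>e'\<in>F. ip M g e' * ip M e' e)" unfolding s_def by (rule ip_sum_left[OF F(1) FL FL[OF e]])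
    also have "\<dots> = (\<Sum>e'\<in>F. if e' = e then ip M g e' else 0)" by (rule sum.cong[OF refl]) (simp add: F(3) e)
    also have "\<dots> = ip M g e" using F(1) e by simp
    finally show ?thesis .
  qed
  have *: "ip M s h = of_real A" if h: "h \<in> L2 M" "\<And>e. e \<in> F \<Longrightarrow> ip M h e = ip M g e" for h
  proof -
    have "ip M s h = (\<Sum>e\<in>F. ip M g e * ip M e h)" unfolding s_def by (rule ip_sum_left[OF F(1) FL h(1)])
    also have "\<dots> = (\<Sum>e\<in>F. ip M g e * cnj (ip M g e))"
      by (rule sum.cong[OF refl]) (subst ip_commute, simp add: h(2))
    also have "\<dots> = of_real A" unfolding A_def of_real_sum complex_norm_square ..
    finally show ?thesis .
  qed
  have A0: "0 \<le> A" unfolding A_def by (rule sum_nonneg) simp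
  have "(l2norm M s)\<^sup>2 = A" using *[OF s se] unfolding ip_self of_real_eq_iff .
  then have ns: "l2norm M s = sqrt A" using l2norm_nonneg[of M s] by (metis real_sqrt_unique)
  have "A \<le> sqrt A * l2norm M g" using ip_le[OF s g] *[OF g refl] A0 ns by simp
  then have "sqrt A * sqrt A \<le> sqrt A * l2norm M g" using A0 by simp
  then have "sqrt A \<le> l2norm M g"
  proof (cases "A = 0")
    case False
    then have "0 < sqrt A" using A0 by simp
    show ?thesis by (rule iffD1[OF mult_le_cancel_left_pos[OF \<open>0 < sqrt A\<close>] \<open>sqrt A * sqrt A \<le> sqrt A * l2norm M g\<close>])
  qed (simp add: l2norm_nonneg)
  then have "(sqrt A)\<^sup>2 \<le> (l2norm M g)\<^sup>2" using A0 by (intro power_mono) auto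
  then show ?thesis using A0 by (simp add: A_def)
qed

text \<open>For fixed x, the values (T e) x are up to conjugation the coefficients of the section
  cnj (K (x, t)) with respect to \<open>E\<close>. Bessel's inequality bounds the sum of their
  squares, and integrating over x gives the squared norm of the kernel.\<close>

theorem hs_norm_le:
  assumes M: "sigma_finite_measure M" and K: "K \<in> L2 (M \<Otimes>\<^sub>M M)" and E: "orthonormal_basis M E"
    and T: "\<And>e. e \<in> E \<Longrightarrow> AE x in M. T e x = (\<integral>t. K (x, t) * e t \<partial>M)"
  shows "hs_norm M E T \<le> ennreal (l2norm (M \<Otimes>\<^sub>M M) K)"
proof -
  interpret sigma_finite_measure M by (rule M)
  have EL: "e \<in> L2 M" if "e \<in> E" for e using E that unfolding orthonormal_basis_def by blast
  have Km[measurable]: "K \<in> borel_measurable (M \<Otimes>\<^sub>M M)" by (rule L2D(1)[OF K])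
  define k where "k e x = (\<integral>t. K (x, t) * e t \<partial>M)" for e x
  have km: "k e \<in> borel_measurable M" if "e \<in> E" for e
  proof -
    have [measurable]: "e \<in> borel_measurable M" by (rule L2D(1)[OF EL[OF that]])
    show ?thesis unfolding k_def by measurable
  qed
  define \<sigma> where "\<sigma> = (\<Sum>\<^sub>\<infinity>e\<in>E. \<integral>\<^sup>+x. ennreal ((norm (T e x))\<^sup>2) \<partial>M)"
  have fin: "(\<Sum>e\<in>F. \<integral>\<^sup>+x. ennreal ((norm (T e x))\<^sup>2) \<partial>M) \<le> ennreal ((l2norm (M \<Otimes>\<^sub>M M) K)\<^sup>2)" if F: "finite F" "F \<subseteq> E" for F
  proof -
    have "(\<Sum>e\<in>F. \<integral>\<^sup>+x. ennreal ((norm (T e x))\<^sup>2) \<partial>M) = (\<Sum>e\<in>F. \<integral>\<^sup>+x. ennreal ((norm (k e x))\<^sup>2) \<partial>M)"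
    proof (rule sum.cong[OF refl], rule nn_integral_cong_AE)
      fix e assume "e \<in> F"
      then have "AE x in M. T e x = k e x" unfolding k_def using T F(2) by blast
      then show "AE x in M. ennreal ((norm (T e x))\<^sup>2) = ennreal ((norm (k e x))\<^sup>2)" by eventually_elim simp
    qed
    also have "\<dots> = (\<integral>\<^sup>+x. (\<Sum>e\<in>F. ennreal ((norm (k e x))\<^sup>2)) \<partial>M)"
    proof (rule nn_integral_sum[symmetric])
      fix e assume "e \<in> F"
      then have [measurable]: "k e \<in> borel_measurable M" using km F(2) by blast
      show "(\<lambda>x. ennreal ((norm (k e x))\<^sup>2)) \<in> borel_measurable M" by measurable
    qed
    also have "\<dots> \<le> (\<integral>\<^sup>+x. \<integral>\<^sup>+t. ennreal ((norm (K (x, t)))\<^sup>2) \<partial>M \<partial>M)"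
    proof (rule nn_integral_mono)
      fix x assume x: "x \<in> space M"
      have Kx: "(\<lambda>t. K (x, t)) \<in> borel_measurable M" using x by measurable
      show "(\<Sum>e\<in>F. ennreal ((norm (k e x))\<^sup>2)) \<le> (\<integral>\<^sup>+t. ennreal ((norm (K (x, t)))\<^sup>2) \<partial>M)"
      \<comment> \<open>For a section of infinite norm the bound holds trivially, so no exceptional
        null set of x has to be tracked.\<close>
      proof (cases "(\<integral>\<^sup>+t. ennreal ((norm (K (x, t)))\<^sup>2) \<partial>M) < \<infinity>")
        case True
        then have KL: "(\<lambda>t. K (x, t)) \<in> L2 M" using Kx by (simp add: L2_iff_nn_integral)
        let ?g = "\<lambda>t. cnj (K (x, t))"
        have ke: "norm (k e x) = norm (ip M ?g e)" if "e \<in> F" for e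
        proof -
          have "ip M e ?g = k e x" unfolding ip_def k_def by (simp add: mult.commute)
          then have "ip M ?g e = cnj (k e x)" using ip_commute[of M ?g e] by simp
          then show ?thesis by simp
        qed
        have "(\<Sum>e\<in>F. ennreal ((norm (k e x))\<^sup>2)) = ennreal (\<Sum>e\<in>F. (norm (ip M ?g e))\<^sup>2)"
          by (simp add: ke flip: sum_ennreal)
        also have "\<dots> \<le> ennreal ((l2norm M ?g)\<^sup>2)"
        proof (rule ennreal_leI, rule Bessel_inequality[OF F(1) _ _ L2_cnj[OF KL]])
          show "F \<subseteq> L2 M" using EL F(2) by blast
          show "ip M e e' = (if e = e' then 1 else 0)" if "e \<in> F" "e' \<in> F" for e e'
            using E F(2) that unfolding orthonormal_basis_def by blast
        qed
        also have "\<dots> = (\<integral>\<^sup>+t. ennreal ((norm (K (x, t)))\<^sup>2) \<partial>M)"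
          using L2_nn_integral[OF L2_cnj[OF KL]] by simp
        finally show ?thesis .
      qed (simp add: not_less top_unique)
    qed
    also have "\<dots> = (\<integral>\<^sup>+z. ennreal ((norm (K z))\<^sup>2) \<partial>(M \<Otimes>\<^sub>M M))"
      by (rule nn_integral_fst) measurable
    also have "\<dots> = ennreal ((l2norm (M \<Otimes>\<^sub>M M) K)\<^sup>2)" by (rule L2_nn_integral[OF K])
    finally show ?thesis .
  qed
  have "\<sigma> \<le> ennreal ((l2norm (M \<Otimes>\<^sub>M M) K)\<^sup>2)"
    unfolding \<sigma>_def by (subst nonneg_infsum_complete) (auto intro!: SUP_least fin)
  then have "\<sigma> \<noteq> \<infinity>" and "enn2real \<sigma> \<le> (l2norm (M \<Otimes>\<^sub>M M) K)\<^sup>2"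
    by (auto simp: top_unique enn2real_leI)
  then have "sqrt (enn2real \<sigma>) \<le> l2norm (M \<Otimes>\<^sub>M M) K"
    using real_sqrt_le_mono[of "enn2real \<sigma>" "(l2norm (M \<Otimes>\<^sub>M M) K)\<^sup>2"] by (simp add: l2norm_nonneg)
  with \<open>\<sigma> \<noteq> \<infinity>\<close> show ?thesis unfolding hs_norm_def \<sigma>_def[symmetric] by (simp add: Let_def ennreal_leI)
qed

section \<open>All solutions are square integrable near a lim-4 endpoint\<close>

context weighted_expression
begin

lemma tends_right_exists: "\<exists>S. tends_right S"
proof (rule einterval_Icc_approximation[OF ab])
  fix u l :: "nat \<Rightarrow> real"
  assume ul: "II = (\<Union>i. {l i .. u i})" "\<And>i. l i < u i" "(\<lambda>x. ereal (u x)) \<longlonglongrightarrow> b"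
  have "u n \<in> II" for n
  proof -
    have "u n \<in> {l n..u n}" using ul(2)[of n] by auto
    then show ?thesis unfolding ul(1) by blast
  qed
  then show ?thesis using tends_rightI ul(3) by blast
qed

lemma tail_tendsto_0:
  assumes f: "L2_near_b f" and S: "tends_right S"
  shows "(\<lambda>n. l2norm M (zero_ext (HR (S n)) f)) \<longlonglongrightarrow> 0"
proof -
  obtain c where c: "c \<in> II" using point_in_II by blast
  have SI: "S n \<in> II" for n using S by (simp add: tends_right_def)
  have L: "zero_ext (HR d) f \<in> L2 M" if "d \<in> II" for d using f that by (simp add: L2_near_b_def)
  have "(\<lambda>n. (l2norm M (zero_ext (HR (S n)) f))\<^sup>2) \<longlonglongrightarrow> 0"
  proof -
    let ?g = "\<lambda>n x. (norm (zero_ext (HR (S n)) f x))\<^sup>2"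
    have t1: "(\<lambda>n. \<integral>x. indicator {c..} x * ?g n x \<partial>M) \<longlonglongrightarrow> (\<integral>x. 0 \<partial>M)"
    proof (rule integral_dominated_convergence)
      show "integrable M (\<lambda>x. (norm (zero_ext (HR c) f x))\<^sup>2)" using L2D(2)[OF L[OF c]] .
      have i: "(\<lambda>x. indicator {c..} x * ?g n x) = (\<lambda>x. indicator (HR c) x * ?g n x)" for n
        by (auto simp: fun_eq_iff zero_ext_def HR_def indicator_def)
      show "(\<lambda>x. indicator {c..} x * ?g n x) \<in> borel_measurable M" for n
        unfolding i by (intro borel_measurable_times borel_measurable_indicator HR_sets borel_measurable_integrable L2D(2) L SI)
      show "AE x in M. (\<lambda>n. indicator {c..} x * ?g n x) \<longlonglongrightarrow> 0"
      proof (rule AE_I2, rule tendsto_eventually)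
        fix x assume "x \<in> space M"
        then have "\<forall>\<^sub>F n in sequentially. x < S n" using S by (simp add: tends_right_def space_M)
        then show "\<forall>\<^sub>F n in sequentially. indicator {c..} x * ?g n x = 0"
          by eventually_elim (auto simp: zero_ext_def HR_def)
      qed
      show "AE x in M. norm (indicator {c..} x * ?g n x) \<le> (norm (zero_ext (HR c) f x))\<^sup>2" for n
        by (intro AE_I2) (auto simp: zero_ext_def HR_def indicator_def)
    qed simp
    have t2: "\<forall>\<^sub>F n in sequentially. (\<integral>x. indicator {c..} x * ?g n x \<partial>M) = (l2norm M (zero_ext (HR (S n)) f))\<^sup>2"
    proof -
      have "\<forall>\<^sub>F n in sequentially. c < S n" using S c by (simp add: tends_right_def)
      then show ?thesis
      proof eventually_elim
        case (elim n)
        show ?case unfolding l2norm_sq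
          by (rule Bochner_Integration.integral_cong) (use elim in \<open>auto simp: zero_ext_def HR_def\<close>)
      qed
    qed
    have "(\<integral>x. 0 \<partial>M) = (0 :: real)" by simp
    with t1 have "(\<lambda>n. \<integral>x. indicator {c..} x * ?g n x \<partial>M) \<longlonglongrightarrow> 0" by (simp only:)
    then show ?thesis by (rule Lim_transform_eventually[OF _ t2])
  qed
  then have "(\<lambda>n. sqrt ((l2norm M (zero_ext (HR (S n)) f))\<^sup>2)) \<longlonglongrightarrow> sqrt 0" by (rule tendsto_real_sqrt)
  then show ?thesis by (simp add: l2norm_nonneg)
qed

text \<open>Dimension count. The solutions that are square integrable near \<open>b\<close> form a
  space of dimension 4, while all solutions, normalised to 0 outside the interval, lie in the span
  of four functions; hence every solution belongs to that space.\<close>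

lemma lim4_imp_NB_i:
  assumes b4: "lim_type_right a b p s q w 4" and x0: "x0 \<in> II"
  shows "L2_near_b (fundamental \<i> x0 k)"
proof -
  define W where "W = {y. is_solution II p s q w \<i> y \<and> (\<forall>x. x \<notin> II \<longrightarrow> y x = 0) \<and>
       (\<exists>c\<in>II. y \<in> L2 (wmeasure (einterval (ereal c) b) w))}"
  have dimW: "cfun.dim W = 4" using b4 unfolding lim_type_right_def W_def .
  have WS: "y \<in> Sol \<i>" "L2_near_b y" "x \<notin> II \<Longrightarrow> y x = 0" if "y \<in> W" for y x
  proof -
    show S: "y \<in> Sol \<i>" using that by (auto simp: W_def is_solution_def Sol_def AE_lebesgue_on_iff[OF I(1)])
    show "L2_near_b y" using that L2_near_b_from_einterval[OF qdiff_continuous[OF SolD(1)[OF S]]] by (auto simp: W_def)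
    show "x \<notin> II \<Longrightarrow> y x = 0" using that by (auto simp: W_def)
  qed
  obtain B where B: "B \<subseteq> W" "cfun.independent B" "W \<subseteq> cfun.span B" "card B = cfun.dim W"
    using cfun.basis_exists by blast
  have cB: "card B = 4" using B(4) dimW by simp
  define F where "F k = zero_ext II (fundamental \<i> x0 k)" for k
  have BF: "B \<subseteq> cfun.span (range F)"
  proof
    fix y assume "y \<in> B"
    then have y: "y \<in> W" using B(1) by blast
    have "y = (\<Sum>k\<in>UNIV. (\<lambda>x. data y x0 $ k * F k x))"
    proof (rule ext)
      fix x
      show "y x = (\<Sum>k\<in>UNIV. (\<lambda>x. data y x0 $ k * F k x)) x"
      proof (cases "x \<in> II")
        case True
        then show ?thesis using Sol_expand[OF WS(1)[OF y] x0 True] by (simp add: F_def zero_ext_def sum_4)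
      next
        case False
        then show ?thesis using WS(3)[OF y False] by (simp add: F_def zero_ext_def sum_4)
      qed
    qed
    also have "\<dots> \<in> cfun.span (range F)"
      by (intro cfun.span_sum cfun.span_scale cfun.span_base) auto
    finally show "y \<in> cfun.span (range F)" .
  qed
  have "finite (range F)" by simp
  have "F k \<in> cfun.span B"
  proof (rule ccontr)
    assume n: "F k \<notin> cfun.span B"
    \<comment> \<open>Otherwise \<open>B\<close> together with \<open>F k\<close> would be five
      independent functions in the span of four.\<close>
    then have ind: "cfun.independent (insert (F k) B)" by (rule cfun.independent_insertI[OF _ B(2)])
    have "F k \<in> cfun.span (range F)" by (rule cfun.span_base) simp
    then have "insert (F k) B \<subseteq> cfun.span (range F)" using BF by blast
    from cfun.independent_span_bound[OF \<open>finite (range F)\<close> ind this]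
    have "card (insert (F k) B) \<le> card (range F)" by blast
    also have "\<dots> \<le> 4" using card_image_le[of "UNIV :: 4 set" F] by simp
    finally have "card (insert (F k) B) \<le> 4" .
    moreover have "F k \<notin> B" using n cfun.span_base by blast
    moreover have "finite B" using cB by (intro card_ge_0_finite) simp
    ultimately show False using cB by simp
  qed
  also have "cfun.span B \<subseteq> {y. L2_near_b y}"
  proof (rule cfun.span_minimal)
    show "B \<subseteq> {y. L2_near_b y}" using B(1) WS(2) by blast
    show "cfun.subspace {y. L2_near_b y}"
      unfolding cfun.subspace_def
    proof (intro conjI ballI allI)
      show "0 \<in> {y. L2_near_b y}" using L2_near_b_zero by (simp add: zero_fun_def)
      fix y z assume "y \<in> {y. L2_near_b y}" "z \<in> {y. L2_near_b y}"
      then show "y + z \<in> {y. L2_near_b y}" using L2_near_b_lin[of y z 1] by (simp add: plus_fun_def)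
    next
      fix c y assume "y \<in> {y. L2_near_b y}"
      then show "(\<lambda>x. c * y x) \<in> {y. L2_near_b y}" using L2_near_b_lin[of "\<lambda>x. 0" y c] L2_near_b_zero by simp
    qed
  qed
  finally have "L2_near_b (F k)" by simp
  then show ?thesis by (rule L2_near_b_cong) (simp add: F_def zero_ext_def)
qed

lemma lim4_imp_NB_Sol_i:
  assumes b4: "lim_type_right a b p s q w 4" and y: "y \<in> Sol \<i>"
  shows "L2_near_b y"
proof -
  obtain x0 where x0: "x0 \<in> II" using point_in_II by blast
  have "L2_near_b (\<lambda>x. \<Sum>k\<in>UNIV. data y x0 $ k * fundamental \<i> x0 k x)"
    by (intro L2_near_b_sum lim4_imp_NB_i[OF b4 x0])
  then show ?thesis by (rule L2_near_b_cong) (rule Sol_expand[OF y x0, symmetric])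
qed

lemma lim4_imp_NB_Sol_minus_i:
  assumes b4: "lim_type_right a b p s q w 4" and y: "y \<in> Sol (cnj \<i>)"
  shows "L2_near_b y"
proof -
  have "(\<lambda>x. cnj (y x)) \<in> Sol \<i>" using Sol_cnj[OF y] by simp
  from L2_near_b_cnj[OF lim4_imp_NB_Sol_i[OF b4 this]] show ?thesis by simp
qed

text \<open>Fatou's lemma: a bound on the norms over [c, d] that is uniform in d passes to the
  half-line.\<close>

lemma L2_from_bounded_truncations:
  assumes f: "continuous_on II f" and c: "c \<in> II" and K: "\<And>d. d \<in> II \<Longrightarrow> c \<le> d \<Longrightarrow> l2norm M (zero_ext {c..d} f) \<le> K"
  shows "zero_ext (HR c) f \<in> L2 M"
proof -
  obtain S where S: "tends_right S" using tends_right_exists by blast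
  have SI: "S n \<in> II" for n using S by (simp add: tends_right_def)
  have fm: "f \<in> borel_measurable M" by (rule continuous_measurable_M[OF f])
  have m: "zero_ext (HR c) f \<in> borel_measurable M" by (rule zero_ext_measurable[OF fm HR_sets])
  have mn: "zero_ext {c..S n} f \<in> borel_measurable M" for n by (rule zero_ext_measurable[OF fm Icc_sets[OF subI[OF c SI]]])
  have "(\<integral>\<^sup>+x. ennreal ((norm (zero_ext (HR c) f x))\<^sup>2) \<partial>M) = (\<integral>\<^sup>+x. liminf (\<lambda>n. ennreal ((norm (zero_ext {c..S n} f x))\<^sup>2)) \<partial>M)"
  proof (rule nn_integral_cong)
    fix x assume "x \<in> space M"
    then have "x \<in> II" by (simp add: space_M)
    then have "\<forall>\<^sub>F n in sequentially. x < S n" using S by (simp add: tends_right_def)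
    then have "\<forall>\<^sub>F n in sequentially. ennreal ((norm (zero_ext {c..S n} f x))\<^sup>2) = ennreal ((norm (zero_ext (HR c) f x))\<^sup>2)"
      by eventually_elim (use \<open>x \<in> II\<close> in \<open>auto simp: zero_ext_def HR_def\<close>)
    then have "(\<lambda>n. ennreal ((norm (zero_ext {c..S n} f x))\<^sup>2)) \<longlonglongrightarrow> ennreal ((norm (zero_ext (HR c) f x))\<^sup>2)"
      by (rule tendsto_eventually)
    then show "ennreal ((norm (zero_ext (HR c) f x))\<^sup>2) = liminf (\<lambda>n. ennreal ((norm (zero_ext {c..S n} f x))\<^sup>2))"
      by (rule lim_imp_Liminf[OF sequentially_bot, symmetric])
  qed
  also have "\<dots> \<le> liminf (\<lambda>n. \<integral>\<^sup>+x. ennreal ((norm (zero_ext {c..S n} f x))\<^sup>2) \<partial>M)"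
    by (rule nn_integral_liminf) (use mn in measurable)
  also have "\<dots> \<le> limsup (\<lambda>n. \<integral>\<^sup>+x. ennreal ((norm (zero_ext {c..S n} f x))\<^sup>2) \<partial>M)"
    by (rule Liminf_le_Limsup) simp
  also have "\<dots> \<le> ennreal (K\<^sup>2)"
  proof (rule Limsup_bounded)
    have "\<forall>\<^sub>F n in sequentially. c < S n" using S c by (simp add: tends_right_def)
    then show "\<forall>\<^sub>F n in sequentially. (\<integral>\<^sup>+x. ennreal ((norm (zero_ext {c..S n} f x))\<^sup>2) \<partial>M) \<le> ennreal (K\<^sup>2)"
    proof eventually_elim
      case (elim n)
      have "l2norm M (zero_ext {c..S n} f) \<le> K" by (rule K[OF SI]) (use elim in simp)
      then have "(l2norm M (zero_ext {c..S n} f))\<^sup>2 \<le> K\<^sup>2" by (intro power_mono l2norm_nonneg)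
      then show ?case
        by (simp add: L2_nn_integral[OF continuous_zero_ext_L2[OF f subI[OF c SI]]] ennreal_leI)
    qed
  qed
  finally show ?thesis unfolding L2_iff_nn_integral using m by (auto intro: le_less_trans)
qed

text \<open>The classical independence of the limit-circle property from the spectral parameter.
  \<open>y\<close> is expanded in solutions for \<open>\<i>\<close>, with coefficients whose
  increments are integrals of (z - \<i>) y against solutions for the conjugate parameter; far out,
  this perturbation is small enough to be absorbed.\<close>

theorem lim4_imp_NB_Sol:
  assumes b4: "lim_type_right a b p s q w 4" and y: "y \<in> Sol z"
  shows "L2_near_b y"
proof -
  obtain x0 where x0: "x0 \<in> II" using point_in_II by blast
  obtain S where S: "tends_right S" using tends_right_exists by blast
  have SI: "S n \<in> II" for n using S by (simp add: tends_right_def)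
  define \<eta> where "\<eta> = fundamental (cnj \<i>) x0"
  define \<epsilon> where "\<epsilon> = dual_fundamental \<i> x0"
  have \<eta>S: "\<eta> k \<in> Sol (cnj \<i>)" and \<epsilon>S: "\<epsilon> k \<in> Sol \<i>" for k
    unfolding \<eta>_def \<epsilon>_def using fundamental(1)[OF x0] dual_fundamental(1)[OF x0] by auto
  have \<eta>: "L2_near_b (\<eta> k)" and \<epsilon>: "L2_near_b (\<epsilon> k)" for k
    using lim4_imp_NB_Sol_minus_i[OF b4 \<eta>S] lim4_imp_NB_Sol_i[OF b4 \<epsilon>S] by auto
  have yq: "qdiff y" by (rule SolD(1)[OF y])
  have yc: "continuous_on II y" by (rule qdiff_continuous[OF yq])
  define \<kappa> where "\<kappa> = norm (z - \<i>)"
  define nh where "nh n k = l2norm M (zero_ext (HR (S n)) (\<eta> k))" for n k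
  define ne where "ne n k = l2norm M (zero_ext (HR (S n)) (\<epsilon> k))" for n k
  have "(\<lambda>n. \<Sum>k\<in>UNIV. \<kappa> * nh n k * ne n k) \<longlonglongrightarrow> (\<Sum>k\<in>(UNIV :: 4 set). \<kappa> * 0 * 0)"
    unfolding nh_def ne_def by (intro tendsto_sum tendsto_mult tendsto_const tail_tendsto_0 \<eta> \<epsilon> S)
  then have "\<forall>\<^sub>F n in sequentially. (\<Sum>k\<in>UNIV. \<kappa> * nh n k * ne n k) < 1/2"
    by (intro order_tendstoD(2)) auto
  \<comment> \<open>Starting so far out that the product of the tails is below 1/2 makes the term
    containing \<open>N\<close> absorbable at the end.\<close>
  then obtain n where n: "(\<Sum>k\<in>UNIV. \<kappa> * nh n k * ne n k) < 1/2" by (auto simp: eventually_sequentially)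
  define c where "c = S n"
  have c: "c \<in> II" using SI by (simp add: c_def)
  define \<beta> where "\<beta> k = norm (br y (\<eta> k) c)" for k
  have pos: "0 \<le> nh n k" "0 \<le> ne n k" "0 \<le> \<kappa>" "0 \<le> \<beta> k" for k by (auto simp: nh_def ne_def \<kappa>_def \<beta>_def l2norm_nonneg)
  have "zero_ext (HR c) y \<in> L2 M"
  proof (rule L2_from_bounded_truncations[OF yc c])
    fix d assume d: "d \<in> II" "c \<le> d"
    define N where "N = l2norm M (zero_ext {c..d} y)"
    have N0: "0 \<le> N" by (simp add: N_def l2norm_nonneg)
    have cdI: "{c..d} \<subseteq> II" by (rule subI[OF c d(1)])
    have yL: "zero_ext {c..d} y \<in> L2 M" by (rule continuous_zero_ext_L2[OF yc cdI])
    have hL: "zero_ext (HR c) (\<eta> k) \<in> L2 M" and eL: "zero_ext (HR c) (\<epsilon> k) \<in> L2 M" for k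
      using \<eta> \<epsilon> c by (auto simp: L2_near_b_def)
    \<comment> \<open>The increment of the bracket from c is an integral of (z - \<i>) y cnj \<eta>
      over a part of [c, d]; Cauchy-Schwarz bounds it by \<open>N\<close> times a tail norm.\<close>
    have brb: "norm (br y (\<eta> k) x) \<le> \<beta> k + \<kappa> * (N * nh n k)" if x: "x \<in> {c..d}" for x k
    proof -
      have xI: "x \<in> II" "c \<le> x" using x cdI by auto
      have "br y (\<eta> k) x = br y (\<eta> k) c + (LINT t:{c..x}|M. Lag y (\<eta> k) t)"
        using Lag_Icc[OF yq SolD(1)[OF \<eta>S] xI(2) c xI(1)] by simp
      moreover have "norm (LINT t:{c..x}|M. Lag y (\<eta> k) t) \<le> \<kappa> * (N * nh n k)"
      proof -
        have ae: "AE t in M. indicator {c..x} t *\<^sub>R Lag y (\<eta> k) t = indicator {c..x} t *\<^sub>R ((z - \<i>) * (y t * cnj (\<eta> k t)))"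
          unfolding AE_M using SolD(2)[OF y] SolD(2)[OF \<eta>S[of k]] by eventually_elim (auto simp: algebra_simps)
        have "(LINT t:{c..x}|M. Lag y (\<eta> k) t) = (\<integral>t. indicator {c..x} t *\<^sub>R ((z - \<i>) * (y t * cnj (\<eta> k t))) \<partial>M)"
          unfolding set_lebesgue_integral_def
        proof (rule integral_cong_AE[OF _ _ ae])
          have ix: "{c..x} \<in> sets M" by (rule Icc_sets[OF subI[OF c xI(1)]])
          show "(\<lambda>t. indicator {c..x} t *\<^sub>R Lag y (\<eta> k) t) \<in> borel_measurable M"
            by (intro borel_measurable_scaleR borel_measurable_indicator ix Lag_measurable[OF yq SolD(1)[OF \<eta>S]])
          show "(\<lambda>t. indicator {c..x} t *\<^sub>R ((z - \<i>) * (y t * cnj (\<eta> k t)))) \<in> borel_measurable M"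
            by (intro borel_measurable_scaleR borel_measurable_indicator ix borel_measurable_times borel_measurable_const
                borel_measurable_cnj continuous_measurable_M yc qdiff_continuous SolD(1)[OF \<eta>S])
        qed
        also have "norm \<dots> \<le> (\<integral>t. norm (indicator {c..x} t *\<^sub>R ((z - \<i>) * (y t * cnj (\<eta> k t)))) \<partial>M)"
          by (rule integral_norm_bound)
        also have "\<dots> \<le> (\<integral>t. \<kappa> * (norm (zero_ext {c..d} y t) * norm (zero_ext (HR c) (\<eta> k) t)) \<partial>M)"
        proof (rule integral_mono')
          show "integrable M (\<lambda>t. \<kappa> * (norm (zero_ext {c..d} y t) * norm (zero_ext (HR c) (\<eta> k) t)))"
            by (intro integrable_mult_right L2_prod_integrable(2) yL hL)
          fix t
          have "t \<in> {c..x} \<Longrightarrow> t \<in> {c..d} \<and> t \<in> HR c" using x cdI by (auto simp: HR_def)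
          then show "norm (indicator {c..x} t *\<^sub>R ((z - \<i>) * (y t * cnj (\<eta> k t)))) \<le> \<kappa> * (norm (zero_ext {c..d} y t) * norm (zero_ext (HR c) (\<eta> k) t))"
            by (cases "t \<in> {c..x}") (simp_all add: zero_ext_def norm_mult \<kappa>_def)
        qed (simp add: \<kappa>_def)
        also have "\<dots> = \<kappa> * (\<integral>t. norm (zero_ext {c..d} y t) * norm (zero_ext (HR c) (\<eta> k) t) \<partial>M)"
          by simp
        also have "\<dots> \<le> \<kappa> * (N * nh n k)"
          unfolding N_def nh_def c_def[symmetric] by (intro mult_left_mono L2_Cauchy_Schwarz yL hL pos)
        finally show ?thesis .
      qed
      moreover have "norm (br y (\<eta> k) c + Q) \<le> \<beta> k + r" if "norm Q \<le> r" for Q r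
        unfolding \<beta>_def using norm_triangle_ineq[of "br y (\<eta> k) c" Q] that by linarith
      ultimately show ?thesis by simp
    qed
    let ?C = "\<lambda>k. \<beta> k + \<kappa> * (N * nh n k)"
    let ?G = "\<lambda>t. \<Sum>k\<in>UNIV. complex_of_real (?C k) * complex_of_real (norm (zero_ext (HR c) (\<epsilon> k) t))"
    have eLn: "(\<lambda>t. complex_of_real (norm (zero_ext (HR c) (\<epsilon> k) t))) \<in> L2 M" for k
      by (rule l2norm_mono(1)[OF eL[of k]]) (use L2D(1)[OF eL[of k]] in \<open>auto\<close>)
    have eLn2: "l2norm M (\<lambda>t. complex_of_real (norm (zero_ext (HR c) (\<epsilon> k) t))) = ne n k" for k
      by (simp add: l2norm_def ne_def c_def)
    have GL: "?G \<in> L2 M" by (intro L2_sum L2_scale eLn)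
    have le: "l2norm M (zero_ext {c..d} y) \<le> l2norm M ?G"
    proof (rule l2norm_mono(2)[OF GL L2D(1)[OF yL]], rule AE_I2)
      fix t assume "t \<in> space M"
      show "norm (zero_ext {c..d} y t) \<le> norm (?G t)"
      proof (cases "t \<in> {c..d}")
        case True
        then have tI: "t \<in> II" "t \<in> HR c" using cdI by (auto simp: HR_def)
        have "data y t = (\<Sum>k\<in>UNIV. br y (\<eta> k) t *s data (\<epsilon> k) t)"
          using dual_expansion[OF x0 tI(1), of y \<i>] unfolding \<eta>_def \<epsilon>_def .
        then have "y t = (\<Sum>k\<in>UNIV. br y (\<eta> k) t * \<epsilon> k t)"
          unfolding vec_eq_iff by (auto simp: sum_4 data_nth dest: spec[of _ 1])
        then have "norm (y t) \<le> (\<Sum>k\<in>UNIV. norm (br y (\<eta> k) t) * norm (\<epsilon> k t))"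
          using norm_sum[of "\<lambda>k. br y (\<eta> k) t * \<epsilon> k t" UNIV] by (simp add: norm_mult)
        also have "\<dots> \<le> (\<Sum>k\<in>UNIV. ?C k * norm (\<epsilon> k t))"
          by (intro sum_mono mult_right_mono brb True) auto
        also have "\<dots> = (\<Sum>k\<in>UNIV. ?C k * norm (zero_ext (HR c) (\<epsilon> k) t))"
          using tI(2) by (simp add: zero_ext_def)
        also have "\<dots> \<le> norm (complex_of_real (\<Sum>k\<in>UNIV. ?C k * norm (zero_ext (HR c) (\<epsilon> k) t)))"
          by (subst norm_of_real) (rule abs_ge_self)
        also have "complex_of_real (\<Sum>k\<in>UNIV. ?C k * norm (zero_ext (HR c) (\<epsilon> k) t)) = ?G t" by simp
        finally show ?thesis using True by (simp add: zero_ext_def)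
      qed (auto simp: zero_ext_def)
    qed
    have "N \<le> l2norm M ?G" using le unfolding N_def .
    also have "\<dots> \<le> (\<Sum>k\<in>UNIV. l2norm M (\<lambda>t. complex_of_real (?C k) * complex_of_real (norm (zero_ext (HR c) (\<epsilon> k) t))))"
      by (intro l2norm_sum_le L2_scale eLn) simp
    also have "\<dots> = (\<Sum>k\<in>UNIV. ?C k * ne n k)"
    proof (rule sum.cong[OF refl])
      fix k
      have "0 \<le> ?C k" using pos N0 by simp
      then show "l2norm M (\<lambda>t. complex_of_real (?C k) * complex_of_real (norm (zero_ext (HR c) (\<epsilon> k) t))) = ?C k * ne n k"
        unfolding l2norm_scale eLn2 norm_of_real by simp
    qed
    also have "\<dots> = (\<Sum>k\<in>UNIV. \<beta> k * ne n k) + N * (\<Sum>k\<in>UNIV. \<kappa> * nh n k * ne n k)"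
      by (simp add: distrib_right sum.distrib sum_distrib_left algebra_simps)
    also have "\<dots> \<le> (\<Sum>k\<in>UNIV. \<beta> k * ne n k) + N * (1/2)"
      using n N0 by (intro add_left_mono mult_left_mono) auto
    \<comment> \<open>\<open>N\<close> is a norm over a compact interval, hence finite, so N / 2 may
      be subtracted. The remaining bound does not involve d.\<close>
    finally show "N \<le> 2 * (\<Sum>k\<in>UNIV. \<beta> k * ne n k)" by simp
  qed
  then show ?thesis by (rule L2_near_b_I[OF yc c])
qed

end

section \<open>The boundary value problem\<close>

lemma is_interval_einterval_ereal: "is_interval (einterval c d)"
  unfolding is_interval_1
proof (intro ballI allI impI)
  fix x y z assume "x \<in> einterval c d" "y \<in> einterval c d" "x \<le> z \<and> z \<le> y"
  then have "c < ereal x" "ereal x \<le> ereal z" "ereal z \<le> ereal y" "ereal y < d" by (auto simp: einterval_def)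
  then have "c < ereal z" "ereal z < d" by (blast intro: less_le_trans le_less_trans)+
  then show "z \<in> einterval c d" by (simp add: einterval_def)
qed

context weighted_expression
begin

lemma eventually_right: "d \<in> II \<Longrightarrow> (\<And>x. x \<in> II \<Longrightarrow> d < x \<Longrightarrow> P x) \<Longrightarrow> \<forall>\<^sub>F t in at_left b. P (real_of_ereal t)"
proof -
  assume d: "d \<in> II" and P: "\<And>x. x \<in> II \<Longrightarrow> d < x \<Longrightarrow> P x"
  have "ereal d < b" using d by (simp add: einterval_def)
  moreover have "P (real_of_ereal t)" if "ereal d < t" "t < b" for t
  proof -
    have "a < t" using d that(1) by (auto simp: einterval_def intro: less_trans)
    note r = real_of_ereal_mem[OF this that(2)]
    have "ereal d < ereal (real_of_ereal t)" using that(1) unfolding r(2) .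
    then show ?thesis by (intro P r(1)) simp
  qed
  ultimately show ?thesis by (intro eventually_at_left[THEN iffD2]) blast+
qed

lemma eventually_left: "d \<in> II \<Longrightarrow> (\<And>x. x \<in> II \<Longrightarrow> x < d \<Longrightarrow> P x) \<Longrightarrow> \<forall>\<^sub>F t in at_right a. P (real_of_ereal t)"
proof -
  assume d: "d \<in> II" and P: "\<And>x. x \<in> II \<Longrightarrow> x < d \<Longrightarrow> P x"
  have "a < ereal d" using d by (simp add: einterval_def)
  moreover have "P (real_of_ereal t)" if "t < ereal d" "a < t" for t
  proof -
    have "t < b" using d that(1) by (auto simp: einterval_def intro: less_trans)
    note r = real_of_ereal_mem[OF that(2) this]
    have "ereal (real_of_ereal t) < ereal d" using that(1) unfolding r(2) .
    then show ?thesis by (intro P r(1)) simp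
  qed
  ultimately show ?thesis by (intro eventually_at_right[THEN iffD2]) blast+
qed

lemma lim_right_cong:
  assumes "lim_right F l" "d \<in> II" "\<And>x. x \<in> II \<Longrightarrow> d < x \<Longrightarrow> F x = G x"
  shows "lim_right G l"
  by (rule Lim_transform_eventually[OF assms(1) eventually_right[OF assms(2,3)]])

lemma lim_left_cong:
  assumes "lim_left F l" "d \<in> II" "\<And>x. x \<in> II \<Longrightarrow> x < d \<Longrightarrow> F x = G x"
  shows "lim_left G l"
  by (rule Lim_transform_eventually[OF assms(1) eventually_left[OF assms(2,3)]])

lemma lim_right_zero: "d \<in> II \<Longrightarrow> (\<And>x. x \<in> II \<Longrightarrow> d < x \<Longrightarrow> F x = 0) \<Longrightarrow> lim_right F 0"
  by (rule lim_right_cong[OF tendsto_const]) auto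

lemma lim_left_zero: "d \<in> II \<Longrightarrow> (\<And>x. x \<in> II \<Longrightarrow> x < d \<Longrightarrow> F x = 0) \<Longrightarrow> lim_left F 0"
  by (rule lim_left_cong[OF tendsto_const]) auto

lemma br_lin: "qdiff y \<Longrightarrow> qdiff z \<Longrightarrow> x \<in> II \<Longrightarrow> br (\<lambda>x. y x + k * z x) g x = br y g x + k * br z g x"
  unfolding bracket_eq_form by (simp add: qdiff_lin(2) form_lin_left)

lemma lim_right_lin:
  assumes "qdiff y" "qdiff z" "lim_right (br y g) l" "lim_right (br z g) m"
  shows "lim_right (br (\<lambda>x. y x + k * z x) g) (l + k * m)"
proof -
  obtain c where c: "c \<in> II" using point_in_II by blast
  have "lim_right (\<lambda>x. br y g x + k * br z g x) (l + k * m)" by (intro tendsto_add tendsto_mult tendsto_const assms)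
  then show ?thesis by (rule lim_right_cong[OF _ c]) (simp add: br_lin assms)
qed

lemma lim_left_lin:
  assumes "qdiff y" "qdiff z" "lim_left (br y g) l" "lim_left (br z g) m"
  shows "lim_left (br (\<lambda>x. y x + k * z x) g) (l + k * m)"
proof -
  obtain c where c: "c \<in> II" using point_in_II by blast
  have "lim_left (\<lambda>x. br y g x + k * br z g x) (l + k * m)" by (intro tendsto_add tendsto_mult tendsto_const assms)
  then show ?thesis by (rule lim_left_cong[OF _ c]) (simp add: br_lin assms)
qed

lemma L2_near_b_AE:
  assumes "L2_near_b f" "c \<in> II" "AE x in lebesgue. x \<in> II \<longrightarrow> c < x \<longrightarrow> f x = g x" "g \<in> borel_measurable M" "d \<in> II" "c < d"
  shows "zero_ext (HR d) g \<in> L2 M"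
proof (rule L2_cong_AE)
  show "zero_ext (HR d) f \<in> L2 M" using assms by (simp add: L2_near_b_def)
  show "AE x in M. zero_ext (HR d) f x = zero_ext (HR d) g x" unfolding AE_M
    using assms(3) by eventually_elim (use assms(6) in \<open>auto simp: zero_ext_def HR_def\<close>)
  show "zero_ext (HR d) g \<in> borel_measurable M" by (rule zero_ext_measurable[OF assms(4) HR_sets])
qed

lemma L2_near_a_AE:
  assumes "L2_near_a f" "c \<in> II" "AE x in lebesgue. x \<in> II \<longrightarrow> x < c \<longrightarrow> f x = g x" "g \<in> borel_measurable M" "d \<in> II" "d < c"
  shows "zero_ext (HL d) g \<in> L2 M"
proof (rule L2_cong_AE)
  show "zero_ext (HL d) f \<in> L2 M" using assms by (simp add: L2_near_a_def)
  show "AE x in M. zero_ext (HL d) f x = zero_ext (HL d) g x" unfolding AE_M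
    using assms(3) by eventually_elim (use assms(6) in \<open>auto simp: zero_ext_def HL_def\<close>)
  show "zero_ext (HL d) g \<in> borel_measurable M" by (rule zero_ext_measurable[OF assms(4) HL_sets])
qed

lemma L2_near_b_AE_eq: "L2_near_b f \<Longrightarrow> AE x in lebesgue. x \<in> II \<longrightarrow> f x = g x \<Longrightarrow> g \<in> borel_measurable M \<Longrightarrow> L2_near_b g"
  unfolding L2_near_b_def
proof
  fix d assume *: "\<forall>c\<in>II. zero_ext (HR c) f \<in> L2 M" "AE x in lebesgue. x \<in> II \<longrightarrow> f x = g x" "g \<in> borel_measurable M" and d: "d \<in> II"
  obtain c where c: "c \<in> II" "c < d" using smaller_point[OF d] by blast
  show "zero_ext (HR d) g \<in> L2 M"
    by (rule L2_near_b_AE[OF _ c(1) _ *(3) d c(2)]) (use * in \<open>auto simp: L2_near_b_def elim: eventually_mono\<close>)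
qed

lemma L2_near_a_AE_eq: "L2_near_a f \<Longrightarrow> AE x in lebesgue. x \<in> II \<longrightarrow> f x = g x \<Longrightarrow> g \<in> borel_measurable M \<Longrightarrow> L2_near_a g"
  unfolding L2_near_a_def
proof
  fix d assume *: "\<forall>c\<in>II. zero_ext (HL c) f \<in> L2 M" "AE x in lebesgue. x \<in> II \<longrightarrow> f x = g x" "g \<in> borel_measurable M" and d: "d \<in> II"
  obtain c where c: "c \<in> II" "d < c" using larger_point[OF d] by blast
  show "zero_ext (HL d) g \<in> L2 M"
    by (rule L2_near_a_AE[OF _ c(1) _ *(3) d c(2)]) (use * in \<open>auto simp: L2_near_a_def elim: eventually_mono\<close>)
qed

lemma Sol_measurable: "y \<in> Sol z \<Longrightarrow> y \<in> borel_measurable M"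
  by (intro continuous_measurable_M qdiff_continuous SolD(1))

lemma Sol_NB_el: assumes y: "y \<in> Sol z" and n: "L2_near_b y" shows "L2_near_b (el y)"
proof (rule L2_near_b_AE_eq)
  show "L2_near_b (\<lambda>x. z * y x)" using L2_near_b_lin[OF L2_near_b_zero n, of z] by simp
  show "AE x in lebesgue. x \<in> II \<longrightarrow> z * y x = el y x" using SolD(2)[OF y] by eventually_elim auto
qed (rule el_measurable[OF SolD(1)[OF y]])

lemma Sol_NA_el: assumes y: "y \<in> Sol z" and n: "L2_near_a y" shows "L2_near_a (el y)"
proof (rule L2_near_a_AE_eq)
  show "L2_near_a (\<lambda>x. z * y x)" using L2_near_a_lin[OF L2_near_a_zero n, of z] by simp
  show "AE x in lebesgue. x \<in> II \<longrightarrow> z * y x = el y x" using SolD(2)[OF y] by eventually_elim auto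
qed (rule el_measurable[OF SolD(1)[OF y]])

lemma right_interval:
  assumes "c \<in> II"
  shows "open (einterval (ereal c) b)" "is_interval (einterval (ereal c) b)" "einterval (ereal c) b \<subseteq> II" "\<And>x. x \<in> einterval (ereal c) b \<longleftrightarrow> x \<in> II \<and> c < x"
proof -
  show "open (einterval (ereal c) b)" by simp
  show "is_interval (einterval (ereal c) b)" by (rule is_interval_einterval_ereal)
qed (use assms in \<open>auto simp: einterval_right HR_def\<close>)

lemma left_interval:
  assumes "c \<in> II"
  shows "open (einterval a (ereal c))" "is_interval (einterval a (ereal c))" "einterval a (ereal c) \<subseteq> II" "\<And>x. x \<in> einterval a (ereal c) \<longleftrightarrow> x \<in> II \<and> x < c"
proof -
  show "open (einterval a (ereal c))" by simp
  show "is_interval (einterval a (ereal c))" by (rule is_interval_einterval_ereal)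
qed (use assms in \<open>auto simp: einterval_left HL_def\<close>)

lemma agree_right:
  assumes y: "qdiff y" "qdiff z" and c: "c \<in> II" and eq: "\<And>x. x \<in> II \<Longrightarrow> c < x \<Longrightarrow> z x = y x"
  shows "\<And>x. x \<in> II \<Longrightarrow> c < x \<Longrightarrow> data z x = data y x" "AE x in lebesgue. x \<in> II \<longrightarrow> c < x \<longrightarrow> el z x = el y x"
  using local_eq[OF right_interval(1-3)[OF c] y] eq by (auto simp: right_interval(4)[OF c])

lemma agree_left:
  assumes y: "qdiff y" "qdiff z" and c: "c \<in> II" and eq: "\<And>x. x \<in> II \<Longrightarrow> x < c \<Longrightarrow> z x = y x"
  shows "\<And>x. x \<in> II \<Longrightarrow> x < c \<Longrightarrow> data z x = data y x" "AE x in lebesgue. x \<in> II \<longrightarrow> x < c \<longrightarrow> el z x = el y x"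
  using local_eq[OF left_interval(1-3)[OF c] y] eq by (auto simp: left_interval(4)[OF c])

lemma el_cong_near_right:
  assumes y: "qdiff y" "qdiff z" and c: "c \<in> II" and eq: "\<And>x. x \<in> II \<Longrightarrow> c < x \<Longrightarrow> z x = y x" and n: "L2_near_b y" "L2_near_b (el y)" and d: "d \<in> II" "c < d"
  shows "zero_ext (HR d) z \<in> L2 M" "zero_ext (HR d) (el z) \<in> L2 M"
proof -
  show "zero_ext (HR d) z \<in> L2 M"
    by (rule L2_near_b_AE[OF n(1) c _ continuous_measurable_M[OF qdiff_continuous[OF y(2)]] d]) (use eq in \<open>auto intro: AE_I2\<close>)
  show "zero_ext (HR d) (el z) \<in> L2 M"
    by (rule L2_near_b_AE[OF n(2) c _ el_measurable[OF y(2)] d]) (use agree_right(2)[OF y c eq] in \<open>auto elim: eventually_mono\<close>)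
qed

lemma el_cong_near_left:
  assumes y: "qdiff y" "qdiff z" and c: "c \<in> II" and eq: "\<And>x. x \<in> II \<Longrightarrow> x < c \<Longrightarrow> z x = y x" and n: "L2_near_a y" "L2_near_a (el y)" and d: "d \<in> II" "d < c"
  shows "zero_ext (HL d) z \<in> L2 M" "zero_ext (HL d) (el z) \<in> L2 M"
proof -
  show "zero_ext (HL d) z \<in> L2 M"
    by (rule L2_near_a_AE[OF n(1) c _ continuous_measurable_M[OF qdiff_continuous[OF y(2)]] d]) (use eq in \<open>auto intro: AE_I2\<close>)
  show "zero_ext (HL d) (el z) \<in> L2 M"
    by (rule L2_near_a_AE[OF n(2) c _ el_measurable[OF y(2)] d]) (use agree_left(2)[OF y c eq] in \<open>auto elim: eventually_mono\<close>)
qed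

text \<open>Any regular behaviour near \<open>a\<close> can be combined with any regular behaviour
  near \<open>b\<close> inside the maximal domain; this is what makes cut-off arguments at a single
  endpoint possible.\<close>

lemma join:
  assumes y: "qdiff y1" "qdiff y2" and n: "L2_near_a y1" "L2_near_a (el y1)" "L2_near_b y2" "L2_near_b (el y2)"
  shows "\<exists>Z. \<exists>c\<in>II. \<exists>d\<in>II. c < d \<and> qdiff Z \<and> Z \<in> L2 M \<and> el Z \<in> L2 M \<and> (\<forall>x\<in>II. x < c \<longrightarrow> Z x = y1 x) \<and> (\<forall>x\<in>II. d < x \<longrightarrow> Z x = y2 x)"
proof -
  obtain c where c: "c \<in> II" using point_in_II by blast
  obtain d where d: "d \<in> II" "c < d" using larger_point[OF c] by blast
  have cd: "{c..d} \<subseteq> II" by (rule subI[OF c d(1)])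
  obtain Z h where Z: "qdiff Z" "\<forall>x\<in>II. x \<le> c \<longrightarrow> data Z x = data y1 x" "\<forall>x\<in>II. d < x \<longrightarrow> data Z x = data y2 x"
    "AE x in lebesgue. x \<in> II \<longrightarrow> x \<le> c \<longrightarrow> el Z x = el y1 x" "AE x in lebesgue. x \<in> II \<longrightarrow> d < x \<longrightarrow> el Z x = el y2 x"
    "continuous_on II h" "AE x in lebesgue. x \<in> II \<longrightarrow> c < x \<longrightarrow> x \<le> d \<longrightarrow> el Z x = h x"
    using patch[OF y d(2) cd] by blast
  have z1: "Z x = y1 x" if "x \<in> II" "x < c" for x
    using Z(2) that data_nth(1)[of Z x] data_nth(1)[of y1 x] by simp
  have z2: "Z x = y2 x" if "x \<in> II" "d < x" for x
    using Z(3) that data_nth(1)[of Z x] data_nth(1)[of y2 x] by simp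
  obtain c' where c': "c' \<in> II" "c' < c" using smaller_point[OF c] by blast
  obtain d' where d': "d' \<in> II" "d < d'" using larger_point[OF d(1)] by blast
  have Zc: "continuous_on II Z" by (rule qdiff_continuous[OF Z(1)])
  have NAZ: "L2_near_a Z" by (rule L2_near_a_I[OF Zc c'(1)]) (rule el_cong_near_left(1)[OF y(1) Z(1) c z1 n(1,2) c'])
  have NBZ: "L2_near_b Z" by (rule L2_near_b_I[OF Zc d'(1)]) (rule el_cong_near_right(1)[OF y(2) Z(1) d(1) z2 n(3,4) d'])
  have ZL: "Z \<in> L2 M" by (rule L2_iff_NA_NB[OF c]) (use c NAZ NBZ in \<open>auto simp: L2_near_a_def L2_near_b_def\<close>)
  have "zero_ext (HL c) (el y1) \<in> L2 M" using n(2) c by (simp add: L2_near_a_def)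
  moreover have "zero_ext {c..d} h \<in> L2 M" by (rule continuous_zero_ext_L2[OF Z(6) cd])
  moreover have "zero_ext (HR d) (el y2) \<in> L2 M" using n(4) d by (simp add: L2_near_b_def)
  \<comment> \<open>Removing d here and c from the middle interval makes the three pieces disjoint,
    so that their sum is \<open>ell\<close> of \<open>Z\<close> almost everywhere.\<close>
  moreover have "zero_ext (HR d - {d}) (el y2) \<in> L2 M"
    by (rule zero_ext_L2_mono[OF \<open>zero_ext (HR d) (el y2) \<in> L2 M\<close>]) (auto intro!: open_sets_M simp: HR_def)
  moreover have "zero_ext ({c..d} - {c}) h \<in> L2 M"
    by (rule zero_ext_L2_mono[OF \<open>zero_ext {c..d} h \<in> L2 M\<close>]) (use cd in \<open>auto intro!: open_sets_M\<close>)
  ultimately have "(\<lambda>x. zero_ext (HL c) (el y1) x + zero_ext (HR d - {d}) (el y2) x + zero_ext ({c..d} - {c}) h x) \<in> L2 M"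
    by (intro L2_add)
  then have "el Z \<in> L2 M"
  proof (rule L2_cong_AE[OF _ _ el_measurable[OF Z(1)]])
    show "AE x in M. zero_ext (HL c) (el y1) x + zero_ext (HR d - {d}) (el y2) x + zero_ext ({c..d} - {c}) h x = el Z x"
      unfolding AE_M using Z(4,5,7) by eventually_elim (use d(2) in \<open>auto simp: zero_ext_def HL_def HR_def\<close>)
  qed
  with ZL Z(1) z1 z2 c d show ?thesis by blast
qed

end

section \<open>The self-adjoint problem and boundary forms at the two endpoints\<close>

locale boundary_problem = weighted_expression +
  fixes \<Phi> :: "(real \<Rightarrow> complex) option" and \<theta> :: "2 \<Rightarrow> real \<Rightarrow> complex" and \<mu>\<^sub>0 :: real
  assumes b4: "lim_type_right a b p s q w 4"
    and \<Phi>_qdiff: "\<And>\<phi>. \<Phi> = Some \<phi> \<Longrightarrow> qdiff \<phi>"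
    and \<theta>: "\<And>i. \<theta> i \<in> Sol (of_real \<mu>\<^sub>0)"
    and \<theta>_indep: "\<And>\<alpha>. (\<And>x. x \<in> II \<Longrightarrow> (\<Sum>i\<in>UNIV. \<alpha> i * \<theta> i x) = 0) \<Longrightarrow> \<alpha> i = 0"
    and \<theta>_bracket: "\<And>i j x. x \<in> II \<Longrightarrow> br (\<theta> i) (\<theta> j) x = 0"
    and sa: "self_adjoint M (bc_operator \<Phi> (\<theta> 1) (\<theta> 2) a b p s q w)"
begin

abbreviation "L \<equiv> bc_operator \<Phi> (\<theta> 1) (\<theta> 2) a b p s q w"

text \<open>Vacuous when \<open>\<Phi>\<close> is \<open>None\<close>, so that lim-2 and lim-3
  endpoints are treated by one argument.\<close>

definition condition_a :: "(real \<Rightarrow> complex) \<Rightarrow> bool" where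
  "condition_a y \<longleftrightarrow> (\<forall>\<phi>. \<Phi> = Some \<phi> \<longrightarrow> lim_left (br y \<phi>) 0)"

definition condition_b :: "(real \<Rightarrow> complex) \<Rightarrow> bool" where
  "condition_b y \<longleftrightarrow> (\<forall>i. lim_right (br y (\<theta> i)) 0)"

text \<open>Membership in the domain of \<open>L\<close> splits into one property for each endpoint
  (\<open>Dom_iff\<close>); a solution for nonreal z can be required to satisfy one of the two
  halves.\<close>

definition admissible_a :: "(real \<Rightarrow> complex) \<Rightarrow> bool" where "admissible_a y \<longleftrightarrow> qdiff y \<and> L2_near_a y \<and> L2_near_a (el y) \<and> condition_a y"
definition admissible_b :: "(real \<Rightarrow> complex) \<Rightarrow> bool" where "admissible_b y \<longleftrightarrow> qdiff y \<and> L2_near_b y \<and> L2_near_b (el y) \<and> condition_b y"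
definition Dom :: "(real \<Rightarrow> complex) set" where
  "Dom = {y. qdiff y \<and> y \<in> L2 M \<and> el y \<in> L2 M \<and> condition_a y \<and> condition_b y}"

lemma L2_near_b_Sol: "y \<in> Sol z \<Longrightarrow> L2_near_b y" by (rule lim4_imp_NB_Sol[OF b4])

lemma L_eq: "L = (\<lambda>y. (y, el y)) ` Dom"
  unfolding bc_operator_def ell_graph_def bc_domain_def Dom_def Dmax_def condition_a_def condition_b_def
    bracket_zero_left_def bracket_zero_right_def forall_2
  by (intro image_cong refl) auto

lemma Dom_iff: "y \<in> Dom \<longleftrightarrow> admissible_a y \<and> admissible_b y"
proof
  assume "admissible_a y \<and> admissible_b y"
  moreover obtain c where c: "c \<in> II" using point_in_II by blast
  ultimately have "zero_ext (HL c) y \<in> L2 M" "zero_ext (HR c) y \<in> L2 M" "zero_ext (HL c) (el y) \<in> L2 M" "zero_ext (HR c) (el y) \<in> L2 M"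
    by (auto simp: admissible_a_def admissible_b_def L2_near_a_def L2_near_b_def)
  then have "y \<in> L2 M" "el y \<in> L2 M" using L2_iff_NA_NB[OF c] by auto
  with \<open>admissible_a y \<and> admissible_b y\<close> show "y \<in> Dom" by (simp add: Dom_def admissible_a_def admissible_b_def)
qed (auto simp: Dom_def admissible_a_def admissible_b_def L2_NA_NB)

lemma condition_a_lin: "qdiff y \<Longrightarrow> qdiff z \<Longrightarrow> condition_a y \<Longrightarrow> condition_a z \<Longrightarrow> condition_a (\<lambda>x. y x + k * z x)"
  unfolding condition_a_def using lim_left_lin[of y z _ 0 0 k] by simp

lemma condition_b_lin: "qdiff y \<Longrightarrow> qdiff z \<Longrightarrow> condition_b y \<Longrightarrow> condition_b z \<Longrightarrow> condition_b (\<lambda>x. y x + k * z x)"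
  unfolding condition_b_def using lim_right_lin[of y z _ 0 0 k] by simp

lemma el_lin_measurable: "qdiff y \<Longrightarrow> qdiff z \<Longrightarrow> el (\<lambda>x. y x + k * z x) \<in> borel_measurable M"
  by (intro el_measurable qdiff_lin(1))

lemma admissible_a_lin: assumes "admissible_a y" "admissible_a z" shows "admissible_a (\<lambda>x. y x + k * z x)"
proof -
  have q: "qdiff y" "qdiff z" using assms by (auto simp: admissible_a_def)
  have "L2_near_a (el (\<lambda>x. y x + k * z x))"
    by (rule L2_near_a_AE_eq[OF L2_near_a_lin[of "el y" "el z" k] _ el_lin_measurable[OF q]])
       (use assms qdiff_lin(3)[OF q, of k] in \<open>auto simp: admissible_a_def elim: eventually_mono\<close>)
  then show ?thesis using assms by (auto simp: admissible_a_def intro: condition_a_lin L2_near_a_lin qdiff_lin(1))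
qed

lemma admissible_b_lin: assumes "admissible_b y" "admissible_b z" shows "admissible_b (\<lambda>x. y x + k * z x)"
proof -
  have q: "qdiff y" "qdiff z" using assms by (auto simp: admissible_b_def)
  have "L2_near_b (el (\<lambda>x. y x + k * z x))"
    by (rule L2_near_b_AE_eq[OF L2_near_b_lin[of "el y" "el z" k] _ el_lin_measurable[OF q]])
       (use assms qdiff_lin(3)[OF q, of k] in \<open>auto simp: admissible_b_def elim: eventually_mono\<close>)
  then show ?thesis using assms by (auto simp: admissible_b_def intro: condition_b_lin L2_near_b_lin qdiff_lin(1))
qed

lemma zero_bc: "condition_a (\<lambda>x. 0)" "condition_b (\<lambda>x. 0)" "L2_near_a (el (\<lambda>x. 0))" "L2_near_b (el (\<lambda>x. 0))"
proof -
  obtain c where c: "c \<in> II" using point_in_II by blast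
  have "br (\<lambda>x. 0) g x = 0" if "x \<in> II" for g x using that by (simp add: bracket_eq_form qdiff_zero(2) form_def)
  then show "condition_a (\<lambda>x. 0)" "condition_b (\<lambda>x. 0)" unfolding condition_a_def condition_b_def
    by (auto intro!: lim_left_zero[OF c] lim_right_zero[OF c])
  show "L2_near_a (el (\<lambda>x. 0))" by (rule L2_near_a_AE_eq[OF L2_near_a_zero _ el_measurable[OF qdiff_zero(1)]]) (use qdiff_zero(3) in \<open>auto elim: eventually_mono\<close>)
  show "L2_near_b (el (\<lambda>x. 0))" by (rule L2_near_b_AE_eq[OF L2_near_b_zero _ el_measurable[OF qdiff_zero(1)]]) (use qdiff_zero(3) in \<open>auto elim: eventually_mono\<close>)
qed

lemma admissible_a_zero: "admissible_a (\<lambda>x. 0)" and admissible_b_zero: "admissible_b (\<lambda>x. 0)"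
  by (auto simp: admissible_a_def admissible_b_def zero_bc qdiff_zero(1) L2_near_a_zero L2_near_b_zero)

lemma condition_a_local:
  assumes y: "condition_a y" "qdiff y" and z: "qdiff z" and c: "c \<in> II" and eq: "\<And>x. x \<in> II \<Longrightarrow> x < c \<Longrightarrow> z x = y x"
  shows "condition_a z"
  unfolding condition_a_def
proof (intro allI impI)
  fix \<phi> assume \<phi>: "\<Phi> = Some \<phi>"
  have "lim_left (br y \<phi>) 0" using y(1) \<phi> unfolding condition_a_def by blast
  then show "lim_left (br z \<phi>) 0"
    by (rule lim_left_cong[OF _ c]) (simp add: bracket_eq_form agree_left(1)[OF y(2) z c eq])
qed

lemma condition_b_local:
  assumes y: "condition_b y" "qdiff y" and z: "qdiff z" and c: "c \<in> II" and eq: "\<And>x. x \<in> II \<Longrightarrow> c < x \<Longrightarrow> z x = y x"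
  shows "condition_b z"
  unfolding condition_b_def
proof (intro allI impI)
  fix i
  have "lim_right (br y (\<theta> i)) 0" using y by (simp add: condition_b_def)
  then show "lim_right (br z (\<theta> i)) 0"
    by (rule lim_right_cong[OF _ c]) (simp add: bracket_eq_form agree_right(1)[OF y(2) z c eq])
qed

text \<open>The boundary conditions are separated and depend on germs at the endpoints, so a patched
  function satisfies both.\<close>

lemma Dom_join:
  assumes "admissible_a y1" "admissible_b y2"
  shows "\<exists>Z\<in>Dom. \<exists>c\<in>II. \<exists>d\<in>II. c < d \<and> (\<forall>x\<in>II. x < c \<longrightarrow> Z x = y1 x) \<and> (\<forall>x\<in>II. d < x \<longrightarrow> Z x = y2 x)"
proof -
  have y: "qdiff y1" "qdiff y2" "L2_near_a y1" "L2_near_a (el y1)" "L2_near_b y2" "L2_near_b (el y2)" "condition_a y1" "condition_b y2"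
    using assms by (auto simp: admissible_a_def admissible_b_def)
  obtain Z c d where Z: "c \<in> II" "d \<in> II" "c < d" "qdiff Z" "Z \<in> L2 M" "el Z \<in> L2 M" "\<forall>x\<in>II. x < c \<longrightarrow> Z x = y1 x" "\<forall>x\<in>II. d < x \<longrightarrow> Z x = y2 x"
    using join[OF y(1-6)] by blast
  have "condition_a Z" by (rule condition_a_local[OF y(7,1) Z(4,1)]) (use Z(7) in blast)
  moreover have "condition_b Z" by (rule condition_b_local[OF y(8,2) Z(4,2)]) (use Z(8) in blast)
  ultimately have "Z \<in> Dom" using Z by (simp add: Dom_def)
  with Z show ?thesis by blast
qed

lemma Dom_symmetric:
  assumes "f \<in> Dom" "g \<in> Dom"
  shows "(\<integral>x. Lag f g x \<partial>M) = 0"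
proof -
  have L: "f \<in> L2 M" "el f \<in> L2 M" "g \<in> L2 M" "el g \<in> L2 M" using assms by (auto simp: Dom_def)
  have "(g, el g) \<in> adjoint_graph M L" using sa assms unfolding self_adjoint_def L_eq by blast
  moreover have "(f, el f) \<in> L" using assms unfolding L_eq by blast
  ultimately have "ip M (el f) g = ip M f (el g)" unfolding adjoint_graph_def by blast
  then show ?thesis unfolding ip_def using L by (simp add: L2_prod_integrable(1) L2_cnj)
qed

lemma Lag_integrable_L2:
  assumes "f \<in> Dom" "g \<in> Dom" "A \<in> sets M"
  shows "set_integrable M A (\<lambda>x. Lag f g x)"
  by (rule Lag_integrable) (use assms in \<open>auto simp: Dom_def intro: zero_ext_L2\<close>)

text \<open>\<open>f\<close> and \<open>g\<close> are continued to elements of the domain that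
  vanish near \<open>b\<close>. Symmetry of \<open>L\<close> makes the whole Lagrange integral 0;
  the bracket also vanishes at a point e where \<open>F\<close> is already 0, so its limit at
  \<open>a\<close> is 0. The boundary condition itself is never computed with.\<close>

lemma admissible_a_lim:
  assumes "admissible_a f" "admissible_a g"
  shows "lim_left (br f g) 0"
proof -
  obtain F c d where F: "F \<in> Dom" "c \<in> II" "d \<in> II" "\<And>x. x \<in> II \<Longrightarrow> x < c \<Longrightarrow> F x = f x" "\<And>x. x \<in> II \<Longrightarrow> d < x \<Longrightarrow> F x = 0"
    using Dom_join[OF assms(1) admissible_b_zero] by blast
  obtain G c' where G: "G \<in> Dom" "c' \<in> II" "\<And>x. x \<in> II \<Longrightarrow> x < c' \<Longrightarrow> G x = g x"
    using Dom_join[OF assms(2) admissible_b_zero] by blast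
  have q: "qdiff F" "qdiff G" "qdiff f" "qdiff g" using F(1) G(1) assms by (auto simp: Dom_def admissible_a_def)
  obtain e where e: "e \<in> II" "d < e" using larger_point[OF F(3)] by blast
  have de: "data F x = 0" if "x \<in> II" "d < x" for x
    using agree_right(1)[OF qdiff_zero(1) q(1) F(3,5) that] qdiff_zero(2)[OF that(1)] by simp
  have br0: "br F G e = 0" using de[OF e] by (simp add: bracket_eq_form form_def)
  have elF: "AE x in lebesgue. x \<in> II \<longrightarrow> d < x \<longrightarrow> el F x = el (\<lambda>x. 0) x"
    by (rule agree_right(2)[OF qdiff_zero(1) q(1) F(3)]) (rule F(5))
  have "(LINT x:HL e|M. Lag F G x) = (\<integral>x. Lag F G x \<partial>M)"
    unfolding set_lebesgue_integral_def
  proof (rule integral_cong_AE)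
    show "(\<lambda>x. indicator (HL e) x *\<^sub>R Lag F G x) \<in> borel_measurable M" "(\<lambda>x. Lag F G x) \<in> borel_measurable M"
      by (intro borel_measurable_scaleR borel_measurable_indicator HL_sets Lag_measurable q)+
    show "AE x in M. indicator (HL e) x *\<^sub>R Lag F G x = Lag F G x"
      unfolding AE_M using elF qdiff_zero(3)
      by eventually_elim (use e F(5) in \<open>auto simp: HL_def indicator_def\<close>)
  qed
  then have "lim_left (br F G) 0"
    using bracket_lim_left[OF q(1,2) e(1) Lag_integrable_L2[OF F(1) G(1) HL_sets]] Dom_symmetric[OF F(1) G(1)] br0 by simp
  moreover have "min c c' \<in> II" using F(2) G(2) by (simp add: min_def)
  ultimately show ?thesis
  proof (rule lim_left_cong)
    fix x assume x: "x \<in> II" "x < min c c'"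
    then show "br F G x = br f g x"
      using agree_left(1)[OF q(3,1) F(2,4), of x] agree_left(1)[OF q(4,2) G(2,3), of x] by (simp add: bracket_eq_form)
  qed
qed

lemma admissible_b_lim:
  assumes "admissible_b f" "admissible_b g"
  shows "lim_right (br f g) 0"
proof -
  obtain F c d where F: "F \<in> Dom" "d \<in> II" "c \<in> II" "\<And>x. x \<in> II \<Longrightarrow> d < x \<Longrightarrow> F x = f x" "\<And>x. x \<in> II \<Longrightarrow> x < c \<Longrightarrow> F x = 0"
    using Dom_join[OF admissible_a_zero assms(1)] by blast
  obtain G d' where G: "G \<in> Dom" "d' \<in> II" "\<And>x. x \<in> II \<Longrightarrow> d' < x \<Longrightarrow> G x = g x"
    using Dom_join[OF admissible_a_zero assms(2)] by blast
  have q: "qdiff F" "qdiff G" "qdiff f" "qdiff g" using F(1) G(1) assms by (auto simp: Dom_def admissible_b_def)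
  obtain e where e: "e \<in> II" "e < c" using smaller_point[OF F(3)] by blast
  have de: "data F x = 0" if "x \<in> II" "x < c" for x
    using agree_left(1)[OF qdiff_zero(1) q(1) F(3,5) that] qdiff_zero(2)[OF that(1)] by simp
  have br0: "br F G e = 0" using de[OF e] by (simp add: bracket_eq_form form_def)
  have elF: "AE x in lebesgue. x \<in> II \<longrightarrow> x < c \<longrightarrow> el F x = el (\<lambda>x. 0) x"
    by (rule agree_left(2)[OF qdiff_zero(1) q(1) F(3)]) (rule F(5))
  have "(LINT x:HR e|M. Lag F G x) = (\<integral>x. Lag F G x \<partial>M)"
    unfolding set_lebesgue_integral_def
  proof (rule integral_cong_AE)
    show "(\<lambda>x. indicator (HR e) x *\<^sub>R Lag F G x) \<in> borel_measurable M" "(\<lambda>x. Lag F G x) \<in> borel_measurable M"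
      by (intro borel_measurable_scaleR borel_measurable_indicator HR_sets Lag_measurable q)+
    show "AE x in M. indicator (HR e) x *\<^sub>R Lag F G x = Lag F G x"
      unfolding AE_M using elF qdiff_zero(3)
      by eventually_elim (use e F(5) in \<open>auto simp: HR_def indicator_def\<close>)
  qed
  then have "lim_right (br F G) 0"
    using bracket_lim_right[OF q(1,2) e(1) Lag_integrable_L2[OF F(1) G(1) HR_sets]] Dom_symmetric[OF F(1) G(1)] br0 by simp
  moreover have "max d d' \<in> II" using F(2) G(2) by (simp add: max_def)
  ultimately show ?thesis
  proof (rule lim_right_cong)
    fix x assume x: "x \<in> II" "max d d' < x"
    then show "br F G x = br f g x"
      using agree_right(1)[OF q(3,1) F(2,4), of x] agree_right(1)[OF q(4,2) G(2,3), of x] by (simp add: bracket_eq_form)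
  qed
qed

lemma Sol_admissible_a: "y \<in> Sol z \<Longrightarrow> admissible_a y \<longleftrightarrow> L2_near_a y \<and> condition_a y"
  using Sol_NA_el SolD(1) by (auto simp: admissible_a_def)

lemma Sol_admissible_b: "y \<in> Sol z \<Longrightarrow> admissible_b y \<longleftrightarrow> condition_b y"
  using Sol_NB_el SolD(1) L2_near_b_Sol by (auto simp: admissible_b_def)

lemma resolvent_L:
  assumes z: "z \<notin> \<real>" and f: "f \<in> L2 M"
  shows "resolvent M L z f \<in> Dom" "AE x in lebesgue. x \<in> II \<longrightarrow> el (resolvent M L z f) x - z * resolvent M L z f x = f x"
proof -
  have "\<exists>y v. (y, v) \<in> L \<and> (AE x in M. v x - z * y x = f x)"
  proof (rule self_adjoint_resolvent_exists[OF sa z _ _ f])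
    show "L \<noteq> {}" using admissible_a_zero admissible_b_zero unfolding L_eq by (auto simp: Dom_iff)
    fix y v y' v' c assume "(y, v) \<in> L" "(y', v') \<in> L"
    then have *: "y \<in> Dom" "y' \<in> Dom" "v = el y" "v' = el y'" by (auto simp: L_eq)
    then have "(\<lambda>x. y x + c * y' x) \<in> Dom" by (auto simp: Dom_iff admissible_a_lin admissible_b_lin)
    moreover have "AE x in M. el (\<lambda>x. y x + c * y' x) x = v x + c * v' x"
      unfolding AE_M *(3,4) by (rule qdiff_lin(3)) (use * in \<open>auto simp: Dom_def\<close>)
    ultimately show "\<exists>v''. (\<lambda>x. y x + c * y' x, v'') \<in> L \<and> (AE x in M. v'' x = v x + c * v' x)"
      unfolding L_eq by blast
  qed
  from someI_ex[OF this] have "\<exists>v. (resolvent M L z f, v) \<in> L \<and> (AE x in M. v x - z * resolvent M L z f x = f x)"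
    unfolding resolvent_def .
  then show "resolvent M L z f \<in> Dom" "AE x in lebesgue. x \<in> II \<longrightarrow> el (resolvent M L z f) x - z * resolvent M L z f x = f x"
    unfolding L_eq AE_M by auto
qed

text \<open>\<open>W\<close> agrees with \<open>Z\<close> near \<open>b\<close> and vanishes near
  \<open>a\<close>. Subtracting the resolvent of el W - z W leaves a solution that is admissible at
  \<open>a\<close> and differs from \<open>Z\<close> near \<open>b\<close> by an element of the
  domain; it therefore has the boundary values of \<open>Z\<close>.\<close>

lemma lift:
  assumes z: "z \<notin> \<real>" and Z: "qdiff Z" "L2_near_b Z" "L2_near_b (el Z)"
  shows "\<exists>e\<in>Sol z. admissible_a e \<and> (\<exists>y\<in>Dom. \<exists>c\<in>II. \<forall>x\<in>II. c < x \<longrightarrow> e x = Z x - y x)"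
proof -
  obtain W c d where W: "c \<in> II" "d \<in> II" "qdiff W" "W \<in> L2 M" "el W \<in> L2 M" "\<And>x. x \<in> II \<Longrightarrow> x < c \<Longrightarrow> W x = 0" "\<And>x. x \<in> II \<Longrightarrow> d < x \<Longrightarrow> W x = Z x"
    using join[OF qdiff_zero(1) Z(1) L2_near_a_zero zero_bc(3) Z(2,3)] by blast
  have "condition_a W" by (rule condition_a_local[OF zero_bc(1) qdiff_zero(1) W(3,1,6)])
  then have AW: "admissible_a W" using W by (simp add: admissible_a_def L2_NA_NB)
  define f where "f x = el W x - z * W x" for x
  have f: "f \<in> L2 M" unfolding f_def by (intro L2_diff L2_scale W)
  define y where "y = resolvent M L z f"
  note y = resolvent_L[OF z f, folded y_def]
  have qy: "qdiff y" using y(1) by (simp add: Dom_def)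
  define e where "e = (\<lambda>x. W x + (-1) * y x)"
  have "e \<in> Sol z"
  proof -
    have "AE x in lebesgue. x \<in> II \<longrightarrow> el e x = z * e x"
      using qdiff_lin(3)[OF W(3) qy, of "-1", folded e_def] y(2)
    proof eventually_elim
      case (elim x)
      show ?case
      proof
        assume x: "x \<in> II"
        have "el e x = el W x - el y x" using elim(1) x by simp
        moreover have "el y x = z * y x + (el W x - z * W x)" using elim(2) x by (simp add: f_def diff_eq_eq add.commute)
        moreover have "e x = W x - y x" by (simp add: e_def)
        ultimately show "el e x = z * e x" by (simp add: right_diff_distrib)
      qed
    qed
    then show ?thesis using qdiff_lin(1)[OF W(3) qy, of "-1", folded e_def] by (simp add: Sol_def)
  qed
  moreover have "admissible_a e" unfolding e_def by (rule admissible_a_lin[OF AW]) (use y(1) in \<open>simp add: Dom_iff\<close>)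
  ultimately show ?thesis using y(1) W(2,7) by (intro bexI[of _ e] conjI bexI[of _ y] bexI[of _ d]) (auto simp: e_def)
qed

text \<open>\<open>lift\<close> for \<open>u\<close> itself: near \<open>b\<close>, the remainder u
  - e is an element of the domain, so it meets the conditions there.\<close>

lemma Sol_split:
  assumes z: "z \<notin> \<real>" and u: "u \<in> Sol z"
  shows "\<exists>e\<in>Sol z. \<exists>e'\<in>Sol z. admissible_a e \<and> admissible_b e' \<and> u = (\<lambda>x. e x + e' x)"
proof -
  obtain e y c where e: "e \<in> Sol z" "admissible_a e" "y \<in> Dom" "c \<in> II" "\<And>x. x \<in> II \<Longrightarrow> c < x \<Longrightarrow> e x = u x - y x"
    using lift[OF z SolD(1)[OF u] L2_near_b_Sol[OF u] Sol_NB_el[OF u L2_near_b_Sol[OF u]]] by blast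
  define e' where "e' x = u x + (-1) * e x" for x
  have e': "e' \<in> Sol z" unfolding e'_def by (rule Sol_lin[OF u e(1)])
  have "condition_b e'" by (rule condition_b_local[of y, OF _ _ SolD(1)[OF e'] e(4)]) (use e in \<open>auto simp: Dom_def e'_def\<close>)
  then have "admissible_b e'" by (simp add: Sol_admissible_b[OF e'])
  with e(1,2) e' show ?thesis by (intro bexI[of _ e] bexI[of _ e'] conjI) (auto simp: e'_def)
qed

end

section \<open>Lagrangian boundary conditions and boundary values of solutions\<close>

context quasi_expression
begin

lemma form_zero: "form 0 v = 0" "form v 0 = 0"
  by (auto simp: form_def)

text \<open>The dual vectors \<open>z\<close> show that the \<open>u i\<close> span a plane of half
  the dimension on which the form vanishes. Such a Lagrangian plane is its own orthogonal
  complement, so \<open>v\<close> lies in it.\<close>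

lemma form_lagrangian:
  fixes u z :: "2 \<Rightarrow> complex^4"
  assumes uu: "\<And>i k. form (u i) (u k) = 0" and zu: "\<And>i k. form (z i) (u k) = (if i = k then 1 else 0)"
    and v: "\<And>i. form v (u i) = 0"
  shows "form v v = 0"
proof -
  have uz: "form (u i) (z k) = (if i = k then -1 else 0)" for i k
    using form_commute[of "u i" "z k"] zu[of k i] by auto
  define B :: "4 \<Rightarrow> complex^4" where "B k = (if k = 1 then u 1 else if k = 2 then u 2 else if k = 3 then z 1 else z 2)" for k
  define F where "F v = (\<chi> k. form v (B k))" for v
  have lin: "linear F"
  proof (rule linearI)
    show "F (x + y) = F x + F y" for x y
      unfolding F_def using form_lin_left[of x 1 y] by (simp add: vec_eq_iff)
    show "F (r *\<^sub>R x) = r *\<^sub>R F x" for r x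
      unfolding F_def by (simp add: vec_eq_iff form_def scaleR_diff_right scaleR_add_right)
  qed
  have "surj F" unfolding surj_def
  proof
    fix t :: "complex^4"
    \<comment> \<open>The \<open>z i\<close> need not be orthogonal to each other, so the
      coefficients of the \<open>u i\<close> compensate the values form (z 1) (z i) and form (z 2)
      (z i).\<close>
    define c where "c i = t $ 1 * form (z 1) (z i) + t $ 2 * form (z 2) (z i) - (if i = 1 then t $ 3 else t $ 4)" for i :: 2
    let ?v = "((t $ 1 *s z 1 + t $ 2 *s z 2) + c 1 *s u 1) + c 2 *s u 2"
    have f: "form ?v w = t $ 1 * form (z 1) w + t $ 2 * form (z 2) w + c 1 * form (u 1) w + c 2 * form (u 2) w" for w
      using form_lin_left[of 0 "t $ 1" "z 1" w] by (simp add: form_lin_left form_zero)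
    have "F ?v = t" unfolding F_def vec_eq_iff forall_4 by (simp add: f B_def uu zu uz) (simp add: c_def)
    then show "\<exists>v. t = F v" by metis
  qed
  then have inj: "inj F" using linear_surjective_imp_injective[OF lin] by blast
  \<comment> \<open>The plus signs come from form (u i) (z i) = -1; the corrected vector is
    orthogonal to the whole basis.\<close>
  let ?v = "(v + form v (z 1) *s u 1) + form v (z 2) *s u 2"
  have "F ?v = 0" unfolding F_def vec_eq_iff forall_4 by (simp add: B_def form_lin_left v uu uz)
  moreover have "F 0 = 0" unfolding F_def vec_eq_iff by (simp add: form_zero)
  ultimately have "?v = 0" using inj by (metis injD)
  then have e: "v = (0 + (- form v (z 1)) *s u 1) + (- form v (z 2)) *s u 2"
    by (simp add: vec_eq_iff eq_neg_iff_add_eq_0) (simp add: algebra_simps eq_neg_iff_add_eq_0)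
  have "form v w = 0" if "w = (0 + \<alpha> *s u 1) + \<beta> *s u 2" for w \<alpha> \<beta>
    unfolding that by (simp only: form_lin_right form_zero v)  simp
  from this[OF e] show ?thesis .
qed

end

context boundary_problem
begin

text \<open>Solutions dual to \<open>\<theta>\<close> under the bracket. They are solved for at one
  point by inverting a Gram matrix, and duality holds everywhere because brackets of solutions for
  the same real parameter are constant.\<close>

lemma boundary_dual:
  "\<exists>\<zeta> :: 2 \<Rightarrow> real \<Rightarrow> complex. \<forall>i. \<zeta> i \<in> Sol (of_real \<mu>\<^sub>0) \<and> (\<forall>k. \<forall>x\<in>II. br (\<zeta> i) (\<theta> k) x = (if i = k then 1 else 0))"
proof -
  obtain x0 where x0: "x0 \<in> II" using point_in_II by blast
  define u where "u i = data (\<theta> i) x0" for i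
  \<comment> \<open>The matrix of the form is applied to \<open>u i\<close> so that form (v i) (u k)
    becomes the standard Hermitian inner product of \<open>u i\<close> and
    \<open>u k\<close>.\<close>
  define v :: "2 \<Rightarrow> complex^4" where "v i = (\<chi> l. if l = 1 then u i $ 4 else if l = 2 then u i $ 3 else if l = 3 then - u i $ 2 else - u i $ 1)" for i
  have vn: "v i $ 1 = u i $ 4" "v i $ 2 = u i $ 3" "v i $ 3 = - u i $ 2" "v i $ 4 = - u i $ 1" for i
    by (auto simp: v_def)
  have fvu: "form (v i) (u k) = (\<Sum>l\<in>UNIV. u i $ l * cnj (u k $ l))" for i k
    by (simp add: form_def vn sum_4)
  define G :: "complex^2^2" where "G = (\<chi> k i. form (v i) (u k))"
  have lin: "linear (\<lambda>c. G *v c)"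
  proof (rule linearI)
    show "G *v (x + y) = G *v x + G *v y" for x y by (rule matrix_vector_right_distrib)
    show "G *v (r *\<^sub>R x) = r *\<^sub>R (G *v x)" for r x by (simp add: vec_eq_iff matrix_vector_mult_def scaleR_sum_right)
  qed
  have inj0: "c = 0" if "G *v c = 0" for c
  proof -
    define W where "W l = (\<Sum>i\<in>UNIV. c $ i * u i $ l)" for l
    \<comment> \<open>The quadratic form of the Gram matrix is the squared norm of the combination
      of the \<open>u i\<close>, so a null vector gives a combination with zero data.\<close>
    have "(\<Sum>k\<in>UNIV. cnj (c $ k) * (G *v c) $ k) = (\<Sum>l\<in>UNIV. W l * cnj (W l))"
      unfolding W_def G_def matrix_vector_mult_def by (simp add: fvu sum_2 sum_4 algebra_simps)
    then have "(\<Sum>l\<in>UNIV. W l * cnj (W l)) = 0" using that by simp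
    then have "complex_of_real (\<Sum>l\<in>UNIV. (norm (W l))\<^sup>2) = 0" unfolding of_real_sum complex_norm_square .
    then have "(\<Sum>l\<in>UNIV. (norm (W l))\<^sup>2) = 0" by (simp only: of_real_eq_0_iff)
    then have W0: "W l = 0" for l by (simp add: sum_nonneg_eq_0_iff)
    define y where "y x = (0 + c $ 1 * \<theta> 1 x) + c $ 2 * \<theta> 2 x" for x
    have ys: "(\<lambda>x. 0 + c $ 1 * \<theta> 1 x) \<in> Sol (of_real \<mu>\<^sub>0)" by (rule Sol_lin[OF Sol_zero \<theta>])
    have y: "y \<in> Sol (of_real \<mu>\<^sub>0)" unfolding y_def by (rule Sol_lin[OF ys \<theta>])
    have "data y x0 = c $ 1 *s u 1 + c $ 2 *s u 2"
      unfolding y_def u_def qdiff_lin(2)[OF SolD(1)[OF ys] SolD(1)[OF \<theta>] x0] qdiff_lin(2)[OF qdiff_zero(1) SolD(1)[OF \<theta>] x0]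
      by (simp add: qdiff_zero(2)[OF x0])
    also have "\<dots> = 0" using W0 by (simp add: vec_eq_iff W_def sum_2)
    finally have "data y x = 0" if "x \<in> II" for x using Sol_unique[OF y x0 _ that] by blast
    then have "y x = 0" if "x \<in> II" for x using data_nth(1)[of y x] that by simp
    then have "(\<Sum>i\<in>UNIV. c $ i * \<theta> i x) = 0" if "x \<in> II" for x using that by (simp add: y_def sum_2)
    then have "c $ i = 0" for i using \<theta>_indep[of "\<lambda>i. c $ i"] by blast
    then show ?thesis by (simp add: vec_eq_iff)
  qed
  have "inj (\<lambda>c. G *v c)" using linear_injective_0[OF lin] inj0 by blast
  then have "surj (\<lambda>c. G *v c)" using linear_injective_imp_surjective[OF lin] by blast
  then have "\<exists>c. axis i 1 = G *v c" for i by (metis surjD)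
  then obtain C where C: "\<And>i. axis i 1 = G *v C i" by metis
  have ex: "\<exists>y\<in>Sol (of_real \<mu>\<^sub>0). data y x0 = (0 + C i $ 1 *s v 1) + C i $ 2 *s v 2" for i by (rule Sol_exists[OF x0])
  then obtain \<zeta> where \<zeta>: "\<And>i. \<zeta> i \<in> Sol (of_real \<mu>\<^sub>0)" "\<And>i. data (\<zeta> i) x0 = (0 + C i $ 1 *s v 1) + C i $ 2 *s v 2" by metis
  have "br (\<zeta> i) (\<theta> k) x = (if i = k then 1 else 0)" if x: "x \<in> II" for i k x
  proof -
    have "br (\<zeta> i) (\<theta> k) x = br (\<zeta> i) (\<theta> k) x0"
      by (rule bracket_Sol_constant[OF \<zeta>(1) _ x x0]) (use \<theta> in simp)
    also have "\<dots> = C i $ 1 * form (v 1) (u k) + C i $ 2 * form (v 2) (u k)"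
      by (simp add: bracket_eq_form \<zeta>(2) form_lin_left form_zero u_def[symmetric] del: add_0)
    also have "\<dots> = (G *v C i) $ k" by (simp add: G_def matrix_vector_mult_def sum_2 mult.commute)
    also have "\<dots> = (if i = k then 1 else 0)" by (simp flip: C add: axis_def)
    finally show ?thesis .
  qed
  with \<zeta>(1) show ?thesis by blast
qed

lemma lim_right_bracket_Sol:
  assumes "y \<in> Sol z" "y' \<in> Sol z'"
  shows "\<exists>l. lim_right (br y y') l"
proof -
  obtain c where c: "c \<in> II" using point_in_II by blast
  have "set_integrable M (HR c) (\<lambda>x. Lag y y' x)"
    by (rule Lag_integrable) (use c L2_near_b_Sol[OF assms(1)] L2_near_b_Sol[OF assms(2)] Sol_NB_el[OF assms(1)] Sol_NB_el[OF assms(2)] in \<open>auto simp: L2_near_b_def\<close>)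
  from bracket_lim_right[OF SolD(1)[OF assms(1)] SolD(1)[OF assms(2)] c this] show ?thesis by blast
qed

lemma admissible_a_Sol_L2: "y \<in> Sol z \<Longrightarrow> admissible_a y \<Longrightarrow> y \<in> L2 M"
proof -
  assume y: "y \<in> Sol z" "admissible_a y"
  obtain c where c: "c \<in> II" using point_in_II by blast
  show "y \<in> L2 M" by (rule L2_iff_NA_NB[OF c]) (use y L2_near_b_Sol[OF y(1)] c in \<open>auto simp: admissible_a_def L2_near_a_def L2_near_b_def\<close>)
qed

text \<open>The dual solutions for the real parameter have the right brackets but solve a different
  equation; \<open>lift\<close> replaces them by admissible solutions for z with the same boundary
  values.\<close>

lemma boundary_values_exist:
  assumes z: "z \<notin> \<real>"
  shows "\<exists>\<psi> :: 2 \<Rightarrow> real \<Rightarrow> complex. \<forall>i. \<psi> i \<in> Sol z \<and> admissible_a (\<psi> i) \<and> (\<forall>k. lim_right (br (\<psi> i) (\<theta> k)) (if i = k then 1 else 0))"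
proof -
  obtain \<zeta> where \<zeta>: "\<And>i. \<zeta> i \<in> Sol (of_real \<mu>\<^sub>0)" "\<And>i k x. x \<in> II \<Longrightarrow> br (\<zeta> i) (\<theta> k) x = (if i = k then 1 else 0)"
    using boundary_dual by blast
  have "\<exists>e. e \<in> Sol z \<and> admissible_a e \<and> (\<forall>k. lim_right (br e (\<theta> k)) (if i = k then 1 else 0))" for i
  proof -
    obtain e y c where e: "e \<in> Sol z" "admissible_a e" "y \<in> Dom" "c \<in> II" "\<And>x. x \<in> II \<Longrightarrow> c < x \<Longrightarrow> e x = \<zeta> i x - y x"
      using lift[OF z SolD(1)[OF \<zeta>(1)] L2_near_b_Sol[OF \<zeta>(1)] Sol_NB_el[OF \<zeta>(1) L2_near_b_Sol[OF \<zeta>(1)]], of i] by blast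
    have q: "qdiff (\<zeta> i)" "qdiff y" "qdiff e" using SolD(1)[OF \<zeta>(1)] SolD(1)[OF e(1)] e(3) by (auto simp: Dom_def)
    have "lim_right (br e (\<theta> k)) (if i = k then 1 else 0)" for k
    proof -
      have "lim_right (br (\<zeta> i) (\<theta> k)) (if i = k then 1 else 0)"
        by (rule lim_right_cong[OF tendsto_const e(4)]) (simp add: \<zeta>(2))
      moreover have "lim_right (br y (\<theta> k)) 0" using e(3) by (simp add: Dom_def condition_b_def)
      ultimately have "lim_right (br (\<lambda>x. \<zeta> i x + (-1) * y x) (\<theta> k)) ((if i = k then 1 else 0) + (-1) * 0)"
        by (rule lim_right_lin[OF q(1,2)])
      then have *: "lim_right (br (\<lambda>x. \<zeta> i x + (-1) * y x) (\<theta> k)) (if i = k then 1 else 0)" by simp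
      show ?thesis
      proof (rule lim_right_cong[OF * e(4)])
        fix x assume x: "x \<in> II" "c < x"
        have "data e x = data (\<lambda>x. \<zeta> i x + (-1) * y x) x"
          by (rule agree_right(1)[OF qdiff_lin(1)[OF q(1,2)] q(3) e(4) _ x]) (simp add: e(5))
        then show "br (\<lambda>x. \<zeta> i x + (-1) * y x) (\<theta> k) x = br e (\<theta> k) x" by (simp only: bracket_eq_form)
      qed
    qed
    with e(1,2) show ?thesis by blast
  qed
  then show ?thesis by metis
qed

text \<open>The boundary conditions at \<open>x\<close> are Lagrangian, which forces \<open>[d, d](x) = 0\<close>.\<close>

lemma interior_injective:
  assumes d: "d \<in> Sol z" "admissible_a d" and x: "x \<in> II" and bc: "\<And>i. br d (\<theta> i) x = 0" and z: "z \<notin> \<real>" and t: "t \<in> II"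
  shows "data d t = 0"
proof -
  obtain \<zeta> where \<zeta>: "\<And>i. \<zeta> i \<in> Sol (of_real \<mu>\<^sub>0)" "\<And>i k x. x \<in> II \<Longrightarrow> br (\<zeta> i) (\<theta> k) x = (if i = k then 1 else 0)"
    using boundary_dual by blast
  have q: "qdiff d" by (rule SolD(1)[OF d(1)])
  have "form (data d x) (data d x) = 0"
  proof (rule form_lagrangian[of "\<lambda>i. data (\<theta> i) x" "\<lambda>i. data (\<zeta> i) x"])
    show "form (data (\<theta> i) x) (data (\<theta> k) x) = 0" for i k using \<theta>_bracket[OF x] by (simp flip: bracket_eq_form)
    show "form (data (\<zeta> i) x) (data (\<theta> k) x) = (if i = k then 1 else 0)" for i k using \<zeta>(2)[OF x] by (simp flip: bracket_eq_form)
    show "form (data d x) (data (\<theta> i) x) = 0" for i using bc by (simp flip: bracket_eq_form)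
  qed
  then have b0: "br d d x = 0" by (simp add: bracket_eq_form)
  have dL: "zero_ext (HL x) d \<in> L2 M" "zero_ext (HL x) (el d) \<in> L2 M" using d(2) x by (auto simp: admissible_a_def L2_near_a_def)
  have "lim_left (br d d) (br d d x - (LINT t:HL x|M. Lag d d t))"
    by (rule bracket_lim_left[OF q q x Lag_integrable[OF dL dL]])
  then have "(LINT t:HL x|M. Lag d d t) = 0" using lim_left_unique[OF admissible_a_lim[OF d(2) d(2)]] b0 by fastforce
  \<comment> \<open>The bracket of d with itself vanishes at x and in the limit at \<open>a\<close>,
    so this integral is 0. It equals z - cnj z times the squared norm of d to the left of x.\<close>
  moreover have "(LINT t:HL x|M. Lag d d t) = (\<integral>t. (z - cnj z) * (zero_ext (HL x) d t * cnj (zero_ext (HL x) d t)) \<partial>M)"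
    unfolding set_lebesgue_integral_def
  proof (rule integral_cong_AE)
    show "(\<lambda>t. indicator (HL x) t *\<^sub>R Lag d d t) \<in> borel_measurable M"
      by (intro borel_measurable_scaleR borel_measurable_indicator HL_sets Lag_measurable q)
    show "(\<lambda>t. (z - cnj z) * (zero_ext (HL x) d t * cnj (zero_ext (HL x) d t))) \<in> borel_measurable M"
      by (intro borel_measurable_times borel_measurable_const borel_measurable_cnj L2D(1)[OF dL(1)])
    show "AE t in M. indicator (HL x) t *\<^sub>R Lag d d t = (z - cnj z) * (zero_ext (HL x) d t * cnj (zero_ext (HL x) d t))"
      unfolding AE_M using SolD(2)[OF d(1)] by eventually_elim (auto simp: algebra_simps zero_ext_def indicator_def)
  qed
  moreover have "\<dots> = (z - cnj z) * of_real ((l2norm M (zero_ext (HL x) d))\<^sup>2)"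
    using ip_self[of M "zero_ext (HL x) d"] by (simp add: ip_def)
  moreover have "z \<noteq> cnj z" using z by (metis Reals_cnj_iff)
  ultimately have "l2norm M (zero_ext (HL x) d) = 0" by simp
  then have "AE t in M. zero_ext (HL x) d t = 0" by (rule l2norm_eq_0_AE[OF dL(1)])
  then have ae: "AE t in lebesgue. t \<in> II \<longrightarrow> zero_ext (HL x) d t = 0" by (simp add: AE_M)
  obtain c where c: "c \<in> II" "c < x" using smaller_point[OF x] by blast
  have "AE t in lebesgue. t \<in> {c..x} \<longrightarrow> d t = 0"
    using ae by eventually_elim (use subI[OF c(1) x] in \<open>auto simp: zero_ext_def HL_def\<close>)
  then show ?thesis by (rule Sol_zero_on_subinterval[OF d(1) c(2) subI[OF c(1) x] _ t])
qed

end

section \<open>Green's representation of the resolvent\<close>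

locale resolvent_problem = boundary_problem +
  fixes \<mu> :: complex and x0 :: real
  assumes \<mu>: "\<mu> \<notin> \<real>" and x0: "x0 \<in> II"
begin

abbreviation "S \<equiv> resolvent M L \<mu>"
abbreviation "\<eta> \<equiv> fundamental (cnj \<mu>) x0"
abbreviation "\<epsilon> \<equiv> dual_fundamental \<mu> x0"

text \<open>A fundamental solution for cnj \<mu> is split into a part admissible at \<open>a\<close>
  and a part admissible at \<open>b\<close>, so that its bracket with \<open>S f\<close> can be
  integrated inward from both endpoints.\<close>

definition \<eta>X :: "4 \<Rightarrow> real \<Rightarrow> complex" where
  "\<eta>X k = (SOME e. e \<in> Sol (cnj \<mu>) \<and> admissible_a e \<and> (\<exists>e'\<in>Sol (cnj \<mu>). admissible_b e' \<and> \<eta> k = (\<lambda>x. e x + e' x)))"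

definition \<eta>Y :: "4 \<Rightarrow> real \<Rightarrow> complex" where "\<eta>Y k = (\<lambda>x. \<eta> k x - \<eta>X k x)"

lemma cnj_\<mu>: "cnj \<mu> \<notin> \<real>" using \<mu> by (metis Reals_cnj_iff complex_cnj_cnj)

lemma \<eta>XY: "\<eta>X k \<in> Sol (cnj \<mu>)" "admissible_a (\<eta>X k)" "\<eta>Y k \<in> Sol (cnj \<mu>)" "admissible_b (\<eta>Y k)" "\<eta> k = (\<lambda>x. \<eta>X k x + 1 * \<eta>Y k x)"
proof -
  have "\<exists>e. e \<in> Sol (cnj \<mu>) \<and> admissible_a e \<and> (\<exists>e'\<in>Sol (cnj \<mu>). admissible_b e' \<and> \<eta> k = (\<lambda>x. e x + e' x))"
    using Sol_split[OF cnj_\<mu> fundamental(1)[OF x0]] by blast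
  from someI_ex[OF this] have *: "\<eta>X k \<in> Sol (cnj \<mu>)" "admissible_a (\<eta>X k)" "\<exists>e'\<in>Sol (cnj \<mu>). admissible_b e' \<and> \<eta> k = (\<lambda>x. \<eta>X k x + e' x)"
    unfolding \<eta>X_def[symmetric] by auto
  then show "\<eta>X k \<in> Sol (cnj \<mu>)" "admissible_a (\<eta>X k)" by auto
  from *(3) obtain e' where e': "e' \<in> Sol (cnj \<mu>)" "admissible_b e'" "\<eta> k = (\<lambda>x. \<eta>X k x + e' x)" by blast
  have "\<eta>Y k = e'" unfolding \<eta>Y_def e'(3) by simp
  with e' show "\<eta>Y k \<in> Sol (cnj \<mu>)" "admissible_b (\<eta>Y k)" by auto
  show "\<eta> k = (\<lambda>x. \<eta>X k x + 1 * \<eta>Y k x)" unfolding \<eta>Y_def by simp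
qed

lemma \<epsilon>_Sol: "\<epsilon> k \<in> Sol \<mu>" by (rule dual_fundamental(1)[OF x0])

lemma \<eta>X_L2: "\<eta>X k \<in> L2 M" by (rule admissible_a_Sol_L2[OF \<eta>XY(1,2)])

lemma \<eta>Y_L2: "c \<in> II \<Longrightarrow> zero_ext (HR c) (\<eta>Y k) \<in> L2 M" using \<eta>XY(4) by (auto simp: admissible_b_def L2_near_b_def)

text \<open>\<open>G x k\<close> represents the functional that sends f to the bracket of
  \<open>S f\<close> with \<open>\<eta> k\<close> at x; the minus sign comes from integrating from x
  towards \<open>b\<close>.\<close>

definition G :: "real \<Rightarrow> 4 \<Rightarrow> real \<Rightarrow> complex" where
  "G x k t = cnj (zero_ext (HL x) (\<eta>X k) t) - cnj (zero_ext (HR x) (\<eta>Y k) t)"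

lemma G_L2: "x \<in> II \<Longrightarrow> G x k \<in> L2 M"
  unfolding G_def by (intro L2_diff L2_cnj zero_ext_L2 \<eta>X_L2 HL_sets \<eta>Y_L2)

lemma S_Dom: "f \<in> L2 M \<Longrightarrow> S f \<in> Dom" by (rule resolvent_L(1)[OF \<mu>])

lemma Lag_S:
  assumes f: "f \<in> L2 M" and h: "h \<in> Sol (cnj \<mu>)"
  shows "AE t in lebesgue. t \<in> II \<longrightarrow> Lag (S f) h t = f t * cnj (h t)"
  using resolvent_L(2)[OF \<mu> f] SolD(2)[OF h]
proof eventually_elim
  case (elim t)
  show ?case
  proof
    assume t: "t \<in> II"
    have "el (S f) t = f t + \<mu> * S f t" using elim(1) t by (simp add: diff_eq_eq)
    moreover have "el h t = cnj \<mu> * h t" using elim(2) t by simp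
    ultimately show "Lag (S f) h t = f t * cnj (h t)" by (simp add: algebra_simps)
  qed
qed

lemma Lag_S_integral:
  assumes f: "f \<in> L2 M" and h: "h \<in> Sol (cnj \<mu>)" and A: "A \<in> sets M"
  shows "(LINT t:A|M. Lag (S f) h t) = (\<integral>t. cnj (zero_ext A h t) * f t \<partial>M)"
  unfolding set_lebesgue_integral_def
proof (rule integral_cong_AE)
  have q: "qdiff (S f)" using S_Dom[OF f] by (simp add: Dom_def)
  show "(\<lambda>t. indicator A t *\<^sub>R Lag (S f) h t) \<in> borel_measurable M"
    by (intro borel_measurable_scaleR borel_measurable_indicator A Lag_measurable q SolD(1)[OF h])
  show "(\<lambda>t. cnj (zero_ext A h t) * f t) \<in> borel_measurable M"
    by (intro borel_measurable_times borel_measurable_cnj zero_ext_measurable A Sol_measurable[OF h] L2D(1)[OF f])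
  show "AE t in M. indicator A t *\<^sub>R Lag (S f) h t = cnj (zero_ext A h t) * f t"
    unfolding AE_M using Lag_S[OF f h] by eventually_elim (auto simp: zero_ext_def indicator_def mult.commute)
qed

text \<open>The bracket of \<open>S f\<close> with \<open>\<eta>X k\<close> vanishes at
  \<open>a\<close> and the one with \<open>\<eta>Y k\<close> at \<open>b\<close>; at x each equals,
  up to sign, a Lagrange integral in which only f is left.\<close>

theorem S_bracket_\<eta>:
  assumes f: "f \<in> L2 M" and x: "x \<in> II"
  shows "br (S f) (\<eta> k) x = (\<integral>t. G x k t * f t \<partial>M)"
proof -
  have D: "S f \<in> Dom" "admissible_a (S f)" "admissible_b (S f)" "qdiff (S f)" using S_Dom[OF f] by (auto simp: Dom_iff admissible_a_def)
  have SL: "zero_ext A (S f) \<in> L2 M" "zero_ext A (el (S f)) \<in> L2 M" if "A \<in> sets M" for A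
    using D(1) that by (auto simp: Dom_def intro: zero_ext_L2)
  have X: "zero_ext (HL x) (\<eta>X k) \<in> L2 M" "zero_ext (HL x) (el (\<eta>X k)) \<in> L2 M" using \<eta>XY(2)[of k] x by (auto simp: admissible_a_def L2_near_a_def)
  have Y: "zero_ext (HR x) (\<eta>Y k) \<in> L2 M" "zero_ext (HR x) (el (\<eta>Y k)) \<in> L2 M" using \<eta>XY(4)[of k] x by (auto simp: admissible_b_def L2_near_b_def)
  have q: "qdiff (\<eta>X k)" "qdiff (\<eta>Y k)" using SolD(1) \<eta>XY by blast+
  have 1: "br (S f) (\<eta>X k) x = (\<integral>t. cnj (zero_ext (HL x) (\<eta>X k) t) * f t \<partial>M)"
    using lim_left_unique[OF admissible_a_lim[OF D(2) \<eta>XY(2)] bracket_lim_left[OF D(4) q(1) x Lag_integrable[OF SL[OF HL_sets] X]]]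
      Lag_S_integral[OF f \<eta>XY(1)[of k] HL_sets[of x]] by simp
  have 2: "br (S f) (\<eta>Y k) x = - (\<integral>t. cnj (zero_ext (HR x) (\<eta>Y k) t) * f t \<partial>M)"
    using lim_right_unique[OF admissible_b_lim[OF D(3) \<eta>XY(4)] bracket_lim_right[OF D(4) q(2) x Lag_integrable[OF SL[OF HR_sets] Y]]]
      Lag_S_integral[OF f \<eta>XY(3)[of k] HR_sets[of x]] by (simp add: eq_neg_iff_add_eq_0)
  have "data (\<eta> k) x = data (\<eta>X k) x + 1 *s data (\<eta>Y k) x"
    by (subst \<eta>XY(5)) (rule qdiff_lin(2)[OF q x])
  then have "br (S f) (\<eta> k) x = br (S f) (\<eta>X k) x + br (S f) (\<eta>Y k) x"
    using form_lin_right[of "data (S f) x" "data (\<eta>X k) x" 1] by (simp add: bracket_eq_form)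
  also have "\<dots> = (\<integral>t. cnj (zero_ext (HL x) (\<eta>X k) t) * f t - cnj (zero_ext (HR x) (\<eta>Y k) t) * f t \<partial>M)"
    unfolding 1 2 using Bochner_Integration.integral_diff[OF L2_prod_integrable(1)[OF L2_cnj[OF X(1)] f] L2_prod_integrable(1)[OF L2_cnj[OF Y(1)] f]] by simp
  also have "\<dots> = (\<integral>t. G x k t * f t \<partial>M)" by (simp add: G_def left_diff_distrib)
  finally show ?thesis .
qed

lemma data_S:
  assumes f: "f \<in> L2 M" and x: "x \<in> II"
  shows "data (S f) x = (\<Sum>k\<in>UNIV. (\<integral>t. G x k t * f t \<partial>M) *s data (\<epsilon> k) x)"
  using dual_expansion[OF x0 x, of "S f" \<mu>] by (simp add: S_bracket_\<eta>[OF f x])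

lemma S_eq: "f \<in> L2 M \<Longrightarrow> x \<in> II \<Longrightarrow> S f x = (\<Sum>k\<in>UNIV. (\<integral>t. G x k t * f t \<partial>M) * \<epsilon> k x)"
  using data_S[of f x] unfolding vec_eq_iff by (auto simp: data_nth sum_4 dest: spec[of _ 1])

lemma form_sum_left: "form (\<Sum>k\<in>A. c k *s u k) v = (\<Sum>k\<in>A. c k * form (u k) v)" if "finite A"
  using that
proof induction
  case (insert k A)
  then show ?case using form_lin_left[of "\<Sum>k\<in>A. c k *s u k" "c k" "u k" v] by (simp add: add.commute)
qed (simp add: form_zero)

lemma S_bracket: "f \<in> L2 M \<Longrightarrow> x \<in> II \<Longrightarrow> br (S f) g x = (\<Sum>k\<in>UNIV. (\<integral>t. G x k t * f t \<partial>M) * br (\<epsilon> k) g x)"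
  by (simp add: bracket_eq_form data_S form_sum_left)

end

section \<open>Comparison with the truncated problem\<close>

context weighted_expression
begin

lemma br_continuous: "qdiff f \<Longrightarrow> qdiff g \<Longrightarrow> continuous_on II (br f g)"
  by (rule loc_abs_cont_continuous_on[OF I(1) is_primitive_imp_loc_abs_cont[OF Lagrange_identity]])

text \<open>The endpoint of a truncated problem is an interior point of the full interval; there the
  limit in the boundary condition is a value.\<close>

lemma lim_interior:
  fixes F :: "real \<Rightarrow> complex"
  assumes "continuous_on II F" "x \<in> II"
  shows "((\<lambda>t. F (real_of_ereal t)) \<longlongrightarrow> F x) (at_left (ereal x))"
proof -
  have "isCont F x" using assms by (simp add: continuous_on_eq_continuous_at)
  moreover have "(real_of_ereal \<longlongrightarrow> x) (at_left (ereal x))"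
    by (rule lim_real_of_ereal[of "\<lambda>x. x"]) (rule tendsto_ident_at)
  ultimately show ?thesis by (rule isCont_tendsto_compose)
qed

lemma restrict_weighted:
  assumes x: "x \<in> II"
  shows "weighted_expression a (ereal x) p s q w"
proof
  note J = left_interval(3)[OF x]
  show "a < ereal x" using x by (simp add: einterval_def)
  show "L1_loc (einterval a (ereal x)) (\<lambda>x. 1 / p x)" "L1_loc (einterval a (ereal x)) s" "L1_loc (einterval a (ereal x)) q" "L1_loc (einterval a (ereal x)) w"
    using coeffs' J unfolding L1_loc_def by blast+
  show "AE t in lebesgue. t \<in> einterval a (ereal x) \<longrightarrow> 0 < p t"
    using pos'(1) by eventually_elim (use J in auto)
  show "AE t in lebesgue. t \<in> einterval a (ereal x) \<longrightarrow> 0 < w t"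
    using pos'(2) by eventually_elim (use J in auto)
qed

end

context resolvent_problem
begin

text \<open>Solutions for \<mu> admissible at \<open>a\<close>, normalised by their boundary values
  at \<open>b\<close>. They span the range of the correction.\<close>

definition \<psi> :: "2 \<Rightarrow> real \<Rightarrow> complex" where
  "\<psi> = (SOME \<psi>. \<forall>i. \<psi> i \<in> Sol \<mu> \<and> admissible_a (\<psi> i) \<and> (\<forall>k. lim_right (br (\<psi> i) (\<theta> k)) (if i = k then 1 else 0)))"

lemma \<psi>: "\<psi> i \<in> Sol \<mu>" "admissible_a (\<psi> i)" "lim_right (br (\<psi> i) (\<theta> k)) (if i = k then 1 else 0)"
  using someI_ex[OF boundary_values_exist[OF \<mu>]] unfolding \<psi>_def[symmetric] by blast+

text \<open>The leading \<open>0 +\<close> gives both additions the shape y + k z of the linearity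
  lemmas.\<close>

definition comb :: "(2 \<Rightarrow> complex) \<Rightarrow> real \<Rightarrow> complex" where
  "comb c = (\<lambda>x. (0 + c 1 * \<psi> 1 x) + c 2 * \<psi> 2 x)"

lemma comb_eq: "comb c x = (\<Sum>k\<in>UNIV. c k * \<psi> k x)" by (simp add: comb_def sum_2)

lemma comb1: "(\<lambda>x. 0 + c 1 * \<psi> 1 x) \<in> Sol \<mu>" by (rule Sol_lin[OF Sol_zero \<psi>(1)])

lemma comb: "comb c \<in> Sol \<mu>" "admissible_a (comb c)"
  unfolding comb_def by (rule Sol_lin[OF comb1 \<psi>(1)]) (intro admissible_a_lin admissible_a_zero \<psi>)

lemma br_comb:
  assumes x: "x \<in> II"
  shows "br (comb c) g x = (\<Sum>k\<in>UNIV. c k * br (\<psi> k) g x)"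
  unfolding comb_def br_lin[OF SolD(1)[OF comb1] SolD(1)[OF \<psi>(1)] x] br_lin[OF qdiff_zero(1) SolD(1)[OF \<psi>(1)] x]
  using qdiff_zero(2)[OF x] by (simp add: sum_2 bracket_eq_form form_zero)

lemma comb_lim: "lim_right (br (comb c) (\<theta> i)) (c i)"
proof -
  have 0: "lim_right (br (\<lambda>x. 0) (\<theta> i)) 0" using zero_bc(2) by (simp add: condition_b_def)
  have 1: "lim_right (br (\<lambda>x. 0 + c 1 * \<psi> 1 x) (\<theta> i)) (0 + c 1 * (if 1 = i then 1 else 0))"
    by (rule lim_right_lin[OF qdiff_zero(1) SolD(1)[OF \<psi>(1)] 0 \<psi>(3)])
  have "lim_right (br (comb c) (\<theta> i)) ((0 + c 1 * (if 1 = i then 1 else 0)) + c 2 * (if 2 = i then 1 else 0))"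
    unfolding comb_def by (rule lim_right_lin[OF SolD(1)[OF comb1[of c]] SolD(1)[OF \<psi>(1)[of 2]] 1 \<psi>(3)[of 2 i]])
  moreover have "i = 1 \<or> i = 2" by (rule exhaust_2)
  ultimately show ?thesis by auto
qed

definition N :: "real \<Rightarrow> 2 \<Rightarrow> 2 \<Rightarrow> complex" where "N x i k = br (\<psi> k) (\<theta> i) x"
definition N_det :: "real \<Rightarrow> complex" where "N_det x = N x 1 1 * N x 2 2 - N x 1 2 * N x 2 1"

text \<open>A combination whose brackets vanish at the interior point x is the zero solution; its
  boundary values at \<open>b\<close>, which are its coefficients, then vanish as well.\<close>

lemma N_injective:
  assumes x: "x \<in> II" and c: "\<And>i. (\<Sum>k\<in>UNIV. c k * N x i k) = 0"
  shows "c i = 0"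
proof -
  have "br (comb c) (\<theta> i) x = 0" for i using c[of i] by (simp add: br_comb[OF x] N_def)
  then have d: "data (comb c) t = 0" if "t \<in> II" for t by (rule interior_injective[OF comb x _ \<mu> that])
  have "lim_right (br (comb c) (\<theta> i)) 0"
    by (rule lim_right_zero[OF x]) (simp add: d bracket_eq_form form_zero)
  then show ?thesis by (rule lim_right_unique[OF comb_lim])
qed

lemma N_det_nonzero:
  assumes x: "x \<in> II"
  shows "N_det x \<noteq> 0"
proof
  assume D: "N_det x = 0"
  have inj: "c1 = 0 \<and> c2 = 0" if "c1 * N x 1 1 + c2 * N x 1 2 = 0" "c1 * N x 2 1 + c2 * N x 2 2 = 0" for c1 c2
  proof -
    define c :: "2 \<Rightarrow> complex" where "c k = (if k = 1 then c1 else c2)" for k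
    have c: "c 1 = c1" "c 2 = c2" by (simp_all add: c_def)
    have "(\<Sum>k\<in>UNIV. c k * N x i k) = 0" for i
      using exhaust_2[of i] that by (auto simp: sum_2 c)
    from N_injective[OF x this] show ?thesis using c by metis
  qed
  \<comment> \<open>If the determinant vanishes, the columns of the adjugate are null vectors, hence
    zero. Then \<open>N x\<close> is the zero matrix and (1, 0) is a null vector too.\<close>
  have "N x 2 2 = 0 \<and> - N x 2 1 = 0" by (rule inj) (use D in \<open>simp_all add: N_det_def algebra_simps\<close>)
  moreover have "- N x 1 2 = 0 \<and> N x 1 1 = 0" by (rule inj) (use D in \<open>simp_all add: N_det_def algebra_simps\<close>)
  ultimately have "(1 :: complex) = 0 \<and> (0 :: complex) = 0" by (intro inj) simp_all
  then show False by simp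
qed

definition V :: "real \<Rightarrow> 2 \<Rightarrow> 2 \<Rightarrow> complex" where
  "V x k i = (if k = 1 then if i = 1 then N x 2 2 else - N x 1 2 else if i = 1 then - N x 2 1 else N x 1 1) / N_det x"

lemma N_V: "x \<in> II \<Longrightarrow> (\<Sum>k\<in>UNIV. (\<Sum>i\<in>UNIV. V x k i * m i) * N x l k) = m l"
proof -
  assume x: "x \<in> II"
  have "N_det x * (\<Sum>k\<in>UNIV. (\<Sum>i\<in>UNIV. V x k i * m i) * N x l k) = N_det x * m l"
  proof -
    have v: "N_det x * V x 1 1 = N x 2 2" "N_det x * V x 1 2 = - N x 1 2" "N_det x * V x 2 1 = - N x 2 1" "N_det x * V x 2 2 = N x 1 1"
      using N_det_nonzero[OF x] by (auto simp: V_def)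
    have "N_det x * (\<Sum>k\<in>UNIV. (\<Sum>i\<in>UNIV. V x k i * m i) * N x l k) =
      ((N_det x * V x 1 1) * m 1 + (N_det x * V x 1 2) * m 2) * N x l 1 + ((N_det x * V x 2 1) * m 1 + (N_det x * V x 2 2) * m 2) * N x l 2"
      by (simp add: sum_2 algebra_simps)
    also have "\<dots> = N_det x * m l" unfolding v using exhaust_2[of l] by (auto simp: N_det_def algebra_simps)
    finally show ?thesis .
  qed
  then show ?thesis using N_det_nonzero[OF x] by simp
qed

text \<open>Represents the bracket of \<open>S f\<close> with \<open>\<theta> i\<close> at x
  (\<open>S_bracket_\<theta>\<close>). Applying the inverse matrix \<open>V\<close> yields
  \<open>h\<close>, which represents the coefficients of the correction in terms of the
  \<open>\<psi> k\<close>.\<close>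

definition g :: "real \<Rightarrow> 2 \<Rightarrow> real \<Rightarrow> complex" where
  "g x i t = (\<Sum>k\<in>UNIV. br (\<epsilon> k) (\<theta> i) x * G x k t)"

definition h :: "real \<Rightarrow> 2 \<Rightarrow> real \<Rightarrow> complex" where
  "h x k t = (\<Sum>i\<in>UNIV. V x k i * g x i t)"

lemma g_L2: "x \<in> II \<Longrightarrow> g x i \<in> L2 M" and h_L2: "x \<in> II \<Longrightarrow> h x k \<in> L2 M"
proof -
  show *: "g x i \<in> L2 M" if "x \<in> II" for i unfolding g_def by (intro L2_sum L2_scale G_L2 that)
  show "h x k \<in> L2 M" if "x \<in> II" unfolding h_def by (intro L2_sum L2_scale * that)
qed

lemma integral_comb_mult:
  assumes "\<And>i. i \<in> A \<Longrightarrow> u i \<in> L2 M" "f \<in> L2 M"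
  shows "(\<integral>t. (\<Sum>i\<in>A. c i * u i t) * f t \<partial>M) = (\<Sum>i\<in>A. c i * (\<integral>t. u i t * f t \<partial>M))"
proof -
  have "(\<integral>t. (\<Sum>i\<in>A. c i * u i t) * f t \<partial>M) = (\<integral>t. (\<Sum>i\<in>A. c i * (u i t * f t)) \<partial>M)"
    by (simp add: sum_distrib_right mult.assoc)
  also have "\<dots> = (\<Sum>i\<in>A. \<integral>t. c i * (u i t * f t) \<partial>M)"
    by (rule Bochner_Integration.integral_sum) (intro integrable_mult_right L2_prod_integrable(1) assms)
  finally show ?thesis by simp
qed

lemma S_bracket_\<theta>: "f \<in> L2 M \<Longrightarrow> x \<in> II \<Longrightarrow> br (S f) (\<theta> i) x = (\<integral>t. g x i t * f t \<partial>M)"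
  unfolding g_def by (subst integral_comb_mult) (auto simp: G_L2 S_bracket mult.commute)

definition corr :: "real \<Rightarrow> (real \<Rightarrow> complex) \<Rightarrow> 2 \<Rightarrow> complex" where
  "corr x f k = (\<integral>t. h x k t * f t \<partial>M)"

lemma corr_bracket:
  assumes f: "f \<in> L2 M" and x: "x \<in> II"
  shows "br (comb (corr x f)) (\<theta> i) x = br (S f) (\<theta> i) x"
proof -
  have c: "corr x f k = (\<Sum>i\<in>UNIV. V x k i * (\<integral>t. g x i t * f t \<partial>M))" for k
    unfolding corr_def h_def by (rule integral_comb_mult) (use f x g_L2 in auto)
  show ?thesis unfolding br_comb[OF x] N_def[symmetric] c S_bracket_\<theta>[OF f x] by (rule N_V[OF x])
qed

text \<open>The corrected function \<open>y0\<close> solves the truncated problem, so the choice in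
  \<open>resolvent\<close> has a witness. Whatever is chosen differs from \<open>y0\<close> by a
  solution that is admissible at \<open>a\<close> with vanishing brackets at \<beta>, and such a
  solution is 0 by \<open>interior_injective\<close>.\<close>

theorem truncated_resolvent:
  assumes \<beta>: "\<beta> \<in> II" and J: "J = einterval a (ereal \<beta>)" and f: "f \<in> L2 M" and f': "f' \<in> L2 (wmeasure J w)" and ae: "AE x in wmeasure J w. f' x = f x"
    and R: "R = resolvent (wmeasure J w) (bc_operator \<Phi> (\<theta> 1) (\<theta> 2) a (ereal \<beta>) p s q w) \<mu> f'" and x: "x \<in> J"
  shows "R x = S f x - comb (corr \<beta> f) x"
proof -
  interpret J: weighted_expression a "ereal \<beta>" p s q w by (rule restrict_weighted[OF \<beta>])
  have JI: "open J" "is_interval J" "J \<subseteq> II" and Jmem: "\<And>t. t \<in> J \<longleftrightarrow> t \<in> II \<and> t < \<beta>"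
    unfolding J by (rule left_interval[OF \<beta>])+
  note Jd = J[symmetric]
  let ?LJ = "bc_operator \<Phi> (\<theta> 1) (\<theta> 2) a (ereal \<beta>) p s q w"
  let ?DJ = "bc_domain \<Phi> (\<theta> 1) (\<theta> 2) a (ereal \<beta>) p s q w"
  have LJ_iff: "(y, v) \<in> ?LJ \<longleftrightarrow> y \<in> ?DJ \<and> v = ell J p s q w y" for y v
    unfolding bc_operator_def ell_graph_def J by auto
  have DJ_iff: "y \<in> ?DJ \<longleftrightarrow> quasi_diff J p s y \<and> y \<in> L2 (wmeasure J w) \<and> ell J p s q w y \<in> L2 (wmeasure J w) \<and>
      (\<forall>\<phi>. \<Phi> = Some \<phi> \<longrightarrow> J.lim_left (bracket J p s y \<phi>) 0) \<and> (\<forall>i. J.lim_right (bracket J p s y (\<theta> i)) 0)" for y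
    unfolding bc_domain_def Dmax_def bracket_zero_left_def bracket_zero_right_def forall_2 J by auto
  define e where "e = comb (corr \<beta> f)"
  have e: "e \<in> Sol \<mu>" "admissible_a e" unfolding e_def by (rule comb)+
  have SD: "S f \<in> Dom" by (rule S_Dom[OF f])
  have qS: "qdiff (S f)" and qe: "qdiff e" using SD SolD(1)[OF e(1)] by (auto simp: Dom_def)
  define y0 where "y0 = (\<lambda>x. S f x + (-1) * e x)"
  have q0: "qdiff y0" unfolding y0_def by (rule qdiff_lin(1)[OF qS qe])
  have A0: "admissible_a y0" unfolding y0_def by (rule admissible_a_lin) (use SD e in \<open>auto simp: Dom_iff\<close>)
  have L0: "y0 \<in> L2 M" unfolding y0_def using SD by (intro L2_add L2_scale admissible_a_Sol_L2[OF e]) (auto simp: Dom_def)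
  have br0: "br y0 (\<theta> i) \<beta> = 0" for i
    unfolding y0_def br_lin[OF qS qe \<beta>] using corr_bracket[OF f \<beta>, of i] by (simp add: e_def)
  have JL: "u \<in> L2 M \<Longrightarrow> u \<in> L2 (wmeasure J w)" for u
    unfolding L2_wmeasure_iff[OF JI(1,3)] by (rule zero_ext_L2) (use JI in \<open>auto intro: open_sets_M\<close>)
  have ae': "AE t in lebesgue. t \<in> J \<longrightarrow> f' t = f t" using ae unfolding J by (simp add: J.AE_M)
  have el0: "AE t in lebesgue. t \<in> J \<longrightarrow> ell J p s q w y0 t = \<mu> * y0 t + f' t"
    using restrict_quasi_diff(4)[OF JI q0] qdiff_lin(3)[OF qS qe, of "-1", folded y0_def] resolvent_L(2)[OF \<mu> f] SolD(2)[OF e(1)] ae'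
  proof eventually_elim
    case (elim t)
    show ?case
    proof
      assume t: "t \<in> J"
      then have tI: "t \<in> II" using JI by auto
      have "ell J p s q w y0 t = el (S f) t + (-1) * el e t" using elim(1,2) t tI by simp
      moreover have "el (S f) t = f t + \<mu> * S f t" using elim(3) tI by (simp add: diff_eq_eq)
      ultimately show "ell J p s q w y0 t = \<mu> * y0 t + f' t" using elim(4,5) t tI by (simp add: y0_def algebra_simps)
    qed
  qed
  have Jq0: "quasi_diff J p s y0" by (rule restrict_quasi_diff(1)[OF JI q0])
  have y0J: "y0 \<in> ?DJ"
    unfolding DJ_iff
  proof (intro conjI allI impI)
    show "quasi_diff J p s y0" by (rule Jq0)
    show y0L: "y0 \<in> L2 (wmeasure J w)" by (rule JL[OF L0])
    show "ell J p s q w y0 \<in> L2 (wmeasure J w)"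
    proof (rule L2_cong_AE)
      show "(\<lambda>t. \<mu> * y0 t + f' t) \<in> L2 (wmeasure J w)" by (intro L2_add L2_scale y0L f')
      show "AE t in wmeasure J w. \<mu> * y0 t + f' t = ell J p s q w y0 t"
        unfolding J J.AE_M unfolding Jd using el0 by eventually_elim auto
      show "ell J p s q w y0 \<in> borel_measurable (wmeasure J w)" unfolding J by (rule J.el_measurable) (use Jq0 in \<open>simp add: J\<close>)
    qed
    show "J.lim_left (bracket J p s y0 \<phi>) 0" if \<phi>: "\<Phi> = Some \<phi>" for \<phi>
    proof (rule lim_left_cong[OF _ \<beta>])
      show "lim_left (br y0 \<phi>) 0" using A0 \<phi> unfolding admissible_a_def condition_a_def by blast
      show "br y0 \<phi> t = bracket J p s y0 \<phi> t" if "t \<in> II" "t < \<beta>" for t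
        by (rule restrict_bracket[OF JI q0 \<Phi>_qdiff[OF \<phi>], symmetric]) (use that Jmem in blast)
    qed
    show "J.lim_right (bracket J p s y0 (\<theta> i)) 0" for i
    proof (rule J.lim_right_cong)
      show "J.lim_right (br y0 (\<theta> i)) 0"
        using lim_interior[OF br_continuous[OF q0 SolD(1)[OF \<theta>[of i]]] \<beta>] br0[of i] by simp
      show "x \<in> einterval a (ereal \<beta>)" using x J by simp
      show "br y0 (\<theta> i) t = bracket J p s y0 (\<theta> i) t" if "t \<in> einterval a (ereal \<beta>)" for t
        by (rule restrict_bracket[OF JI q0 SolD(1)[OF \<theta>], symmetric]) (use that J in simp)
    qed
  qed
  have "\<exists>y v. (y, v) \<in> ?LJ \<and> (AE t in wmeasure J w. v t - \<mu> * y t = f' t)"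
  proof (intro exI conjI)
    show "(y0, ell J p s q w y0) \<in> ?LJ" using y0J by (simp add: LJ_iff)
    show "AE t in wmeasure J w. ell J p s q w y0 t - \<mu> * y0 t = f' t"
      unfolding J J.AE_M unfolding Jd using el0 by eventually_elim auto
  qed
  from someI_ex[OF this] have "\<exists>v. (R, v) \<in> ?LJ \<and> (AE t in wmeasure J w. v t - \<mu> * R t = f' t)"
    unfolding R resolvent_def .
  then have RD: "R \<in> ?DJ" and Rae: "AE t in wmeasure J w. ell J p s q w R t - \<mu> * R t = f' t" by (auto simp: LJ_iff)
  have elR: "AE t in lebesgue. t \<in> J \<longrightarrow> ell J p s q w R t = \<mu> * R t + f' t"
    using Rae unfolding J J.AE_M by eventually_elim (auto simp: diff_eq_eq add.commute)
  have JqR: "quasi_diff J p s R" using RD by (simp add: DJ_iff)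
  define d where "d = (\<lambda>x. R x + (-1) * y0 x)"
  note dlin = J.qdiff_lin[OF JqR[unfolded J] Jq0[unfolded J], of "-1", folded d_def]
  have dS: "d \<in> J.Sol \<mu>"
    unfolding J.Sol_def
  proof (intro CollectI conjI)
    show "quasi_diff (einterval a (ereal \<beta>)) p s d" by (rule dlin(1))
    show "AE t in lebesgue. t \<in> einterval a (ereal \<beta>) \<longrightarrow> ell (einterval a (ereal \<beta>)) p s q w d t = \<mu> * d t"
      using dlin(3) el0[unfolded J] elR[unfolded J] by eventually_elim (simp add: d_def algebra_simps)
  qed
  have xI: "x \<in> II" "x \<in> einterval a (ereal \<beta>)" using x JI J by auto
  \<comment> \<open>\<open>interior_injective\<close> speaks of solutions on the full interval;
    \<open>d\<close> lives on \<open>J\<close> and is therefore continued by solving the initial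
    value problem with its data at x.\<close>
  obtain d' where d': "d' \<in> Sol \<mu>" "data d' x = J.data d x" using Sol_exists[OF xI(1)] by blast
  have qd': "qdiff d'" by (rule SolD(1)[OF d'(1)])
  have d'S: "d' \<in> J.Sol \<mu>"
    unfolding J.Sol_def
  proof (intro CollectI conjI)
    show "quasi_diff (einterval a (ereal \<beta>)) p s d'" using restrict_quasi_diff(1)[OF JI qd'] J by simp
    show "AE t in lebesgue. t \<in> einterval a (ereal \<beta>) \<longrightarrow> ell (einterval a (ereal \<beta>)) p s q w d' t = \<mu> * d' t"
      using restrict_quasi_diff(4)[OF JI qd', unfolded J] SolD(2)[OF d'(1)] by eventually_elim (use JI J in auto)
  qed
  have "J.data d' x = J.data d x"
    using d'(2) restrict_quasi_diff(2,3)[OF JI qd' x] unfolding J.data_eq_iff data_eq_iff by (simp add: J)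
  then have dd': "J.data d' t = J.data d t" "d' t = d t" if "t \<in> J" for t
    using J.Sol_eq_on[OF d'S dS xI(2) _ that[unfolded J]] by auto
  have brJ: "bracket J p s d \<phi> t = br d' \<phi> t" if "t \<in> J" "qdiff \<phi>" for \<phi> t
  proof -
    have "bracket J p s d \<phi> t = bracket J p s d' \<phi> t"
      using dd'(1)[OF that(1)] unfolding J J.bracket_eq_form by simp
    also have "\<dots> = br d' \<phi> t" by (rule restrict_bracket[OF JI qd' that(2,1)])
    finally show ?thesis .
  qed
  have L2_near_a: "L2_near_a d'"
  proof (rule L2_near_a_I[OF qdiff_continuous[OF qd'] xI(1)])
    have HLJ: "HL x \<subseteq> J"
    proof
      fix t assume "t \<in> HL x"
      then have "t \<in> II" "t \<le> x" by (auto simp: HL_def)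
      moreover have "x < \<beta>" using Jmem[of x] x by blast
      ultimately show "t \<in> J" using Jmem[of t] by simp
    qed
    have "d \<in> L2 (wmeasure J w)" unfolding d_def using RD y0J by (intro L2_add L2_scale) (auto simp: DJ_iff)
    then have "zero_ext J d \<in> L2 M" by (simp add: L2_wmeasure_iff[OF JI(1,3)])
    then have "zero_ext (HL x) d \<in> L2 M"
      by (rule zero_ext_L2_mono[OF _ HL_sets HLJ])
    moreover have "zero_ext (HL x) d = zero_ext (HL x) d'"
      by (rule zero_ext_cong) (rule dd'(2)[OF subsetD[OF HLJ], symmetric])
    ultimately show "zero_ext (HL x) d' \<in> L2 M" by simp
  qed
  have "condition_a d'"
    unfolding condition_a_def
  proof (intro allI impI)
    fix \<phi> assume \<phi>: "\<Phi> = Some \<phi>"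
    have 1: "J.lim_left (bracket (einterval a (ereal \<beta>)) p s R \<phi>) 0" "J.lim_left (bracket (einterval a (ereal \<beta>)) p s y0 \<phi>) 0"
      using RD y0J \<phi> unfolding DJ_iff unfolding J by blast+
    have "J.lim_left (bracket (einterval a (ereal \<beta>)) p s d \<phi>) (0 + (-1) * 0)"
      unfolding d_def by (rule J.lim_left_lin[OF JqR[unfolded J] Jq0[unfolded J] 1])
    then have "lim_left (bracket (einterval a (ereal \<beta>)) p s d \<phi>) 0" by simp
    then show "lim_left (br d' \<phi>) 0"
      by (rule lim_left_cong[OF _ \<beta>]) (use brJ[OF _ \<Phi>_qdiff[OF \<phi>]] Jmem J in auto)
  qed
  then have A': "admissible_a d'" using L2_near_a by (simp add: Sol_admissible_a[OF d'(1)])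
  have "br d' (\<theta> i) \<beta> = 0" for i
  proof -
    have 1: "J.lim_right (bracket (einterval a (ereal \<beta>)) p s R (\<theta> i)) 0" "J.lim_right (bracket (einterval a (ereal \<beta>)) p s y0 (\<theta> i)) 0"
      using RD y0J unfolding DJ_iff unfolding J by blast+
    have "J.lim_right (bracket (einterval a (ereal \<beta>)) p s d (\<theta> i)) (0 + (-1) * 0)"
      unfolding d_def by (rule J.lim_right_lin[OF JqR[unfolded J] Jq0[unfolded J] 1])
    then have "J.lim_right (bracket (einterval a (ereal \<beta>)) p s d (\<theta> i)) 0" by simp
    then have "J.lim_right (br d' (\<theta> i)) 0"
      by (rule J.lim_right_cong[OF _ xI(2)]) (use brJ[OF _ SolD(1)[OF \<theta>[of i]]] J in auto)
    moreover have "J.lim_right (br d' (\<theta> i)) (br d' (\<theta> i) \<beta>)"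
      by (rule lim_interior[OF br_continuous[OF qd' SolD(1)[OF \<theta>]] \<beta>])
    ultimately show ?thesis using J.lim_right_unique by blast
  qed
  then have "data d' x = 0" by (rule interior_injective[OF d'(1) A' \<beta> _ \<mu> xI(1)])
  then have "d' x = 0" using data_nth(1)[of d' x] by simp
  then have "d x = 0" using dd'(2)[OF x] by simp
  then have "R x - (S f x - comb (corr \<beta> f) x) = 0" by (simp add: d_def y0_def e_def algebra_simps)
  then show ?thesis by (rule eq_iff_diff_eq_0[THEN iffD2])
qed

end

section \<open>Norm convergence of the representing functions\<close>

lemma L2_norm_fun: "f \<in> L2 M \<Longrightarrow> (\<lambda>x. complex_of_real (norm (f x))) \<in> L2 M"
proof (rule l2norm_mono(1))
  assume f: "f \<in> L2 M"
  note [measurable] = L2D(1)[OF f]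
  show "(\<lambda>x. complex_of_real (norm (f x))) \<in> borel_measurable M" by measurable
qed auto

lemma l2norm_norm_fun: "l2norm M (\<lambda>x. complex_of_real (norm (f x))) = l2norm M f"
  by (simp add: l2norm_def)

context resolvent_problem
begin

lemma br_\<epsilon>_lim: "\<exists>l. lim_right (br (\<epsilon> k) (\<theta> i)) l"
  by (rule lim_right_bracket_Sol[OF \<epsilon>_Sol \<theta>])

text \<open>\<open>G x k\<close> differs from the conjugate of \<open>\<eta>X k\<close> only to the
  right of x, where both parts of \<open>\<eta> k\<close> have small norm as x approaches
  \<open>b\<close>.\<close>

lemma G_near_\<eta>X:
  assumes x: "x \<in> II"
  shows "(\<lambda>t. G x k t - cnj (\<eta>X k t)) \<in> L2 M"
    "l2norm M (\<lambda>t. G x k t - cnj (\<eta>X k t)) \<le> l2norm M (zero_ext (HR x) (\<eta>X k)) + l2norm M (zero_ext (HR x) (\<eta>Y k))"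
proof -
  show "(\<lambda>t. G x k t - cnj (\<eta>X k t)) \<in> L2 M" by (intro L2_diff G_L2 x L2_cnj \<eta>X_L2)
  let ?d = "\<lambda>t. cnj (zero_ext (HL x) (\<eta>X k) t) - cnj (\<eta>X k t)"
  let ?z = "\<lambda>t. cnj (zero_ext (HR x) (\<eta>Y k) t)"
  have dL: "?d \<in> L2 M" by (intro L2_diff L2_cnj zero_ext_L2 \<eta>X_L2 HL_sets)
  have zL: "?z \<in> L2 M" by (intro L2_cnj \<eta>Y_L2 x)
  have "l2norm M (\<lambda>t. G x k t - cnj (\<eta>X k t)) = l2norm M (\<lambda>t. ?d t + (-1) * ?z t)"
    by (rule arg_cong[of _ _ "l2norm M"]) (simp add: G_def fun_eq_iff)
  also have "\<dots> \<le> l2norm M ?d + l2norm M (\<lambda>t. (-1) * ?z t)" by (rule l2norm_triangle[OF dL L2_scale[OF zL]])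
  also have "l2norm M (\<lambda>t. (-1) * ?z t) = l2norm M ?z" unfolding l2norm_scale by simp
  also have "l2norm M ?z = l2norm M (zero_ext (HR x) (\<eta>Y k))" by (simp add: l2norm_def)
  also have "l2norm M ?d \<le> l2norm M (zero_ext (HR x) (\<eta>X k))"
    by (rule l2norm_mono(2)[OF zero_ext_L2[OF \<eta>X_L2 HR_sets] L2D(1)[OF dL]])
       (auto simp: zero_ext_def HL_def HR_def space_M intro!: AE_I2)
  finally show "l2norm M (\<lambda>t. G x k t - cnj (\<eta>X k t)) \<le> l2norm M (zero_ext (HR x) (\<eta>X k)) + l2norm M (zero_ext (HR x) (\<eta>Y k))"
    by simp
qed

context
  fixes \<beta> :: "nat \<Rightarrow> real"
  assumes \<beta>: "\<And>n. \<beta> n \<in> II" "(\<lambda>n. ereal (\<beta> n)) \<longlonglongrightarrow> b"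
begin

lemma \<beta>_right: "tends_right \<beta>" by (rule tends_rightI[OF \<beta>])

text \<open>The brackets of \<open>\<epsilon> k\<close> with \<open>\<theta> i\<close> have limits
  at \<open>b\<close>, so \<open>g\<close> converges in norm to an explicit \<open>g'\<close>. The
  boundary condition satisfied by the range of \<open>S\<close> forces \<open>g'\<close> to be
  0.\<close>

lemma g_tendsto_0: "(\<lambda>n. l2norm M (g (\<beta> n) i)) \<longlonglongrightarrow> 0"
proof -
  obtain l where l: "\<And>k. lim_right (br (\<epsilon> k) (\<theta> i)) (l k)" using br_\<epsilon>_lim[of _ i] by metis
  define e where "e n k = br (\<epsilon> k) (\<theta> i) (\<beta> n)" for n k
  have e: "(\<lambda>n. e n k) \<longlonglongrightarrow> l k" for k unfolding e_def by (rule lim_rightD[OF l \<beta>])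
  define g' where "g' = (\<lambda>t. \<Sum>k\<in>UNIV. l k * cnj (\<eta>X k t))"
  have g'L: "g' \<in> L2 M" unfolding g'_def by (intro L2_sum L2_scale L2_cnj \<eta>X_L2)
  define R where "R n k = l2norm M (zero_ext (HR (\<beta> n)) (\<eta>X k)) + l2norm M (zero_ext (HR (\<beta> n)) (\<eta>Y k))" for n k
  have R: "(\<lambda>n. R n k) \<longlonglongrightarrow> 0 + 0" for k
    unfolding R_def by (intro tendsto_add tail_tendsto_0 \<beta>_right L2_near_b_Sol[OF \<eta>XY(1)] L2_near_b_Sol[OF \<eta>XY(3)])
  have bound: "l2norm M (\<lambda>t. g (\<beta> n) i t - g' t) \<le> (\<Sum>k\<in>UNIV. norm (e n k - l k) * l2norm M (\<eta>X k) + norm (e n k) * R n k)" for n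
  proof -
    let ?u = "\<lambda>k t. (e n k - l k) * cnj (\<eta>X k t) + e n k * (G (\<beta> n) k t - cnj (\<eta>X k t))"
    have 1: "(\<lambda>t. (e n k - l k) * cnj (\<eta>X k t)) \<in> L2 M" for k by (intro L2_scale L2_cnj \<eta>X_L2)
    have 2: "(\<lambda>t. e n k * (G (\<beta> n) k t - cnj (\<eta>X k t))) \<in> L2 M" for k by (intro L2_scale G_near_\<eta>X(1) \<beta>)
    have u: "?u k \<in> L2 M" for k by (rule L2_add[OF 1 2])
    have eq: "(\<lambda>t. g (\<beta> n) i t - g' t) = (\<lambda>t. \<Sum>k\<in>UNIV. ?u k t)"
      unfolding g_def g'_def e_def[symmetric] by (simp add: fun_eq_iff algebra_simps flip: sum_subtractf)
    have "l2norm M (\<lambda>t. g (\<beta> n) i t - g' t) \<le> (\<Sum>k\<in>UNIV. l2norm M (?u k))"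
      unfolding eq by (rule l2norm_sum_le) (auto intro: u)
    also have "\<dots> \<le> (\<Sum>k\<in>UNIV. norm (e n k - l k) * l2norm M (\<eta>X k) + norm (e n k) * R n k)"
    proof (rule sum_mono)
      fix k
      have "l2norm M (?u k) \<le> norm (e n k - l k) * l2norm M (\<lambda>t. cnj (\<eta>X k t)) + norm (e n k) * l2norm M (\<lambda>t. G (\<beta> n) k t - cnj (\<eta>X k t))"
        using l2norm_triangle[OF 1[of k] 2[of k]] by (simp only: l2norm_scale)
      also have "l2norm M (\<lambda>t. cnj (\<eta>X k t)) = l2norm M (\<eta>X k)" by (simp add: l2norm_def)
      finally show "l2norm M (?u k) \<le> norm (e n k - l k) * l2norm M (\<eta>X k) + norm (e n k) * R n k"
        using mult_left_mono[OF G_near_\<eta>X(2)[OF \<beta>(1)[of n], of k] norm_ge_zero[of "e n k"]] unfolding R_def by linarith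
    qed
    finally show ?thesis .
  qed
  have "(\<lambda>n. \<Sum>k\<in>UNIV. norm (e n k - l k) * l2norm M (\<eta>X k) + norm (e n k) * R n k) \<longlonglongrightarrow>
      (\<Sum>k\<in>UNIV. norm (l k - l k) * l2norm M (\<eta>X k) + norm (l k) * (0 + 0))"
    by (intro tendsto_sum tendsto_add tendsto_mult tendsto_norm tendsto_diff tendsto_const e R)
  then have up: "(\<lambda>n. \<Sum>k\<in>UNIV. norm (e n k - l k) * l2norm M (\<eta>X k) + norm (e n k) * R n k) \<longlonglongrightarrow> 0" by simp
  have conv: "(\<lambda>n. l2norm M (\<lambda>t. g (\<beta> n) i t - g' t)) \<longlonglongrightarrow> 0"
    by (rule tendsto_sandwich[OF _ _ tendsto_const up]) (auto intro!: always_eventually simp: l2norm_nonneg bound)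
  have gL: "g (\<beta> n) i \<in> L2 M" for n by (rule g_L2[OF \<beta>(1)])
  have 1: "(\<lambda>n. ip M g' (g (\<beta> n) i)) \<longlonglongrightarrow> ip M g' g'" by (rule ip_tendsto_right[OF gL g'L g'L conv])
  \<comment> \<open>For f = cnj g' this bracket is the conjugate of an inner product that tends to
    the squared norm of \<open>g'\<close>, while the boundary condition at \<open>b\<close> sends it
    to 0.\<close>
  have "(\<lambda>n. br (S (\<lambda>t. cnj (g' t))) (\<theta> i) (\<beta> n)) \<longlonglongrightarrow> 0"
    by (rule lim_rightD[OF _ \<beta>]) (use S_Dom[OF L2_cnj[OF g'L]] in \<open>simp add: Dom_def condition_b_def\<close>)
  moreover have "br (S (\<lambda>t. cnj (g' t))) (\<theta> i) (\<beta> n) = cnj (ip M g' (g (\<beta> n) i))" for n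
    unfolding S_bracket_\<theta>[OF L2_cnj[OF g'L] \<beta>(1)] by (subst ip_commute[symmetric]) (simp add: ip_def)
  ultimately have "(\<lambda>n. cnj (cnj (ip M g' (g (\<beta> n) i)))) \<longlonglongrightarrow> cnj 0" by (intro tendsto_cnj) simp
  then have "ip M g' g' = 0" using LIMSEQ_unique[OF 1] by simp
  then have n0: "l2norm M g' = 0" by (simp add: ip_self)
  have "l2norm M (g (\<beta> n) i) \<le> l2norm M (\<lambda>t. g (\<beta> n) i t - g' t)" for n
    using l2norm_triangle[OF L2_diff[OF gL[of n] g'L] g'L] n0 by simp
  then show ?thesis by (intro tendsto_sandwich[OF _ _ tendsto_const conv]) (auto intro!: always_eventually simp: l2norm_nonneg)
qed

lemma N_lim: "(\<lambda>n. N (\<beta> n) i k) \<longlonglongrightarrow> (if k = i then 1 else 0)"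
  unfolding N_def by (rule lim_rightD[OF \<psi>(3) \<beta>])

text \<open>The \<open>\<psi> k\<close> are normalised at \<open>b\<close>, so the matrix
  \<open>N\<close> tends to the identity and its determinant to 1; the entries of the inverse
  converge.\<close>

lemma V_bounded: "\<exists>l. (\<lambda>n. V (\<beta> n) k i) \<longlonglongrightarrow> l"
proof -
  have "(\<lambda>n. N_det (\<beta> n)) \<longlonglongrightarrow> (if (1::2) = 1 then 1 else 0) * (if (2::2) = 2 then 1 else 0) - (if (2::2) = 1 then 1 else 0) * (if (1::2) = 2 then 1 else 0)"
    unfolding N_det_def by (intro tendsto_diff tendsto_mult N_lim)
  then have D: "(\<lambda>n. N_det (\<beta> n)) \<longlonglongrightarrow> 1" by simp
  let ?m = "\<lambda>n. if k = 1 then if i = 1 then N (\<beta> n) 2 2 else - N (\<beta> n) 1 2 else if i = 1 then - N (\<beta> n) 2 1 else N (\<beta> n) 1 1"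
  have "\<exists>l. ?m \<longlonglongrightarrow> l"
    using N_lim tendsto_minus[OF N_lim] by (cases "k = 1"; cases "i = 1") fastforce+
  then obtain l where "?m \<longlonglongrightarrow> l" by blast
  then have "(\<lambda>n. ?m n / N_det (\<beta> n)) \<longlonglongrightarrow> l / 1" by (intro tendsto_divide D) auto
  then show ?thesis unfolding V_def by blast
qed

lemma h_tendsto_0: "(\<lambda>n. l2norm M (h (\<beta> n) k)) \<longlonglongrightarrow> 0"
proof -
  obtain l where l: "\<And>i. (\<lambda>n. V (\<beta> n) k i) \<longlonglongrightarrow> l i" using V_bounded by metis
  have "(\<lambda>n. \<Sum>i\<in>UNIV. norm (V (\<beta> n) k i) * l2norm M (g (\<beta> n) i)) \<longlonglongrightarrow> (\<Sum>i\<in>UNIV. norm (l i) * 0)"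
    by (intro tendsto_sum tendsto_mult tendsto_norm l g_tendsto_0)
  then have up: "(\<lambda>n. \<Sum>i\<in>UNIV. norm (V (\<beta> n) k i) * l2norm M (g (\<beta> n) i)) \<longlonglongrightarrow> 0" by simp
  have "l2norm M (h (\<beta> n) k) \<le> (\<Sum>i\<in>UNIV. norm (V (\<beta> n) k i) * l2norm M (g (\<beta> n) i))" for n
    using l2norm_sum_le[of UNIV "\<lambda>i t. V (\<beta> n) k i * g (\<beta> n) i t" M] L2_scale[OF g_L2[OF \<beta>(1)]]
    unfolding h_def l2norm_scale by simp
  then show ?thesis by (intro tendsto_sandwich[OF _ _ tendsto_const up]) (auto intro!: always_eventually simp: l2norm_nonneg)
qed

end

text \<open>For \<open>x < \<beta>\<close> the difference of the resolvents is the correction that restores the boundary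
  condition at \<open>\<beta>\<close>, and for \<open>x \<ge> \<beta>\<close> it is the resolvent itself.\<close>

definition Ker :: "real \<Rightarrow> real \<times> real \<Rightarrow> complex" where
  "Ker \<beta> z = (if fst z < \<beta> then \<Sum>k\<in>UNIV. \<psi> k (fst z) * h \<beta> k (snd z) else \<Sum>k\<in>UNIV. \<epsilon> k (fst z) * G (fst z) k (snd z))"

section \<open>Square integrability and smallness of the kernel\<close>

lemma Ker_integral:
  assumes f: "f \<in> L2 M" and \<beta>: "\<beta> \<in> II" and x: "x \<in> II"
  shows "(\<integral>t. Ker \<beta> (x, t) * f t \<partial>M) = (if x < \<beta> then comb (corr \<beta> f) x else S f x)"
proof (cases "x < \<beta>")
  case True
  then have "(\<integral>t. Ker \<beta> (x, t) * f t \<partial>M) = (\<integral>t. (\<Sum>k\<in>UNIV. \<psi> k x * h \<beta> k t) * f t \<partial>M)" by (simp add: Ker_def)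
  also have "\<dots> = comb (corr \<beta> f) x"
    unfolding comb_eq corr_def by (subst integral_comb_mult) (use h_L2[OF \<beta>] f in \<open>auto simp: mult.commute\<close>)
  finally show ?thesis using True by simp
next
  case False
  then have "(\<integral>t. Ker \<beta> (x, t) * f t \<partial>M) = (\<integral>t. (\<Sum>k\<in>UNIV. \<epsilon> k x * G x k t) * f t \<partial>M)" by (simp add: Ker_def)
  also have "\<dots> = S f x"
    unfolding S_eq[OF f x] by (subst integral_comb_mult) (use G_L2[OF x] f in \<open>auto simp: mult.commute\<close>)
  finally show ?thesis using False by simp
qed

lemma Ker_measurable:
  assumes \<beta>: "\<beta> \<in> II"
  shows "Ker \<beta> \<in> borel_measurable (M \<Otimes>\<^sub>M M)"
proof -
  have [measurable]: "\<psi> k \<in> borel_measurable M" "\<epsilon> j \<in> borel_measurable M" "\<eta>X j \<in> borel_measurable M" "\<eta>Y j \<in> borel_measurable M" "h \<beta> k \<in> borel_measurable M" for k j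
    using Sol_measurable[OF \<psi>(1)] Sol_measurable[OF \<epsilon>_Sol] Sol_measurable[OF \<eta>XY(1)] Sol_measurable[OF \<eta>XY(3)] L2D(1)[OF h_L2[OF \<beta>]] by auto
  have [measurable]: "(\<lambda>x. x) \<in> M \<rightarrow>\<^sub>M (borel :: real measure)" unfolding measurable_M
    by (rule continuous_imp_measurable_on_sets_lebesgue) (auto intro: continuous_on_id)
  have "(\<lambda>x. x) \<circ> fst \<in> (M \<Otimes>\<^sub>M M) \<rightarrow>\<^sub>M (borel :: real measure)" "(\<lambda>x. x) \<circ> snd \<in> (M \<Otimes>\<^sub>M M) \<rightarrow>\<^sub>M (borel :: real measure)"
    by measurable
  then have [measurable]: "fst \<in> (M \<Otimes>\<^sub>M M) \<rightarrow>\<^sub>M (borel :: real measure)" "snd \<in> (M \<Otimes>\<^sub>M M) \<rightarrow>\<^sub>M (borel :: real measure)"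
    by (simp_all add: comp_def)
  \<comment> \<open>In \<open>G\<close> the set carrying the section moves with the first variable.
    Written as comparisons of the two coordinates, the same kernel is jointly measurable.\<close>
  let ?K = "\<lambda>z. if fst z < \<beta> then \<Sum>k\<in>UNIV. \<psi> k (fst z) * h \<beta> k (snd z)
    else \<Sum>k\<in>UNIV. \<epsilon> k (fst z) * (cnj (if snd z \<le> fst z then \<eta>X k (snd z) else 0) - cnj (if fst z \<le> snd z then \<eta>Y k (snd z) else 0))"
  have "?K \<in> borel_measurable (M \<Otimes>\<^sub>M M)"
  proof -
    have 1: "(\<lambda>z. cnj (if snd z \<le> fst z then \<eta>X k (snd z) else 0)) \<in> borel_measurable (M \<Otimes>\<^sub>M M)" for k
      by (rule borel_measurable_cnj) measurable
    have 2: "(\<lambda>z. cnj (if fst z \<le> snd z then \<eta>Y k (snd z) else 0)) \<in> borel_measurable (M \<Otimes>\<^sub>M M)" for k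
      by (rule borel_measurable_cnj) measurable
    note [measurable] = 1 2
    show ?thesis by measurable
  qed
  also have "?K \<in> borel_measurable (M \<Otimes>\<^sub>M M) \<longleftrightarrow> Ker \<beta> \<in> borel_measurable (M \<Otimes>\<^sub>M M)"
    by (rule measurable_cong) (auto simp: space_pair_measure space_M Ker_def G_def zero_ext_def HL_def HR_def intro!: sum.cong)
  finally show ?thesis .
qed

text \<open>The first sum belongs to x < \<beta>. The other two belong to x \<ge> \<beta>, where
  \<open>HR x\<close> lies in \<open>HR \<beta>\<close> and \<open>G x k\<close> is bounded by
  \<open>\<eta>X k\<close> plus the tail of \<open>\<eta>Y k\<close>. Each product has a factor
  tending to 0.\<close>

definition Ker_bound :: "real \<Rightarrow> real" where
  "Ker_bound \<beta> = (\<Sum>k\<in>UNIV. l2norm M (\<psi> k) * l2norm M (h \<beta> k)) +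
     ((\<Sum>k\<in>UNIV. l2norm M (zero_ext (HR \<beta>) (\<epsilon> k)) * l2norm M (\<eta>X k)) +
      (\<Sum>k\<in>UNIV. l2norm M (zero_ext (HR \<beta>) (\<epsilon> k)) * l2norm M (zero_ext (HR \<beta>) (\<eta>Y k))))"

lemma Ker_L2:
  assumes \<beta>: "\<beta> \<in> II"
  shows "Ker \<beta> \<in> L2 (M \<Otimes>\<^sub>M M)" "l2norm (M \<Otimes>\<^sub>M M) (Ker \<beta>) \<le> Ker_bound \<beta>"
proof -
  \<comment> \<open>Tensor products of absolute values: their sum is nonnegative, so it dominates
    the kernel without cancellation.\<close>
  define T where "T u v z = complex_of_real (norm (u (fst z))) * complex_of_real (norm (v (snd z)))" for u v :: "real \<Rightarrow> complex" and z :: "real \<times> real"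
  have T: "T u v \<in> L2 (M \<Otimes>\<^sub>M M)" "l2norm (M \<Otimes>\<^sub>M M) (T u v) = l2norm M u * l2norm M v" if "u \<in> L2 M" "v \<in> L2 M" for u v
    using L2_tensor[OF sigma_finite_M L2_norm_fun[OF that(1)] L2_norm_fun[OF that(2)]] unfolding T_def by (simp_all add: l2norm_norm_fun)
  have \<psi>L: "\<psi> k \<in> L2 M" for k by (rule admissible_a_Sol_L2[OF \<psi>(1,2)])
  have \<epsilon>L: "zero_ext (HR \<beta>) (\<epsilon> k) \<in> L2 M" for k using L2_near_b_Sol[OF \<epsilon>_Sol[of k]] \<beta> by (simp add: L2_near_b_def)
  let ?H1 = "\<lambda>z. \<Sum>k\<in>UNIV. T (\<psi> k) (h \<beta> k) z"
  let ?H2 = "\<lambda>z. \<Sum>k\<in>UNIV. T (zero_ext (HR \<beta>) (\<epsilon> k)) (\<eta>X k) z"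
  let ?H3 = "\<lambda>z. \<Sum>k\<in>UNIV. T (zero_ext (HR \<beta>) (\<epsilon> k)) (zero_ext (HR \<beta>) (\<eta>Y k)) z"
  let ?H = "\<lambda>z. ?H1 z + (?H2 z + ?H3 z)"
  note L = T(1)[OF \<psi>L h_L2[OF \<beta>]] T(1)[OF \<epsilon>L \<eta>X_L2] T(1)[OF \<epsilon>L \<eta>Y_L2[OF \<beta>]]
  have H1: "?H1 \<in> L2 (M \<Otimes>\<^sub>M M)" and H2: "?H2 \<in> L2 (M \<Otimes>\<^sub>M M)" and H3: "?H3 \<in> L2 (M \<Otimes>\<^sub>M M)"
    by (rule L2_sum; rule L)+
  have H: "?H \<in> L2 (M \<Otimes>\<^sub>M M)" by (intro L2_add H1 H2 H3)
  have Hn: "l2norm (M \<Otimes>\<^sub>M M) ?H \<le> Ker_bound \<beta>"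
  proof -
    have 1: "l2norm (M \<Otimes>\<^sub>M M) ?H1 \<le> (\<Sum>k\<in>UNIV. l2norm M (\<psi> k) * l2norm M (h \<beta> k))"
      using l2norm_sum_le[of UNIV "\<lambda>k. T (\<psi> k) (h \<beta> k)" "M \<Otimes>\<^sub>M M"] L(1) T(2)[OF \<psi>L h_L2[OF \<beta>]] by simp
    have 2: "l2norm (M \<Otimes>\<^sub>M M) ?H2 \<le> (\<Sum>k\<in>UNIV. l2norm M (zero_ext (HR \<beta>) (\<epsilon> k)) * l2norm M (\<eta>X k))"
      using l2norm_sum_le[of UNIV "\<lambda>k. T (zero_ext (HR \<beta>) (\<epsilon> k)) (\<eta>X k)" "M \<Otimes>\<^sub>M M"] L(2) T(2)[OF \<epsilon>L \<eta>X_L2] by simp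
    have 3: "l2norm (M \<Otimes>\<^sub>M M) ?H3 \<le> (\<Sum>k\<in>UNIV. l2norm M (zero_ext (HR \<beta>) (\<epsilon> k)) * l2norm M (zero_ext (HR \<beta>) (\<eta>Y k)))"
      using l2norm_sum_le[of UNIV "\<lambda>k. T (zero_ext (HR \<beta>) (\<epsilon> k)) (zero_ext (HR \<beta>) (\<eta>Y k))" "M \<Otimes>\<^sub>M M"] L(3) T(2)[OF \<epsilon>L \<eta>Y_L2[OF \<beta>]] by simp
    from l2norm_triangle[OF H1 L2_add[OF H2 H3]] l2norm_triangle[OF H2 H3] 1 2 3
    show ?thesis unfolding Ker_bound_def by linarith
  qed
  have ae: "AE z in M \<Otimes>\<^sub>M M. norm (Ker \<beta> z) \<le> norm (?H z)"
  proof (rule AE_I2)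
    fix z assume "z \<in> space (M \<Otimes>\<^sub>M M)"
    then obtain x t where z: "z = (x, t)" "x \<in> II" "t \<in> II" by (auto simp: space_pair_measure space_M)
    define r1 where "r1 = (\<Sum>k\<in>UNIV. norm (\<psi> k x) * norm (h \<beta> k t))"
    define r2 where "r2 = (\<Sum>k\<in>UNIV. norm (zero_ext (HR \<beta>) (\<epsilon> k) x) * norm (\<eta>X k t))"
    define r3 where "r3 = (\<Sum>k\<in>UNIV. norm (zero_ext (HR \<beta>) (\<epsilon> k) x) * norm (zero_ext (HR \<beta>) (\<eta>Y k) t))"
    have nn: "0 \<le> r1" "0 \<le> r2" "0 \<le> r3" unfolding r1_def r2_def r3_def by (auto intro!: sum_nonneg)
    have "?H z = complex_of_real (r1 + (r2 + r3))" by (simp add: T_def z r1_def r2_def r3_def)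
    then have nH: "norm (?H z) = r1 + (r2 + r3)" using nn by (simp del: of_real_add)
    show "norm (Ker \<beta> z) \<le> norm (?H z)"
    proof (cases "x < \<beta>")
      case True
      then have "norm (Ker \<beta> z) \<le> r1"
        using norm_sum[of "\<lambda>k. \<psi> k x * h \<beta> k t" UNIV] by (simp add: Ker_def z r1_def norm_mult)
      then show ?thesis unfolding nH using nn by linarith
    next
      case False
      then have xR: "x \<in> HR \<beta>" using z by (simp add: HR_def)
      have "norm (G x k t) \<le> norm (\<eta>X k t) + norm (zero_ext (HR \<beta>) (\<eta>Y k) t)" for k
      proof -
        have "norm (G x k t) \<le> norm (cnj (zero_ext (HL x) (\<eta>X k) t)) + norm (cnj (zero_ext (HR x) (\<eta>Y k) t))"
          unfolding G_def by (rule norm_triangle_ineq4)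
        moreover have "norm (zero_ext (HL x) (\<eta>X k) t) \<le> norm (\<eta>X k t)" by (simp add: zero_ext_def)
        moreover have "norm (zero_ext (HR x) (\<eta>Y k) t) \<le> norm (zero_ext (HR \<beta>) (\<eta>Y k) t)"
          using False by (auto simp: zero_ext_def HR_def)
        ultimately show ?thesis by simp
      qed
      then have "(\<Sum>k\<in>UNIV. norm (\<epsilon> k x) * norm (G x k t)) \<le> (\<Sum>k\<in>UNIV. norm (\<epsilon> k x) * (norm (\<eta>X k t) + norm (zero_ext (HR \<beta>) (\<eta>Y k) t)))"
        by (intro sum_mono mult_left_mono) auto
      also have "\<dots> = r2 + r3" using xR by (simp add: r2_def r3_def zero_ext_def distrib_left sum.distrib)
      finally have "norm (Ker \<beta> z) \<le> r2 + r3"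
        using False norm_sum[of "\<lambda>k. \<epsilon> k x * G x k t" UNIV] by (simp add: Ker_def z norm_mult)
      then show ?thesis unfolding nH using nn by linarith
    qed
  qed
  show "Ker \<beta> \<in> L2 (M \<Otimes>\<^sub>M M)" by (rule l2norm_mono(1)[OF H Ker_measurable[OF \<beta>] ae])
  have "l2norm (M \<Otimes>\<^sub>M M) (Ker \<beta>) \<le> l2norm (M \<Otimes>\<^sub>M M) ?H" by (rule l2norm_mono(2)[OF H Ker_measurable[OF \<beta>] ae])
  with Hn show "l2norm (M \<Otimes>\<^sub>M M) (Ker \<beta>) \<le> Ker_bound \<beta>" by linarith
qed

lemma Ker_bound_tendsto_0:
  assumes \<beta>: "\<And>n. \<beta> n \<in> II" "(\<lambda>n. ereal (\<beta> n)) \<longlonglongrightarrow> b"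
  shows "(\<lambda>n. Ker_bound (\<beta> n)) \<longlonglongrightarrow> 0"
proof -
  have "(\<lambda>n. Ker_bound (\<beta> n)) \<longlonglongrightarrow> (\<Sum>k\<in>UNIV. l2norm M (\<psi> k) * 0) + ((\<Sum>k\<in>(UNIV :: 4 set). 0 * l2norm M (\<eta>X k)) + (\<Sum>k\<in>(UNIV :: 4 set). 0 * 0))"
    unfolding Ker_bound_def
    by (intro tendsto_add tendsto_sum tendsto_mult tendsto_const h_tendsto_0 tail_tendsto_0 \<beta>_right \<beta> L2_near_b_Sol[OF \<epsilon>_Sol] L2_near_b_Sol[OF \<eta>XY(3)])
  then show ?thesis by simp
qed

text \<open>The choice in \<open>orth_proj\<close> fixes the projection only up to null sets. The
  zero extension of f to \<open>J\<close> is a witness, and testing the difference with its own part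
  on \<open>J\<close> shows that any choice agrees with f there almost everywhere.\<close>

lemma orth_proj_restriction:
  assumes \<beta>: "\<beta> \<in> II" and J: "J = einterval a (ereal \<beta>)" and f: "f \<in> L2 M"
    and g: "g' = orth_proj M (zero_ext J ` L2 (wmeasure J w)) f"
  shows "g' \<in> L2 (wmeasure J w)" "AE x in wmeasure J w. g' x = f x"
proof -
  have JI: "open J" "J \<subseteq> II" unfolding J by (rule left_interval[OF \<beta>])+
  have Js: "J \<in> sets M" by (rule open_sets_M) (use JI in auto)
  note L2J = L2_wmeasure_iff[OF JI]
  let ?V = "zero_ext J ` L2 (wmeasure J w)"
  have zz: "zero_ext J (zero_ext J u) = zero_ext J u" for u by (auto simp: zero_ext_def)
  have inV: "zero_ext J u \<in> ?V" if "u \<in> L2 M" for u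
    using zero_ext_L2[OF that Js] unfolding L2J[symmetric] by blast
  have "\<exists>g. g \<in> ?V \<and> (\<forall>v\<in>?V. ip M (\<lambda>x. f x - g x) v = 0)"
  proof (intro exI conjI ballI)
    show "zero_ext J f \<in> ?V" by (rule inV[OF f])
    fix v assume "v \<in> ?V"
    then obtain v' where v: "v = zero_ext J v'" by blast
    have "(\<lambda>x. (f x - zero_ext J f x) * cnj (v x)) = (\<lambda>x. 0)" by (auto simp: v zero_ext_def)
    then show "ip M (\<lambda>x. f x - zero_ext J f x) v = 0" by (simp add: ip_def)
  qed
  from someI_ex[OF this] have gV: "g' \<in> ?V" and orth: "\<And>v. v \<in> ?V \<Longrightarrow> ip M (\<lambda>x. f x - g' x) v = 0"
    unfolding g orth_proj_def by blast+
  obtain g0 where g0: "g' = zero_ext J g0" "g0 \<in> L2 (wmeasure J w)" using gV by blast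
  have gL: "g' \<in> L2 M" using g0 L2J by simp
  then show "g' \<in> L2 (wmeasure J w)" unfolding L2J g0(1) zz .
  define d where "d x = f x - g' x" for x
  have dL: "d \<in> L2 M" unfolding d_def by (intro L2_diff f gL)
  have zd: "zero_ext J d \<in> L2 M" by (rule zero_ext_L2[OF dL Js])
  have "ip M (zero_ext J d) (zero_ext J d) = ip M d (zero_ext J d)"
    unfolding ip_def by (rule Bochner_Integration.integral_cong[OF refl]) (simp add: zero_ext_def)
  also have "\<dots> = 0" using orth[OF inV[OF dL]] unfolding d_def .
  finally have "l2norm M (zero_ext J d) = 0" by (simp add: ip_self)
  then have "AE x in M. zero_ext J d x = 0" by (rule l2norm_eq_0_AE[OF zd])
  then have "AE x in lebesgue. x \<in> J \<longrightarrow> g' x = f x"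
    unfolding AE_M by eventually_elim (use JI in \<open>auto simp: zero_ext_def d_def\<close>)
  then show "AE x in wmeasure J w. g' x = f x"
    unfolding J weighted_expression.AE_M[OF restrict_weighted[OF \<beta>]] .
qed

theorem resolvent_difference:
  assumes \<beta>: "\<beta> \<in> II" and J: "J = einterval a (ereal \<beta>)" and f: "f \<in> L2 M"
    and R: "R = resolvent (wmeasure J w) (bc_operator \<Phi> (\<theta> 1) (\<theta> 2) a (ereal \<beta>) p s q w) \<mu> (orth_proj M (zero_ext J ` L2 (wmeasure J w)) f)"
  shows "(\<lambda>x. S f x - zero_ext J R x) \<in> L2 M" "x \<in> II \<Longrightarrow> S f x - zero_ext J R x = (\<integral>t. Ker \<beta> (x, t) * f t \<partial>M)"
proof -
  have Jmem: "t \<in> J \<longleftrightarrow> t \<in> II \<and> t < \<beta>" for t unfolding J by (rule left_interval(4)[OF \<beta>])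
  have Js: "J \<in> sets M" unfolding J by (rule open_sets_M) (use left_interval(3)[OF \<beta>] in auto)
  note P = orth_proj_restriction[OF \<beta> J f refl]
  have RJ: "R t = S f t - comb (corr \<beta> f) t" if "t \<in> J" for t
    by (rule truncated_resolvent[OF \<beta> J f P R that])
  have "(\<lambda>x. S f x - comb (corr \<beta> f) x) \<in> L2 M"
    using S_Dom[OF f] admissible_a_Sol_L2[OF comb] by (intro L2_diff) (auto simp: Dom_def)
  then have "zero_ext J (\<lambda>x. S f x - comb (corr \<beta> f) x) \<in> L2 M" by (rule zero_ext_L2[OF _ Js])
  also have "zero_ext J (\<lambda>x. S f x - comb (corr \<beta> f) x) = zero_ext J R" by (rule zero_ext_cong) (simp add: RJ)
  finally show "(\<lambda>x. S f x - zero_ext J R x) \<in> L2 M" using S_Dom[OF f] by (intro L2_diff) (auto simp: Dom_def)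
  show "S f x - zero_ext J R x = (\<integral>t. Ker \<beta> (x, t) * f t \<partial>M)" if x: "x \<in> II"
    unfolding Ker_integral[OF f \<beta> x] using x RJ[of x] Jmem[of x] by (simp add: zero_ext_def)
qed

end

section \<open>Assembly along the sequence of truncation points\<close>

theorem theorem1:
  fixes a b :: ereal
    and p s q w :: "real \<Rightarrow> real"
    and \<Phi> :: "(real \<Rightarrow> complex) option"
    and \<theta>\<^sub>1 \<theta>\<^sub>2 :: "real \<Rightarrow> complex"
    and \<mu>\<^sub>0 :: real
    and \<mu> :: complex
    and \<beta> :: "nat \<Rightarrow> real"
    and I :: "real set" and J :: "nat \<Rightarrow> real set"
    and M :: "real measure" and MJ :: "nat \<Rightarrow> real measure"
    and L :: "((real \<Rightarrow> complex) \<times> (real \<Rightarrow> complex)) set"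
    and LJ :: "nat \<Rightarrow> ((real \<Rightarrow> complex) \<times> (real \<Rightarrow> complex)) set"
    and S :: "(real \<Rightarrow> complex) \<Rightarrow> (real \<Rightarrow> complex)"
    and SJ P T :: "nat \<Rightarrow> (real \<Rightarrow> complex) \<Rightarrow> (real \<Rightarrow> complex)"
  assumes interval: "a < b" "I = einterval a b"
    and coeffs: "L1_loc I (\<lambda>x. 1 / p x)" "L1_loc I s" "L1_loc I q" "L1_loc I w"
    and pos: "AE x in lebesgue_on I. p x > 0" "AE x in lebesgue_on I. w x > 0"
    and M: "M = wmeasure I w"
    and a_type: "case \<Phi> of
          None \<Rightarrow> lim_type_left a b p s q w 2
        | Some \<phi> \<Rightarrow> lim_type_left a b p s q w 3 \<and>
            \<phi> \<in> Dmax I p s q w - Dmin I p s q w \<and>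
            (\<exists>c\<in>I. \<forall>x\<in>I. c < x \<longrightarrow> \<phi> x = 0) \<and>
            bracket_zero_left a b p s \<phi> \<phi>"
    and b_type: "lim_type_right a b p s q w 4"
    and theta_sol: "is_solution I p s q w (of_real \<mu>\<^sub>0) \<theta>\<^sub>1" "is_solution I p s q w (of_real \<mu>\<^sub>0) \<theta>\<^sub>2"
    and theta_indep: "\<And>\<alpha> \<gamma> :: complex. (\<forall>x\<in>I. \<alpha> * \<theta>\<^sub>1 x + \<gamma> * \<theta>\<^sub>2 x = 0) \<Longrightarrow> \<alpha> = 0 \<and> \<gamma> = 0"
    and theta_bracket: "\<And>x. x \<in> I \<Longrightarrow> bracket I p s \<theta>\<^sub>1 \<theta>\<^sub>1 x = 0"
      "\<And>x. x \<in> I \<Longrightarrow> bracket I p s \<theta>\<^sub>1 \<theta>\<^sub>2 x = 0"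
      "\<And>x. x \<in> I \<Longrightarrow> bracket I p s \<theta>\<^sub>2 \<theta>\<^sub>2 x = 0"
    and L: "L = bc_operator \<Phi> \<theta>\<^sub>1 \<theta>\<^sub>2 a b p s q w"
    and L_sa: "self_adjoint M L"
    and L_ext: "ell_graph I p s q w (Dmin I p s q w) \<subseteq> L"
    and beta: "incseq \<beta>" "\<And>j. \<beta> j \<in> I" "(\<lambda>j. ereal (\<beta> j)) \<longlonglongrightarrow> b"
    and J: "\<And>j. J j = einterval a (ereal (\<beta> j))"
    and MJ: "\<And>j. MJ j = wmeasure (J j) w"
    and LJ: "\<And>j. LJ j = bc_operator \<Phi> \<theta>\<^sub>1 \<theta>\<^sub>2 a (ereal (\<beta> j)) p s q w"
    and mu: "\<mu> \<notin> \<real>"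
    and S: "S = resolvent M L \<mu>"
    and SJ: "\<And>j. SJ j = resolvent (MJ j) (LJ j) \<mu>"
    and P: "\<And>j. P j = orth_proj M (zero_ext (J j) ` L2 (MJ j))"
    and T: "\<And>j. T j = (\<lambda>f x. S f x - zero_ext (J j) (SJ j (P j f)) x)"
  shows "(\<forall>j. hs_integral_operator M (T j)) \<and>
         (\<forall>E. orthonormal_basis M E \<longrightarrow> (\<lambda>j. hs_norm M E (T j)) \<longlonglongrightarrow> 0)"
proof -
  have posI: "AE x in lebesgue. x \<in> einterval a b \<longrightarrow> p x > 0" "AE x in lebesgue. x \<in> einterval a b \<longrightarrow> w x > 0"
    using pos unfolding interval(2) AE_lebesgue_on_iff[OF open_einterval] .
  define \<theta> :: "2 \<Rightarrow> real \<Rightarrow> complex" where "\<theta> i = (if i = 1 then \<theta>\<^sub>1 else \<theta>\<^sub>2)" for i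
  have \<theta>12: "\<theta> 1 = \<theta>\<^sub>1" "\<theta> 2 = \<theta>\<^sub>2" by (simp_all add: \<theta>_def)
  interpret E: weighted_expression a b p s q w
    by (unfold_locales; (rule interval(1) coeffs[unfolded interval(2)] posI))
  have \<theta>S: "\<theta> i \<in> E.Sol (of_real \<mu>\<^sub>0)" for i
    using theta_sol exhaust_2[of i] unfolding E.Sol_def is_solution_def interval(2) AE_lebesgue_on_iff[OF open_einterval]
    by (auto simp: \<theta>12)
  \<comment> \<open>\<open>\<beta> 0\<close> serves as the interior base point of the fundamental
    solutions; the resulting kernels are then used at all truncation points.\<close>
  have "resolvent_problem a b p s q w \<Phi> \<theta> \<mu>\<^sub>0 \<mu> (\<beta> 0)"
  proof unfold_locales
    show "lim_type_right a b p s q w 4" by (rule b_type)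
    show "quasi_diff (einterval a b) p s \<phi>" if "\<Phi> = Some \<phi>" for \<phi>
      using a_type that unfolding interval(2) by (simp add: Dmax_def)
    show "\<theta> i \<in> E.Sol (of_real \<mu>\<^sub>0)" for i by (rule \<theta>S)
    show "\<alpha> i = 0" if "\<And>x. x \<in> einterval a b \<Longrightarrow> (\<Sum>i\<in>UNIV. \<alpha> i * \<theta> i x) = 0" for \<alpha> i
    proof -
      have "\<alpha> 1 = 0 \<and> \<alpha> 2 = 0"
        by (rule theta_indep) (use that in \<open>simp add: interval(2) sum_2 \<theta>12\<close>)
      then show ?thesis using exhaust_2[of i] by auto
    qed
    show "bracket (einterval a b) p s (\<theta> i) (\<theta> j) x = 0" if "x \<in> einterval a b" for i j x
    proof -
      have b: "bracket (einterval a b) p s \<theta>\<^sub>1 \<theta>\<^sub>1 x = 0" "bracket (einterval a b) p s \<theta>\<^sub>1 \<theta>\<^sub>2 x = 0" "bracket (einterval a b) p s \<theta>\<^sub>2 \<theta>\<^sub>2 x = 0"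
        using theta_bracket[of x] that unfolding interval(2) by auto
      \<comment> \<open>The fourth bracket follows from the second, since the form is
        skew-Hermitian.\<close>
      then have "bracket (einterval a b) p s \<theta>\<^sub>2 \<theta>\<^sub>1 x = 0"
        using E.form_commute[of "E.data \<theta>\<^sub>2 x" "E.data \<theta>\<^sub>1 x"] by (simp add: E.bracket_eq_form)
      with b show ?thesis using exhaust_2[of i] exhaust_2[of j] by (auto simp: \<theta>12)
    qed
    show "self_adjoint (wmeasure (einterval a b) w) (bc_operator \<Phi> (\<theta> 1) (\<theta> 2) a b p s q w)"
      using L_sa unfolding M L interval(2) \<theta>12 .
    show "\<mu> \<notin> \<real>" by (rule mu)
    show "\<beta> 0 \<in> einterval a b" using beta(2) unfolding interval(2) .
  qed
  then interpret R: resolvent_problem a b p s q w \<Phi> \<theta> \<mu>\<^sub>0 \<mu> "\<beta> 0" .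
  have \<beta>: "\<beta> j \<in> einterval a b" for j using beta(2) unfolding interval(2) .
  have MR: "M = wmeasure (einterval a b) w" by (simp add: M interval(2))
  have TL: "T j f \<in> L2 M" and TK: "x \<in> einterval a b \<Longrightarrow> T j f x = (\<integral>t. R.Ker (\<beta> j) (x, t) * f t \<partial>M)" if f: "f \<in> L2 M" for j f x
  proof -
    have Tj: "T j f = (\<lambda>x. resolvent M L \<mu> f x - zero_ext (J j) (resolvent (wmeasure (J j) w) (bc_operator \<Phi> (\<theta> 1) (\<theta> 2) a (ereal (\<beta> j)) p s q w) \<mu>
        (orth_proj M (zero_ext (J j) ` L2 (wmeasure (J j) w)) f)) x)"
      unfolding T S SJ P MJ LJ \<theta>12 ..
    have LR: "L = bc_operator \<Phi> (\<theta> 1) (\<theta> 2) a b p s q w" unfolding L \<theta>12 ..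
    note * = R.resolvent_difference[OF \<beta>[of j] J[of j] f[unfolded MR] refl]
    show "T j f \<in> L2 M" unfolding Tj LR MR by (rule *(1))
    show "T j f x = (\<integral>t. R.Ker (\<beta> j) (x, t) * f t \<partial>M)" if "x \<in> einterval a b"
      unfolding Tj LR MR by (rule *(2)[OF that])
  qed
  have TK': "AE x in M. T j f x = (\<integral>t. R.Ker (\<beta> j) (x, t) * f t \<partial>M)" if "f \<in> L2 M" for j f
    by (rule AE_I2) (use TK[OF that] in \<open>simp add: MR E.space_M\<close>)
  have K: "R.Ker (\<beta> j) \<in> L2 (M \<Otimes>\<^sub>M M)" "l2norm (M \<Otimes>\<^sub>M M) (R.Ker (\<beta> j)) \<le> R.Ker_bound (\<beta> j)" for j
    unfolding MR by (rule R.Ker_L2[OF \<beta>])+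
  show ?thesis
  proof (intro conjI allI impI)
    show "hs_integral_operator M (T j)" for j
      unfolding hs_integral_operator_def using K(1) TL TK' by blast
    fix E assume E: "orthonormal_basis M E"
    have bound: "hs_norm M E (T j) \<le> ennreal (R.Ker_bound (\<beta> j))" for j
    proof -
      have "hs_norm M E (T j) \<le> ennreal (l2norm (M \<Otimes>\<^sub>M M) (R.Ker (\<beta> j)))"
      proof (rule hs_norm_le[OF _ K(1) E])
        show "sigma_finite_measure M" unfolding MR by (rule E.sigma_finite_M)
        show "AE x in M. T j e x = (\<integral>t. R.Ker (\<beta> j) (x, t) * e t \<partial>M)" if "e \<in> E" for e
          by (rule TK') (use E that in \<open>auto simp: orthonormal_basis_def\<close>)
      qed
      also have "\<dots> \<le> ennreal (R.Ker_bound (\<beta> j))" by (rule ennreal_leI[OF K(2)])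
      finally show ?thesis .
    qed
    have lim: "(\<lambda>j. ennreal (R.Ker_bound (\<beta> j))) \<longlonglongrightarrow> 0"
      using tendsto_ennrealI[OF R.Ker_bound_tendsto_0[of \<beta>, OF \<beta> beta(3)]] by simp
    show "(\<lambda>j. hs_norm M E (T j)) \<longlonglongrightarrow> 0"
      by (rule tendsto_sandwich[OF always_eventually[OF allI[OF zero_le]] always_eventually[OF allI[OF bound]] tendsto_const lim])
  qed
qed

end
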